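(* Let $\mathbf{x}=(x_n)_{n\in\mathbb{N}_0}$ be a sequence of positive real numbers and let $S_{\mathbf{x}}$ be the zero-twist tight flute surface associated with $\mathbf{x}$. Then $S_{\mathbf{x}}$ is of parabolic type if and only if $\sum x_n$ diverges.
   Context: $\mathbb{N}_0=\{0,1,2,\dots\}$, $\mathbb{N}=\{1,2,\dots\}$. An open (non-compact) Riemann surface is of parabolic type if it carries no negative non-constant subharmonic function (equivalently, it has no Green's function). A geodesic pair of pants is a hyperbolic surface of finite area whose interior is homeomorphic to a three-punctured sphere, each of whose ends is a cusp or a closed geodesic boundary component, with at least one closed geodesic boundary component. A tight pair of pants is one with exactly one cusp. In a geodesic pair of pants with a cusp, the marked point of a boundary geodesic $\alpha$ is the point where $\alpha$ meets the simple geodesic ray orthogonal to $\alpha$ going out to a cusp. A zero-twist tight flute surface $S(\{l_n,0\})_{n\in\mathbb{N}}$ is obtained by starting with a geodesic pair of pants $P_0$ with two cusps and one closed boundary geodesic, and consecutively gluing tight pairs of pants $P_1,P_2,\dots$ in an infinite chain, where for each $n\ge1$ the free boundary geodesic of $P_0\cup\dots\cup P_{n-1}$ is glued by an isometry to a boundary geodesic of $P_n$ of the same length $l_n>0$, so that marked points match (zero twist) and the result is orientable. It carries the induced hyperbolic metric (not necessarily complete) and hence a Riemann surface structure. For a sequence $\mathbf{x}=(x_n)_{n\in\mathbb{N}_0}$ of positive reals put $s_n=\sum_{i=0}^n x_i$. The associated surface $S_{\mathbf{x}}$ is the zero-twist tight flute surface $S(\{l_n,0\})_{n\in\mathbb{N}}$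 with $$l_n=\ln\left(\frac{s_{n-1}+s_n+2\sqrt{s_{n-1}s_n}}{s_{n-1}+s_n-2\sqrt{s_{n-1}s_n}}\right),\qquad n\ge1.$$ Equivalently, with $s_{-1}=0$, $S_{\mathbf{x}}$ is isometric to the convex core (without its boundary geodesics) of $\mathbb{H}^2/\Gamma_{\mathbf{x}}$, where $\Gamma_{\mathbf{x}}\le\mathrm{PSL}(2,\mathbb{R})$ is generated by $$g_n(z)=\frac{\left(1+\frac{2s_{n-1}}{s_n-s_{n-1}}\right)z-2s_{n-1}\left(1+\frac{s_{n-1}}{s_n-s_{n-1}}\right)}{-\frac{2}{s_n-s_{n-1}}\,z+\left(1+\frac{2s_{n-1}}{s_n-s_{n-1}}\right)},\qquad n\in\mathbb{N}_0.$$ *)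

theory Defs
  imports "HOL-Analysis.Analysis"
begin

section \<open>Riemann surfaces and parabolic type\<close>

text \<open>A surface is a topology together with a family of charts \<open>(U, \<phi>)\<close>; only the values
  of \<open>\<phi>\<close> on \<open>U\<close> matter.\<close>

record 'a surface =
  surf_top :: "'a topology"
  surf_charts :: "('a set \<times> ('a \<Rightarrow> complex)) set"

definition riemann_surface :: "'a surface \<Rightarrow> bool" where
  "riemann_surface S \<longleftrightarrow>
     Hausdorff_space (surf_top S) \<and> connected_space (surf_top S) \<and> topspace (surf_top S) \<noteq> {} \<and>
     \<Union>(fst ` surf_charts S) = topspace (surf_top S) \<and>
     (\<forall>(U, \<phi>) \<in> surf_charts S.
        openin (surf_top S) U \<and> open (\<phi> ` U) \<and>
        homeomorphic_map (subtopology (surf_top S) U) (top_of_set (\<phi> ` U)) \<phi>) \<and>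
     (\<forall>(U, \<phi>) \<in> surf_charts S. \<forall>(V, \<psi>) \<in> surf_charts S.
        (\<psi> \<circ> the_inv_into U \<phi>) holomorphic_on (\<phi> ` (U \<inter> V)))"

text \<open>Mean value over the circle of radius \<open>r\<close> about \<open>a\<close>, as positive part minus negative part
  (\<^const>\<open>e2ennreal\<close> sends negative numbers to \<open>0\<close>). For an upper semicontinuous
  \<open>u < \<infinity>\<close> the first integral is finite, so the difference is meaningful.\<close>

definition circle_mean :: "(complex \<Rightarrow> ereal) \<Rightarrow> complex \<Rightarrow> real \<Rightarrow> ereal" where
  "circle_mean u a r =
     (enn2ereal (\<integral>\<^sup>+ t \<in> {0..2 * pi}. e2ennreal (u (a + of_real r * cis t)) \<partial>lborel)
      - enn2ereal (\<integral>\<^sup>+ t \<in> {0..2 * pi}. e2ennreal (- u (a + of_real r * cis t)) \<partial>lborel))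
     / ereal (2 * pi)"

definition subharmonic :: "'a surface \<Rightarrow> ('a \<Rightarrow> ereal) \<Rightarrow> bool" where
  "subharmonic S u \<longleftrightarrow>
     (\<forall>p \<in> topspace (surf_top S). u p < \<infinity>) \<and>
     (\<forall>c. openin (surf_top S) {p \<in> topspace (surf_top S). u p < c}) \<and>
     (\<forall>(U, \<phi>) \<in> surf_charts S. \<forall>a r. 0 < r \<and> cball a r \<subseteq> \<phi> ` U \<longrightarrow>
        u (the_inv_into U \<phi> a) \<le> circle_mean (u \<circ> the_inv_into U \<phi>) a r)"

definition parabolic_type :: "'a surface \<Rightarrow> bool" where
  "parabolic_type S \<longleftrightarrow>
     riemann_surface S \<and> \<not> compact_space (surf_top S) \<and>
     \<not> (\<exists>u. subharmonic S u \<and>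
            (\<forall>p \<in> topspace (surf_top S). u p < 0) \<and>
            (\<exists>p \<in> topspace (surf_top S). \<exists>q \<in> topspace (surf_top S). u p \<noteq> u q))"


section \<open>The hyperbolic plane (upper half-plane model)\<close>

definition hyp_dist :: "complex \<Rightarrow> complex \<Rightarrow> real" where
  "hyp_dist z w = arcosh (1 + (cmod (z - w))\<^sup>2 / (2 * Im z * Im w))"

definition hyp_isometry :: "(complex \<Rightarrow> complex) \<Rightarrow> bool" where
  "hyp_isometry m \<longleftrightarrow>
     (\<exists>a b c d :: real. a * d - b * c = 1 \<and>
        m = (\<lambda>z. (of_real a * z + of_real b) / (of_real c * z + of_real d)))"

text \<open>The geodesic with ideal endpoints \<open>a < b\<close> (a semicircle), and the closed half-plane outside
  it. Such a geodesic is orthogonal to the geodesic \<open>\<bar>z\<bar> = r\<close> iff \<open>a * b = r\<^sup>2\<close>.\<close>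

definition geodesic_line :: "real \<Rightarrow> real \<Rightarrow> complex set" where
  "geodesic_line a b = {z. 0 < Im z \<and> (Re z - a) * (Re z - b) + (Im z)\<^sup>2 = 0}"

definition outer_half_plane :: "real \<Rightarrow> real \<Rightarrow> complex set" where
  "outer_half_plane a b = {z. 0 < Im z \<and> (Re z - a) * (Re z - b) + (Im z)\<^sup>2 \<ge> 0}"


section \<open>Pairs of pants\<close>

text \<open>
  A geodesic pair of pants is determined up to isometry by its boundary lengths (length \<open>0\<close>
  for a cusp): the simple geodesics orthogonal to the boundary geodesics, or running into the
  cusps, which join its three ends pairwise (the seams) cut it into two mirror-image polygons,
  right-angled at the boundary geodesics and with an ideal vertex at each cusp. It is realised
  here as the double of this polygon along the seams.

  For the tight pair of pants \<open>P\<^sub>n\<close>, \<open>n \<ge> 1\<close>, with boundary lengths \<open>l n\<close> and \<open>l (n + 1)\<close>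
  the polygon is normalised so that the seam joining the two boundary geodesics lies on the
  imaginary axis and the halves of the boundary geodesics lie on \<open>\<bar>z\<bar> = 1\<close> (length \<open>l n / 2\<close>)
  and on \<open>\<bar>z\<bar> = outer_radius l n\<close> (length \<open>l (n + 1) / 2\<close>). With \<open>cusp_coord l n = tanh (l n / 4)\<close>, the
  ideal vertex is \<open>1 / cusp_coord l n\<close>, and the seams going out to the cusp are orthogonal to the two
  boundary geodesics. For \<open>P\<^sub>0\<close> the ideal vertices are \<open>0\<close> and \<open>cusp_coord l 1\<close>, and the boundary
  geodesic of length \<open>l 1\<close> lies on \<open>\<bar>z\<bar> = 1\<close>. The value \<open>l 0\<close> is never used. The side lengths
  are verified below in \<open>inner_boundary_arc\<close>, \<open>outer_boundary_arc\<close> and \<open>hyp_dist_arc\<close>.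
\<close>

definition cusp_coord :: "(nat \<Rightarrow> real) \<Rightarrow> nat \<Rightarrow> real" where
  "cusp_coord l n = tanh (l n / 4)"

fun outer_radius :: "(nat \<Rightarrow> real) \<Rightarrow> nat \<Rightarrow> real" where
  "outer_radius l 0 = 1"
| "outer_radius l (Suc n) = 1 / (cusp_coord l (Suc n) * cusp_coord l (Suc (Suc n)))"

text \<open>Ideal endpoints of the geodesics carrying the two seams that run into the cusp \<open>1 / cusp_coord l n\<close>
  (into \<open>cusp_coord l 1\<close> if \<open>n = 0\<close>). The first seam comes from the inner boundary geodesic
  (from the other cusp \<open>0\<close> if \<open>n = 0\<close>), the second one from the outer boundary geodesic.\<close>

fun inner_seam :: "(nat \<Rightarrow> real) \<Rightarrow> nat \<Rightarrow> real \<times> real" where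
  "inner_seam l 0 = (0, cusp_coord l 1)"
| "inner_seam l (Suc n) = (cusp_coord l (Suc n), 1 / cusp_coord l (Suc n))"

fun outer_seam :: "(nat \<Rightarrow> real) \<Rightarrow> nat \<Rightarrow> real \<times> real" where
  "outer_seam l 0 = (cusp_coord l 1, 1 / cusp_coord l 1)"
| "outer_seam l (Suc n) =
     (1 / cusp_coord l (Suc n), 1 / (cusp_coord l (Suc n) * (cusp_coord l (Suc (Suc n)))\<^sup>2))"

definition half_pants :: "(nat \<Rightarrow> real) \<Rightarrow> nat \<Rightarrow> complex set" where
  "half_pants l n =
     {z. 0 < Im z \<and> 0 \<le> Re z \<and> (n \<noteq> 0 \<longrightarrow> 1 \<le> cmod z) \<and> cmod z \<le> outer_radius l n}
     \<inter> case_prod outer_half_plane (inner_seam l n) \<inter> case_prod outer_half_plane (outer_seam l n)"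

definition seams :: "(nat \<Rightarrow> real) \<Rightarrow> nat \<Rightarrow> complex set" where
  "seams l n = half_pants l n \<inter>
     ({z. Re z = 0} \<union> case_prod geodesic_line (inner_seam l n)
                   \<union> case_prod geodesic_line (outer_seam l n))"

text \<open>Unit speed parametrisation of the geodesic \<open>\<bar>z\<bar> = 1\<close>, starting at \<open>\<i>\<close>.\<close>

definition unit_arc :: "real \<Rightarrow> complex" where
  "unit_arc t = Complex (tanh t) (1 / cosh t)"

lemma tanh_square_real: "(tanh t)\<^sup>2 = 1 - (1 / cosh t)\<^sup>2" for t :: real
proof -
  have "cosh t \<noteq> 0" using cosh_real_pos[of t] by simp
  moreover have "(sinh t)\<^sup>2 = (cosh t)\<^sup>2 - 1" by (simp add: sinh_square_eq)
  ultimately show ?thesis by (simp add: tanh_def power_divide diff_divide_distrib)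
qed

lemma hyp_dist_arc:
  assumes "r > 0" "t \<ge> 0"
  shows "hyp_dist (of_real r * unit_arc 0) (of_real r * unit_arc t) = t"
proof -
  have c: "cosh t > 0" by (rule cosh_real_pos)
  have "of_real r * unit_arc 0 - of_real r * unit_arc t
      = Complex (- r * tanh t) (r * (1 - 1 / cosh t))"
    by (simp add: unit_arc_def complex_eq_iff algebra_simps)
  then have "(cmod (of_real r * unit_arc 0 - of_real r * unit_arc t))\<^sup>2
      = r\<^sup>2 * ((tanh t)\<^sup>2 + (1 - 1 / cosh t)\<^sup>2)"
    by (simp only: cmod_power2 complex.sel power_mult_distrib power2_minus distrib_left)
  also have "(tanh t)\<^sup>2 + (1 - 1 / cosh t)\<^sup>2 = (2 * cosh t - 2) / cosh t"
    using c unfolding tanh_square_real by (simp add: field_simps power2_eq_square)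
  finally have "1 + (cmod (of_real r * unit_arc 0 - of_real r * unit_arc t))\<^sup>2
      / (2 * Im (of_real r * unit_arc 0) * Im (of_real r * unit_arc t)) = cosh t"
    using c assms by (simp add: unit_arc_def field_simps power2_eq_square)
  then show ?thesis
    using assms by (simp add: hyp_dist_def arcosh_cosh_real)
qed

lemma unit_arc_image:
  assumes "0 \<le> T"
  shows "unit_arc ` {0..T} = {z. 0 < Im z \<and> cmod z = 1 \<and> 0 \<le> Re z \<and> Re z \<le> tanh T}"
proof (intro equalityI subsetI)
  fix z assume "z \<in> unit_arc ` {0..T}"
  then obtain t where t: "0 \<le> t" "t \<le> T" "z = unit_arc t" by auto
  have c: "cosh t > 0" by (rule cosh_real_pos)
  have "(cmod z)\<^sup>2 = 1"
    by (simp add: t(3) unit_arc_def cmod_power2 tanh_square_real)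
  then have "cmod z = 1" using power2_eq_1_iff[of "cmod z"] norm_ge_zero[of z] by linarith
  then show "z \<in> {z. 0 < Im z \<and> cmod z = 1 \<and> 0 \<le> Re z \<and> Re z \<le> tanh T}"
    using t c by (simp add: unit_arc_def)
next
  fix z assume "z \<in> {z. 0 < Im z \<and> cmod z = 1 \<and> 0 \<le> Re z \<and> Re z \<le> tanh T}"
  then have z: "0 < Im z" "cmod z = 1" "0 \<le> Re z" "Re z \<le> tanh T" by auto
  have "continuous_on {0..T} tanh"
    by (intro continuous_intros) (simp add: less_imp_neq[OF cosh_real_pos, symmetric])
  then obtain t where "0 \<le> t" "t \<le> T" and t: "tanh t = Re z"
    using IVT'[of tanh 0 "Re z" T] z assms by auto
  have c: "cosh t > 0" by (rule cosh_real_pos)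
  have "(Im z)\<^sup>2 = 1 - (tanh t)\<^sup>2" using z(2) cmod_power2[of z] t by simp
  also have "\<dots> = (1 / cosh t)\<^sup>2" by (simp add: tanh_square_real)
  finally have "Im z = 1 / cosh t" by (rule power2_eq_imp_eq) (use z(1) c in auto)
  then have "z = unit_arc t" using t by (simp add: unit_arc_def complex_eq_iff)
  then show "z \<in> unit_arc ` {0..T}" using \<open>0 \<le> t\<close> \<open>t \<le> T\<close> by auto
qed

lemma cusp_coord_bounds: "l n > 0 \<Longrightarrow> 0 < cusp_coord l n" "cusp_coord l n < 1"
  by (simp_all add: cusp_coord_def tanh_real_lt_1)

lemma tanh_half_cusp_coord:
  assumes "l n > 0"
  shows "tanh (l n / 2) * (cusp_coord l n + 1 / cusp_coord l n) = 2"
proof -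
  have "tanh (l n / 2) = tanh (l n / 4 + l n / 4)" by simp
  also have "\<dots> = 2 * cusp_coord l n / (1 + (cusp_coord l n)\<^sup>2)"
    by (subst tanh_add) (simp_all add: cusp_coord_def power2_eq_square)
  finally have T: "tanh (l n / 2) = 2 * cusp_coord l n / (1 + (cusp_coord l n)\<^sup>2)" .
  have c: "0 < cusp_coord l n" using assms by (rule cusp_coord_bounds(1))
  then have "cusp_coord l n + 1 / cusp_coord l n = (1 + (cusp_coord l n)\<^sup>2) / cusp_coord l n"
    by (simp add: field_simps power2_eq_square)
  moreover have "1 + (cusp_coord l n)\<^sup>2 > 0" by (intro add_pos_nonneg) auto
  ultimately show ?thesis using c T by simp
qed

lemma half_plane_expand:
  "(Re z - a) * (Re z - b) + (Im z)\<^sup>2 = (cmod z)\<^sup>2 + a * b - Re z * (a + b)"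
  unfolding cmod_power2 by (simp add: algebra_simps power2_eq_square)

lemma inner_boundary_arc:
  assumes "l (Suc n) > 0" "l (Suc (Suc n)) > 0"
  shows "{z \<in> half_pants l (Suc n). cmod z = 1} = unit_arc ` {0..l (Suc n) / 2}"
proof -
  define c where "c = cusp_coord l (Suc n)"
  define d where "d = cusp_coord l (Suc (Suc n))"
  define T where "T = tanh (l (Suc n) / 2)"
  have c: "0 < c" "c < 1" and d: "0 < d" "d < 1"
    using assms by (auto simp: c_def d_def cusp_coord_bounds)
  have T: "T * (c + 1 / c) = 2"
    unfolding T_def c_def using tanh_half_cusp_coord[of l "Suc n"] assms by simp
  have cd: "1 \<le> 1 / (c * d)" using c d by (simp add: mult_le_one)
  have "z \<in> half_pants l (Suc n) \<longleftrightarrow> Re z \<le> T" if z: "cmod z = 1" "0 < Im z" "0 \<le> Re z" for z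
  proof -
    have "Re z \<le> 1" using complex_Re_le_cmod[of z] z by simp
    moreover have "1 / c \<ge> 1" "1 / (c * d\<^sup>2) \<ge> 1"
      using c d by (simp_all add: mult_le_one power_le_one)
    ultimately have "(Re z - 1 / c) * (Re z - 1 / (c * d\<^sup>2)) \<ge> 0"
      by (intro mult_nonpos_nonpos) linarith+
    then have "z \<in> outer_half_plane (1 / c) (1 / (c * d\<^sup>2))"
      using z by (simp add: outer_half_plane_def)
    moreover have "z \<in> outer_half_plane c (1 / c) \<longleftrightarrow> Re z * (c + 1 / c) \<le> 2"
      using z c by (simp add: outer_half_plane_def half_plane_expand)
    moreover have "\<dots> \<longleftrightarrow> Re z \<le> T"
      unfolding T[symmetric] by (rule mult_le_cancel_right_pos) (use c in \<open>auto intro: add_pos_pos\<close>)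
    ultimately show ?thesis
      using z cd by (simp add: half_pants_def flip: c_def d_def)
  qed
  moreover have "1 \<le> outer_radius l (Suc n)" using cd by (simp add: c_def d_def)
  ultimately have "{z \<in> half_pants l (Suc n). cmod z = 1}
      = {z. 0 < Im z \<and> cmod z = 1 \<and> 0 \<le> Re z \<and> Re z \<le> T}"
    by (auto simp: half_pants_def)
  then show ?thesis
    using unit_arc_image[of "l (Suc n) / 2"] assms by (simp add: T_def)
qed

lemma outer_boundary_arc:
  assumes "\<And>k. k > 0 \<Longrightarrow> l k > 0"
  shows "{z \<in> half_pants l n. cmod z = outer_radius l n}
       = (\<lambda>t. of_real (outer_radius l n) * unit_arc t) ` {0..l (Suc n) / 2}"
proof -
  define e where "e = cusp_coord l (Suc n)"
  define R where "R = outer_radius l n"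
  define T where "T = tanh (l (Suc n) / 2)"
  have l: "l (Suc n) > 0" using assms by simp
  have e: "0 < e" "e < 1" using l by (simp_all add: e_def cusp_coord_bounds)
  have T: "T * (e + 1 / e) = 2"
    unfolding T_def e_def using l by (rule tanh_half_cusp_coord)
  have "R > 0 \<and> outer_seam l n = (R * e, R / e)"
  proof (cases n)
    case 0
    then show ?thesis by (simp add: R_def e_def)
  next
    case (Suc k)
    have "cusp_coord l n > 0" using assms[of n] Suc by (simp add: cusp_coord_bounds)
    then show ?thesis using e Suc by (simp add: R_def e_def power2_eq_square)
  qed
  then have R: "R > 0" and os: "outer_seam l n = (R * e, R / e)" by simp_all
  have inn: "z \<in> case_prod outer_half_plane (inner_seam l n)" and R1: "n \<noteq> 0 \<longrightarrow> 1 \<le> R"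
    if z: "cmod z = R" "0 < Im z" for z
  proof -
    have "\<exists>a b. inner_seam l n = (a, b) \<and> 0 \<le> a \<and> a \<le> b \<and> b \<le> R"
    proof (cases n)
      case 0 then show ?thesis using e by (auto simp: R_def e_def)
    next
      case (Suc k)
      then have c: "0 < cusp_coord l n" "cusp_coord l n < 1"
        using assms[of n] by (simp_all add: cusp_coord_bounds)
      have "R = 1 / (cusp_coord l n * e)" by (simp add: R_def Suc e_def)
      moreover have "1 / cusp_coord l n \<le> 1 / (cusp_coord l n * e)"
        using c e by (simp add: field_simps)
      moreover have "cusp_coord l n \<le> 1 / cusp_coord l n"
        using c by (simp add: field_simps mult_le_one)
      ultimately show ?thesis using c Suc by auto
    qed
    then obtain a b where ab: "inner_seam l n = (a, b)" "0 \<le> a" "a \<le> b" "b \<le> R"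
      by (elim exE conjE) (rule that)
    have "Re z * (a + b) \<le> R * (a + b)"
      using complex_Re_le_cmod[of z] z ab by (intro mult_right_mono) auto
    moreover have "R\<^sup>2 + a * b - R * (a + b) = (R - a) * (R - b)"
      by (simp add: algebra_simps power2_eq_square)
    moreover have "(R - a) * (R - b) \<ge> 0" using ab by simp
    ultimately have "R\<^sup>2 + a * b - Re z * (a + b) \<ge> 0" by linarith
    then show "z \<in> case_prod outer_half_plane (inner_seam l n)"
      using z ab by (simp add: outer_half_plane_def half_plane_expand)
    show "n \<noteq> 0 \<longrightarrow> 1 \<le> R"
    proof
      assume "n \<noteq> 0"
      then obtain k where k: "n = Suc k" by (cases n) auto
      then have "0 < cusp_coord l n" "cusp_coord l n < 1"
        using assms[of n] by (simp_all add: cusp_coord_bounds)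
      then show "1 \<le> R" using e by (simp add: R_def k e_def mult_le_one)
    qed
  qed
  have key: "z \<in> half_pants l n \<longleftrightarrow> Re z \<le> R * T"
    if z: "cmod z = R" "0 < Im z" "0 \<le> Re z" for z
  proof -
    have "z \<in> outer_half_plane (R * e) (R / e) \<longleftrightarrow> Re z * (R * (e + 1 / e)) \<le> (R * T) * (R * (e + 1 / e))"
    proof -
      have "(R * T) * (R * (e + 1 / e)) = R\<^sup>2 * (T * (e + 1 / e))"
        by (simp add: power2_eq_square mult_ac)
      also have "\<dots> = R\<^sup>2 + (R * e) * (R / e)"
        using e by (simp add: T power2_eq_square)
      finally have *: "(R * T) * (R * (e + 1 / e)) = R\<^sup>2 + (R * e) * (R / e)" .
      have **: "R * (e + 1 / e) = R * e + R / e" by (simp add: distrib_left)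
      have "z \<in> outer_half_plane (R * e) (R / e)
          \<longleftrightarrow> Re z * (R * e + R / e) \<le> R\<^sup>2 + (R * e) * (R / e)"
        unfolding outer_half_plane_def half_plane_expand using z by auto
      then show ?thesis unfolding * by (simp only: **)
    qed
    also have "\<dots> \<longleftrightarrow> Re z \<le> R * T"
      by (rule mult_le_cancel_right_pos) (use e R in \<open>simp add: add_pos_pos\<close>)
    finally show ?thesis
      using z inn[of z] R1[of z] os by (auto simp: half_pants_def R_def)
  qed
  have "0 < Im z \<and> 0 \<le> Re z" if "z \<in> half_pants l n" for z
    using that by (simp add: half_pants_def)
  then have "{z \<in> half_pants l n. cmod z = R}
      = {z. 0 < Im z \<and> cmod z = R \<and> 0 \<le> Re z \<and> Re z \<le> R * T}"
    using key by blast
  also have "\<dots> = (\<lambda>w. of_real R * w) ` {z. 0 < Im z \<and> cmod z = 1 \<and> 0 \<le> Re z \<and> Re z \<le> T}"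
  proof (intro equalityI subsetI)
    fix z assume z: "z \<in> {z. 0 < Im z \<and> cmod z = R \<and> 0 \<le> Re z \<and> Re z \<le> R * T}"
    have "z = of_real R * (z / of_real R)" using R by simp
    moreover have "z / of_real R \<in> {z. 0 < Im z \<and> cmod z = 1 \<and> 0 \<le> Re z \<and> Re z \<le> T}"
      using z R by (simp add: norm_divide field_simps)
    ultimately show "z \<in> (\<lambda>w. of_real R * w) ` {z. 0 < Im z \<and> cmod z = 1 \<and> 0 \<le> Re z \<and> Re z \<le> T}"
      by blast
  qed (use R in \<open>auto simp: norm_mult\<close>)
  also have "\<dots> = (\<lambda>w. of_real R * w) ` unit_arc ` {0..l (Suc n) / 2}"
    using unit_arc_image[of "l (Suc n) / 2"] assms[of "Suc n"] by (simp add: T_def)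
  finally show ?thesis by (simp add: R_def image_image)
qed

text \<open>The marked point, at the end of either arc, is where the seam to the cusp starts.\<close>

lemma marked_point_inner:
  assumes "l (Suc n) > 0"
  shows "unit_arc (l (Suc n) / 2) \<in> case_prod geodesic_line (inner_seam l (Suc n))"
proof -
  have c: "0 < cusp_coord l (Suc n)" using assms by (simp add: cusp_coord_bounds)
  have "unit_arc (l (Suc n) / 2) \<in> unit_arc ` {0..l (Suc n) / 2}" using assms by auto
  then have "cmod (unit_arc (l (Suc n) / 2)) = 1" "Im (unit_arc (l (Suc n) / 2)) > 0"
    using unit_arc_image[of "l (Suc n) / 2"] assms by auto
  moreover have "Re (unit_arc (l (Suc n) / 2)) = tanh (l (Suc n) / 2)"
    by (simp add: unit_arc_def)
  ultimately show ?thesis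
    using tanh_half_cusp_coord[of l "Suc n", OF assms] c
    by (simp add: geodesic_line_def half_plane_expand)
qed

lemma marked_point_outer:
  assumes "\<And>k. k > 0 \<Longrightarrow> l k > 0"
  shows "of_real (outer_radius l n) * unit_arc (l (Suc n) / 2)
       \<in> case_prod geodesic_line (outer_seam l n)"
proof -
  define e where "e = cusp_coord l (Suc n)"
  define R where "R = outer_radius l n"
  define T where "T = tanh (l (Suc n) / 2)"
  define u where "u = unit_arc (l (Suc n) / 2)"
  have l: "l (Suc n) > 0" using assms by simp
  have e: "0 < e" "e < 1" using l by (simp_all add: e_def cusp_coord_bounds)
  have T: "T * (e + 1 / e) = 2"
    unfolding T_def e_def using l by (rule tanh_half_cusp_coord)
  have "R > 0 \<and> outer_seam l n = (R * e, R / e)"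
  proof (cases n)
    case 0
    then show ?thesis by (simp add: R_def e_def)
  next
    case (Suc k)
    have "cusp_coord l n > 0" using assms[of n] Suc by (simp add: cusp_coord_bounds)
    then show ?thesis using e Suc by (simp add: R_def e_def power2_eq_square)
  qed
  then have R: "R > 0" and os: "outer_seam l n = (R * e, R / e)" by simp_all
  have "u \<in> unit_arc ` {0..l (Suc n) / 2}" using assms[of "Suc n"] by (auto simp: u_def)
  then have u: "cmod u = 1" "Im u > 0"
    using unit_arc_image[of "l (Suc n) / 2"] assms[of "Suc n"] by auto
  have "Re u = T" by (simp add: unit_arc_def u_def T_def)
  moreover have "R * T * (R * e + R / e) = R\<^sup>2 * (T * (e + 1 / e))"
    by (simp add: algebra_simps power2_eq_square)
  moreover have "cmod (of_real R * u) = R" using u R by (simp add: norm_mult)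
  moreover have "(R * e) * (R / e) = R\<^sup>2" using e by (simp add: power2_eq_square)
  ultimately have "of_real R * u \<in> geodesic_line (R * e) (R / e)"
    unfolding geodesic_line_def half_plane_expand using T R u(2) by simp
  then show ?thesis by (simp add: os u_def R_def)
qed


section \<open>Zero-twist tight flute surfaces\<close>

definition quotient_topology :: "'a topology \<Rightarrow> ('a \<Rightarrow> 'b) \<Rightarrow> 'b topology" where
  "quotient_topology X f =
     topology (\<lambda>V. V \<subseteq> f ` topspace X \<and> openin X {x \<in> topspace X. f x \<in> V})"

lemma openin_quotient_topology:
  "openin (quotient_topology X f) V \<longleftrightarrow> V \<subseteq> f ` topspace X \<and> openin X {x \<in> topspace X. f x \<in> V}"
proof -
  have "istopology (\<lambda>V. V \<subseteq> f ` topspace X \<and> openin X {x \<in> topspace X. f x \<in> V})"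
    unfolding istopology_def
  proof (intro conjI allI impI)
    fix S T assume "S \<subseteq> f ` topspace X \<and> openin X {x \<in> topspace X. f x \<in> S}"
      and "T \<subseteq> f ` topspace X \<and> openin X {x \<in> topspace X. f x \<in> T}"
    moreover have "{x \<in> topspace X. f x \<in> S \<inter> T}
        = {x \<in> topspace X. f x \<in> S} \<inter> {x \<in> topspace X. f x \<in> T}" by auto
    ultimately show "S \<inter> T \<subseteq> f ` topspace X" "openin X {x \<in> topspace X. f x \<in> S \<inter> T}"
      by auto
  next
    fix K assume K: "\<forall>V\<in>K. V \<subseteq> f ` topspace X \<and> openin X {x \<in> topspace X. f x \<in> V}"
    have "{x \<in> topspace X. f x \<in> \<Union>K} = (\<Union>V\<in>K. {x \<in> topspace X. f x \<in> V})" by auto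
    then show "\<Union>K \<subseteq> f ` topspace X" "openin X {x \<in> topspace X. f x \<in> \<Union>K}"
      using K by auto
  qed
  then show ?thesis
    by (simp add: quotient_topology_def topology_inverse')
qed

lemma topspace_quotient_topology [simp]: "topspace (quotient_topology X f) = f ` topspace X"
proof (rule antisym)
  show "topspace (quotient_topology X f) \<subseteq> f ` topspace X"
    using openin_quotient_topology[of X f "topspace (quotient_topology X f)"] by simp
  have "{x \<in> topspace X. f x \<in> f ` topspace X} = topspace X" by auto
  then have "openin (quotient_topology X f) (f ` topspace X)"
    by (simp add: openin_quotient_topology)
  then show "f ` topspace X \<subseteq> topspace (quotient_topology X f)"
    by (rule openin_subset)
qed

lemma quotient_map_quotient_topology: "quotient_map X (quotient_topology X f) f"
  by (auto simp: quotient_map_def openin_quotient_topology)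

text \<open>
  The point \<open>((n, \<sigma>), z)\<close> is the point \<open>z\<close> of the front (\<open>\<sigma> = True\<close>) or back (\<open>\<sigma> = False\<close>)
  polygon of \<open>P\<^sub>n\<close>; the back polygon is oriented oppositely to the upper half-plane.
  The seam rule makes a pair of pants out of its two halves. The zero twist rule
  glues the outer boundary geodesic of \<open>P\<^sub>n\<close> isometrically to the inner one of \<open>P\<^sub>n\<^sub>+\<^sub>1\<close>, marked
  point to marked point; it maps front to front since the result is to be orientable.
\<close>

type_synonym flute_piece_point = "(nat \<times> bool) \<times> complex"

inductive glued :: "(nat \<Rightarrow> real) \<Rightarrow> flute_piece_point \<Rightarrow> flute_piece_point \<Rightarrow> bool"
  for l where
  seam: "z \<in> seams l n \<Longrightarrow> glued l ((n, \<sigma>), z) ((n, \<not> \<sigma>), z)"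
| zero_twist: "z \<in> half_pants l n \<Longrightarrow> cmod z = outer_radius l n \<Longrightarrow>
    glued l ((n, \<sigma>), z) ((Suc n, \<sigma>), z / of_real (outer_radius l n))"

definition glue_class :: "(nat \<Rightarrow> real) \<Rightarrow> flute_piece_point \<Rightarrow> flute_piece_point set" where
  "glue_class l p = {p'. equivclp (glued l) p p'}"

definition flute_topology :: "(nat \<Rightarrow> real) \<Rightarrow> flute_piece_point set topology" where
  "flute_topology l =
     quotient_topology (sum_topology (\<lambda>(n, \<sigma>). top_of_set (half_pants l n)) UNIV) (glue_class l)"

text \<open>The charts of the induced hyperbolic metric: homeomorphisms from open sets of the surface onto
  open sets of the hyperbolic plane which on every polygon are locally isometries, orientation
  preserving with respect to the orientation of the surface.\<close>

definition flute_chart :: "(nat \<Rightarrow> real) \<Rightarrow> flute_piece_point set set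
    \<Rightarrow> (flute_piece_point set \<Rightarrow> complex) \<Rightarrow> bool" where
  "flute_chart l U \<phi> \<longleftrightarrow>
     openin (flute_topology l) U \<and> open (\<phi> ` U) \<and> \<phi> ` U \<subseteq> {z. 0 < Im z} \<and>
     homeomorphic_map (subtopology (flute_topology l) U) (top_of_set (\<phi> ` U)) \<phi> \<and>
     (\<forall>n \<sigma>. \<forall>z \<in> half_pants l n. glue_class l ((n, \<sigma>), z) \<in> U \<longrightarrow>
        (\<exists>W m. open W \<and> z \<in> W \<and> hyp_isometry m \<and>
           (\<forall>w \<in> half_pants l n \<inter> W. glue_class l ((n, \<sigma>), w) \<in> U \<and>
              \<phi> (glue_class l ((n, \<sigma>), w)) = m (if \<sigma> then w else - cnj w))))"

definition zero_twist_flute :: "(nat \<Rightarrow> real) \<Rightarrow> flute_piece_point set surface" where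
  "zero_twist_flute l =
     \<lparr>surf_top = flute_topology l, surf_charts = {(U, \<phi>). flute_chart l U \<phi>}\<rparr>"

definition associated_length :: "(nat \<Rightarrow> real) \<Rightarrow> nat \<Rightarrow> real" where
  "associated_length x n =
     (let s = (\<lambda>n. \<Sum>i\<le>n. x i) in
      ln ((s (n - 1) + s n + 2 * sqrt (s (n - 1) * s n)) /
          (s (n - 1) + s n - 2 * sqrt (s (n - 1) * s n))))"

lemma associated_length_pos:
  assumes "\<And>n. x n > 0" "n > 0"
  shows "associated_length x n > 0"
proof -
  define A where "A = (\<Sum>i\<le>n - 1. x i)"
  define B where "B = (\<Sum>i\<le>n. x i)"
  have A: "A > 0" unfolding A_def using assms by (intro sum_pos) auto
  have "B = A + x n" using assms(2) by (cases n) (auto simp: A_def B_def)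
  then have B: "A < B" using assms(1)[of n] by simp
  have "(sqrt B - sqrt A)\<^sup>2 > 0" using B by simp
  also have "(sqrt B - sqrt A)\<^sup>2 = A + B - 2 * sqrt (A * B)"
    using A B by (simp add: power2_diff real_sqrt_mult)
  finally have "A + B - 2 * sqrt (A * B) > 0" .
  moreover have "sqrt (A * B) > 0" using A B by simp
  ultimately have "(A + B + 2 * sqrt (A * B)) / (A + B - 2 * sqrt (A * B)) > 1"
    by (simp add: less_divide_eq)
  then have "ln ((A + B + 2 * sqrt (A * B)) / (A + B - 2 * sqrt (A * B))) > 0"
    by (rule ln_gt_zero)
  then show ?thesis
    by (simp only: associated_length_def Let_def A_def B_def)
qed

definition associated_surface :: "(nat \<Rightarrow> real) \<Rightarrow> flute_piece_point set surface" where
  "associated_surface x = zero_twist_flute (associated_length x)"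

end

theory Submission
  imports Defs "HOL-Complex_Analysis.Complex_Analysis"
begin

text \<open>
  Rescaling the polygons by \<open>scale n\<close> makes them fit together along circles about \<open>0\<close>; with
  their mirror images they tile a domain \<open>Q\<close> in the upper half plane, bounded by half circles over the
  intervals between consecutive points \<open>\<plusminus> node n\<close>, and the surface is \<open>Q\<close> with each side glued to
  its mirror image.

  If the nodes are bounded with limit \<open>L\<close>, the geodesic \<open>\<bar>z\<bar> = L\<close> lies beyond all of \<open>Q\<close>, and
  minus the angle coordinate relative to it, a function of the distance to that geodesic, is
  negative, subharmonic and non-constant; it stays subharmonic across a side because the
  distance decreases from the side into \<open>Q\<close>, on both of the glued sides.

  If the nodes are unbounded, \<open>Q\<close> is cut off only by a cusp region at each node and by large
  circles, and there are cutoff functions \<open>\<eta>\<close> of arbitrarily small Dirichlet energy. For a positive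
  superharmonic \<open>\<phi>\<close>, the Caccioppoli argument with test function \<open>\<eta>\<^sup>2 / \<phi>\<close> bounds the energy of
  \<open>ln \<phi>\<close> by that of \<open>\<eta>\<close>, so \<open>\<phi>\<close> is constant. As \<open>\<phi>\<close> is only semicontinuous, no derivatives
  are used: energies are double integrals of squared differences against an isometry invariant
  kernel of small radius \<open>r\<close>, of order \<open>r\<^sup>4\<close>.
\<close>

section \<open>The fundamental domain\<close>

text \<open>The length formula makes \<open>tanh (l n / 4)\<close> the square root of the ratio of
  two consecutive nodes. This puts every ideal vertex at a point \<plusminus> \<open>node n\<close>,
  and the question becomes whether the nodes are bounded. No universal cover is used: near a side
  only \<open>Q\<close> and the one copy of it behind that side matter, so one side pairing
  (\<open>unf\<close>) suffices. Subharmonicity speaks of all charts of the metric and of all closed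
  discs in them. Hence charts are shown to be local Moebius maps, by agreement at infinitely many
  points of each seam or circle, and mean inequalities on small discs are extended to all discs. In
  the order r^4 one factor r^2 is the mass of the kernel and the other the squared difference of a
  Lipschitz function. Energy of smaller order on a disc forces constancy almost everywhere; lower
  semicontinuity and the mean inequality then remove the null set. The cutoffs are invariant under
  \<open>J\<close> and may be compared across sides because reflecting a point behind a side does
  not increase its distance to points of \<open>Q\<close>.\<close>

locale flute_seq =
  fixes x :: "nat \<Rightarrow> real"
  assumes x_pos: "\<And>n. x n > 0"
begin

text \<open>\<open>node n\<close> is \<open>s\<^bsub>n-1\<^esub>\<close> of the informal statement. The side \<open>(n, b)\<close> has ideal endpoints
  \<open>\<plusminus> node n\<close>, \<open>\<plusminus> node (Suc n)\<close>, with sign \<open>+\<close> iff \<open>b\<close>; it is glued to \<open>opp (n, b)\<close> by \<open>J\<close>.\<close>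

definition node :: "nat \<Rightarrow> real" where "node k = (\<Sum>i<k. x i)"
text \<open>The circle of this radius about 0 is orthogonal to the side over
  \<open>{node n..node (Suc n)}\<close>, as the square of the radius is the product of the end
  points. These circles carry the rescaled boundary geodesics; \<open>level 0 = 0\<close> reflects
  that the first pair of pants has a cusp instead of an inner boundary.\<close>

definition level :: "nat \<Rightarrow> real" where "level n = sqrt (node n * node (Suc n))"
text \<open>A polygon with n > 0 has its inner boundary on |z| = 1, but polygon 0 has its outer
  boundary there, whence \<open>level 1\<close> in that case.\<close>

definition scale :: "nat \<Rightarrow> real" where "scale n = (if n = 0 then level 1 else level n)"
definition cen :: "nat \<times> bool \<Rightarrow> real" where
  "cen j = (if snd j then 1 else -1) * ((node (fst j) + node (Suc (fst j))) / 2)"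
definition rad :: "nat \<times> bool \<Rightarrow> real" where "rad j = x (fst j) / 2"
definition opp :: "nat \<times> bool \<Rightarrow> nat \<times> bool" where "opp j = (fst j, \<not> snd j)"
abbreviation len :: "nat \<Rightarrow> real" where "len \<equiv> associated_length x"

text \<open>Bounded nodes make the polygons accumulate at the half circle whose radius is the limit,
  and the domain has to stop there; for unbounded nodes this is the whole half plane.\<close>

definition reg :: "complex set" where "reg = {z. 0 < Im z \<and> (\<exists>n. cmod z < node n)}"
definition Q :: "complex set" where
  "Q = {z \<in> reg. \<forall>j. rad j \<le> cmod (z - of_real (cen j))}"
definition on_side :: "complex \<Rightarrow> bool" where
  "on_side z \<longleftrightarrow> (\<exists>j. cmod (z - of_real (cen j)) = rad j)"
definition J :: "complex \<Rightarrow> complex" where "J z = - cnj z"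
definition emb :: "nat \<Rightarrow> bool \<Rightarrow> complex \<Rightarrow> complex" where
  "emb n \<sigma> w = (if \<sigma> then of_real (scale n) * w else J (of_real (scale n) * w))"
definition unemb :: "nat \<Rightarrow> bool \<Rightarrow> complex \<Rightarrow> complex" where
  "unemb n \<sigma> z = (if \<sigma> then z else J z) / of_real (scale n)"
text \<open>Closed at both ends, so that consecutive blocks share a circle and mirror images share
  the axis: the overlaps are where boundary geodesics and axis seams are glued.\<close>

definition block :: "nat \<Rightarrow> bool \<Rightarrow> complex set" where
  "block n \<sigma> = {z. level n \<le> cmod z \<and> cmod z \<le> level (Suc n) \<and> (if \<sigma> then 0 \<le> Re z else Re z \<le> 0)}"

section \<open>Reflection, nodes and levels\<close>

lemma J_simps [simp]: "Re (J z) = - Re z" "Im (J z) = Im z" "cmod (J z) = cmod z" "J (J z) = z"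
  by (simp_all add: J_def complex_eq_iff)

lemma J_inj [simp]: "J z = J w \<longleftrightarrow> z = w" by (metis J_simps(4))

lemma J_scale: "J (of_real r * z) = of_real r * J z" by (simp add: J_def)
lemma J_divide: "J (z / of_real r) = J z / of_real r" by (simp add: J_def)

lemma node_0 [simp]: "node 0 = 0" and node_Suc: "node (Suc k) = node k + x k"
  by (simp_all add: node_def)

lemma node_strict_mono: "i < j \<Longrightarrow> node i < node j"
  by (rule strict_monoD[OF strict_mono_Suc_iff[THEN iffD2]]) (simp_all add: node_Suc x_pos)

lemma node_mono: "i \<le> j \<Longrightarrow> node i \<le> node j"
  using node_strict_mono[of i j] by (cases "i = j") auto

lemma node_nonneg [simp]: "0 \<le> node k" using node_mono[of 0 k] by simp
lemma node_Suc_pos [simp]: "0 < node (Suc k)" using node_strict_mono[of 0 "Suc k"] by simp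
lemma node_pos: "0 < k \<Longrightarrow> 0 < node k" using node_strict_mono[of 0 k] by simp

lemma level_0 [simp]: "level 0 = 0" by (simp add: level_def)
lemma level_nonneg [simp]: "0 \<le> level n" by (simp add: level_def)

lemma node_le_level: "node n \<le> level n"
proof -
  have "node n = sqrt (node n * node n)" by simp
  also have "\<dots> \<le> level n" unfolding level_def
    by (intro real_sqrt_le_mono mult_left_mono node_mono) auto
  finally show ?thesis .
qed

lemma level_less_node: "level n < node (Suc n)"
proof -
  have "level n < sqrt (node (Suc n) * node (Suc n))" unfolding level_def
    by (intro real_sqrt_less_mono mult_strict_right_mono node_strict_mono) auto
  then show ?thesis using node_nonneg[of "Suc n"] by (simp del: node_nonneg)
qed

lemma level_less_Suc: "level n < level (Suc n)"
  using level_less_node[of n] node_le_level[of "Suc n"] by linarith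

lemma level_strict_mono: "i < j \<Longrightarrow> level i < level j"
  by (rule strict_monoD[OF strict_mono_Suc_iff[THEN iffD2]]) (simp_all add: level_less_Suc)

lemma level_mono: "i \<le> j \<Longrightarrow> level i \<le> level j"
  using level_strict_mono[of i j] by (cases "i = j") auto

lemma level_Suc_pos [simp]: "0 < level (Suc n)" using level_strict_mono[of 0 "Suc n"] by simp

lemma scale_pos [simp]: "0 < scale n"
  by (cases n) (simp_all add: scale_def)
lemma scale_nz [simp]: "scale n \<noteq> 0" using scale_pos[of n] by linarith

lemma emb_unemb [simp]: "emb n \<sigma> (unemb n \<sigma> z) = z" and unemb_emb [simp]: "unemb n \<sigma> (emb n \<sigma> w) = w"
  by (simp_all add: emb_def unemb_def J_scale J_divide)

text \<open>With a and b the square roots of the two partial sums, the quotient inside the logarithm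
  is the square of q = (b + a) / (b - a). So a quarter of the length is (ln q) / 2, whose tanh is (q
  - 1) / (q + 1) = a / b.\<close>

lemma cusp_coord_len:
  assumes "n > 0"
  shows "cusp_coord len n = sqrt (node n / node (Suc n))"
proof -
  define a where "a = sqrt (node n)"
  define b where "b = sqrt (node (Suc n))"
  define q where "q = (b + a) / (b - a)"
  have a: "0 < a" using node_pos[OF assms] by (simp add: a_def)
  have ab: "a < b" using node_strict_mono[of n "Suc n"] by (simp add: a_def b_def)
  have q: "q > 1" using a ab by (simp add: q_def)
  have A: "(\<Sum>i\<le>n - 1. x i) = a\<^sup>2" using assms
    by (cases n) (simp_all add: a_def node_def lessThan_Suc_atMost sum_nonneg x_pos less_imp_le)
  have B: "(\<Sum>i\<le>n. x i) = b\<^sup>2"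
    by (simp add: b_def node_def lessThan_Suc_atMost sum_nonneg x_pos less_imp_le)
  have sq: "sqrt (a\<^sup>2 * b\<^sup>2) = a * b" using a ab by (simp add: real_sqrt_mult)
  have "len n = ln ((a\<^sup>2 + b\<^sup>2 + 2 * (a * b)) / (a\<^sup>2 + b\<^sup>2 - 2 * (a * b)))"
    unfolding associated_length_def Let_def A B sq ..
  also have "(a\<^sup>2 + b\<^sup>2 + 2 * (a * b)) / (a\<^sup>2 + b\<^sup>2 - 2 * (a * b)) = q\<^sup>2"
    by (simp add: q_def power_divide power2_sum power2_diff algebra_simps)
  also have "ln (q\<^sup>2) = 2 * ln q" using q by (simp add: ln_realpow)
  finally have l: "len n / 4 = ln q / 2" by simp
  have "tanh (ln q / 2) = (1 - exp (- 2 * (ln q / 2))) / (1 + exp (- 2 * (ln q / 2)))"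
    by (rule tanh_real_altdef)
  also have "exp (- 2 * (ln q / 2)) = 1 / q" using q by (simp add: exp_minus field_simps)
  also have "(1 - 1 / q) / (1 + 1 / q) = (q - 1) / (q + 1)"
  proof -
    have "1 - 1 / q = (q - 1) / q" "1 + 1 / q = (q + 1) / q" using q by (simp_all add: field_simps)
    then show ?thesis using q by simp
  qed
  also have "\<dots> = a / b" using a ab by (simp add: q_def field_simps)
  finally show ?thesis unfolding cusp_coord_def l by (simp add: a_def b_def real_sqrt_divide)
qed

text \<open>\<open>node n\<close>, \<open>level n\<close>, \<open>node (Suc n)\<close> form a
  geometric progression with ratio \<open>1 / cusp_coord len n\<close>.\<close>

lemma cusp_level:
  assumes "n > 0"
  shows "cusp_coord len n * level n = node n" "cusp_coord len n * node (Suc n) = level n"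
    "cusp_coord len n > 0"
proof -
  define a b where "a = sqrt (node n)" and "b = sqrt (node (Suc n))"
  have ab: "0 < a" "0 < b" using assms by (simp_all add: a_def b_def node_pos)
  have n: "node n = a * a" "node (Suc n) = b * b" by (simp_all add: a_def b_def)
  have l: "level n = a * b" by (simp add: level_def real_sqrt_mult a_def b_def)
  have c: "cusp_coord len n = a / b" by (simp add: cusp_coord_len[OF assms] real_sqrt_divide a_def b_def)
  show "cusp_coord len n * level n = node n" "cusp_coord len n * node (Suc n) = level n"
    "cusp_coord len n > 0"
    using ab by (simp_all add: n l c)
qed

text \<open>After rescaling, the outer circle of polygon n is the inner circle of polygon n + 1;
  this turns the zero twist gluing into the identity on \<open>Q\<close>.\<close>

lemma outer_radius_scale: "scale n * outer_radius len n = level (Suc n)"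
proof (cases n)
  case 0 then show ?thesis by (simp add: scale_def)
next
  case (Suc m)
  define c d where "c = cusp_coord len n" and "d = cusp_coord len (Suc n)"
  have c: "c * node (Suc n) = level n" "c > 0" and d: "d * level (Suc n) = node (Suc n)" "d > 0"
    using cusp_level[of n] cusp_level[of "Suc n"] Suc by (simp_all add: c_def d_def)
  have "scale n = c * d * level (Suc n)" using c(1) d(1) Suc by (simp add: scale_def mult.assoc)
  moreover have "outer_radius len n = 1 / (c * d)" by (simp add: Suc c_def d_def)
  ultimately show ?thesis using c(2) d(2) by simp
qed

text \<open>Together with \<open>outer_seam_scale\<close> this shows that the outer cusp seam of
  polygon n and the inner cusp seam of polygon n + 1 lie on one side of \<open>Q\<close>.\<close>

lemma inner_seam_scale: "scale n * fst (inner_seam len n) = node n"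
    "scale n * snd (inner_seam len n) = node (Suc n)"
proof -
  have "scale n * fst (inner_seam len n) = node n \<and> scale n * snd (inner_seam len n) = node (Suc n)"
  proof (cases n)
    case 0 then show ?thesis using cusp_level(1)[of 1] by (simp add: scale_def mult.commute)
  next
    case (Suc m)
    then have n: "n > 0" by simp
    show ?thesis using cusp_level[OF n] Suc by (simp add: scale_def field_simps)
  qed
  then show "scale n * fst (inner_seam len n) = node n"
    "scale n * snd (inner_seam len n) = node (Suc n)" by auto
qed

lemma outer_seam_scale: "scale n * fst (outer_seam len n) = node (Suc n)"
    "scale n * snd (outer_seam len n) = node (Suc (Suc n))"
proof -
  have "scale n * fst (outer_seam len n) = node (Suc n) \<and> scale n * snd (outer_seam len n) = node (Suc (Suc n))"
  proof (cases n)
    case 0 then show ?thesis using cusp_level[of 1] by (simp add: scale_def field_simps)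
  next
    case (Suc m)
    define c d where "c = cusp_coord len n" and "d = cusp_coord len (Suc n)"
    have c: "c * node (Suc n) = level n" "c > 0"
      and d: "d * level (Suc n) = node (Suc n)" "d * node (Suc (Suc n)) = level (Suc n)" "d > 0"
      using cusp_level[of n] cusp_level[of "Suc n"] Suc by (simp_all add: c_def d_def)
    have os: "outer_seam len n = (1 / c, 1 / (c * d\<^sup>2))" by (simp add: Suc c_def d_def)
    have sc: "scale n = level n" using Suc by (simp add: scale_def)
    have "scale n / c = node (Suc n)" using c sc by (simp add: field_simps)
    moreover have "scale n / (c * d\<^sup>2) = node (Suc (Suc n))"
    proof -
      have "scale n = c * (d * (d * node (Suc (Suc n))))" using c d sc by simp
      then show ?thesis using c(2) d(3) by (simp add: power2_eq_square)
    qed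
    ultimately show ?thesis by (simp add: os)
  qed
  then show "scale n * fst (outer_seam len n) = node (Suc n)"
    "scale n * snd (outer_seam len n) = node (Suc (Suc n))" by auto
qed

section \<open>Half discs over the intervals between nodes\<close>

lemma rad_pos [simp]: "0 < rad j" by (simp add: rad_def x_pos)
lemma cen_opp [simp]: "cen (opp j) = - cen j" and rad_opp [simp]: "rad (opp j) = rad j"
  and opp_opp [simp]: "opp (opp j) = j"
  by (simp_all add: cen_def rad_def opp_def)

lemma dist_J: "cmod (J z - of_real (cen j)) = cmod (z - of_real (cen (opp j)))"
proof -
  have "J z - of_real (cen j) = J (z - of_real (cen (opp j)))" by (simp add: J_def)
  then show ?thesis by (simp only: J_simps)
qed

lemma on_side_J [simp]: "on_side (J z) = on_side z"
  unfolding on_side_def by (metis dist_J rad_opp opp_opp)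

lemma Q_J [simp]: "J z \<in> Q \<longleftrightarrow> z \<in> Q"
proof -
  have "(\<forall>j. rad j \<le> cmod (J z - of_real (cen j))) \<longleftrightarrow> (\<forall>j. rad j \<le> cmod (z - of_real (cen j)))"
    unfolding dist_J by (metis rad_opp opp_opp)
  then show ?thesis by (simp add: Q_def reg_def)
qed

lemma quad_expand: "(Re z - a) * (Re z - b) + (Im z)\<^sup>2
    = (cmod (z - of_real ((a + b) / 2)))\<^sup>2 - ((b - a) / 2)\<^sup>2"
  unfolding cmod_power2 by (simp add: field_simps power2_eq_square)

lemma side_strip:
  assumes "cmod (z - of_real (cen j)) \<le> rad j" "0 < Im z"
  shows "node (fst j) < (if snd j then 1 else -1) * Re z" "(if snd j then 1 else -1) * Re z < node (Suc (fst j))"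
proof -
  have cr: "\<bar>Re z - cen j\<bar> < rad j"
  proof -
    have "\<bar>Re z - cen j\<bar>\<^sup>2 < (cmod (z - of_real (cen j)))\<^sup>2"
      unfolding cmod_power2 using assms(2) by simp
    also have "\<dots> \<le> (rad j)\<^sup>2" using assms(1) by (intro power_mono) auto
    finally show ?thesis using rad_pos[of j] by (simp add: power2_less_imp_less less_imp_le)
  qed
  define a b where "a = node (fst j)" and "b = node (Suc (fst j))"
  have rj: "2 * rad j = b - a" by (simp add: rad_def a_def b_def node_Suc)
  have iv: "cen j - rad j < Re z" "Re z < cen j + rad j" using cr by linarith+
  have "a < (if snd j then 1 else -1) * Re z \<and> (if snd j then 1 else -1) * Re z < b"
  proof (cases "snd j")
    case True
    then have "2 * cen j = a + b" by (simp add: cen_def a_def b_def)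
    then have "a < Re z" "Re z < b" using iv rj by linarith+
    then show ?thesis using True by simp
  next
    case False
    then have "2 * cen j = - (a + b)" unfolding cen_def a_def[symmetric] b_def[symmetric] by simp
    then have "a < - Re z" "- Re z < b" using iv rj by linarith+
    then show ?thesis using False by simp
  qed
  then show "node (fst j) < (if snd j then 1 else -1) * Re z" "(if snd j then 1 else -1) * Re z < node (Suc (fst j))"
    by (simp_all add: a_def b_def)
qed

text \<open>Half discs over different intervals can touch only at ideal end points, and these are
  excluded by \<open>0 < Im z\<close>.\<close>

lemma side_unique:
  assumes "cmod (z - of_real (cen i)) \<le> rad i" "cmod (z - of_real (cen j)) \<le> rad j" "0 < Im z"
  shows "i = j"
proof -
  note i = side_strip[OF assms(1,3)] and j = side_strip[OF assms(2,3)]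
  have "snd i = snd j"
    using i(1) j(1) node_nonneg[of "fst i"] node_nonneg[of "fst j"]
    by (auto simp del: node_nonneg split: if_splits)
  then have "node (fst i) < node (Suc (fst j))" "node (fst j) < node (Suc (fst i))"
    using i j by (auto split: if_splits)
  then have "fst i = fst j" using node_mono[of "Suc (fst j)" "fst i"] node_mono[of "Suc (fst i)" "fst j"]
    by (meson le_less_trans less_irrefl linorder_neqE_nat not_less Suc_leI)
  with \<open>snd i = snd j\<close> show ?thesis by (simp add: prod_eq_iff)
qed

text \<open>Expanding the square turns membership in the half disc over \<open>{a..b}\<close> into
  |z|^2 \<le> (a + b) Re z - a b, up to the sign of the side, and the right-hand side is below b^2
  because Re z < b.\<close>

lemma side_cmod:
  assumes "cmod (z - of_real (cen j)) \<le> rad j" "0 < Im z"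
  shows "node (fst j) < cmod z" "cmod z < node (Suc (fst j))"
proof -
  define a b where "a = node (fst j)" and "b = node (Suc (fst j))"
  define e where "e = (if snd j then 1 else -1 :: real)"
  have e: "a < e * Re z" "e * Re z < b" using side_strip[OF assms] by (simp_all add: a_def b_def e_def)
  have "e * Re z \<le> cmod z" using abs_Re_le_cmod[of z] by (auto simp: e_def)
  then show "node (fst j) < cmod z" using e by (simp add: a_def)
  have ab: "0 \<le> a" "0 < b" by (simp_all add: a_def b_def)
  have ce: "cen j = e * ((a + b) / 2)" and ra: "rad j = (b - a) / 2"
    by (simp_all add: cen_def a_def b_def e_def rad_def node_Suc)
  have ee: "e * e = 1" by (simp add: e_def)
  have "(cmod (z - of_real (cen j)))\<^sup>2 = (cmod z)\<^sup>2 - (a + b) * (e * Re z) + (e * e) * ((a + b) / 2)\<^sup>2"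
    unfolding cmod_power2 ce by (simp add: field_simps power2_eq_square)
  moreover have "(cmod (z - of_real (cen j)))\<^sup>2 \<le> ((b - a) / 2)\<^sup>2"
    using assms(1) by (intro power_mono) (simp_all add: ra)
  ultimately have "(cmod z)\<^sup>2 \<le> (a + b) * (e * Re z) - a * b"
    using ee by (simp add: field_simps power2_eq_square)
  also have "\<dots> < (a + b) * b - a * b" using ab e(2) by (intro diff_strict_right_mono mult_strict_left_mono) auto
  also have "\<dots> = b\<^sup>2" by (simp add: algebra_simps power2_eq_square)
  finally show "cmod z < node (Suc (fst j))" using ab by (simp add: b_def power2_less_imp_less less_imp_le)
qed

text \<open>Of the infinitely many half discs only those with index n and n + 1 meet the annulus
  between \<open>level n\<close> and \<open>level (Suc n)\<close>, because
  \<open>node n \<le> level n < node (Suc n)\<close>.\<close>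

lemma block_side:
  assumes "cmod (z - of_real (cen j)) \<le> rad j" "0 < Im z" "level n \<le> cmod z" "cmod z \<le> level (Suc n)"
  shows "fst j = n \<or> fst j = Suc n"
proof (rule ccontr)
  assume "\<not> ?thesis"
  then consider "Suc (fst j) \<le> n" | "Suc (Suc n) \<le> fst j" by linarith
  then show False
  proof cases
    case 1
    then have "node (Suc (fst j)) \<le> level n" using node_mono[of "Suc (fst j)" n] node_le_level[of n] by linarith
    then show False using side_cmod(2)[OF assms(1,2)] assms(3) by linarith
  next
    case 2
    then have "level (Suc n) < node (fst j)" using node_mono[of "Suc (Suc n)" "fst j"] level_less_node[of "Suc n"] by linarith
    then show False using side_cmod(1)[OF assms(1,2)] assms(4) by linarith
  qed
qed

text \<open>A polygon imposes the conditions of its two cusp seams only; on its block all other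
  conditions in \<open>Q\<close> are automatic, by \<open>block_side\<close> for the index and by
  \<open>side_strip\<close> for the sign.\<close>

lemma half_pants_iff:
  "w \<in> half_pants len n \<longleftrightarrow> emb n \<sigma> w \<in> Q \<and> emb n \<sigma> w \<in> block n \<sigma>"
proof -
  define z where "z = of_real (scale n) * w"
  have outer: "w \<in> case_prod outer_half_plane p \<longleftrightarrow>
      0 < Im w \<and> rad (k, True) \<le> cmod (z - of_real (cen (k, True)))"
    if p: "scale n * fst p = node k" "scale n * snd p = node (Suc k)" for p k
  proof -
    have e: "z - of_real (cen (k, True)) = of_real (scale n) * (w - of_real ((fst p + snd p) / 2))"
      using p by (simp add: z_def cen_def algebra_simps add_divide_distrib flip: of_real_mult of_real_add)
    have r: "rad (k, True) = scale n * ((snd p - fst p) / 2)"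
      using p by (simp add: rad_def node_Suc algebra_simps diff_divide_distrib)
    then have "(snd p - fst p) / 2 \<ge> 0" using rad_pos[of "(k,True)"] scale_pos[of n]
      by (metis less_imp_le zero_less_mult_pos)
    then have "w \<in> case_prod outer_half_plane p \<longleftrightarrow>
      0 < Im w \<and> (snd p - fst p) / 2 \<le> cmod (w - of_real ((fst p + snd p) / 2))"
      by (auto simp: outer_half_plane_def quad_expand case_prod_beta
          intro: power_mono dest: power2_le_imp_le simp del: of_real_divide of_real_add)
    then show ?thesis unfolding e r norm_mult using mult_le_cancel_left_pos[OF scale_pos[of n]]
      by (simp add: abs_of_pos del: of_real_divide of_real_add)
  qed
  have nz: "cmod z = scale n * cmod w" by (simp add: z_def norm_mult abs_of_pos)
  have sp: "\<not> scale n \<le> 0" "\<not> scale n < 0" using scale_pos[of n] by linarith+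
  have Re: "Re z \<ge> 0 \<longleftrightarrow> Re w \<ge> 0" and Im: "Im z > 0 \<longleftrightarrow> Im w > 0"
    by (simp_all add: sp z_def zero_le_mult_iff zero_less_mult_iff less_imp_le)
  have mod1: "(n \<noteq> 0 \<longrightarrow> 1 \<le> cmod w) \<longleftrightarrow> level n \<le> cmod z"
    unfolding nz using mult_le_cancel_left_pos[OF scale_pos[of n], of 1 "cmod w"]
    by (cases "n = 0") (auto simp: scale_def)
  have mod2: "cmod w \<le> outer_radius len n \<longleftrightarrow> cmod z \<le> level (Suc n)"
    unfolding nz outer_radius_scale[symmetric] by simp
  have "w \<in> half_pants len n \<longleftrightarrow> 0 < Im z \<and> 0 \<le> Re z \<and> level n \<le> cmod z \<and> cmod z \<le> level (Suc n) \<and>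
     rad (n, True) \<le> cmod (z - of_real (cen (n, True))) \<and>
     rad (Suc n, True) \<le> cmod (z - of_real (cen (Suc n, True)))"
    unfolding half_pants_def Int_iff mem_Collect_eq mod1 mod2
      outer[OF inner_seam_scale] outer[OF outer_seam_scale] Re Im by auto
  also have "\<dots> \<longleftrightarrow> z \<in> Q \<and> z \<in> block n True"
  proof (intro iffI conjI)
    assume a: "0 < Im z \<and> 0 \<le> Re z \<and> level n \<le> cmod z \<and> cmod z \<le> level (Suc n) \<and>
     rad (n, True) \<le> cmod (z - of_real (cen (n, True))) \<and>
     rad (Suc n, True) \<le> cmod (z - of_real (cen (Suc n, True)))"
    then show "z \<in> block n True" by (simp add: block_def)
    have "cmod z < node (Suc (Suc n))" using a level_less_node[of "Suc n"] by linarith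
    moreover have "rad j \<le> cmod (z - of_real (cen j))" for j
    proof (rule ccontr)
      assume n: "\<not> ?thesis"
      then have "fst j = n \<or> fst j = Suc n" using a by (intro block_side[of z j n]) auto
      moreover have "snd j" using side_strip(1)[of z j] n a node_nonneg[of "fst j"]
        by (auto simp del: node_nonneg split: if_splits)
      ultimately have "j = (n, True) \<or> j = (Suc n, True)" by (cases j) auto
      then show False using a n by auto
    qed
    ultimately show "z \<in> Q" using a by (auto simp: Q_def reg_def)
  qed (auto simp: Q_def reg_def block_def)
  finally have *: "w \<in> half_pants len n \<longleftrightarrow> z \<in> Q \<and> z \<in> block n True" .
  show ?thesis
    unfolding * emb_def by (cases \<sigma>) (simp_all add: z_def block_def)
qed

lemma unemb_half_pants: "z \<in> Q \<Longrightarrow> z \<in> block n \<sigma> \<Longrightarrow> unemb n \<sigma> z \<in> half_pants len n"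
  by (simp add: half_pants_iff[where \<sigma> = \<sigma>])

text \<open>Inside a block no other side can be met than the two that carry its cusp seams, so the
  seams exhaust what the polygon contains of the axis and of all sides.\<close>

lemma seams_iff:
  "w \<in> seams len n \<longleftrightarrow> w \<in> half_pants len n \<and> (Re (emb n \<sigma> w) = 0 \<or> on_side (emb n \<sigma> w))"
proof (cases "w \<in> half_pants len n")
  case True
  define z where "z = of_real (scale n) * w"
  have zz: "z \<in> Q" "z \<in> block n True" using True half_pants_iff[of w n True] by (simp_all add: emb_def z_def)
  have Im: "0 < Im w" using True by (simp add: half_pants_def)
  have outer: "w \<in> case_prod geodesic_line p \<longleftrightarrow> cmod (z - of_real (cen (k, True))) = rad (k, True)"
    if p: "scale n * fst p = node k" "scale n * snd p = node (Suc k)" for p k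
  proof -
    have e: "z - of_real (cen (k, True)) = of_real (scale n) * (w - of_real ((fst p + snd p) / 2))"
      using p by (simp add: z_def cen_def algebra_simps add_divide_distrib flip: of_real_mult of_real_add)
    have r: "rad (k, True) = scale n * ((snd p - fst p) / 2)"
      using p by (simp add: rad_def node_Suc algebra_simps diff_divide_distrib)
    then have "(snd p - fst p) / 2 \<ge> 0" using rad_pos[of "(k,True)"] scale_pos[of n]
      by (metis less_imp_le zero_less_mult_pos)
    then have "w \<in> case_prod geodesic_line p \<longleftrightarrow>
      cmod (w - of_real ((fst p + snd p) / 2)) = (snd p - fst p) / 2"
      using Im by (auto simp: geodesic_line_def quad_expand case_prod_beta power2_eq_iff_nonneg
           simp del: of_real_divide of_real_add)
    then show ?thesis unfolding e r norm_mult
      by (simp add: abs_of_pos mult_left_cancel del: of_real_divide of_real_add times_divide_eq_right)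
  qed
  have "w \<in> seams len n \<longleftrightarrow> Re w = 0 \<or> cmod (z - of_real (cen (n, True))) = rad (n, True) \<or>
     cmod (z - of_real (cen (Suc n, True))) = rad (Suc n, True)"
    using True unfolding seams_def Int_iff Un_iff mem_Collect_eq
     outer[OF inner_seam_scale] outer[OF outer_seam_scale] by auto
  also have "\<dots> \<longleftrightarrow> Re z = 0 \<or> on_side z"
  proof -
    have "j = (n, True) \<or> j = (Suc n, True)" if "cmod (z - of_real (cen j)) = rad j" for j
    proof -
      have "fst j = n \<or> fst j = Suc n" using zz that
        by (intro block_side[of z j n]) (auto simp: block_def Q_def reg_def)
      moreover have "snd j" using side_strip(1)[of z j] that zz node_nonneg[of "fst j"]
        by (auto simp: block_def Q_def reg_def simp del: node_nonneg split: if_splits)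
      ultimately show ?thesis by (cases j) auto
    qed
    moreover have "Re z = 0 \<longleftrightarrow> Re w = 0" by (simp add: z_def)
    ultimately show ?thesis unfolding on_side_def by metis
  qed
  finally show ?thesis using True by (simp add: emb_def z_def)
next
  case False then show ?thesis by (simp add: seams_def)
qed

subsection \<open>Gluing\<close>

text \<open>An invariant of the gluing. It shows points to be inequivalent without any analysis of
  chains of gluing steps.\<close>

definition code :: "flute_piece_point \<Rightarrow> complex set" where
  "code p = (let z = emb (fst (fst p)) (snd (fst p)) (snd p) in if on_side z then {z, J z} else {z})"

lemma emb_flip: "emb n (\<not> \<sigma>) w = J (emb n \<sigma> w)" by (simp add: emb_def)

lemma J_id: "Re z = 0 \<Longrightarrow> J z = z" by (simp add: J_def complex_eq_iff)

lemma outer_radius_pos: "outer_radius len n > 0"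
  using outer_radius_scale[of n] level_Suc_pos[of n] scale_pos[of n] by (metis zero_less_mult_pos)

lemma emb_zero_twist: "emb (Suc n) \<sigma> (w / of_real (outer_radius len n)) = emb n \<sigma> w"
proof -
  have "scale (Suc n) = scale n * outer_radius len n" by (simp add: outer_radius_scale) (simp add: scale_def)
  then have "of_real (scale (Suc n)) * (w / of_real (outer_radius len n)) = of_real (scale n) * w"
    using outer_radius_pos[of n] by simp
  then show ?thesis by (simp add: emb_def)
qed

text \<open>A seam step acts as \<open>J\<close>, which fixes the axis and is absorbed by the
  unordered pair on a side; a twist step does not move the embedded point.\<close>

lemma glued_code: "glued len p q \<Longrightarrow> code p = code q"
proof (induction rule: glued.induct)
  case (seam z n \<sigma>)
  then have "Re (emb n \<sigma> z) = 0 \<or> on_side (emb n \<sigma> z)" using seams_iff[of z n \<sigma>] by simp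
  then show ?case by (auto simp: code_def Let_def emb_flip J_id)
next
  case (zero_twist z n \<sigma>)
  then show ?case by (simp add: code_def emb_zero_twist del: outer_radius.simps)
qed

lemma equivclp_code: "equivclp (glued len) p q \<Longrightarrow> code p = code q"
  by (induction rule: equivclp_induct) (auto dest: glued_code)

lemma glue_class_eq_iff: "glue_class l p = glue_class l q \<longleftrightarrow> equivclp (glued l) p q"
proof
  assume "glue_class l p = glue_class l q"
  then have "q \<in> glue_class l p" by (simp add: glue_class_def)
  then show "equivclp (glued l) p q" by (simp add: glue_class_def)
next
  assume "equivclp (glued l) p q"
  then show "glue_class l p = glue_class l q" unfolding glue_class_def
    by (auto intro: equivclp_trans equivclp_sym)
qed

lemma glue_class_seam:
  assumes "z \<in> Q" "z \<in> block n \<sigma>" "Re z = 0 \<or> on_side z"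
  shows "glue_class len ((n, \<sigma>), unemb n \<sigma> z) = glue_class len ((n, \<not> \<sigma>), unemb n \<sigma> z)"
proof -
  have "unemb n \<sigma> z \<in> seams len n" using assms seams_iff[of "unemb n \<sigma> z" n \<sigma>] unemb_half_pants by simp
  then show ?thesis unfolding glue_class_eq_iff by (intro r_into_equivclp glued.seam)
qed

lemma glue_class_twist:
  assumes "z \<in> Q" "z \<in> block n \<sigma>" "z \<in> block (Suc n) \<sigma>"
  shows "glue_class len ((n, \<sigma>), unemb n \<sigma> z) = glue_class len ((Suc n, \<sigma>), unemb (Suc n) \<sigma> z)"
proof -
  define w where "w = unemb n \<sigma> z"
  have z: "emb n \<sigma> w = z" by (simp add: w_def)
  have "cmod z = level (Suc n)" using assms by (auto simp: block_def)
  moreover have "cmod z = scale n * cmod w"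
    unfolding z[symmetric] by (simp add: emb_def norm_mult abs_of_pos)
  ultimately have "cmod w = outer_radius len n"
    using outer_radius_scale[of n] scale_nz[of n] by (metis mult_left_cancel)
  moreover have "w \<in> half_pants len n" unfolding w_def by (rule unemb_half_pants[OF assms(1,2)])
  ultimately have "glued len ((n, \<sigma>), w) ((Suc n, \<sigma>), w / of_real (outer_radius len n))"
    by (intro glued.zero_twist)
  moreover have "w / of_real (outer_radius len n) = unemb (Suc n) \<sigma> z"
    by (metis z emb_zero_twist unemb_emb)
  ultimately show ?thesis unfolding glue_class_eq_iff w_def by (auto intro: r_into_equivclp)
qed

text \<open>A block is picked canonically only to obtain a function; by \<open>prj_glue\<close>
  every block containing the point gives the same class.\<close>

definition prj :: "complex \<Rightarrow> flute_piece_point set" where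
  "prj z = (let n = (LEAST n. cmod z \<le> level (Suc n)); \<sigma> = (0 \<le> Re z)
     in glue_class len ((n, \<sigma>), unemb n \<sigma> z))"

lemma Q_level: assumes "z \<in> Q" shows "\<exists>n. cmod z \<le> level (Suc n)"
proof -
  obtain n where "cmod z < node n" using assms by (auto simp: Q_def reg_def)
  then show ?thesis using node_le_level[of n] level_less_Suc[of n] by (intro exI[of _ n]) linarith
qed

lemma Q_block: assumes "z \<in> Q" shows "z \<in> block (LEAST n. cmod z \<le> level (Suc n)) (0 \<le> Re z)"
proof -
  define m where "m = (LEAST n. cmod z \<le> level (Suc n))"
  have 1: "cmod z \<le> level (Suc m)" unfolding m_def by (rule LeastI_ex[OF Q_level[OF assms]])
  have 2: "level m \<le> cmod z"
  proof (cases m)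
    case (Suc i) then have "\<not> cmod z \<le> level (Suc i)" unfolding m_def by (metis lessI not_less_Least)
    then show ?thesis using Suc by simp
  qed simp
  show ?thesis unfolding m_def[symmetric] using 1 2 by (auto simp: block_def)
qed

text \<open>Two blocks containing z can differ in the sign only on the axis, and the index can
  exceed the least one only by one, on the common circle. Either change is a single gluing
  step.\<close>

lemma prj_glue:
  assumes "z \<in> Q" "z \<in> block n \<sigma>"
  shows "prj z = glue_class len ((n, \<sigma>), unemb n \<sigma> z)"
proof -
  define m where "m = (LEAST n. cmod z \<le> level (Suc n))"
  define \<tau> where "\<tau> = (0 \<le> Re z)"
  have b: "z \<in> block m \<tau>" unfolding m_def \<tau>_def by (rule Q_block[OF assms(1)])
  have p: "prj z = glue_class len ((m, \<tau>), unemb m \<tau> z)" by (simp add: prj_def Let_def m_def \<tau>_def)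
  have 1: "glue_class len ((m, \<tau>), unemb m \<tau> z) = glue_class len ((m, \<sigma>), unemb m \<sigma> z)"
  proof (cases "\<sigma> = \<tau>")
    case False
    then have r: "Re z = 0" using assms(2) b by (auto simp: block_def split: if_splits)
    have "unemb m \<sigma> z = unemb m \<tau> z" by (simp add: unemb_def J_id[OF r])
    moreover have "\<sigma> = (\<not> \<tau>)" using False by auto
    ultimately show ?thesis using glue_class_seam[OF assms(1) b] r by simp
  qed simp
  have b': "z \<in> block m \<sigma>" using b assms(2) by (auto simp: block_def)
  have mn: "m \<le> n" unfolding m_def by (rule Least_le) (use assms(2) in \<open>simp add: block_def\<close>)
  have "m = n \<or> n = Suc m"
  proof (rule ccontr)
    assume "\<not> ?thesis"
    then have "Suc m < n" using mn by linarith
    then have "level (Suc m) < level n" by (rule level_strict_mono)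
    then show False using b assms(2) by (simp add: block_def)
  qed
  then have 2: "glue_class len ((m, \<sigma>), unemb m \<sigma> z) = glue_class len ((n, \<sigma>), unemb n \<sigma> z)"
  proof
    assume "n = Suc m" then show ?thesis using glue_class_twist[OF assms(1) b'] assms(2) by simp
  qed simp
  show ?thesis using p 1 2 by simp
qed

lemma prj_emb: "w \<in> half_pants len n \<Longrightarrow> prj (emb n \<sigma> w) = glue_class len ((n, \<sigma>), w)"
  using prj_glue[of "emb n \<sigma> w" n \<sigma>] half_pants_iff[of w n \<sigma>] by simp

lemma prj_J: assumes "z \<in> Q" "on_side z" shows "prj (J z) = prj z"
proof -
  obtain n \<sigma> where b: "z \<in> block n \<sigma>" using Q_block[OF assms(1)] by blast
  have "J z \<in> block n (\<not> \<sigma>)" using b by (auto simp: block_def)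
  then have "prj (J z) = glue_class len ((n, \<not> \<sigma>), unemb n (\<not> \<sigma>) (J z))"
    using assms by (intro prj_glue) auto
  moreover have "unemb n (\<not> \<sigma>) (J z) = unemb n \<sigma> z" by (simp add: unemb_def)
  ultimately show ?thesis using prj_glue[OF assms(1) b] glue_class_seam[OF assms(1) b] assms(2) by simp
qed

text \<open>That nothing else is identified comes from the invariant \<open>code\<close>, the
  identification on sides from \<open>prj_J\<close>.\<close>

lemma prj_eq_iff:
  assumes "z \<in> Q" "z' \<in> Q"
  shows "prj z = prj z' \<longleftrightarrow> z = z' \<or> (on_side z \<and> z' = J z)"
proof
  assume e: "prj z = prj z'"
  obtain n \<sigma> where b: "z \<in> block n \<sigma>" using Q_block[OF assms(1)] by blast
  obtain n' \<sigma>' where b': "z' \<in> block n' \<sigma>'" using Q_block[OF assms(2)] by blast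
  have "code ((n, \<sigma>), unemb n \<sigma> z) = code ((n', \<sigma>'), unemb n' \<sigma>' z')"
    using e prj_glue[OF assms(1) b] prj_glue[OF assms(2) b'] by (intro equivclp_code) (simp add: glue_class_eq_iff)
  then show "z = z' \<or> (on_side z \<and> z' = J z)"
    by (auto simp: code_def Let_def doubleton_eq_iff split: if_splits)
qed (use assms in \<open>auto simp: prj_J\<close>)

subsection \<open>The surface as a quotient of a fundamental domain\<close>

lemma topspace_flute: "topspace (flute_topology len) = prj ` Q"
proof -
  have "topspace (flute_topology len) = glue_class len ` Sigma UNIV (\<lambda>(n,\<sigma>). half_pants len n)"
    unfolding flute_topology_def topspace_quotient_topology topspace_sum_topology
    by (intro arg_cong[where f = "image _"]) (auto simp: split_beta)
  also have "\<dots> = prj ` Q"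
  proof (intro equalityI subsetI)
    fix c assume "c \<in> glue_class len ` Sigma UNIV (\<lambda>(n,\<sigma>). half_pants len n)"
    then obtain n \<sigma> w where w: "w \<in> half_pants len n" "c = glue_class len ((n,\<sigma>), w)" by auto
    then show "c \<in> prj ` Q" using half_pants_iff[of w n \<sigma>] prj_emb[of w n \<sigma>] by (intro image_eqI[of _ _ "emb n \<sigma> w"]) auto
  next
    fix c assume "c \<in> prj ` Q"
    then obtain z where z: "z \<in> Q" "c = prj z" by auto
    obtain n \<sigma> where b: "z \<in> block n \<sigma>" using Q_block[OF z(1)] by blast
    show "c \<in> glue_class len ` Sigma UNIV (\<lambda>(n,\<sigma>). half_pants len n)"
      using prj_glue[OF z(1) b] z unemb_half_pants[OF z(1) b]
      by (intro image_eqI[of _ _ "((n,\<sigma>), unemb n \<sigma> z)"]) auto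
  qed
  finally show ?thesis .
qed

lemma openin_flute_pieces:
  "openin (flute_topology len) V \<longleftrightarrow> V \<subseteq> prj ` Q \<and>
    (\<forall>n \<sigma>. openin (top_of_set (half_pants len n)) {w \<in> half_pants len n. glue_class len ((n, \<sigma>), w) \<in> V})"
proof -
  let ?X = "\<lambda>(n, \<sigma>::bool). top_of_set (half_pants len n)"
  have "openin (flute_topology len) V \<longleftrightarrow> V \<subseteq> topspace (flute_topology len) \<and>
     openin (sum_topology ?X UNIV) {p \<in> topspace (sum_topology ?X UNIV). glue_class len p \<in> V}"
    unfolding flute_topology_def openin_quotient_topology topspace_quotient_topology ..
  also have "openin (sum_topology ?X UNIV) {p \<in> topspace (sum_topology ?X UNIV). glue_class len p \<in> V} \<longleftrightarrow>
     (\<forall>n \<sigma>. openin (top_of_set (half_pants len n)) {w \<in> half_pants len n. glue_class len ((n, \<sigma>), w) \<in> V})"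
    unfolding openin_sum_topology by (auto simp: split_beta)
  finally show ?thesis unfolding topspace_flute .
qed

lemma continuous_emb: "continuous_on A (emb n \<sigma>)"
  unfolding emb_def J_def by (cases \<sigma>) (auto intro!: continuous_intros)
lemma continuous_unemb: "continuous_on A (unemb n \<sigma>)"
  unfolding unemb_def J_def by (cases \<sigma>) (auto intro!: continuous_intros)

lemma closed_block: "closed (block n \<sigma>)"
  unfolding block_def by (cases \<sigma>) (auto intro!: closed_Collect_conj closed_Collect_le continuous_intros)

text \<open>The blocks form a locally finite closed cover of \<open>Q\<close>, so the quotient of
  the disjoint union of the polygons has the same open sets as the quotient of \<open>Q\<close>.
  From here on the polygons are needed only to understand charts.\<close>

lemma openin_flute:
  "openin (flute_topology len) V \<longleftrightarrow> V \<subseteq> prj ` Q \<and> openin (top_of_set Q) {z \<in> Q. prj z \<in> V}"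
proof (cases "V \<subseteq> prj ` Q")
  case True
  have "(\<forall>n \<sigma>. openin (top_of_set (half_pants len n)) {w \<in> half_pants len n. glue_class len ((n, \<sigma>), w) \<in> V})
     \<longleftrightarrow> openin (top_of_set Q) {z \<in> Q. prj z \<in> V}"
  proof
    assume o: "openin (top_of_set Q) {z \<in> Q. prj z \<in> V}"
    show "\<forall>n \<sigma>. openin (top_of_set (half_pants len n)) {w \<in> half_pants len n. glue_class len ((n, \<sigma>), w) \<in> V}"
    proof (intro allI)
      fix n \<sigma>
      have "openin (top_of_set (half_pants len n)) (half_pants len n \<inter> emb n \<sigma> -` {z \<in> Q. prj z \<in> V})"
        by (rule continuous_openin_preimage[OF continuous_emb _ o]) (use half_pants_iff[of _ n \<sigma>] in auto)
      also have "half_pants len n \<inter> emb n \<sigma> -` {z \<in> Q. prj z \<in> V} = {w \<in> half_pants len n. glue_class len ((n, \<sigma>), w) \<in> V}"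
        using half_pants_iff[of _ n \<sigma>] prj_emb[of _ n \<sigma>] by auto
      finally show "openin (top_of_set (half_pants len n)) {w \<in> half_pants len n. glue_class len ((n, \<sigma>), w) \<in> V}" .
    qed
  next
    assume o: "\<forall>n \<sigma>. openin (top_of_set (half_pants len n)) {w \<in> half_pants len n. glue_class len ((n, \<sigma>), w) \<in> V}"
    have loc: "\<exists>T. open T \<and> z \<in> T \<and> (\<forall>y \<in> T \<inter> Q \<inter> block n \<sigma>. prj y \<in> V)"
      if z: "z \<in> Q" "prj z \<in> V" for z n \<sigma>
    proof (cases "z \<in> block n \<sigma>")
      case True
      have "openin (top_of_set (half_pants len n)) {w \<in> half_pants len n. glue_class len ((n, \<sigma>), w) \<in> V}"
        using o by blast
      then obtain T where T: "open T"
        "{w \<in> half_pants len n. glue_class len ((n, \<sigma>), w) \<in> V} = half_pants len n \<inter> T"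
        unfolding openin_open by blast
      have "open (unemb n \<sigma> -` T)" by (rule open_vimage[OF T(1) continuous_unemb])
      moreover have "unemb n \<sigma> z \<in> T"
        using T(2) prj_glue[OF z(1) True] unemb_half_pants[OF z(1) True] z(2) by auto
      moreover have "prj y \<in> V" if y: "y \<in> unemb n \<sigma> -` T \<inter> Q \<inter> block n \<sigma>" for y
        using T(2) prj_glue[of y n \<sigma>] unemb_half_pants[of y n \<sigma>] y by auto
      ultimately show ?thesis by (intro exI[of _ "unemb n \<sigma> -` T"]) auto
    next
      case False
      then show ?thesis using closed_block[of n \<sigma>] by (intro exI[of _ "- block n \<sigma>"]) auto
    qed
    have "\<exists>T. openin (top_of_set Q) T \<and> z \<in> T \<and> T \<subseteq> {z \<in> Q. prj z \<in> V}" if z: "z \<in> Q" "prj z \<in> V" for z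
    proof -
      obtain T where T: "\<And>n \<sigma>. open (T n \<sigma>) \<and> z \<in> T n \<sigma> \<and> (\<forall>y \<in> T n \<sigma> \<inter> Q \<inter> block n \<sigma>. prj y \<in> V)"
        using loc[OF z] by metis
      obtain N where N: "cmod z \<le> level (Suc N)" using Q_level[OF z(1)] by auto
      \<comment> \<open>Points of modulus below \<open>level (Suc (Suc N))\<close> lie only in
        blocks of index at most \<open>Suc N\<close>, so a finite intersection of the sets
        \<open>T n \<sigma>\<close> is enough.\<close>
      define O' where "O' = ball 0 (level (Suc (Suc N))) \<inter> (\<Inter>n\<in>{..Suc N}. T n True \<inter> T n False)"
      have "open O'" unfolding O'_def using T by (intro open_Int open_INT) auto
      moreover have "z \<in> O'" using T N level_less_Suc[of "Suc N"] by (auto simp: O'_def)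
      moreover have "prj y \<in> V" if y: "y \<in> O' \<inter> Q" for y
      proof -
        obtain n \<sigma> where b: "y \<in> block n \<sigma>" using Q_block[of y] y by blast
        have "level n < level (Suc (Suc N))" using y b by (auto simp: O'_def block_def)
        then have "n < Suc (Suc N)" using level_mono[of "Suc (Suc N)" n] by (meson not_less)
        then have "y \<in> T n \<sigma>" using y by (cases \<sigma>) (auto simp: O'_def)
        then show ?thesis using T b y by auto
      qed
      ultimately show ?thesis by (intro exI[of _ "O' \<inter> Q"]) (auto simp: openin_open z)
    qed
    then show "openin (top_of_set Q) {z \<in> Q. prj z \<in> V}"
      by (subst openin_subopen) auto
  qed
  then show ?thesis using openin_flute_pieces[of V] True by auto
next
  case False
  then show ?thesis using openin_subset[of "flute_topology len" V] topspace_flute by auto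
qed

end

section \<open>Side pairings and charts\<close>

abbreviation uhp :: "complex set" where "uhp \<equiv> {z. 0 < Im z}"

lemma open_uhp: "open uhp"
  by (intro open_Collect_less continuous_intros)

definition mob :: "real \<Rightarrow> real \<Rightarrow> real \<Rightarrow> real \<Rightarrow> complex \<Rightarrow> complex" where
  "mob a b c d z = (of_real a * z + of_real b) / (of_real c * z + of_real d)"

lemma hyp_isometry_mob: "hyp_isometry m \<longleftrightarrow> (\<exists>a b c d. a * d - b * c = 1 \<and> m = mob a b c d)"
  unfolding hyp_isometry_def mob_def[abs_def] ..

lemma mob_denom_nz:
  assumes "a * d - b * c = (1::real)" "0 < Im z"
  shows "of_real c * z + of_real d \<noteq> 0"
proof
  assume "of_real c * z + of_real d = 0"
  then have "Im (of_real c * z + of_real d) = 0" "Re (of_real c * z + of_real d) = 0" by simp_all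
  then show False using assms by auto
qed

lemma Im_mob:
  assumes "a * d - b * c = (1::real)"
  shows "Im (mob a b c d z) = Im z / (cmod (of_real c * z + of_real d))\<^sup>2"
proof -
  have "Im ((of_real a * z + of_real b) * cnj (of_real c * z + of_real d)) = (a * d - b * c) * Im z"
    by (simp add: algebra_simps)
  then show ?thesis unfolding mob_def by (simp add: Im_divide_numeral Im_complex_div_eq_0 complex_div_cnj[of "of_real a * z + of_real b"] assms Im_divide_of_real flip: of_real_power)
qed

lemma mob_comp:
  assumes "a * d - b * c = (1::real)" "0 < Im z"
  shows "mob a' b' c' d' (mob a b c d z) = mob (a' * a + b' * c) (a' * b + b' * d) (c' * a + d' * c) (c' * b + d' * d) z"
proof -
  define w where "w = of_real c * z + of_real d"
  define v where "v = of_real a * z + of_real b"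
  have w: "w \<noteq> 0" unfolding w_def by (rule mob_denom_nz[OF assms])
  have "mob a' b' c' d' (mob a b c d z) = (of_real a' * (v / w) + of_real b') / (of_real c' * (v / w) + of_real d')"
    by (simp add: mob_def v_def w_def)
  also have "\<dots> = ((of_real a' * v + of_real b' * w) / w) / ((of_real c' * v + of_real d' * w) / w)"
    using w by (simp add: add_divide_distrib)
  also have "\<dots> = (of_real a' * v + of_real b' * w) / (of_real c' * v + of_real d' * w)"
    using w by simp
  finally show ?thesis by (simp add: mob_def v_def w_def algebra_simps)
qed

lemma iso_Im: "hyp_isometry m \<Longrightarrow> 0 < Im z \<Longrightarrow> 0 < Im (m z)"
  by (auto simp: hyp_isometry_mob Im_mob mob_denom_nz)

text \<open>The equality is restricted to the half plane: at its real pole \<open>mob\<close> takes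
  the value 0 by the convention for division, which composition does not respect.\<close>

lemma iso_comp:
  assumes "hyp_isometry m" "hyp_isometry m'"
  shows "\<exists>m''. hyp_isometry m'' \<and> (\<forall>z\<in>uhp. m'' z = m' (m z))"
proof -
  obtain a b c d where m: "a * d - b * c = 1" "m = mob a b c d" using assms hyp_isometry_mob by auto
  obtain a' b' c' d' where m': "a' * d' - b' * c' = 1" "m' = mob a' b' c' d'" using assms hyp_isometry_mob by auto
  have "(a' * a + b' * c) * (c' * b + d' * d) - (a' * b + b' * d) * (c' * a + d' * c) = (a' * d' - b' * c') * (a * d - b * c)"
    by (simp add: algebra_simps)
  then have "hyp_isometry (mob (a' * a + b' * c) (a' * b + b' * d) (c' * a + d' * c) (c' * b + d' * d))"
    unfolding hyp_isometry_mob using m(1) m'(1)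
    by (intro exI[of _ "a' * a + b' * c"] exI[of _ "a' * b + b' * d"] exI[of _ "c' * a + d' * c"] exI[of _ "c' * b + d' * d"]) simp
  then show ?thesis using mob_comp[OF m(1)] m(2) m'(2) by (intro exI conjI) auto
qed

lemma mob_id [simp]: "mob 1 0 0 1 z = z" by (simp add: mob_def)
lemma iso_id: "hyp_isometry (\<lambda>z. z)"
  unfolding hyp_isometry_mob by (intro exI[of _ 1] exI[of _ 0]) (auto simp: fun_eq_iff intro!: exI[of _ 1] exI[of _ 0])

lemma iso_inv:
  assumes "hyp_isometry m"
  obtains m' where "hyp_isometry m'" "\<And>z. 0 < Im z \<Longrightarrow> m' (m z) = z" "\<And>z. 0 < Im z \<Longrightarrow> m (m' z) = z"
proof -
  obtain a b c d where m: "a * d - b * c = 1" "m = mob a b c d" using assms hyp_isometry_mob by auto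
  have m': "d * a - (-b) * (-c) = 1" using m(1) by (simp add: algebra_simps)
  then have "hyp_isometry (mob d (-b) (-c) a)" unfolding hyp_isometry_mob by blast
  moreover have "mob d (-b) (-c) a (m z) = z" if "0 < Im z" for z
  proof -
    have "mob d (-b) (-c) a (m z) = mob (a * d - b * c) 0 0 (a * d - b * c) z"
      unfolding m(2) by (subst mob_comp[OF m(1) that]) (simp add: algebra_simps)
    then show ?thesis by (simp add: m(1))
  qed
  moreover have "m (mob d (-b) (-c) a z) = z" if "0 < Im z" for z
  proof -
    have "m (mob d (-b) (-c) a z) = mob (a * d - b * c) 0 0 (a * d - b * c) z"
      unfolding m(2) by (subst mob_comp[OF m' that]) (simp add: algebra_simps)
    then show ?thesis by (simp add: m(1))
  qed
  ultimately show ?thesis by (rule that)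
qed

lemma iso_holomorphic: "hyp_isometry m \<Longrightarrow> m holomorphic_on uhp"
  unfolding hyp_isometry_mob mob_def[abs_def]
  by (auto intro!: holomorphic_intros dest: mob_denom_nz)

lemma iso_continuous: "hyp_isometry m \<Longrightarrow> A \<subseteq> uhp \<Longrightarrow> continuous_on A m"
  using iso_holomorphic holomorphic_on_imp_continuous_on continuous_on_subset by blast

lemma iso_open_preimage:
  assumes "hyp_isometry m" "open T" shows "open {z. 0 < Im z \<and> m z \<in> T}"
proof -
  have "open (uhp \<inter> m -` T)"
    by (rule continuous_open_preimage[OF iso_continuous[OF assms(1)] open_uhp assms(2)]) simp
  then show ?thesis by (simp add: Int_def vimage_def)
qed

lemma iso_open_image:
  assumes "hyp_isometry m" "open T" "T \<subseteq> uhp" shows "open (m ` T)"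
proof -
  obtain m' where m': "hyp_isometry m'" "\<And>z. 0 < Im z \<Longrightarrow> m' (m z) = z" "\<And>z. 0 < Im z \<Longrightarrow> m (m' z) = z"
    using iso_inv[OF assms(1)] by metis
  have "m ` T = {z. 0 < Im z \<and> m' z \<in> T}"
  proof (intro equalityI subsetI)
    fix z assume "z \<in> {z. 0 < Im z \<and> m' z \<in> T}"
    then show "z \<in> m ` T" using m'(3)[of z] by (metis (mono_tags) image_eqI mem_Collect_eq)
  qed (use assms m' iso_Im in auto)
  then show ?thesis using iso_open_preimage[OF m'(1) assms(2)] by simp
qed

text \<open>Cross-multiplication turns agreement at a point into a root of a polynomial of degree at
  most two. This is how the isometries found on two adjacent polygons are recognised as one: they
  agree along a common arc.\<close>

lemma iso_eqI:
  assumes "hyp_isometry m" "hyp_isometry m'" "infinite A" "A \<subseteq> uhp" "\<And>z. z \<in> A \<Longrightarrow> m z = m' z" "0 < Im z"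
  shows "m z = m' z"
proof -
  obtain a b c d where m: "a * d - b * c = 1" "m = mob a b c d" using assms hyp_isometry_mob by auto
  obtain a' b' c' d' where m': "a' * d' - b' * c' = 1" "m' = mob a' b' c' d'" using assms hyp_isometry_mob by auto
  define P :: "complex poly" where "P = [: of_real b, of_real a :] * [: of_real d', of_real c' :] - [: of_real b', of_real a' :] * [: of_real d, of_real c :]"
  have eq: "m w = m' w \<longleftrightarrow> poly P w = 0" if "0 < Im w" for w
    using mob_denom_nz[OF m(1) that] mob_denom_nz[OF m'(1) that]
    by (simp add: m m' mob_def P_def frac_eq_eq algebra_simps)
  have "A \<subseteq> {w. poly P w = 0}" using eq assms(4,5) by auto
  then have "P = 0" using assms(3) poly_roots_finite finite_subset by blast
  then show ?thesis using eq[OF assms(6)] by simp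
qed

lemma iso_scale: "r > 0 \<Longrightarrow> hyp_isometry (\<lambda>z. z / of_real r)"
  unfolding hyp_isometry_mob mob_def[abs_def]
  apply (rule exI[of _ "1 / sqrt r"], rule exI[of _ 0], rule exI[of _ 0], rule exI[of _ "sqrt r"])
  apply (simp add: fun_eq_iff)
  apply (metis less_imp_le of_real_mult real_sqrt_mult_self abs_of_nonneg)
  done

section \<open>Side pairings and unfolding across one side\<close>

context flute_seq begin

declare split_paired_All [simp del] split_paired_Ex [simp del]

lemma rad_nz [simp]: "rad j \<noteq> 0"
  using rad_pos[of j] by linarith

abbreviation S :: "flute_piece_point set topology" where "S \<equiv> flute_topology len"

definition ins :: "nat \<times> bool \<Rightarrow> complex set" where
  "ins j = {z. 0 < Im z \<and> cmod (z - of_real (cen j)) < rad j}"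

text \<open>The side pairing: inversion in the side \<open>j\<close> followed by \<open>J\<close>.\<close>

definition mv :: "nat \<times> bool \<Rightarrow> complex \<Rightarrow> complex" where
  "mv j = mob (- cen j / rad j) (((cen j)\<^sup>2 - (rad j)\<^sup>2) / rad j) (1 / rad j) (- cen j / rad j)"

lemma mv_det: "(- cen j / rad j) * (- cen j / rad j) - (((cen j)\<^sup>2 - (rad j)\<^sup>2) / rad j) * (1 / rad j) = 1"
proof -
  have "(- cen j / rad j) * (- cen j / rad j) = (cen j)\<^sup>2 / (rad j)\<^sup>2" by (simp add: power2_eq_square)
  moreover have "(((cen j)\<^sup>2 - (rad j)\<^sup>2) / rad j) * (1 / rad j) = (cen j)\<^sup>2 / (rad j)\<^sup>2 - 1"
    by (simp add: power2_eq_square diff_divide_distrib)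
  ultimately show ?thesis by simp
qed

lemma iso_mv: "hyp_isometry (mv j)"
  unfolding hyp_isometry_mob mv_def using mv_det by blast

lemma mv_eq: assumes "0 < Im z" shows "mv j z = - of_real (cen j) - of_real ((rad j)\<^sup>2) / (z - of_real (cen j))"
proof -
  have r: "rad j \<noteq> 0" by simp
  have z: "z - of_real (cen j) \<noteq> 0" using assms by (auto simp: complex_eq_iff)
  have "mv j z = (of_real (1 / rad j) * (- of_real (cen j) * (z - of_real (cen j)) - of_real ((rad j)\<^sup>2)))
       / (of_real (1 / rad j) * (z - of_real (cen j)))"
  proof -
    define q where "q = complex_of_real (1 / rad j)"
    have "complex_of_real (- cen j / rad j) = - q * of_real (cen j)"
      "complex_of_real (((cen j)\<^sup>2 - (rad j)\<^sup>2) / rad j) = q * (of_real ((cen j)\<^sup>2) - of_real ((rad j)\<^sup>2))"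
      by (simp_all add: q_def)
    then show ?thesis unfolding mv_def mob_def q_def[symmetric]
      by (simp add: algebra_simps power2_eq_square)
  qed
  also have "\<dots> = (- of_real (cen j) * (z - of_real (cen j)) - of_real ((rad j)\<^sup>2)) / (z - of_real (cen j))"
    using r by (subst mult_divide_mult_cancel_left) auto
  finally show ?thesis using z by (simp add: diff_divide_distrib)
qed

lemma mv_dist: "0 < Im z \<Longrightarrow> cmod (mv j z - of_real (cen (opp j))) = (rad j)\<^sup>2 / cmod (z - of_real (cen j))"
  by (simp add: mv_eq norm_divide norm_power)

text \<open>Inversion fixes the side pointwise, so only \<open>J\<close> remains: the pairing
  extends the gluing of the two sides to a neighbourhood.\<close>

lemma mv_side:
  assumes "0 < Im z" "cmod (z - of_real (cen j)) = rad j" shows "mv j z = J z"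
proof -
  have z: "z - of_real (cen j) \<noteq> 0" using assms(1) by (auto simp: complex_eq_iff)
  have "of_real ((rad j)\<^sup>2) = (z - of_real (cen j)) * cnj (z - of_real (cen j))"
    by (simp only: complex_norm_square[symmetric] assms(2))
  then have "of_real ((rad j)\<^sup>2) / (z - of_real (cen j)) = cnj (z - of_real (cen j))"
    using z by simp
  then show ?thesis using assms(1) by (simp add: mv_eq J_def)
qed

lemma mv_Im: "0 < Im z \<Longrightarrow> 0 < Im (mv j z)" by (rule iso_Im[OF iso_mv])

lemma mv_mv: assumes "0 < Im z" shows "mv (opp j) (mv j z) = z"
proof -
  have z: "z - of_real (cen j) \<noteq> 0" using assms(1) by (auto simp: complex_eq_iff)
  have r: "complex_of_real (rad j) \<noteq> 0" by simp
  have "mv (opp j) (mv j z) = of_real (cen j) - of_real ((rad j)\<^sup>2) / (mv j z + of_real (cen j))"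
    using mv_Im[OF assms, of j] by (simp add: mv_eq[of "mv j z"])
  also have "mv j z + of_real (cen j) = - of_real ((rad j)\<^sup>2) / (z - of_real (cen j))"
    using mv_eq[OF assms, of j] by simp
  finally show ?thesis using z r by (simp add: field_simps)
qed

lemma ins_unique: "z \<in> ins i \<Longrightarrow> z \<in> ins j \<Longrightarrow> i = j"
  by (rule side_unique[of z]) (auto simp: ins_def)

lemma mv_outside:
  assumes "z \<in> ins j" shows "rad j < cmod (mv j z - of_real (cen (opp j)))"
proof -
  have z: "0 < cmod (z - of_real (cen j))" "cmod (z - of_real (cen j)) < rad j" "0 < Im z"
    using assms by (auto simp: ins_def complex_eq_iff)
  have "rad j * cmod (z - of_real (cen j)) < rad j * rad j" using z by simp
  then show ?thesis using z by (simp only: mv_dist) (simp add: less_divide_eq power2_eq_square)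
qed

lemma mv_inside_iff:
  assumes "0 < Im z"
  shows "mv j z \<in> ins (opp j) \<longleftrightarrow> rad j < cmod (z - of_real (cen j))"
proof -
  have z: "0 < cmod (z - of_real (cen j))" using assms by (auto simp: complex_eq_iff)
  have "cmod (mv j z - of_real (cen (opp j))) < rad j \<longleftrightarrow> rad j * rad j < rad j * cmod (z - of_real (cen j))"
    using z assms by (simp only: mv_dist) (simp add: divide_less_eq power2_eq_square)
  then show ?thesis using mv_Im[OF assms] by (simp add: ins_def)
qed

text \<open>One application of a pairing is enough, since a small neighbourhood of a point of
  \<open>Q\<close> reaches at most one copy of \<open>Q\<close> behind one side. Off all half discs
  this is the identity, even outside \<open>Q\<close>; \<open>dom\<close> selects the points with
  image in \<open>Q\<close>.\<close>

definition unf :: "complex \<Rightarrow> complex" where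
  "unf y = (if \<exists>j. y \<in> ins j then mv (THE j. y \<in> ins j) y else y)"

definition dom :: "complex set" where "dom = {y. 0 < Im y \<and> unf y \<in> Q}"
text \<open>Stands in for the universal covering map on the part \<open>dom\<close> of the half
  plane; by \<open>chart_ball_exists\<close> it is a homeomorphism onto an open set near every point
  of \<open>Q\<close>.\<close>

definition lift :: "complex \<Rightarrow> flute_piece_point set" where "lift y = prj (unf y)"

lemma unf_ins: "y \<in> ins j \<Longrightarrow> unf y = mv j y"
proof -
  assume y: "y \<in> ins j"
  have "(THE k. y \<in> ins k) = j" by (rule the_equality) (use y in \<open>auto dest: ins_unique\<close>)
  then show ?thesis using y by (auto simp: unf_def)
qed

lemma Q_notin_ins: "y \<in> Q \<Longrightarrow> y \<notin> ins j" by (auto simp: Q_def ins_def not_less[symmetric])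
lemma unf_Q: "y \<in> Q \<Longrightarrow> unf y = y" unfolding unf_def using Q_notin_ins by auto
lemma Q_Im: "y \<in> Q \<Longrightarrow> 0 < Im y" by (auto simp: Q_def reg_def)
lemma Q_dom: "y \<in> Q \<Longrightarrow> y \<in> dom" by (simp add: dom_def unf_Q Q_Im)
lemma lift_Q: "y \<in> Q \<Longrightarrow> lift y = prj y" by (simp add: lift_def unf_Q)
lemma lift_topspace: "y \<in> dom \<Longrightarrow> lift y \<in> topspace S"
  by (auto simp: lift_def dom_def topspace_flute)

text \<open>A point of modulus below \<open>node n\<close> can be met only by half discs of index
  below n, so near it the infinite intersection is a finite one. The parameter \<open>I\<close>
  exempts the side on which a point may lie.\<close>

lemma open_outside: "open {z \<in> reg. \<forall>i. i \<notin> I \<longrightarrow> rad i < cmod (z - of_real (cen i))}" (is "open ?A")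
proof (subst open_subopen, safe)
  fix z assume z: "z \<in> reg" "\<forall>i. i \<notin> I \<longrightarrow> rad i < cmod (z - of_real (cen i))"
  then obtain n where n: "0 < Im z" "cmod z < node n" by (auto simp: reg_def)
  define T where "T = {y. 0 < Im y} \<inter> {y. cmod y < node n} \<inter>
    (\<Inter>i\<in>({..<n} \<times> UNIV) - I. {y. rad i < cmod (y - of_real (cen i))})"
  have "open T" unfolding T_def
    by (intro open_Int open_INT ballI open_Collect_less continuous_intros) auto
  moreover have "z \<in> T" using n z by (auto simp: T_def)
  moreover have "T \<subseteq> ?A"
  proof (safe)
    fix y assume y: "y \<in> T"
    then show "y \<in> reg" by (auto simp: T_def reg_def)
  next
    fix y a b assume y: "y \<in> T" and i: "(a, b) \<notin> I"
    show "rad (a, b) < cmod (y - of_real (cen (a, b)))"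
    proof (rule ccontr)
      assume c: "\<not> ?thesis"
      then have "node a < cmod y" using side_cmod(1)[of y "(a, b)"] y by (auto simp: T_def)
      then have "node a < node n" using y by (auto simp: T_def)
      then have "a < n" using node_mono[of n a] by (meson not_less)
      then have "(a, b) \<in> ({..<n} \<times> UNIV) - I" using i by auto
      then show False using y c by (auto simp: T_def)
    qed
  qed
  ultimately show "\<exists>T. open T \<and> z \<in> T \<and> T \<subseteq> ?A" by blast
qed

definition Qo :: "complex set" where "Qo = {z \<in> Q. \<not> on_side z}"

lemma Qo_altdef: "Qo = {z \<in> reg. \<forall>i. rad i < cmod (z - of_real (cen i))}"
proof -
  have "(\<forall>i. rad i \<le> cmod (z - of_real (cen i))) \<and> \<not> on_side z \<longleftrightarrow>
      (\<forall>i. rad i < cmod (z - of_real (cen i)))" for z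
    unfolding on_side_def by (metis order_le_less less_irrefl)
  then show ?thesis unfolding Qo_def Q_def by blast
qed

lemma open_Qo: "open Qo" using open_outside[of "{}"] by (simp add: Qo_altdef)

lemma Qo_Q: "z \<in> Qo \<Longrightarrow> z \<in> Q" by (simp add: Qo_def)

lemma Qo_J [simp]: "J z \<in> Qo \<longleftrightarrow> z \<in> Qo" by (simp add: Qo_def)

definition sg :: "nat \<times> bool \<Rightarrow> real" where "sg j = (if snd j then 1 else -1)"

lemma sg_opp [simp]: "sg (opp j) = - sg j" by (simp add: sg_def opp_def)

text \<open>A neighbourhood of p avoiding all sides but j is intersected with the pull-back, under
  \<open>mv j\<close>, of a neighbourhood of \<open>J p\<close> avoiding all sides but
  \<open>opp j\<close>. The signs of the real parts keep the two sheets of the gluing apart.\<close>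

lemma nbhd_side:
  assumes p: "p \<in> Q" "cmod (p - of_real (cen j)) = rad j"
  obtains V where "open V" "p \<in> V" "V \<subseteq> uhp"
    "\<And>y. y \<in> V \<Longrightarrow> 0 < sg j * Re y"
    "\<And>y. y \<in> V \<Longrightarrow> rad j \<le> cmod (y - of_real (cen j)) \<Longrightarrow> y \<in> Q"
    "\<And>y. y \<in> V \<Longrightarrow> rad j < cmod (y - of_real (cen j)) \<Longrightarrow> y \<in> Qo"
    "\<And>y. y \<in> V \<Longrightarrow> y \<in> ins j \<Longrightarrow> mv j y \<in> Qo"
    "\<And>y. y \<in> V \<Longrightarrow> sg j * Re (mv j y) < 0"
proof -
  define A where "A i = {z \<in> reg. \<forall>k. k \<notin> {i} \<longrightarrow> rad k < cmod (z - of_real (cen k))} \<inter> {z. 0 < sg i * Re z}" for i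
  have oA: "open (A i)" for i unfolding A_def
    by (intro open_Int open_outside open_Collect_less continuous_intros)
  have pA: "z \<in> A i" if "z \<in> Q" "cmod (z - of_real (cen i)) = rad i" for z i
  proof -
    have "rad k < cmod (z - of_real (cen k))" if "k \<noteq> i" for k
      using side_unique[of z k i] that \<open>z \<in> Q\<close> \<open>cmod (z - of_real (cen i)) = rad i\<close> Q_Im[of z] by force
    moreover have "0 < sg i * Re z"
      using side_strip(1)[of z i] that Q_Im[of z] node_nonneg[of "fst i"] unfolding sg_def
      by (metis le_less_trans less_imp_le order_refl)
    ultimately show ?thesis using \<open>z \<in> Q\<close> by (simp add: A_def Q_def)
  qed
  define V where "V = A j \<inter> {y. 0 < Im y \<and> mv j y \<in> A (opp j)}"
  have Jp: "mv j p = J p" using p by (intro mv_side) (auto simp: Q_Im)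
  have "cmod (J p - of_real (cen (opp j))) = rad (opp j)"
    using p by (simp only: dist_J opp_opp rad_opp)
  then have "J p \<in> A (opp j)" using pA[of "J p" "opp j"] p(1) Q_J by blast
  have "open V" unfolding V_def by (intro open_Int oA iso_open_preimage iso_mv)
  moreover have "p \<in> V" using p pA[of p j] \<open>J p \<in> A (opp j)\<close> by (simp add: V_def Jp Q_Im)
  moreover have "V \<subseteq> uhp" by (auto simp: V_def)
  moreover have "0 < sg j * Re y" "sg j * Re (mv j y) < 0" if "y \<in> V" for y
    using that by (auto simp: V_def A_def)
  moreover have "y \<in> Q" if "y \<in> V" "rad j \<le> cmod (y - of_real (cen j))" for y
    using that by (auto simp: V_def A_def Q_def)
  moreover have "y \<in> Qo" if "y \<in> V" "rad j < cmod (y - of_real (cen j))" for y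
    using that by (auto simp: V_def A_def Qo_altdef) 
  moreover have "mv j y \<in> Qo" if "y \<in> V" "y \<in> ins j" for y
  proof -
    have "mv j y \<in> A (opp j)" "rad (opp j) < cmod (mv j y - of_real (cen (opp j)))"
      using that(1) mv_outside[OF that(2)] by (auto simp: V_def)
    then have "mv j y \<in> reg" "rad i < cmod (mv j y - of_real (cen i))" for i
      unfolding A_def by (simp, cases "i = opp j") simp_all
    then show ?thesis by (simp add: Qo_altdef)
  qed
  ultimately show ?thesis using that[of V] by blast
qed

section \<open>Open sets of the half plane that serve as coordinates\<close>

lemma prj_preimage_Qo:
  assumes "B \<subseteq> Qo" shows "{z \<in> Q. prj z \<in> prj ` B} = B"
  using assms prj_eq_iff by (auto simp: Qo_def)

lemma openin_prj_Qo: "open B \<Longrightarrow> B \<subseteq> Qo \<Longrightarrow> openin S (prj ` B)"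
  unfolding openin_flute prj_preimage_Qo by (auto intro!: open_openin_trans open_subset dest: Qo_Q simp: subset_iff image_iff)

text \<open>Besides making \<open>lift\<close> a homeomorphism onto an open set, the last clause
  prepares the chart condition on polygons. It runs over all representatives z in \<open>Q\<close>,
  because a point of a side has two, and from each of them the coordinate must be reached by an
  isometry.\<close>

definition chart_ball :: "complex set \<Rightarrow> bool" where
  "chart_ball B \<longleftrightarrow> open B \<and> B \<subseteq> dom \<and> inj_on lift B \<and>
    (\<forall>T. open T \<longrightarrow> T \<subseteq> B \<longrightarrow> openin S (lift ` T)) \<and>
    (\<forall>V. openin S V \<longrightarrow> open {y \<in> B. lift y \<in> V}) \<and>
    (\<forall>y\<in>B. \<forall>z\<in>Q. prj z = lift y \<longrightarrow> (\<exists>m W. hyp_isometry m \<and> open W \<and> z \<in> W \<and>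
        (\<forall>z'\<in>W \<inter> Q. m z' \<in> B \<and> lift (m z') = prj z')))"

lemma chart_ball_Qo: assumes "open B" "B \<subseteq> Qo" shows "chart_ball B"
  unfolding chart_ball_def
proof (intro conjI allI impI ballI)
  have BQ: "B \<subseteq> Q" using assms(2) Qo_Q by auto
  have lB: "lift ` T = prj ` T" if "T \<subseteq> B" for T
    using that BQ lift_Q by (intro image_cong) auto
  show "open B" "B \<subseteq> dom" using assms BQ Q_dom by auto
  show "inj_on lift B"
    using assms BQ by (intro inj_onI) (auto simp: lift_Q prj_eq_iff Qo_def subset_iff)
  show "openin S (lift ` T)" if "open T" "T \<subseteq> B" for T
    using lB[OF that(2)] openin_prj_Qo[OF that(1)] that assms by auto
  show "open {y \<in> B. lift y \<in> V}" if "openin S V" for V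
  proof -
    have "openin (top_of_set Q) {z \<in> Q. prj z \<in> V}" using that openin_flute by blast
    then obtain T where T: "open T" "{z \<in> Q. prj z \<in> V} = Q \<inter> T" unfolding openin_open by blast
    have "y \<in> T \<longleftrightarrow> prj y \<in> V" if "y \<in> Q" for y using T(2) that by blast
    then have "{y \<in> B. lift y \<in> V} = B \<inter> T" using BQ lift_Q by auto
    then show ?thesis using T(1) assms(1) by auto
  qed
  show "\<exists>m W. hyp_isometry m \<and> open W \<and> z \<in> W \<and> (\<forall>z'\<in>W \<inter> Q. m z' \<in> B \<and> lift (m z') = prj z')"
    if "y \<in> B" "z \<in> Q" "prj z = lift y" for y z
  proof -
    have "z = y" using that assms(2) BQ prj_eq_iff[of y z] lift_Q[of y] by (auto simp: Qo_def)
    then show ?thesis using that assms BQ lift_Q iso_id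
      by (intro exI[of _ "\<lambda>z. z"] exI[of _ B]) auto
  qed
qed

text \<open>The side cuts V into an outer half inside \<open>Q\<close>, where \<open>lift\<close> is
  \<open>prj\<close>, and an inner half that \<open>mv j\<close> carries into \<open>Q\<close> next
  to the mirror image of p. The two descriptions fit together on the side by \<open>mv_side\<close>
  and \<open>prj_J\<close>.\<close>

lemma chart_ball_side:
  assumes p: "p \<in> Q" "cmod (p - of_real (cen j)) = rad j"
  obtains B where "chart_ball B" "p \<in> B"
proof -
  obtain V where V: "open V" "p \<in> V" "V \<subseteq> uhp"
    "\<And>y. y \<in> V \<Longrightarrow> 0 < sg j * Re y"
    "\<And>y. y \<in> V \<Longrightarrow> rad j \<le> cmod (y - of_real (cen j)) \<Longrightarrow> y \<in> Q"
    "\<And>y. y \<in> V \<Longrightarrow> rad j < cmod (y - of_real (cen j)) \<Longrightarrow> y \<in> Qo"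
    "\<And>y. y \<in> V \<Longrightarrow> y \<in> ins j \<Longrightarrow> mv j y \<in> Qo"
    "\<And>y. y \<in> V \<Longrightarrow> sg j * Re (mv j y) < 0"
    using nbhd_side[OF p] by blast
  have cases: "(y \<notin> ins j \<and> y \<in> Q \<and> lift y = prj y \<and> unf y = y) \<or>
     (y \<in> ins j \<and> mv j y \<in> Qo \<and> lift y = prj (mv j y) \<and> unf y = mv j y)" if "y \<in> V" for y
  proof (cases "y \<in> ins j")
    case True then show ?thesis using V(7)[OF that True] by (simp add: lift_def unf_ins)
  next
    case False
    then have "rad j \<le> cmod (y - of_real (cen j))" using that V(3) by (auto simp: ins_def)
    then show ?thesis using V(5)[OF that] False by (simp add: lift_Q unf_Q)
  qed
  have Imv: "0 < Im y" if "y \<in> V" for y using V(3) that by auto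
  have side: "on_side y \<Longrightarrow> mv j y = J y \<and> cmod (y - of_real (cen j)) = rad j" if y: "y \<in> V" "y \<notin> ins j" for y
  proof -
    assume "on_side y"
    then have "\<not> rad j < cmod (y - of_real (cen j))" using V(6)[OF y(1)] by (auto simp: Qo_def)
    then have "cmod (y - of_real (cen j)) = rad j" using y V(3) by (auto simp: ins_def)
    then show ?thesis using mv_side[of y j] Imv[OF y(1)] by auto
  qed
  \<comment> \<open>The saturation of T: its part in \<open>Q\<close> together with its copy
    transported by the pairing to the opposite side.\<close>
  have pre: "{z \<in> Q. prj z \<in> lift ` T} = Q \<inter> (T \<union> {z. 0 < Im z \<and> mv (opp j) z \<in> T})" if T: "T \<subseteq> V" for T
  proof (intro equalityI subsetI)
    fix z assume "z \<in> {z \<in> Q. prj z \<in> lift ` T}"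
    then obtain y where y: "z \<in> Q" "y \<in> T" "prj z = lift y" by auto
    have yV: "y \<in> V" using y T by auto
    show "z \<in> Q \<inter> (T \<union> {z. 0 < Im z \<and> mv (opp j) z \<in> T})"
    proof (cases "y \<in> ins j")
      case True
      then have "mv j y \<in> Qo" "prj (mv j y) = prj z" using cases[OF yV] y by auto
      then have "z = mv j y" using prj_eq_iff[of "mv j y" z] y(1) by (auto simp: Qo_def)
      then have "mv (opp j) z = y" using mv_mv[OF Imv[OF yV], of j] by simp
      then show ?thesis using y(1,2) Q_Im[OF y(1)] by simp
    next
      case False
      then have Q: "y \<in> Q" "prj y = prj z" using cases[OF yV] y by auto
      then have "z = y \<or> on_side y \<and> z = J y" using prj_eq_iff y(1) by blast
      then show ?thesis
      proof
        assume "on_side y \<and> z = J y"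
        then have "z = mv j y" using side[OF yV False] by simp
        then have "mv (opp j) z = y" using mv_mv[OF Imv[OF yV], of j] by simp
        then show ?thesis using y(1,2) Q_Im[OF y(1)] by simp
      next
        assume "z = y"
        then show ?thesis using y(1,2) by simp
      qed
    qed
  next
    fix z assume z: "z \<in> Q \<inter> (T \<union> {z. 0 < Im z \<and> mv (opp j) z \<in> T})"
    show "z \<in> {z \<in> Q. prj z \<in> lift ` T}"
    proof (cases "z \<in> T")
      case True then show ?thesis using z lift_Q[of z] by force
    next
      case False
      define y where "y = mv (opp j) z"
      have y: "y \<in> T" "z \<in> Q" using z False by (auto simp: y_def)
      have zy: "mv j y = z" using mv_mv[of z "opp j"] Q_Im[OF y(2)] by (simp add: y_def)
      have yV: "y \<in> V" using y T by auto
      have "lift y = prj z"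
      proof (cases "y \<in> ins j")
        case True then show ?thesis using cases[OF yV] zy by auto
      next
        case f: False
        have "\<not> z \<in> ins (opp j)" using Q_notin_ins[OF y(2)] .
        then have "\<not> rad j < cmod (y - of_real (cen j))" using mv_inside_iff[OF Imv[OF yV], of j] zy by simp
        then have s: "cmod (y - of_real (cen j)) = rad j" using f Imv[OF yV] by (auto simp: ins_def)
        then have "z = J y" "on_side y" using mv_side[OF Imv[OF yV] s] zy s unfolding on_side_def by auto
        then show ?thesis using cases[OF yV] f prj_J by auto
      qed
      then show ?thesis using y by force
    qed
  qed
  have "chart_ball V" unfolding chart_ball_def
  proof (intro conjI allI impI ballI)
    show "open V" by fact
    show "V \<subseteq> dom"
    proof
      fix y assume y: "y \<in> V"
      show "y \<in> dom" using cases[OF y] Imv[OF y] Qo_Q by (auto simp: dom_def)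
    qed
    show "inj_on lift V"
    proof (rule inj_onI)
      fix y y' assume yy: "y \<in> V" "y' \<in> V" "lift y = lift y'"
      have key: "y = y'" if yy: "y \<in> V" "y' \<in> V" "lift y = lift y'" "y \<notin> ins j" for y y'
      proof (cases "y' \<in> ins j")
        case False
        have a: "y \<in> Q" "lift y = prj y" using cases[OF yy(1)] yy(4) by auto
        have b: "y' \<in> Q" "lift y' = prj y'" using cases[OF yy(2)] False by auto
        have "y = y' \<or> (on_side y \<and> y' = J y)" using prj_eq_iff[OF a(1) b(1)] yy(3) a(2) b(2) by simp
        \<comment> \<open>On V the real part has the sign of the side j, while \<open>J\<close>
          reverses it.\<close>
        moreover have "y' \<noteq> J y" using V(4)[OF yy(1)] V(4)[OF yy(2)] by auto
        ultimately show ?thesis by auto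
      next
        case True
        have a: "y \<in> Q" "lift y = prj y" using cases[OF yy(1)] yy(4) by auto
        have b: "mv j y' \<in> Qo" "lift y' = prj (mv j y')" using cases[OF yy(2)] True by auto
        have "prj (mv j y') = prj y" using yy(3) a b by simp
        then have "mv j y' = y" using prj_eq_iff[OF Qo_Q[OF b(1)] a(1)] b(1) by (simp add: Qo_def)
        then show ?thesis using V(8)[OF yy(2)] V(4)[OF yy(1)] by simp
      qed
      show "y = y'"
      proof (cases "y \<in> ins j \<and> y' \<in> ins j")
        case True
        have a: "mv j y \<in> Qo" "lift y = prj (mv j y)" using cases[OF yy(1)] True by auto
        have b: "mv j y' \<in> Qo" "lift y' = prj (mv j y')" using cases[OF yy(2)] True by auto
        have "prj (mv j y) = prj (mv j y')" using yy(3) a b by simp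
        then have "mv j y = mv j y'" using prj_eq_iff[OF Qo_Q[OF a(1)] Qo_Q[OF b(1)]] a(1) by (simp add: Qo_def)
        then have "mv (opp j) (mv j y) = mv (opp j) (mv j y')" by (rule arg_cong)
        then show ?thesis unfolding mv_mv[OF Imv[OF yy(1)]] mv_mv[OF Imv[OF yy(2)]] .
      next
        case False
        then consider "y \<notin> ins j" | "y' \<notin> ins j" by blast
        then show ?thesis
        proof cases
          case 1 show ?thesis by (rule key[OF yy 1])
        next
          case 2 show ?thesis by (rule key[OF yy(2,1) yy(3)[symmetric] 2, symmetric])
        qed
      qed
    qed
    show "openin S (lift ` T)" if T: "open T" "T \<subseteq> V" for T
    proof -
      have "lift ` T \<subseteq> prj ` Q" 
      proof (rule image_subsetI)
        fix y assume "y \<in> T"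
        then show "lift y \<in> prj ` Q" using cases[of y] T(2) Qo_Q by (auto intro: imageI)
      qed
      moreover have "openin (top_of_set Q) {z \<in> Q. prj z \<in> lift ` T}"
        unfolding pre[OF T(2)] by (intro openin_open_Int open_Un T iso_open_preimage iso_mv)
      ultimately show ?thesis by (simp add: openin_flute)
    qed
    show "open {y \<in> V. lift y \<in> U}" if U: "openin S U" for U
    proof -
      have "openin (top_of_set Q) {z \<in> Q. prj z \<in> U}" using U openin_flute by blast
      then obtain T where T: "open T" "{z \<in> Q. prj z \<in> U} = Q \<inter> T" unfolding openin_open by blast
      \<comment> \<open>E covers the points strictly outside the side and I those strictly inside. M
        is a neighbourhood of the points on the side, where y and \<open>J y = mv j y\<close> must
        both lie in T.\<close>
      define E where "E = V \<inter> {y. rad j < cmod (y - of_real (cen j))} \<inter> T"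
      define I where "I = V \<inter> ins j \<inter> {y. 0 < Im y \<and> mv j y \<in> T}"
      define M where "M = V \<inter> T \<inter> {y. 0 < Im y \<and> mv j y \<in> T}"
      have oins: "open (ins j)" unfolding ins_def
        by (intro open_Collect_conj open_Collect_less continuous_intros)
      have "open (E \<union> I \<union> M)" unfolding E_def I_def M_def
        by (intro open_Un open_Int V(1) T(1) iso_open_preimage iso_mv oins open_Collect_less continuous_intros)
      moreover have "{y \<in> V. lift y \<in> U} = E \<union> I \<union> M"
      proof (intro equalityI subsetI)
        fix y assume y: "y \<in> {y \<in> V. lift y \<in> U}"
        then have yV: "y \<in> V" by simp
        show "y \<in> E \<union> I \<union> M"
        proof (cases "y \<in> ins j")
          case True
          then have "mv j y \<in> {z \<in> Q. prj z \<in> U}" using y cases[OF yV] Qo_Q by auto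
          then show ?thesis using T(2) True yV Imv by (auto simp: I_def)
        next
          case False
          then have yQ: "y \<in> {z \<in> Q. prj z \<in> U}" using y cases[OF yV] by auto
          then have yT: "y \<in> T" using T(2) by auto
          show ?thesis
          proof (cases "rad j < cmod (y - of_real (cen j))")
            case True then show ?thesis using yT yV by (auto simp: E_def)
          next
            case f: False
            then have s: "cmod (y - of_real (cen j)) = rad j" using False Imv[OF yV] by (auto simp: ins_def)
            then have "J y \<in> {z \<in> Q. prj z \<in> U}" 
            proof -
              have "on_side y" using s unfolding on_side_def by (rule exI)
              then show ?thesis using yQ prj_J[of y] by simp
            qed
            then have "J y \<in> T" using T(2) by auto
            then show ?thesis using yT yV Imv[OF yV] mv_side[OF Imv[OF yV] s] by (auto simp: M_def)
          qed
        qed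
      next
        fix y assume y: "y \<in> E \<union> I \<union> M"
        then have yV: "y \<in> V" by (auto simp: E_def I_def M_def)
        show "y \<in> {y \<in> V. lift y \<in> U}"
        proof (cases "y \<in> ins j")
          case True
          then have "mv j y \<in> T" using y by (auto simp: E_def I_def M_def ins_def)
          then have "mv j y \<in> {z \<in> Q. prj z \<in> U}" using T(2) cases[OF yV] True Qo_Q by blast
          then show ?thesis using cases[OF yV] True yV by auto
        next
          case False
          then have "y \<in> T" using y by (auto simp: E_def I_def M_def)
          then have "y \<in> {z \<in> Q. prj z \<in> U}" using T(2) cases[OF yV] False by blast
          then show ?thesis using cases[OF yV] False yV by auto
        qed
      qed
      ultimately show ?thesis by simp
    qed
    show "\<exists>m W. hyp_isometry m \<and> open W \<and> z \<in> W \<and> (\<forall>z'\<in>W \<inter> Q. m z' \<in> V \<and> lift (m z') = prj z')"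
      if y: "y \<in> V" "z \<in> Q" "prj z = lift y" for y z
    proof -
      have "z \<in> V \<or> mv (opp j) z \<in> V" using pre[of V] y by blast
      then show ?thesis
      proof
        assume "z \<in> V"
        then show ?thesis using V(1) lift_Q iso_id by (intro exI[of _ "\<lambda>z. z"] exI[of _ V]) auto
      next
        assume z: "mv (opp j) z \<in> V"
        define W where "W = {z. 0 < Im z \<and> mv (opp j) z \<in> V}"
        have "open W" "z \<in> W" using z Q_Im[OF y(2)] by (auto simp: W_def intro!: iso_open_preimage iso_mv V(1))
        moreover have "mv (opp j) z' \<in> V \<and> lift (mv (opp j) z') = prj z'" if z': "z' \<in> W \<inter> Q" for z'
        proof
          show v: "mv (opp j) z' \<in> V" using z' by (auto simp: W_def)
          have "prj z' \<in> lift ` {mv (opp j) z'}" using pre[of "{mv (opp j) z'}"] v z' Q_Im[of z'] by blast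
          then show "lift (mv (opp j) z') = prj z'" by auto
        qed
        ultimately show ?thesis using iso_mv by (intro exI[of _ "mv (opp j)"] exI[of _ W]) auto
      qed
    qed
  qed
  then show ?thesis using V(2) by (rule that)
qed

lemma chart_ball_exists:
  assumes "p \<in> Q" obtains B where "chart_ball B" "p \<in> B"
proof (cases "on_side p")
  case True
  then obtain j where "cmod (p - of_real (cen j)) = rad j" by (auto simp: on_side_def)
  then show ?thesis using chart_ball_side[OF assms] that by blast
next
  case False
  then show ?thesis using chart_ball_Qo[OF open_Qo] that assms by (auto simp: Qo_def)
qed

end

section \<open>Infinitely many common points along sides, axis and circles\<close>

definition circ :: "real \<Rightarrow> real \<Rightarrow> real \<Rightarrow> complex" where
  "circ c r u = Complex u (sqrt (r\<^sup>2 - (u - c)\<^sup>2))"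

lemma infinite_curve:
  fixes \<gamma> :: "real \<Rightarrow> complex"
  assumes "inj \<gamma>" "eventually (\<lambda>t. \<gamma> t \<in> A) (at_right 0)"
  shows "infinite A"
proof
  assume A: "finite A"
  obtain b where b: "b > 0" "\<And>t. 0 < t \<Longrightarrow> t < b \<Longrightarrow> \<gamma> t \<in> A"
    using assms(2) by (auto simp: eventually_at_right[of _ 1] eventually_at_right_field)
  have "\<gamma> ` {0<..<b} \<subseteq> A" using b(2) by auto
  then have "finite (\<gamma> ` {0<..<b})" using A finite_subset by blast
  then have "finite {0<..<b}" using assms(1) by (meson finite_imageD inj_on_subset subset_UNIV)
  then show False using b(1) by (simp add: infinite_Ioo)
qed

lemma inj_circ: "d \<noteq> 0 \<Longrightarrow> inj (\<lambda>t. circ c r (a + d * t))"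
  by (auto simp: inj_def circ_def)

text \<open>Along a circle with real centre c the squared distance to any other real point is affine
  in the abscissa. So the sign of d controls the modulus and the distances to all side centres at
  once.\<close>

lemma circ_near:
  assumes z: "0 < Im z" "cmod (z - of_real c) = r" and W: "open W" "z \<in> W"
  shows "eventually (\<lambda>t. circ c r (Re z + d * t) \<in> W \<and> 0 < Im (circ c r (Re z + d * t)) \<and>
     (\<forall>c'. (cmod (circ c r (Re z + d * t) - of_real c'))\<^sup>2 = (cmod (z - of_real c'))\<^sup>2 + 2 * (d * t) * (c - c'))) (at_right 0)"
proof -
  have r: "r\<^sup>2 = (Re z - c)\<^sup>2 + (Im z)\<^sup>2" using z(2) cmod_power2[of "z - of_real c"] by simp
  have z0: "circ c r (Re z + d * 0) = z" using z(1) by (simp add: circ_def r complex_eq_iff)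
  have "isCont (\<lambda>t. circ c r (Re z + d * t)) 0"
    unfolding circ_def Complex_eq by (intro continuous_intros)
  then have lim: "((\<lambda>t. circ c r (Re z + d * t)) \<longlongrightarrow> z) (at_right 0)"
    using z0 by (metis isContD filterlim_at_split)
  have 1: "eventually (\<lambda>t. circ c r (Re z + d * t) \<in> W) (at_right 0)"
    using topological_tendstoD[OF lim W] .
  have 2: "eventually (\<lambda>t. circ c r (Re z + d * t) \<in> {y. 0 < Im y}) (at_right 0)"
    using topological_tendstoD[OF lim open_uhp] z by simp
  show ?thesis using 1 2
  proof eventually_elim
    case (elim t)
    define u where "u = Re z + d * t"
    have p: "0 < sqrt (r\<^sup>2 - (u - c)\<^sup>2)" using elim(2) by (simp add: circ_def u_def)
    then have p': "(sqrt (r\<^sup>2 - (u - c)\<^sup>2))\<^sup>2 = r\<^sup>2 - (u - c)\<^sup>2" by simp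
    have "(cmod (circ c r u - of_real c'))\<^sup>2 = (cmod (z - of_real c'))\<^sup>2 + 2 * (d * t) * (c - c')" for c'
    proof -
      have "(cmod (circ c r u - of_real c'))\<^sup>2 = (u - c')\<^sup>2 + (r\<^sup>2 - (u - c)\<^sup>2)"
        unfolding cmod_power2 using p' by (simp add: circ_def)
      also have "\<dots> = (Re z - c')\<^sup>2 + (Im z)\<^sup>2 + 2 * (d * t) * (c - c')"
        unfolding r u_def by (simp add: power2_eq_square algebra_simps)
      finally show ?thesis unfolding cmod_power2 by simp
    qed
    then show ?case using elim by (simp add: u_def)
  qed
qed

lemma at_right_less: assumes "(a::real) < b"
  shows "eventually (\<lambda>t. a + k * t < b) (at_right 0)"
proof -
  have "((\<lambda>t. a + k * t) \<longlongrightarrow> a + k * 0) (at_right 0)" by (intro tendsto_intros)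
  then show ?thesis using order_tendstoD(2)[of "\<lambda>t. a + k * t" a] assms by simp
qed

context flute_seq begin

definition band :: "nat \<Rightarrow> complex set" where
  "band n = {z. level n \<le> cmod z \<and> cmod z \<le> level (Suc n)}"

lemma band_sq: "z \<in> band n \<longleftrightarrow> (level n)\<^sup>2 \<le> (cmod z)\<^sup>2 \<and> (cmod z)\<^sup>2 \<le> (level (Suc n))\<^sup>2"
  unfolding band_def by (auto simp: abs_le_square_iff[symmetric])

lemma cen_nz: "cen j \<noteq> 0"
  using node_Suc_pos[of "fst j"] node_nonneg[of "fst j"] by (auto simp: cen_def simp del: node_Suc_pos node_nonneg)

text \<open>Supplies the infinite set for \<open>iso_eqI\<close> when two sheets meet along a
  side.\<close>

lemma side_acc:
  assumes p: "p \<in> Q" "cmod (p - of_real (cen j)) = rad j" "p \<in> band n" and W: "open W" "p \<in> W"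
  shows "infinite (W \<inter> uhp \<inter> band n \<inter> {y. cmod (y - of_real (cen j)) = rad j})"
proof -
  have Im: "0 < Im p" using p Q_Im by simp
  \<comment> \<open>Along the side |p|^2 changes by 2 d t \<open>cen j\<close>. The modulus is made
    to grow unless p is already on the outer circle, so the arc stays in the band.\<close>
  define d where "d = (if cmod p < level (Suc n) then sgn (cen j) else - sgn (cen j))"
  have d: "d \<noteq> 0" using cen_nz[of j] by (auto simp: d_def sgn_if)
  have dc: "d * cen j = (if cmod p < level (Suc n) then \<bar>cen j\<bar> else - \<bar>cen j\<bar>)"
    by (simp add: d_def abs_sgn mult.commute)
  have ev: "eventually (\<lambda>t. level n * level n \<le> (cmod p)\<^sup>2 + 2 * (d * t) * cen j \<and>
     (cmod p)\<^sup>2 + 2 * (d * t) * cen j \<le> level (Suc n) * level (Suc n)) (at_right 0)"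
  proof (cases "cmod p < level (Suc n)")
    case True
    then have "(cmod p)\<^sup>2 < level (Suc n) * level (Suc n)" by (simp add: power2_eq_square mult_strict_mono')
    then have "eventually (\<lambda>t. (cmod p)\<^sup>2 + (2 * \<bar>cen j\<bar>) * t < level (Suc n) * level (Suc n)) (at_right 0)"
      by (rule at_right_less)
    moreover have "eventually (\<lambda>t::real. 0 < t) (at_right 0)" by (rule eventually_at_right_less)
    ultimately show ?thesis
    proof eventually_elim
      case (elim t)
      have "2 * (d * t) * cen j = 2 * \<bar>cen j\<bar> * t" using dc True by (simp add: mult_ac)
      moreover have "level n * level n \<le> (cmod p)\<^sup>2" using p(3) by (simp add: band_def power2_eq_square mult_mono')
      moreover have "0 \<le> 2 * \<bar>cen j\<bar> * t" using elim by simp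
      ultimately show ?case using elim by linarith
    qed
  next
    case False
    then have eq: "cmod p = level (Suc n)" using p(3) by (simp add: band_def)
    then have "- ((cmod p)\<^sup>2) < - (level n * level n)" using level_less_Suc[of n]
      by (simp add: power2_eq_square mult_strict_mono')
    then have "eventually (\<lambda>t. - ((cmod p)\<^sup>2) + (2 * \<bar>cen j\<bar>) * t < - (level n * level n)) (at_right 0)"
      by (rule at_right_less)
    moreover have "eventually (\<lambda>t::real. 0 < t) (at_right 0)" by (rule eventually_at_right_less)
    ultimately show ?thesis
    proof eventually_elim
      case (elim t)
      have "2 * (d * t) * cen j = 2 * t * (d * cen j)" by simp
      then have "2 * (d * t) * cen j = - (2 * \<bar>cen j\<bar> * t)" using dc False by simp
      moreover have "(cmod p)\<^sup>2 = level (Suc n) * level (Suc n)" using eq by (simp add: power2_eq_square)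
      moreover have "0 \<le> 2 * \<bar>cen j\<bar> * t" using elim by simp
      ultimately show ?case using elim by linarith
    qed
  qed
  have "eventually (\<lambda>t. circ (cen j) (rad j) (Re p + d * t) \<in> W \<inter> uhp \<inter> band n \<inter> {y. cmod (y - of_real (cen j)) = rad j}) (at_right 0)"
    using circ_near[OF Im p(2) W, of d] ev
  proof eventually_elim
    case (elim t)
    define y where "y = circ (cen j) (rad j) (Re p + d * t)"
    from elim have y: "y \<in> W" "0 < Im y" "\<And>c'. (cmod (y - of_real c'))\<^sup>2 = (cmod (p - of_real c'))\<^sup>2 + 2 * (d * t) * (cen j - c')"
      by (auto simp: y_def)
    have "(cmod (y - of_real (cen j)))\<^sup>2 = (rad j)\<^sup>2" using y(3)[of "cen j"] p(2) by simp
    then have "cmod (y - of_real (cen j)) = rad j" by (simp add: power2_eq_iff_nonneg less_imp_le)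
    moreover have "y \<in> band n" using y(3)[of 0] elim(2) by (simp add: band_sq power2_eq_square[of "level _"])
    ultimately show ?case using y by (simp add: y_def)
  qed
  then show ?thesis using infinite_curve[OF inj_circ[OF d]] by blast
qed

lemma axis_acc:
  assumes p: "Re p = 0" "p \<in> band n" "0 < Im p" and W: "open W" "p \<in> W"
  shows "infinite (W \<inter> uhp \<inter> band n \<inter> {y. Re y = 0})"
proof -
  define d where "d = (if cmod p < level (Suc n) then 1 else - 1 :: real)"
  have pI: "cmod p = Im p" using p by (simp add: cmod_eq_Im)
  define g where "g t = Complex 0 (Im p + d * t)" for t
  have "inj g" by (auto simp: inj_def g_def d_def)
  have p0: "p = g 0" using p by (simp add: g_def complex_eq_iff)
  have "isCont g 0" unfolding g_def[abs_def] Complex_eq by (intro continuous_intros)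
  then have lim: "(g \<longlongrightarrow> p) (at_right 0)" using p0 by (metis isContD filterlim_at_split)
  have 1: "eventually (\<lambda>t. g t \<in> W) (at_right 0)" using topological_tendstoD[OF lim W] .
  have 2: "eventually (\<lambda>t. g t \<in> uhp) (at_right 0)" using topological_tendstoD[OF lim open_uhp] p by simp
  have 3: "eventually (\<lambda>t::real. 0 < t) (at_right 0)" by (rule eventually_at_right_less)
  have 4: "eventually (\<lambda>t. level n \<le> Im p + d * t \<and> Im p + d * t \<le> level (Suc n)) (at_right 0)"
  proof (cases "cmod p < level (Suc n)")
    case True
    then have "Im p < level (Suc n)" by (simp add: pI)
    from at_right_less[OF this, of 1] 3 show ?thesis
      by eventually_elim (use p(2) pI True in \<open>auto simp: d_def band_def\<close>)
  next
    case False
    then have eq: "Im p = level (Suc n)" using p(2) pI by (simp add: band_def)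
    then have "- Im p < - level n" using level_less_Suc[of n] by simp
    from at_right_less[OF this, of 1] 3 show ?thesis
      by eventually_elim (use eq False in \<open>auto simp: d_def\<close>)
  qed
  have "eventually (\<lambda>t. g t \<in> W \<inter> uhp \<inter> band n \<inter> {y. Re y = 0}) (at_right 0)"
    using 1 2 4 by eventually_elim (auto simp: band_def g_def cmod_eq_Im)
  then show ?thesis using infinite_curve[OF \<open>inj g\<close>] by blast
qed

text \<open>Supplies the infinite set for \<open>iso_eqI\<close> on the circle between two bands. If
  p lies on a side, the direction leads away from the centre of that side, so the arc stays in
  \<open>Q\<close>.\<close>

lemma radial_acc:
  assumes p: "p \<in> Q" and W: "open W" "p \<in> W"
  shows "infinite (W \<inter> Q \<inter> {y. cmod y = cmod p})"
proof -
  have Im: "0 < Im p" using p Q_Im by simp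
  obtain V d where V: "open V" "p \<in> V" and d: "d \<noteq> (0::real)"
    and VQ: "\<And>y t. y \<in> V \<Longrightarrow> 0 < t \<Longrightarrow> (\<forall>c'. (cmod (y - of_real c'))\<^sup>2 = (cmod (p - of_real c'))\<^sup>2 + 2 * (d * t) * (0 - c')) \<Longrightarrow> y \<in> Q"
  proof (cases "on_side p")
    case False
    then show ?thesis using open_Qo p by (intro that[of Qo 1]) (auto simp: Qo_def)
  next
    case True
    then obtain j where j: "cmod (p - of_real (cen j)) = rad j" by (auto simp: on_side_def)
    obtain V where V: "open V" "p \<in> V" "\<And>y. y \<in> V \<Longrightarrow> rad j \<le> cmod (y - of_real (cen j)) \<Longrightarrow> y \<in> Q"
      using nbhd_side[OF p j] by metis
    show ?thesis
    proof (rule that[of V "- sgn (cen j)"])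
      fix y t assume y: "y \<in> V" "0 < t" "\<forall>c'. (cmod (y - of_real c'))\<^sup>2 = (cmod (p - of_real c'))\<^sup>2 + 2 * (- sgn (cen j) * t) * (0 - c')"
      have "(cmod (y - of_real (cen j)))\<^sup>2 = (rad j)\<^sup>2 + 2 * (t * (cen j * sgn (cen j)))"
        using y(3) j by (simp add: algebra_simps)
      then have "(rad j)\<^sup>2 \<le> (cmod (y - of_real (cen j)))\<^sup>2" using y(2) by (simp add: abs_sgn[symmetric])
      then have "rad j \<le> cmod (y - of_real (cen j))" by (rule power2_le_imp_le) simp
      then show "y \<in> Q" using V(3) y(1) by blast
    qed (use V cen_nz in \<open>auto simp: sgn_if\<close>)
  qed
  have c0: "cmod (p - of_real 0) = cmod p" and WV: "open (W \<inter> V)" "p \<in> W \<inter> V" using W V by auto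
  have "eventually (\<lambda>t. circ 0 (cmod p) (Re p + d * t) \<in> W \<inter> Q \<inter> {y. cmod y = cmod p}) (at_right 0)"
    using circ_near[OF Im c0 WV, of d] eventually_at_right_less[of 0]
  proof (eventually_elim)
    case (elim t)
    define y where "y = circ 0 (cmod p) (Re p + d * t)"
    from elim have y: "y \<in> W" "y \<in> V" "\<forall>c'. (cmod (y - of_real c'))\<^sup>2 = (cmod (p - of_real c'))\<^sup>2 + 2 * (d * t) * (0 - c')"
      by (auto simp: y_def)
    have "(cmod y)\<^sup>2 = (cmod p)\<^sup>2" using y(3)[rule_format, of 0] by simp
    then have "cmod y = cmod p" by (simp add: power2_eq_iff_nonneg)
    moreover have "y \<in> Q" by (rule VQ[OF y(2) _ y(3)]) (use elim in simp)
    ultimately show ?case using y by (simp add: y_def)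
  qed
  then show ?thesis using infinite_curve[OF inj_circ[OF d]] by blast
qed

section \<open>Charts of the hyperbolic metric\<close>

lemma iso_mult: "r > 0 \<Longrightarrow> hyp_isometry (\<lambda>z. of_real r * z)"
proof -
  assume "r > 0"
  then have h: "hyp_isometry (\<lambda>z. z / of_real (1 / r))" by (intro iso_scale) simp
  have e: "(\<lambda>z. z / complex_of_real (1 / r)) = (\<lambda>z. of_real r * z)" by (auto simp: fun_eq_iff)
  show ?thesis using h unfolding e .
qed

lemma emb_eq: "emb n \<sigma> w = of_real (scale n) * (if \<sigma> then w else - cnj w)"
  by (simp add: emb_def J_def)

lemma half_pants_Im: "w \<in> half_pants len n \<Longrightarrow> 0 < Im w"
  by (simp add: half_pants_def)

text \<open>The isometry m is left free so that every isometric coordinate on B is a chart;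
  \<open>subharmonic_lift\<close> chooses it to suit a given disc.\<close>

lemma chart_from_ball:
  assumes B: "chart_ball B" and m: "hyp_isometry m"
  shows "flute_chart len (lift ` B) (\<lambda>q. m (the_inv_into B lift q))"
proof -
  define \<phi> where "\<phi> q = m (the_inv_into B lift q)" for q
  have B': "open B" "B \<subseteq> dom" "inj_on lift B"
    "\<And>T. open T \<Longrightarrow> T \<subseteq> B \<Longrightarrow> openin S (lift ` T)"
    "\<And>V. openin S V \<Longrightarrow> open {y \<in> B. lift y \<in> V}"
    using B unfolding chart_ball_def by simp_all
  have B6: "\<forall>y\<in>B. \<forall>z\<in>Q. prj z = lift y \<longrightarrow> (\<exists>m W. hyp_isometry m \<and> open W \<and> z \<in> W \<and>
        (\<forall>z'\<in>W \<inter> Q. m z' \<in> B \<and> lift (m z') = prj z'))"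
    using B unfolding chart_ball_def by (elim conjE)
  have BH: "B \<subseteq> uhp" using B'(2) by (auto simp: dom_def)
  have \<phi>l: "\<phi> (lift y) = m y" if "y \<in> B" for y using the_inv_into_f_f[OF B'(3) that] by (simp add: \<phi>_def)
  have im: "\<phi> ` lift ` B = m ` B" by (simp add: image_image \<phi>l cong: image_cong)
  obtain m' where m': "hyp_isometry m'" "\<And>z. 0 < Im z \<Longrightarrow> m' (m z) = z" "\<And>z. 0 < Im z \<Longrightarrow> m (m' z) = z"
    using iso_inv[OF m] by metis
  have tS: "topspace (subtopology S (lift ` B)) = lift ` B"
    using openin_subset[OF B'(4)[OF B'(1) order_refl]] by auto
  have "homeomorphic_maps (subtopology S (lift ` B)) (top_of_set (m ` B)) \<phi> (\<lambda>w. lift (m' w))"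
    unfolding homeomorphic_maps_def
  proof (intro conjI ballI)
    show "continuous_map (subtopology S (lift ` B)) (top_of_set (m ` B)) \<phi>"
      unfolding continuous_map_def tS
    proof (intro conjI allI impI)
      fix T assume "openin (top_of_set (m ` B)) T"
      then obtain T' where T': "open T'" "T = m ` B \<inter> T'" unfolding openin_open by blast
      have "{q \<in> lift ` B. \<phi> q \<in> T} = lift ` (B \<inter> {y. 0 < Im y \<and> m y \<in> T'})"
      proof (intro equalityI subsetI)
        fix q assume "q \<in> {q \<in> lift ` B. \<phi> q \<in> T}"
        then obtain y where y: "y \<in> B" "q = lift y" "m y \<in> T'" using \<phi>l T'(2) by auto
        then show "q \<in> lift ` (B \<inter> {y. 0 < Im y \<and> m y \<in> T'})" using BH by blast
      next
        fix q assume "q \<in> lift ` (B \<inter> {y. 0 < Im y \<and> m y \<in> T'})"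
        then obtain y where y: "y \<in> B" "q = lift y" "m y \<in> T'" by auto
        then show "q \<in> {q \<in> lift ` B. \<phi> q \<in> T}" using \<phi>l[OF y(1)] T'(2) by simp
      qed
      moreover have "openin S \<dots>" by (intro B'(4) open_Int B'(1) iso_open_preimage m T'(1)) auto
      ultimately show "openin (subtopology S (lift ` B)) {q \<in> lift ` B. \<phi> q \<in> T}"
        unfolding openin_subtopology by (intro exI[of _ "{q \<in> lift ` B. \<phi> q \<in> T}"]) auto
    qed (auto simp: \<phi>l)
    show "continuous_map (top_of_set (m ` B)) (subtopology S (lift ` B)) (\<lambda>w. lift (m' w))"
      unfolding continuous_map_def tS
    proof (intro conjI allI impI)
      fix V assume "openin (subtopology S (lift ` B)) V"
      then obtain V' where V': "openin S V'" "V = V' \<inter> lift ` B" unfolding openin_subtopology by blast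
      have "{w \<in> topspace (top_of_set (m ` B)). lift (m' w) \<in> V} = m ` {y \<in> B. lift y \<in> V'}"
      proof (intro equalityI subsetI)
        fix w assume "w \<in> {w \<in> topspace (top_of_set (m ` B)). lift (m' w) \<in> V}"
        then obtain y where y: "y \<in> B" "w = m y" "lift (m' w) \<in> V'" using V'(2) by auto
        then have "m' w = y" using m'(2)[of y] BH by blast
        then show "w \<in> m ` {y \<in> B. lift y \<in> V'}" using y by blast
      next
        fix w assume "w \<in> m ` {y \<in> B. lift y \<in> V'}"
        then obtain y where y: "y \<in> B" "w = m y" "lift y \<in> V'" by auto
        then have "m' w = y" using m'(2)[of y] BH by blast
        then show "w \<in> {w \<in> topspace (top_of_set (m ` B)). lift (m' w) \<in> V}" using y V'(2) by simp
      qed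
      moreover have "open \<dots>" by (rule iso_open_image[OF m B'(5)[OF V'(1)]]) (use BH in auto)
      moreover have "m ` {y \<in> B. lift y \<in> V'} \<subseteq> m ` B" by auto
      ultimately show "openin (top_of_set (m ` B)) {w \<in> topspace (top_of_set (m ` B)). lift (m' w) \<in> V}"
        by (simp add: open_subset)
    next
      have "m' (m y) = y" if "y \<in> B" for y using m'(2)[of y] BH that by blast
      then show "(\<lambda>w. lift (m' w)) \<in> topspace (top_of_set (m ` B)) \<rightarrow> lift ` B" by auto
    qed
    have mm: "m' (m y) = y" if "y \<in> B" for y using m'(2)[of y] BH that by blast
    show "lift (m' (\<phi> q)) = q" if "q \<in> topspace (subtopology S (lift ` B))" for q
      using that unfolding tS by (auto simp: \<phi>l mm)
    show "\<phi> (lift (m' w)) = w" if "w \<in> topspace (top_of_set (m ` B))" for w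
      using that by (auto simp: \<phi>l mm)
  qed
  then have homeo: "homeomorphic_map (subtopology S (lift ` B)) (top_of_set (m ` B)) \<phi>"
    using homeomorphic_map_maps by blast
  have loc: "\<exists>W m0. open W \<and> z \<in> W \<and> hyp_isometry m0 \<and>
           (\<forall>w \<in> half_pants len n \<inter> W. glue_class len ((n, \<sigma>), w) \<in> lift ` B \<and>
              \<phi> (glue_class len ((n, \<sigma>), w)) = m0 (if \<sigma> then w else - cnj w))"
    if z: "z \<in> half_pants len n" "glue_class len ((n, \<sigma>), z) \<in> lift ` B" for n \<sigma> z
  proof -
    have Z: "emb n \<sigma> z \<in> Q" "prj (emb n \<sigma> z) \<in> lift ` B"
      using z half_pants_iff[of z n \<sigma>] prj_emb[OF z(1), of \<sigma>] by auto
    then obtain y where y: "y \<in> B" "prj (emb n \<sigma> z) = lift y" by auto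
    obtain m1 W1 where m1: "hyp_isometry m1" "open W1" "emb n \<sigma> z \<in> W1"
      "\<And>z'. z' \<in> W1 \<inter> Q \<Longrightarrow> m1 z' \<in> B \<and> lift (m1 z') = prj z'"
      using B6[THEN bspec, OF y(1), THEN bspec, OF Z(1), THEN mp, OF y(2)] by (elim exE conjE) blast
    obtain m2 where m2: "hyp_isometry m2" "\<And>v. 0 < Im v \<Longrightarrow> m2 v = m (m1 v)"
      using iso_comp[OF m1(1) m] by auto
    obtain m3 where m3: "hyp_isometry m3" "\<And>v. 0 < Im v \<Longrightarrow> m3 v = m2 (of_real (scale n) * v)"
      using iso_comp[OF iso_mult[OF scale_pos[of n]] m2(1)] by auto
    have "glue_class len ((n, \<sigma>), w) \<in> lift ` B \<and>
              \<phi> (glue_class len ((n, \<sigma>), w)) = m3 (if \<sigma> then w else - cnj w)"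
      if w: "w \<in> half_pants len n \<inter> emb n \<sigma> -` W1" for w
    proof -
      have wQ: "emb n \<sigma> w \<in> W1 \<inter> Q" using w half_pants_iff[of w n \<sigma>] by auto
      have c: "glue_class len ((n, \<sigma>), w) = lift (m1 (emb n \<sigma> w))"
        using m1(4)[OF wQ] prj_emb[of w n \<sigma>] w by auto
      have I: "0 < Im (if \<sigma> then w else - cnj w)" "0 < Im (emb n \<sigma> w)"
        using w half_pants_Im[of w n] wQ Q_Im by auto
      have "m3 (if \<sigma> then w else - cnj w) = m (m1 (emb n \<sigma> w))"
        using m3(2)[OF I(1)] m2(2)[OF I(2)] by (simp only: emb_eq)
      moreover have i: "m1 (emb n \<sigma> w) \<in> B" using m1(4)[OF wQ] by blast
      ultimately show ?thesis unfolding c \<phi>l[OF i] using imageI[OF i, of lift] by simp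
    qed
    then show ?thesis using m1(2,3) m3(1)
      by (intro exI[of _ "emb n \<sigma> -` W1"] exI[of _ m3]) (auto intro: open_vimage continuous_emb)
  qed
  have "open (m ` B)" by (rule iso_open_image[OF m B'(1) BH])
  moreover have "m ` B \<subseteq> uhp" using BH iso_Im[OF m] by auto
  ultimately show ?thesis
    unfolding flute_chart_def \<phi>_def[symmetric, abs_def] im
    using homeo loc B'(4)[OF B'(1) order_refl] by blast
qed

lemma chart_piece:
  assumes "flute_chart len U \<phi>" "z \<in> Q" "z \<in> block n \<sigma>" "prj z \<in> U"
  obtains m W where "hyp_isometry m" "open W" "z \<in> W"
    "\<And>y. y \<in> W \<Longrightarrow> y \<in> Q \<Longrightarrow> y \<in> block n \<sigma> \<Longrightarrow> prj y \<in> U \<and> \<phi> (prj y) = m y"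
proof -
  define w where "w = unemb n \<sigma> z"
  have w: "w \<in> half_pants len n" "glue_class len ((n, \<sigma>), w) \<in> U"
    using unemb_half_pants[OF assms(2,3)] prj_glue[OF assms(2,3)] assms(4) by (auto simp: w_def)
  obtain W m where W: "open W" "w \<in> W" "hyp_isometry m"
    "\<And>v. v \<in> half_pants len n \<Longrightarrow> v \<in> W \<Longrightarrow> glue_class len ((n, \<sigma>), v) \<in> U \<and>
              \<phi> (glue_class len ((n, \<sigma>), v)) = m (if \<sigma> then v else - cnj v)"
    using assms(1) w unfolding flute_chart_def by (metis IntI)
  obtain m2 where m2: "hyp_isometry m2" "\<And>v. 0 < Im v \<Longrightarrow> m2 v = m (v / of_real (scale n))"
    using iso_comp[OF iso_scale[OF scale_pos[of n]] W(3)] by auto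
  show ?thesis
  proof (rule that[of m2 "unemb n \<sigma> -` W"])
    show "open (unemb n \<sigma> -` W)" by (rule open_vimage[OF W(1) continuous_unemb])
    show "z \<in> unemb n \<sigma> -` W" using W(2) by (simp add: w_def)
    fix y assume y: "y \<in> unemb n \<sigma> -` W" "y \<in> Q" "y \<in> block n \<sigma>"
    define v where "v = unemb n \<sigma> y"
    have v: "v \<in> half_pants len n" "v \<in> W" using y unemb_half_pants by (auto simp: v_def)
    have "(if \<sigma> then v else - cnj v) = y / of_real (scale n)"
      by (auto simp: v_def unemb_def J_def)
    then show "prj y \<in> U \<and> \<phi> (prj y) = m2 y"
      using W(4)[OF v] prj_glue[OF y(2,3)] m2(2)[OF Q_Im[OF y(2)]] by (simp add: v_def)
  qed (fact m2(1))
qed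

lemma block_band: "z \<in> block n \<sigma> \<longleftrightarrow> z \<in> band n \<and> (if \<sigma> then 0 \<le> Re z else Re z \<le> 0)"
  by (auto simp: block_def band_def)

text \<open>A chart provides one isometry per polygon. Off the axis and the sides a band contains
  one polygon locally; on the axis the two halves agree along the axis, and on a side they agree
  along the side after one of them is composed with \<open>mv j\<close>. Fixing the band postpones
  the crossing of circles.\<close>

lemma chart_sheet:
  assumes c: "flute_chart len U \<phi>" and p: "p \<in> Q" "p \<in> band n" "prj p \<in> U"
  shows "\<exists>m W. hyp_isometry m \<and> open W \<and> p \<in> W \<and> W \<subseteq> dom \<and>
     (\<forall>y\<in>W. unf y \<in> band n \<longrightarrow> lift y \<in> U \<and> \<phi> (lift y) = m y)"
proof (cases "on_side p")
  case False
  then have pQ: "p \<in> Qo" using p by (simp add: Qo_def)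
  show ?thesis
  proof (cases "Re p = 0")
    case r: False
    define \<sigma> where "\<sigma> = (0 < Re p)"
    have "p \<in> block n \<sigma>" using p by (auto simp: block_band \<sigma>_def)
    from chart_piece[OF c p(1) this p(3)] obtain m W where W: "hyp_isometry m" "open W" "p \<in> W"
      "\<And>y. y \<in> W \<Longrightarrow> y \<in> Q \<Longrightarrow> y \<in> block n \<sigma> \<Longrightarrow> prj y \<in> U \<and> \<phi> (prj y) = m y" by metis
    have "open {y. 0 < Re y * Re p}" by (intro open_Collect_less continuous_intros)
    then show ?thesis using W pQ open_Qo r
      by (intro exI[of _ m] exI[of _ "W \<inter> Qo \<inter> {y. 0 < Re y * Re p}"])
        (auto simp: block_band lift_Q unf_Q Qo_Q Q_dom \<sigma>_def zero_less_mult_iff not_less)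
  next
    case r: True
    have "p \<in> block n True" "p \<in> block n False" using p r by (auto simp: block_band)
    from chart_piece[OF c p(1) this(1) p(3)] chart_piece[OF c p(1) this(2) p(3)]
    obtain m1 W1 m2 W2 where W: "hyp_isometry m1" "open W1" "p \<in> W1"
      "\<And>y. y \<in> W1 \<Longrightarrow> y \<in> Q \<Longrightarrow> y \<in> block n True \<Longrightarrow> prj y \<in> U \<and> \<phi> (prj y) = m1 y"
      "hyp_isometry m2" "open W2" "p \<in> W2"
      "\<And>y. y \<in> W2 \<Longrightarrow> y \<in> Q \<Longrightarrow> y \<in> block n False \<Longrightarrow> prj y \<in> U \<and> \<phi> (prj y) = m2 y" by metis
    define W where "W = W1 \<inter> W2 \<inter> Qo"
    have Wo: "open W" "p \<in> W" using W pQ open_Qo by (auto simp: W_def)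
    have eq: "m1 z = m2 z" if "0 < Im z" for z
    proof (rule iso_eqI[OF W(1,5) axis_acc[OF r p(2) Q_Im[OF p(1)] Wo] _ _ that])
      show "m1 y = m2 y" if "y \<in> W \<inter> uhp \<inter> band n \<inter> {y. Re y = 0}" for y
        using that W(4)[of y] W(8)[of y] Qo_Q[of y] by (auto simp: W_def block_band)
    qed auto
    show ?thesis
    proof (intro exI conjI ballI impI)
      fix y assume y: "y \<in> W" "unf y \<in> band n"
      then have yQ: "y \<in> Q" "y \<in> band n" "lift y = prj y" by (auto simp: W_def Qo_Q unf_Q lift_Q)
      show "lift y \<in> U" "\<phi> (lift y) = m1 y"
        using W(4)[of y] W(8)[of y] y yQ eq[OF Q_Im[OF yQ(1)]]
        by (cases "0 \<le> Re y"; auto simp: W_def block_band)+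
    qed (use W(1) Wo Q_dom Qo_Q in \<open>auto simp: W_def\<close>)
  qed
next
  case True
  then obtain j where j: "cmod (p - of_real (cen j)) = rad j" by (auto simp: on_side_def)
  obtain V where V: "open V" "p \<in> V" "V \<subseteq> uhp"
    "\<And>y. y \<in> V \<Longrightarrow> 0 < sg j * Re y"
    "\<And>y. y \<in> V \<Longrightarrow> rad j \<le> cmod (y - of_real (cen j)) \<Longrightarrow> y \<in> Q"
    "\<And>y. y \<in> V \<Longrightarrow> rad j < cmod (y - of_real (cen j)) \<Longrightarrow> y \<in> Qo"
    "\<And>y. y \<in> V \<Longrightarrow> y \<in> ins j \<Longrightarrow> mv j y \<in> Qo"
    "\<And>y. y \<in> V \<Longrightarrow> sg j * Re (mv j y) < 0"
    using nbhd_side[OF p(1) j] by blast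
  define \<sigma> where "\<sigma> = snd j"
  have b: "y \<in> block n \<sigma> \<longleftrightarrow> y \<in> band n" if "0 < sg j * Re y" for y
    using that by (auto simp: sg_def \<sigma>_def block_band split: if_splits)
  have b': "y \<in> block n (\<not> \<sigma>) \<longleftrightarrow> y \<in> band n" if "sg j * Re y < 0" for y
    using that by (auto simp: sg_def \<sigma>_def block_band split: if_splits)
  have JQ: "J p \<in> Q" "J p \<in> band n" "prj (J p) \<in> U" using p True by (auto simp: band_def prj_J)
  have Jp: "mv j p = J p" by (rule mv_side[OF Q_Im[OF p(1)] j])
  have "p \<in> block n \<sigma>" "J p \<in> block n (\<not> \<sigma>)"
    using b[OF V(4)[OF V(2)]] b'[OF V(8)[OF V(2)]] p JQ Jp by auto
  from chart_piece[OF c p(1) this(1) p(3)] chart_piece[OF c JQ(1) this(2) JQ(3)]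
  obtain m1 W1 m2 W2 where W: "hyp_isometry m1" "open W1" "p \<in> W1"
      "\<And>y. y \<in> W1 \<Longrightarrow> y \<in> Q \<Longrightarrow> y \<in> block n \<sigma> \<Longrightarrow> prj y \<in> U \<and> \<phi> (prj y) = m1 y"
      "hyp_isometry m2" "open W2" "J p \<in> W2"
      "\<And>y. y \<in> W2 \<Longrightarrow> y \<in> Q \<Longrightarrow> y \<in> block n (\<not> \<sigma>) \<Longrightarrow> prj y \<in> U \<and> \<phi> (prj y) = m2 y" by metis
  obtain m3 where m3: "hyp_isometry m3" "\<And>v. 0 < Im v \<Longrightarrow> m3 v = m2 (mv j v)"
    using iso_comp[OF iso_mv[of j] W(5)] by auto
  define W where "W = V \<inter> W1 \<inter> {y. 0 < Im y \<and> mv j y \<in> W2}"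
  have Wo: "open W" unfolding W_def by (intro open_Int V(1) W(2) iso_open_preimage iso_mv W(6))
  have pW: "p \<in> W" using V(2) W(3,7) Jp Q_Im[OF p(1)] by (simp add: W_def)
  have eq: "m1 z = m3 z" if "0 < Im z" for z
  proof (rule iso_eqI[OF W(1) m3(1) side_acc[OF p(1) j p(2) Wo pW] _ _ that])
    fix y assume y: "y \<in> W \<inter> uhp \<inter> band n \<inter> {y. cmod (y - of_real (cen j)) = rad j}"
    then have yy: "y \<in> V" "0 < Im y" "y \<in> band n" "cmod (y - of_real (cen j)) = rad j" "y \<in> W1" "mv j y \<in> W2"
      by (auto simp: W_def)
    have yQ: "y \<in> Q" using V(5)[OF yy(1)] yy(4) by simp
    have mJ: "mv j y = J y" by (rule mv_side[OF yy(2,4)])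
    have "on_side y" using yy(4) unfolding on_side_def by (rule exI)
    then have "prj (mv j y) = prj y" using prj_J[OF yQ] mJ by simp
    moreover have "\<phi> (prj y) = m1 y" using W(4)[OF yy(5) yQ] b[OF V(4)[OF yy(1)]] yy(3) by simp
    moreover have "mv j y \<in> block n (\<not> \<sigma>)" using b'[OF V(8)[OF yy(1)]] mJ yy(3) by (simp add: band_def)
    then have "\<phi> (prj (mv j y)) = m2 (mv j y)" using W(8)[OF yy(6)] yQ mJ by simp
    ultimately show "m1 y = m3 y" using m3(2)[OF yy(2)] by simp
  qed auto
  have main: "y \<in> dom \<and> (unf y \<in> band n \<longrightarrow> lift y \<in> U \<and> \<phi> (lift y) = m1 y)" if y: "y \<in> W" for y
  proof -
    have yy: "y \<in> V" "0 < Im y" "y \<in> W1" "mv j y \<in> W2" using y by (auto simp: W_def)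
    show ?thesis
    proof (cases "y \<in> ins j")
      case True
      have Qy: "mv j y \<in> Q" using V(7)[OF yy(1) True] Qo_Q by blast
      have u: "unf y = mv j y" "lift y = prj (mv j y)" using True by (auto simp: unf_ins lift_def)
      show ?thesis using W(8)[OF yy(4) Qy] b'[OF V(8)[OF yy(1)]] Qy yy(2) m3(2)[OF yy(2)] eq[OF yy(2)]
        by (simp add: dom_def u)
    next
      case False
      then have Qy: "y \<in> Q" using V(5)[OF yy(1)] yy(2) by (auto simp: ins_def)
      show ?thesis using W(4)[OF yy(3) Qy] b[OF V(4)[OF yy(1)]] Qy by (simp add: Q_dom unf_Q lift_Q)
    qed
  qed
  show ?thesis using W(1) Wo pW main by (intro exI[of _ m1] exI[of _ W]) auto
qed

lemma unf_cmod_near: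
  assumes p: "p \<in> Q" "a < cmod p" "cmod p < b"
  shows "\<exists>W. open W \<and> p \<in> W \<and> (\<forall>y\<in>W. y \<in> dom \<and> a < cmod (unf y) \<and> cmod (unf y) < b)"
proof -
  have oA: "open {y::complex. a < cmod y \<and> cmod y < b}"
    by (intro open_Collect_conj open_Collect_less continuous_intros)
  show ?thesis
  proof (cases "on_side p")
    case False
    then show ?thesis using p oA open_Qo
      by (intro exI[of _ "Qo \<inter> {y. a < cmod y \<and> cmod y < b}"]) (auto simp: Qo_Q Q_dom unf_Q, auto simp: Qo_def)
  next
    case True
    then obtain j where j: "cmod (p - of_real (cen j)) = rad j" by (auto simp: on_side_def)
    obtain V where V: "open V" "p \<in> V" "V \<subseteq> uhp"
      "\<And>y. y \<in> V \<Longrightarrow> rad j \<le> cmod (y - of_real (cen j)) \<Longrightarrow> y \<in> Q"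
      "\<And>y. y \<in> V \<Longrightarrow> y \<in> ins j \<Longrightarrow> mv j y \<in> Qo"
      using nbhd_side[OF p(1) j] by metis
    define W where "W = V \<inter> {y. a < cmod y \<and> cmod y < b} \<inter> {y. 0 < Im y \<and> mv j y \<in> {y. a < cmod y \<and> cmod y < b}}"
    have "open W" unfolding W_def by (intro open_Int V(1) oA iso_open_preimage iso_mv)
    moreover have "p \<in> W" using V(2) p Q_Im[OF p(1)] mv_side[OF Q_Im[OF p(1)] j] by (simp add: W_def)
    moreover have "y \<in> dom \<and> a < cmod (unf y) \<and> cmod (unf y) < b" if y: "y \<in> W" for y
    proof (cases "y \<in> ins j")
      case True
      then show ?thesis using y V(5)[of y] Qo_Q by (auto simp: W_def dom_def unf_ins)
    next
      case False
      then have "y \<in> Q" using V(3) V(4)[of y] y by (auto simp: W_def ins_def)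
      then show ?thesis using y by (auto simp: W_def Q_dom unf_Q)
    qed
    ultimately show ?thesis by blast
  qed
qed

text \<open>A point on the outer circle of its band also belongs to the next band, and the two
  isometries agree along that circle. Hence every chart is locally an isometry after a local inverse
  of \<open>lift\<close>.\<close>

theorem chart_local:
  assumes c: "flute_chart len U \<phi>" and p: "p \<in> Q" "prj p \<in> U"
  obtains m W where "hyp_isometry m" "open W" "p \<in> W" "W \<subseteq> dom"
    "\<And>y. y \<in> W \<Longrightarrow> lift y \<in> U \<and> \<phi> (lift y) = m y"
proof -
  define n where "n = (LEAST n. cmod p \<le> level (Suc n))"
  have bn: "p \<in> band n" using Q_block[OF p(1)] by (simp add: block_band n_def)
  from chart_sheet[OF c p(1) bn p(2)] obtain m W where W: "hyp_isometry m" "open W" "p \<in> W" "W \<subseteq> dom"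
    "\<And>y. y \<in> W \<Longrightarrow> unf y \<in> band n \<Longrightarrow> lift y \<in> U \<and> \<phi> (lift y) = m y" by blast
  have lo: "n = 0 \<or> level n < cmod p"
  proof (cases n)
    case (Suc i)
    then have "\<not> cmod p \<le> level (Suc i)" unfolding n_def by (metis lessI not_less_Least)
    then show ?thesis using Suc by simp
  qed simp
  \<comment> \<open>A strict lower bound for |p| that still forces membership in the band; on the
    innermost band, where \<open>level 0\<close> is 0, any negative number does.\<close>
  define a where "a = (if n = 0 then -1 else level n)"
  have a: "a < cmod p" using lo norm_ge_zero[of p] by (auto simp: a_def simp del: norm_ge_zero intro: less_le_trans[of _ 0])
  have la: "a < r \<Longrightarrow> 0 \<le> r \<Longrightarrow> level n \<le> r" for r by (auto simp: a_def split: if_splits)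
  show ?thesis
  proof (cases "cmod p < level (Suc n)")
    case True
    from unf_cmod_near[OF p(1) a True] obtain W' where W': "open W'" "p \<in> W'"
      "\<And>y. y \<in> W' \<Longrightarrow> a < cmod (unf y) \<and> cmod (unf y) < level (Suc n)" by blast
    show ?thesis
    proof (rule that[of m "W \<inter> W'"])
      fix y assume y: "y \<in> W \<inter> W'"
      then have "unf y \<in> band n" using W'(3)[of y] la[of "cmod (unf y)"] by (simp add: band_def)
      then show "lift y \<in> U \<and> \<phi> (lift y) = m y" using W(5) y by blast
    qed (use W W' in auto)
  next
    case False
    then have pl: "cmod p = level (Suc n)" using bn by (simp add: band_def)
    have bn': "p \<in> band (Suc n)" using pl level_less_Suc[of "Suc n"] by (simp add: band_def)
    from chart_sheet[OF c p(1) bn' p(2)] obtain m2 W2 where W2: "hyp_isometry m2" "open W2" "p \<in> W2" "W2 \<subseteq> dom"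
      "\<And>y. y \<in> W2 \<Longrightarrow> unf y \<in> band (Suc n) \<Longrightarrow> lift y \<in> U \<and> \<phi> (lift y) = m2 y" by blast
    have b: "cmod p < level (Suc (Suc n))" using pl level_less_Suc[of "Suc n"] by simp
    from unf_cmod_near[OF p(1) a b] obtain W' where W': "open W'" "p \<in> W'"
      "\<And>y. y \<in> W' \<Longrightarrow> a < cmod (unf y) \<and> cmod (unf y) < level (Suc (Suc n))" by blast
    have WW: "open (W \<inter> W2)" "p \<in> W \<inter> W2" using W W2 by auto
    have eq: "m z = m2 z" if "0 < Im z" for z
    proof (rule iso_eqI[OF W(1) W2(1) radial_acc[OF p(1) WW] _ _ that])
      fix y assume y: "y \<in> W \<inter> W2 \<inter> Q \<inter> {y. cmod y = cmod p}"
      then have "unf y = y" by (auto simp: unf_Q)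
      then have "unf y \<in> band n" "unf y \<in> band (Suc n)" using y pl level_less_Suc[of n] level_less_Suc[of "Suc n"]
        by (auto simp: band_def)
      then show "m y = m2 y" using W(5)[of y] W2(5)[of y] y by auto
    qed (auto dest: Q_Im)
    show ?thesis
    proof (rule that[of m "W \<inter> W2 \<inter> W'"])
      fix y assume y: "y \<in> W \<inter> W2 \<inter> W'"
      then have "unf y \<in> band n \<or> unf y \<in> band (Suc n)"
        using W'(3)[of y] la[of "cmod (unf y)"] by (auto simp: band_def)
      moreover have "0 < Im y" using y W(4) by (auto simp: dom_def)
      ultimately show "lift y \<in> U \<and> \<phi> (lift y) = m y" using W(5)[of y] W2(5)[of y] y eq[of y] by auto
    qed (use W W2 W' in auto)
  qed
qed

end

section \<open>The Riemann surface\<close>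

context flute_seq begin

lemma surf_simps [simp]: "surf_top (associated_surface x) = S"
  "surf_charts (associated_surface x) = {(U, \<phi>). flute_chart len U \<phi>}"
  by (simp_all add: associated_surface_def zero_twist_flute_def)

lemma continuous_prj: "continuous_map (top_of_set Q) S prj"
  unfolding continuous_map_def topspace_flute by (auto simp: openin_flute)

lemma axis_Qo: assumes "Re z = 0" "z \<in> reg" shows "z \<in> Qo"
proof -
  have I: "0 < Im z" using assms(2) by (simp add: reg_def)
  have "rad j < cmod (z - of_real (cen j))" for j
  proof (rule ccontr)
    assume "\<not> ?thesis"
    then have "node (fst j) < (if snd j then 1 else -1) * Re z" using side_strip(1)[of z j] I by simp
    then have "node (fst j) < 0" using assms(1) by simp
    then show False using node_nonneg[of "fst j"] by linarith
  qed
  then show ?thesis using assms by (simp add: Qo_altdef)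
qed

lemma axis_point: "\<i> * of_real (node 1 / 2) \<in> Qo"
proof (rule axis_Qo)
  have "0 < node 1" "node 1 / 2 < node 1" using node_Suc_pos[of 0] by simp_all
  then show "\<i> * of_real (node 1 / 2) \<in> reg" unfolding reg_def
    by (auto simp: norm_mult intro!: exI[of _ 1] simp del: of_real_divide)
qed simp

definition foldp :: "complex \<Rightarrow> complex" where "foldp z = Complex \<bar>Re z\<bar> (Im z)"
text \<open>By \<open>prj_eq_iff\<close> two representatives differ at most by \<open>J\<close>,
  which \<open>foldp\<close> absorbs, so the choice does not matter. The result is a continuous
  function on the surface that separates points up to the reflection.\<close>

definition height :: "flute_piece_point set \<Rightarrow> complex" where
  "height q = foldp (SOME z. z \<in> Q \<and> prj z = q)"

lemma foldp_eq: "foldp z = foldp w \<longleftrightarrow> w = z \<or> w = J z"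
  by (auto simp: foldp_def complex_eq_iff abs_eq_iff)

lemma height_prj: assumes "z \<in> Q" shows "height (prj z) = foldp z"
proof -
  define w where "w = (SOME w. w \<in> Q \<and> prj w = prj z)"
  have w: "w \<in> Q" "prj w = prj z" using someI[of "\<lambda>w. w \<in> Q \<and> prj w = prj z" z] assms by (auto simp: w_def)
  then have "foldp w = foldp z" using prj_eq_iff[OF w(1) assms] foldp_eq[of w z] by auto
  then show ?thesis by (simp add: height_def w_def)
qed

lemma continuous_height: "continuous_map S euclidean height"
  unfolding continuous_map_def
proof (intro conjI allI impI)
  fix T :: "complex set" assume "openin euclidean T"
  then have T: "open T" by simp
  have "continuous_on UNIV foldp" unfolding foldp_def Complex_eq by (intro continuous_intros)
  then have "open (foldp -` T)" using T open_vimage by blast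
  moreover have "{z \<in> Q. prj z \<in> {q \<in> topspace S. height q \<in> T}} = Q \<inter> foldp -` T"
    by (auto simp: topspace_flute height_prj)
  ultimately show "openin S {q \<in> topspace S. height q \<in> T}"
    unfolding openin_flute topspace_flute[symmetric] by (auto simp: openin_open)
qed simp

text \<open>\<open>height\<close> separates everything but mirror images. Distinct mirror images lie
  off the axis and off the sides, and are separated by the left and right halves of
  \<open>Qo\<close>.\<close>

lemma Hausdorff_S: "Hausdorff_space S"
  unfolding Hausdorff_space_def
proof (intro allI impI)
  fix p q assume pq: "p \<in> topspace S \<and> q \<in> topspace S \<and> p \<noteq> q"
  then obtain z w where z: "z \<in> Q" "p = prj z" and w: "w \<in> Q" "q = prj w" by (auto simp: topspace_flute)
  show "\<exists>U V. openin S U \<and> openin S V \<and> p \<in> U \<and> q \<in> V \<and> disjnt U V"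
  proof (cases "height p = height q")
    case False
    then obtain U V where UV: "open U" "open V" "height p \<in> U" "height q \<in> V" "U \<inter> V = {}"
      using hausdorff[OF False] by blast
    have "openin S {r \<in> topspace S. height r \<in> U}" "openin S {r \<in> topspace S. height r \<in> V}"
      using continuous_height UV(1,2) by (auto simp: continuous_map_def)
    then show ?thesis using UV pq
      by (intro exI[of _ "{r \<in> topspace S. height r \<in> U}"] exI[of _ "{r \<in> topspace S. height r \<in> V}"])
        (auto simp: disjnt_def)
  next
    case True
    then have w': "w = J z" using z w pq by (auto simp: height_prj foldp_eq)
    have r: "Re z \<noteq> 0" using w' z w pq J_id[of z] by auto
    have "\<not> on_side z" using w' z w pq prj_J[of z] by auto
    then have zo: "z \<in> Qo" using z by (simp add: Qo_def)
    define B1 where "B1 = Qo \<inter> {y. 0 < Re y * Re z}"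
    define B2 where "B2 = Qo \<inter> {y. Re y * Re z < 0}"
    have "open B1" "open B2" unfolding B1_def B2_def
      by (intro open_Int open_Qo open_Collect_less continuous_intros)+
    then have "openin S (prj ` B1)" "openin S (prj ` B2)"
      by (auto intro!: openin_prj_Qo simp: B1_def B2_def)
    moreover have "disjnt (prj ` B1) (prj ` B2)"
    proof -
      have "prj a \<noteq> prj b" if "a \<in> B1" "b \<in> B2" for a b
      proof
        assume "prj a = prj b"
        then have "a = b" using that prj_eq_iff[of a b] by (auto simp: B1_def B2_def Qo_def)
        then show False using that by (auto simp: B1_def B2_def)
      qed
      then show ?thesis by (force simp: disjnt_def)
    qed
    moreover have "p \<in> prj ` B1" "q \<in> prj ` B2"
      using zo z w w' r by (auto simp: B1_def B2_def zero_less_mult_iff mult_less_0_iff linorder_neq_iff intro!: imageI)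
    ultimately show ?thesis by blast
  qed
qed

lemma chart_inj: "flute_chart len U \<phi> \<Longrightarrow> inj_on \<phi> U"
  unfolding flute_chart_def using openin_subset
  by (metis homeomorphic_imp_injective_map topspace_subtopology_subset)

lemma chart_inv: "flute_chart len U \<phi> \<Longrightarrow> q \<in> U \<Longrightarrow> the_inv_into U \<phi> (\<phi> q) = q"
  by (rule the_inv_into_f_f[OF chart_inj])

lemma chart_subset: "flute_chart len U \<phi> \<Longrightarrow> U \<subseteq> prj ` Q"
  unfolding flute_chart_def using openin_subset topspace_flute by metis

lemma chart_local_inv:
  assumes c: "flute_chart len U \<phi>" and p: "p \<in> Q" "prj p \<in> U"
  obtains g W where "hyp_isometry g" "open W" "\<phi> (prj p) \<in> W" "W \<subseteq> uhp" "g (\<phi> (prj p)) = p"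
    "\<And>w. w \<in> W \<Longrightarrow> w \<in> \<phi> ` U \<and> g w \<in> dom \<and> the_inv_into U \<phi> w = lift (g w)"
proof -
  obtain m W where W: "hyp_isometry m" "open W" "p \<in> W" "W \<subseteq> dom"
    "\<And>y. y \<in> W \<Longrightarrow> lift y \<in> U \<and> \<phi> (lift y) = m y" using chart_local[OF c p] by metis
  obtain g where g: "hyp_isometry g" "\<And>z. 0 < Im z \<Longrightarrow> g (m z) = z" using iso_inv[OF W(1)] by metis
  have WH: "W \<subseteq> uhp" using W(4) by (auto simp: dom_def)
  have mp: "\<phi> (prj p) = m p" using W(5)[OF W(3)] lift_Q[OF p(1)] by simp
  show ?thesis
  proof (rule that[of g "m ` W"])
    show "open (m ` W)" by (rule iso_open_image[OF W(1,2) WH])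
    show "m ` W \<subseteq> uhp" using WH iso_Im[OF W(1)] by auto
    show "\<phi> (prj p) \<in> m ` W" "g (\<phi> (prj p)) = p" using mp W(3) g(2)[OF Q_Im[OF p(1)]] by auto
    fix w assume "w \<in> m ` W"
    then obtain y where y: "y \<in> W" "w = m y" by auto
    then have "g w = y" using g(2)[of y] WH by blast
    moreover have "\<phi> (lift y) = w" "lift y \<in> U" using W(5)[OF y(1)] y by auto
    ultimately show "w \<in> \<phi> ` U \<and> g w \<in> dom \<and> the_inv_into U \<phi> w = lift (g w)"
      using W(4) y chart_inv[OF c, of "lift y"] imageI[of "lift y" U \<phi>] by auto
  qed (fact g(1))
qed

text \<open>Locally the transition is an isometry after an isometry, by
  \<open>chart_local_inv\<close> and \<open>chart_local\<close>.\<close>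

lemma transition_holomorphic:
  assumes c: "flute_chart len U \<phi>" and d: "flute_chart len V \<psi>"
  shows "(\<psi> \<circ> the_inv_into U \<phi>) holomorphic_on (\<phi> ` (U \<inter> V))"
  unfolding holomorphic_on_def
proof (rule ballI)
  fix w assume "w \<in> \<phi> ` (U \<inter> V)"
  then obtain q where q: "q \<in> U" "q \<in> V" "w = \<phi> q" by auto
  then obtain p where p: "p \<in> Q" "q = prj p" using chart_subset[OF c] by blast
  obtain g W where W: "hyp_isometry g" "open W" "\<phi> (prj p) \<in> W" "W \<subseteq> uhp" "g (\<phi> (prj p)) = p"
    "\<And>w. w \<in> W \<Longrightarrow> w \<in> \<phi> ` U \<and> g w \<in> dom \<and> the_inv_into U \<phi> w = lift (g w)"
    using chart_local_inv[OF c p(1)] q p by metis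
  obtain m T where T: "hyp_isometry m" "open T" "p \<in> T"
    "\<And>y. y \<in> T \<Longrightarrow> lift y \<in> V \<and> \<psi> (lift y) = m y" using chart_local[OF d p(1)] q p by metis
  define R where "R = W \<inter> {w. 0 < Im w \<and> g w \<in> T}"
  have R: "open R" "w \<in> R" "R \<subseteq> uhp"
    unfolding R_def using W T q p iso_open_preimage[OF W(1) T(2)] by auto
  obtain k where k: "hyp_isometry k" "\<And>v. 0 < Im v \<Longrightarrow> k v = m (g v)" using iso_comp[OF W(1) T(1)] by auto
  have "k holomorphic_on R" using iso_holomorphic[OF k(1)] R(3) holomorphic_on_subset by blast
  moreover have "k v = (\<psi> \<circ> the_inv_into U \<phi>) v" if "v \<in> R" for v
    using that W(6)[of v] T(4)[of "g v"] k(2)[of v] by (auto simp: R_def)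
  ultimately have "(\<psi> \<circ> the_inv_into U \<phi>) holomorphic_on R" by (rule holomorphic_transform)
  then have "(\<psi> \<circ> the_inv_into U \<phi>) field_differentiable (at w)"
    using R(1,2) holomorphic_on_imp_differentiable_at by blast
  then show "(\<psi> \<circ> the_inv_into U \<phi>) field_differentiable (at w within \<phi> ` (U \<inter> V))"
    by (rule field_differentiable_at_within)
qed

text \<open>One argument for \<open>Q\<close> and \<open>Qo\<close>, with \<le> and < for P. Moving
  straight up increases the distance to every real centre; at a height \<open>node n\<close> above
  |z| a horizontal segment leads to the imaginary axis, which meets no side.\<close>

lemma connected_outside:
  assumes unb: "\<And>r. \<exists>n. r < node n"
    and P: "\<And>a b c. P a b \<Longrightarrow> b \<le> c \<Longrightarrow> P a c" "\<And>a b. a < b \<Longrightarrow> P a b"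
  shows "connected {z \<in> reg. \<forall>j. P (rad j) (cmod (z - of_real (cen j)))}"
proof -
  define X where "X = {z \<in> reg. \<forall>j. P (rad j) (cmod (z - of_real (cen j)))}"
  define A where "A = {z. Re z = 0} \<inter> uhp"
  have AQ: "A \<subseteq> X"
  proof
    fix z assume "z \<in> A"
    then have "z \<in> Qo" using axis_Qo[of z] unb by (simp add: A_def reg_def)
    then show "z \<in> X" using P(2) by (simp add: X_def Qo_altdef)
  qed
  have "A = (\<lambda>t. \<i> * of_real t) ` {0<..}"
    by (auto simp: A_def complex_eq_iff image_iff)
  then have cA: "connected A"
    by (simp only:) (intro connected_continuous_image continuous_intros connected_Ioi)
  have "\<exists>T. connected T \<and> z \<in> T \<and> A \<subseteq> T \<and> T \<subseteq> X" if z: "z \<in> X" for z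
  proof -
    obtain n where n: "cmod z < node n" using z by (auto simp: X_def reg_def)
    have Iz: "0 < Im z" using z by (simp add: X_def reg_def)
    have le: "\<bar>Re z\<bar> < node n" "Im z < node n" using n abs_Re_le_cmod[of z] abs_Im_le_cmod[of z] by linarith+
    define a where "a = Complex (Re z) (node n)"
    define b where "b = Complex 0 (node n)"
    have s1: "closed_segment z a \<subseteq> X"
    proof
      fix w assume "w \<in> closed_segment z a"
      then obtain t where t: "0 \<le> t" "t \<le> 1" "w = (1 - t) *\<^sub>R z + t *\<^sub>R a" by (auto simp: in_segment)
      have R: "Re w = Re z" by (simp add: t(3) a_def algebra_simps)
      have "Im w - Im z = t * (node n - Im z)" by (simp add: t(3) a_def algebra_simps)
      moreover have "0 \<le> t * (node n - Im z)" using t(1) le by simp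
      ultimately have I: "Im z \<le> Im w" by linarith
      have "P (rad j) (cmod (w - of_real (cen j)))" for j
      proof -
        have "(cmod (z - of_real (cen j)))\<^sup>2 \<le> (cmod (w - of_real (cen j)))\<^sup>2"
          unfolding cmod_power2 using R I Iz by (simp add: power_mono)
        then have "cmod (z - of_real (cen j)) \<le> cmod (w - of_real (cen j))" by (rule power2_le_imp_le) simp
        then show ?thesis using z P(1) unfolding X_def by blast
      qed
      then show "w \<in> X" using I Iz unb by (simp add: X_def reg_def)
    qed
    have s2: "closed_segment a b \<subseteq> X"
    proof
      fix w assume "w \<in> closed_segment a b"
      then obtain t where t: "0 \<le> t" "t \<le> 1" "w = (1 - t) *\<^sub>R a + t *\<^sub>R b" by (auto simp: in_segment)
      have I: "Im w = node n" by (simp add: t(3) a_def b_def algebra_simps)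
      have np: "0 < node n" using le by linarith
      have "\<bar>Re w\<bar> = (1 - t) * \<bar>Re z\<bar>" using t by (simp add: a_def b_def abs_mult)
      also have "\<dots> \<le> 1 * \<bar>Re z\<bar>" using t by (intro mult_right_mono) auto
      finally have R: "\<bar>Re w\<bar> < node n" using le by simp
      \<comment> \<open>A half disc over an interval below \<open>node n\<close> has radius less
        than \<open>node n\<close>, so it stays below the segment.\<close>
      have "rad j < cmod (w - of_real (cen j))" for j
      proof (rule ccontr)
        assume c: "\<not> ?thesis"
        then have "node (fst j) < (if snd j then 1 else -1) * Re w" using side_strip(1)[of w j] I np by simp
        then have "node (fst j) < node n" using R by (auto split: if_splits)
        then have "fst j < n" using node_mono[of n "fst j"] by (meson not_less)
        then have "node (Suc (fst j)) \<le> node n" by (intro node_mono) simp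
        moreover have "rad j < node (Suc (fst j))" using node_nonneg[of "fst j"] x_pos[of "fst j"]
          by (simp add: rad_def node_Suc del: node_nonneg)
        moreover have "node n \<le> cmod (w - of_real (cen j))" using abs_Im_le_cmod[of "w - of_real (cen j)"] I np by simp
        ultimately show False using c by linarith
      qed
      then show "w \<in> X" using I np unb P(2) by (simp add: X_def reg_def)
    qed
    have bA: "b \<in> A" using le Iz by (simp add: A_def b_def)
    have "connected (closed_segment a b \<union> A)" by (rule connected_Un) (use cA bA in auto)
    then have "connected (closed_segment z a \<union> (closed_segment a b \<union> A))"
      by (rule connected_Un[rotated]) auto
    then show ?thesis using s1 s2 AQ by (intro exI[of _ "closed_segment z a \<union> (closed_segment a b \<union> A)"]) auto
  qed
  then obtain T where T: "\<And>z. z \<in> X \<Longrightarrow> connected (T z) \<and> z \<in> T z \<and> A \<subseteq> T z \<and> T z \<subseteq> X" by metis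
  have "\<i> \<in> A" by (simp add: A_def)
  then have "\<i> \<in> (\<Inter>z\<in>X. T z)" using T by blast
  then have "(\<Inter>z\<in>X. T z) \<noteq> {}" by blast
  then have "connected (\<Union>z\<in>X. T z)" using T by (intro connected_Union) auto
  moreover have "(\<Union>z\<in>X. T z) = X" using T by blast
  ultimately show ?thesis unfolding X_def by simp
qed

lemma connected_Q: "(\<And>r. \<exists>n. r < node n) \<Longrightarrow> connected Q"
  using connected_outside[of "(\<le>)"] unfolding Q_def by simp

lemma connected_Qo: "(\<And>r. \<exists>n. r < node n) \<Longrightarrow> connected Qo"
  using connected_outside[of "(<)"] unfolding Qo_altdef by simp

lemma connected_S:
  assumes "\<And>r. \<exists>n. r < node n" shows "connected_space S"
proof -
  have "connectedin (top_of_set Q) Q" using connected_Q[OF assms] by (simp add: connectedin_subtopology)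
  then have "connectedin S (prj ` Q)" using connectedin_continuous_map_image[OF continuous_prj] by blast
  then show ?thesis by (simp add: connectedin_topspace flip: topspace_flute)
qed

lemma noncompact_S:
  assumes unb: "\<And>r. \<exists>n. r < node n" shows "\<not> compact_space S"
proof
  assume "compact_space S"
  then have "compactin euclidean (height ` topspace S)"
    using image_compactin[OF _ continuous_height] by (simp add: compact_space_def)
  then have "bounded (height ` topspace S)" by (simp add: compact_imp_bounded)
  then obtain B where B: "\<And>q. q \<in> topspace S \<Longrightarrow> cmod (height q) \<le> B" by (auto simp: bounded_iff)
  define t where "t = \<bar>B\<bar> + 1"
  have zQ: "Complex 0 t \<in> Q" using axis_Qo[of "Complex 0 t"] Qo_Q unb by (auto simp: reg_def t_def)
  have "cmod (height (prj (Complex 0 t))) = t" using height_prj[OF zQ] by (simp add: foldp_def cmod_eq_Im t_def)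
  moreover have "cmod (height (prj (Complex 0 t))) \<le> B" using B zQ by (simp add: topspace_flute)
  ultimately show False by (simp add: t_def)
qed

lemma chart_openin: "flute_chart len U \<phi> \<Longrightarrow> openin S U"
  by (simp add: flute_chart_def)

theorem riemann_surface_S:
  assumes "\<And>r. \<exists>n. r < node n" shows "riemann_surface (associated_surface x)"
  unfolding riemann_surface_def surf_simps
proof (intro conjI)
  show "Hausdorff_space S" by (rule Hausdorff_S)
  show "connected_space S" by (rule connected_S[OF assms])
  show "topspace S \<noteq> {}" using axis_point Qo_Q by (auto simp: topspace_flute)
  show "\<Union> (fst ` {(U, \<phi>). flute_chart len U \<phi>}) = topspace S"
  proof (intro equalityI subsetI)
    fix q assume "q \<in> \<Union> (fst ` {(U, \<phi>). flute_chart len U \<phi>})"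
    then show "q \<in> topspace S" using chart_openin openin_subset by fastforce
  next
    fix q assume "q \<in> topspace S"
    then obtain p where p: "p \<in> Q" "q = prj p" by (auto simp: topspace_flute)
    obtain B where B: "chart_ball B" "p \<in> B" using chart_ball_exists[OF p(1)] by metis
    have "q \<in> lift ` B" using B(2) p lift_Q by force
    then show "q \<in> \<Union> (fst ` {(U, \<phi>). flute_chart len U \<phi>})"
      using chart_from_ball[OF B(1) iso_id] by force
  qed
  show "\<forall>(U, \<phi>)\<in>{(U, \<phi>). flute_chart len U \<phi>}. openin S U \<and> open (\<phi> ` U) \<and>
      homeomorphic_map (subtopology S U) (top_of_set (\<phi> ` U)) \<phi>"
    by (auto simp: flute_chart_def)
  show "\<forall>(U, \<phi>)\<in>{(U, \<phi>). flute_chart len U \<phi>}. \<forall>(V, \<psi>)\<in>{(U, \<phi>). flute_chart len U \<phi>}.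
      (\<psi> \<circ> the_inv_into U \<phi>) holomorphic_on \<phi> ` (U \<inter> V)"
    using transition_holomorphic by auto
qed

section \<open>Subharmonicity in isometric coordinates\<close>

lemma circle_mean_cong:
  assumes "\<And>t. f (a + of_real r * cis t) = g (a + of_real r * cis t)"
  shows "circle_mean f a r = circle_mean g a r"
  unfolding circle_mean_def assms ..

text \<open>The inverse of g after the inverse of \<open>lift\<close> is a chart in which the given
  disc is Euclidean, so the mean inequality holds for Euclidean discs moved into B by any
  isometry.\<close>

lemma subharmonic_lift:
  assumes u: "subharmonic (associated_surface x) u" and B: "chart_ball B" and g: "hyp_isometry g"
    and r: "0 < r" "cball a r \<subseteq> uhp" "g ` cball a r \<subseteq> B"
  shows "u (lift (g a)) \<le> circle_mean (\<lambda>w. u (lift (g w))) a r"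
proof -
  obtain m where m: "hyp_isometry m" "\<And>z. 0 < Im z \<Longrightarrow> m (g z) = z" "\<And>z. 0 < Im z \<Longrightarrow> g (m z) = z"
    using iso_inv[OF g] by metis
  define \<phi> where "\<phi> q = m (the_inv_into B lift q)" for q
  have inj: "inj_on lift B" and BH: "B \<subseteq> uhp" using B by (auto simp: chart_ball_def dom_def)
  have c: "flute_chart len (lift ` B) \<phi>" unfolding \<phi>_def by (rule chart_from_ball[OF B m(1)])
  have inv: "the_inv_into (lift ` B) \<phi> w = lift (g w) \<and> w \<in> \<phi> ` lift ` B" if w: "w \<in> cball a r" for w
  proof -
    have gw: "g w \<in> B" "0 < Im w" using w r by auto
    have "\<phi> (lift (g w)) = w" using the_inv_into_f_f[OF inj gw(1)] m(2)[OF gw(2)] by (simp add: \<phi>_def)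
    then show ?thesis using chart_inv[OF c, of "lift (g w)"] gw by force
  qed
  have "cball a r \<subseteq> \<phi> ` lift ` B" using inv by blast
  then have "u (the_inv_into (lift ` B) \<phi> a) \<le> circle_mean (u \<circ> the_inv_into (lift ` B) \<phi>) a r"
    using u c r(1) unfolding subharmonic_def surf_simps by blast
  also have "circle_mean (u \<circ> the_inv_into (lift ` B) \<phi>) a r = circle_mean (\<lambda>w. u (lift (g w))) a r"
  proof (rule circle_mean_cong)
    fix t
    have "a + of_real r * cis t \<in> cball a r" using r(1) by (simp add: dist_norm norm_mult)
    then show "(u \<circ> the_inv_into (lift ` B) \<phi>) (a + of_real r * cis t) = u (lift (g (a + of_real r * cis t)))"
      using inv by simp
  qed
  finally show ?thesis using inv[of a] r(1) by simp
qed

end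

section \<open>Mean values over circles\<close>

lemma integral_periodic_shift:
  fixes F :: "real \<Rightarrow> real"
  assumes F: "continuous_on UNIV F" "\<And>t. F (t + 2 * pi) = F t" and s: "0 \<le> s" "s \<le> 2 * pi"
  shows "integral {0..2 * pi} (\<lambda>t. F (t + s)) = integral {0..2 * pi} F"
proof -
  have int: "F integrable_on {a..b}" for a b
    using F(1) by (intro integrable_continuous_real) (auto intro: continuous_on_subset)
  have sh: "integral {a..b} (\<lambda>t. F (t + c)) = integral {a + c..b + c} F" for a b c
    using integral_shift[of a c b F] F(1) by (auto simp: o_def intro: continuous_on_subset)
  have "integral {0..2 * pi} (\<lambda>t. F (t + s)) = integral {s..2 * pi + s} F"
    using sh[of 0 "2 * pi" s] by simp
  also have "\<dots> = integral {s..2 * pi} F + integral {2 * pi..2 * pi + s} F"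
    using s int by (intro Henstock_Kurzweil_Integration.integral_combine[symmetric]) auto
  also have "integral {2 * pi..2 * pi + s} F = integral {0..s} (\<lambda>t. F (t + 2 * pi))"
    using sh[of 0 s "2 * pi"] by (simp add: add.commute)
  also have "\<dots> = integral {0..s} F" by (simp add: F(2))
  also have "integral {s..2 * pi} F + integral {0..s} F = integral {0..2 * pi} F"
    using s int Henstock_Kurzweil_Integration.integral_combine[of 0 s "2 * pi" F] by simp
  finally show ?thesis .
qed

definition circle_int :: "(complex \<Rightarrow> real) \<Rightarrow> complex \<Rightarrow> real \<Rightarrow> real" where
  "circle_int f a r = integral {0..2 * pi} (\<lambda>t. f (a + of_real r * cis t))"

lemma circle_point_in_cball: "0 \<le> r \<Longrightarrow> a + of_real r * cis t \<in> cball a r"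
  by (simp add: dist_norm norm_mult)

lemma circle_continuous:
  fixes f :: "complex \<Rightarrow> real"
  assumes "continuous_on (cball a r) f" "0 \<le> r"
  shows "continuous_on T (\<lambda>t. f (a + of_real r * cis t))"
  by (rule continuous_on_compose2[OF assms(1)]) (use assms(2) circle_point_in_cball in \<open>auto intro!: continuous_intros\<close>)

lemma circle_integrable:
  fixes f :: "complex \<Rightarrow> real"
  assumes "continuous_on (cball a r) f" "0 \<le> r"
  shows "(\<lambda>t. f (a + of_real r * cis t)) integrable_on {0..2 * pi}"
  by (rule integrable_continuous_real[OF circle_continuous[OF assms]])

lemma circle_int_mono:
  assumes "continuous_on (cball a r) f" "continuous_on (cball a r) g" "0 \<le> r" "\<And>z. z \<in> cball a r \<Longrightarrow> f z \<le> g z"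
  shows "circle_int f a r \<le> circle_int g a r"
  unfolding circle_int_def
  by (intro integral_le circle_integrable assms circle_point_in_cball)

lemma circle_int_holomorphic:
  assumes "h holomorphic_on cball a r" "0 < r"
  shows "circle_int (\<lambda>z. Im (h z)) a r = 2 * pi * Im (h a)"
proof -
  have "((\<lambda>u. h u / (u - a)) has_contour_integral (2 * of_real pi * \<i> * h a)) (circlepath a r)"
    using Cauchy_integral_circlepath_simple[OF assms(1), of a] assms(2) by simp
  then have "((\<lambda>t. h (a + of_real r * cis t) / (a + of_real r * cis t - a) * of_real r * \<i> * cis t)
      has_integral (2 * of_real pi * \<i> * h a)) {0..2 * pi}"
    unfolding circlepath_def by (subst (asm) has_contour_integral_part_circlepath_iff) (simp_all add: pi_gt_zero)
  moreover have "h (a + of_real r * cis t) / (a + of_real r * cis t - a) * of_real r * \<i> * cis t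
       = \<i> * h (a + of_real r * cis t)" for t
    using assms(2) by (simp add: field_simps)
  ultimately have "((\<lambda>t. \<i> * h (a + of_real r * cis t)) has_integral (2 * of_real pi * \<i> * h a)) {0..2 * pi}"
    by (simp only:)
  then have "((\<lambda>t. - \<i> * (\<i> * h (a + of_real r * cis t))) has_integral (- \<i> * (2 * of_real pi * \<i> * h a))) {0..2 * pi}"
    by (rule has_integral_mult_right)
  then have "((\<lambda>t. h (a + of_real r * cis t)) has_integral (of_real (2 * pi) * h a)) {0..2 * pi}"
    by (simp add: algebra_simps)
  from has_integral_linear[OF this bounded_linear_Im]
  have "((\<lambda>t. Im (h (a + of_real r * cis t))) has_integral (2 * pi * Im (h a))) {0..2 * pi}"
    by (simp add: o_def)
  then show ?thesis unfolding circle_int_def by (rule integral_unique)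
qed

text \<open>On the circle |z - c|^2 is |a - c|^2 + r^2 + 2 Re (cnj (a - c) (z - a)), the imaginary
  part of the holomorphic h, and the mean of h is h(a).\<close>

lemma circle_int_norm_sq:
  assumes "0 < r"
  shows "circle_int (\<lambda>z. (cmod (z - c))\<^sup>2) a r = 2 * pi * ((cmod (a - c))\<^sup>2 + r\<^sup>2)"
proof -
  define h where "h z = \<i> * (2 * cnj (a - c) * (z - a) + of_real ((cmod (a - c))\<^sup>2 + r\<^sup>2))" for z
  have "h holomorphic_on cball a r" unfolding h_def by (intro holomorphic_intros)
  then have "circle_int (\<lambda>z. Im (h z)) a r = 2 * pi * Im (h a)" by (rule circle_int_holomorphic[OF _ assms])
  moreover have "circle_int (\<lambda>z. Im (h z)) a r = circle_int (\<lambda>z. (cmod (z - c))\<^sup>2) a r"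
    unfolding circle_int_def
  proof (rule integral_cong)
    fix t
    define w where "w = of_real r * cis t"
    have w: "(cmod w)\<^sup>2 = r\<^sup>2" by (simp add: w_def norm_mult)
    have "(cmod (a + w - c))\<^sup>2 = (cmod (a - c))\<^sup>2 + (cmod w)\<^sup>2 + 2 * Re (cnj (a - c) * w)"
      unfolding cmod_power2 by (simp add: power2_eq_square algebra_simps)
    then show "Im (h (a + of_real r * cis t)) = (cmod (a + of_real r * cis t - c))\<^sup>2"
      unfolding w_def[symmetric] by (simp add: h_def w algebra_simps)
  qed
  ultimately show ?thesis by (simp add: h_def)
qed

text \<open>Averaging over rotations about \<open>a\<close> makes \<open>f\<close> radial without destroying the local inequality;
  the maximum principle for the average is then the claim.\<close>

theorem submean_local_to_global:
  fixes f :: "complex \<Rightarrow> real"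
  assumes f: "continuous_on (cball a r) f" and r: "0 < r" and e: "0 < e"
    and sub: "\<And>b \<rho>. 0 < \<rho> \<Longrightarrow> \<rho> < e \<Longrightarrow> cball b \<rho> \<subseteq> cball a r \<Longrightarrow> 2 * pi * f b \<le> circle_int f b \<rho>"
  shows "2 * pi * f a \<le> circle_int f a r"
proof -
  define G where "G z = integral {0..2 * pi} (\<lambda>s. f (a + cis s * (z - a)))" for z
  have rot: "a + cis s * (z - a) \<in> cball a r" if "z \<in> cball a r" for s z
    using that by (simp add: dist_norm norm_mult norm_minus_commute)
  have cont2: "continuous_on (cball a r \<times> UNIV) (\<lambda>(z, s). f (a + cis s * (z - a)))"
    unfolding case_prod_beta
    by (rule continuous_on_compose2[OF f]) (use rot in \<open>auto intro!: continuous_intros\<close>)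
  have Gcont: "continuous_on (cball a r) G" unfolding G_def box_real[symmetric]
    by (rule integral_continuous_on_param) (use cont2 in \<open>auto elim: continuous_on_subset\<close>)
  have Grad: "G z = G w" if zw: "cmod (z - a) = cmod (w - a)" "w \<in> cball a r" for z w
  proof -
    obtain p where p: "0 \<le> p" "p \<le> 2 * pi" "z - a = (w - a) * cis p"
    proof (cases "w = a")
      case True then show ?thesis using zw that[of 0] by simp
    next
      case False
      define c where "c = (z - a) / (w - a)"
      have "cmod c = 1" using zw False by (simp add: c_def norm_divide)
      then have c: "cis (Arg2pi c) = c" using Arg2pi_eq[of c] by (simp add: cis_conv_exp mult.commute)
      have "z - a = (w - a) * cis (Arg2pi c)" unfolding c using False by (simp add: c_def)
      then show ?thesis using that[of "Arg2pi c"] Arg2pi_ge_0[of c] Arg2pi_lt_2pi[of c] by simp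
    qed
    define F where "F t = f (a + cis t * (w - a))" for t
    have "continuous_on UNIV F" unfolding F_def
      by (rule continuous_on_compose2[OF f]) (use rot[OF zw(2)] in \<open>auto intro!: continuous_intros\<close>)
    moreover have "F (t + 2 * pi) = F t" for t by (simp add: F_def cis.ctr)
    ultimately have "integral {0..2 * pi} (\<lambda>t. F (t + p)) = integral {0..2 * pi} F"
      using integral_periodic_shift p by blast
    moreover have "f (a + cis s * (z - a)) = F (s + p)" for s
      unfolding F_def p(3) by (simp add: cis_mult[symmetric] mult_ac)
    ultimately have "G z = integral {0..2 * pi} F" by (simp only: G_def)
    then show ?thesis by (simp only: G_def F_def[abs_def])
  qed
  have Gsub: "2 * pi * G b \<le> circle_int G b \<rho>" if \<rho>: "0 < \<rho>" "\<rho> < e" and b: "cball b \<rho> \<subseteq> cball a r" for b \<rho>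
  proof -
    have bin: "b \<in> cball a r" using b \<rho> subsetD[OF b, of b] by simp
    have pin: "b + of_real \<rho> * cis t \<in> cball a r" for t using b circle_point_in_cball[of \<rho> b t] \<rho> by auto
    have c2: "continuous_on UNIV (\<lambda>(s, t). f (a + cis s * (b + of_real \<rho> * cis t - a)))"
      unfolding case_prod_beta
      by (rule continuous_on_compose2[OF f]) (use rot[OF pin] in \<open>auto intro!: continuous_intros\<close>)
    \<comment> \<open>Rotating the small circle by s about a only shifts its parameter, so the inner
      integral is a circle mean of f itself and the local inequality applies.\<close>
    have shift: "integral {0..2 * pi} (\<lambda>t. f (a + cis s * (b + of_real \<rho> * cis t - a))) = circle_int f (a + cis s * (b - a)) \<rho>"
      if s: "s \<in> {0..2 * pi}" for s
    proof -
      define F where "F t = f (a + cis s * (b - a) + of_real \<rho> * cis t)" for t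
      have F: "F (t + s) = f (a + cis s * (b + of_real \<rho> * cis t - a))" for t
        unfolding F_def by (simp add: algebra_simps cis_mult[symmetric])
      have "F t = f (a + cis s * (b + of_real \<rho> * cis (t - s) - a))" for t
        using F[of "t - s"] by simp
      then have Feq: "F = (\<lambda>t. f (a + cis s * (b + of_real \<rho> * cis (t - s) - a)))" by (rule ext)
      have "continuous_on UNIV F" unfolding Feq
        by (rule continuous_on_compose2[OF f]; use rot[OF pin] in \<open>auto intro!: continuous_intros\<close>)
      moreover have "F (t + 2 * pi) = F t" for t by (simp add: F_def cis.ctr)
      ultimately have "integral {0..2 * pi} (\<lambda>t. F (t + s)) = integral {0..2 * pi} F"
        using integral_periodic_shift s by auto
      moreover have "circle_int f (a + cis s * (b - a)) \<rho> = integral {0..2 * pi} F"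
        by (simp only: circle_int_def F_def[abs_def])
      ultimately show ?thesis unfolding F by (simp only:)
    qed
    have "2 * pi * G b = integral {0..2 * pi} (\<lambda>s. 2 * pi * f (a + cis s * (b - a)))"
      by (simp add: G_def)
    also have "\<dots> \<le> integral {0..2 * pi} (\<lambda>s. integral {0..2 * pi} (\<lambda>t. f (a + cis s * (b + of_real \<rho> * cis t - a))))"
    proof (rule integral_le)
      show "(\<lambda>s. 2 * pi * f (a + cis s * (b - a))) integrable_on {0..2 * pi}"
        by (intro integrable_continuous_real continuous_intros continuous_on_compose2[OF f])
           (use rot[OF bin] in auto)
      show "(\<lambda>s. integral {0..2 * pi} (\<lambda>t. f (a + cis s * (b + of_real \<rho> * cis t - a)))) integrable_on {0..2 * pi}"
        unfolding box_real[symmetric]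
        by (intro integrable_continuous integral_continuous_on_param) (use c2 in \<open>auto elim: continuous_on_subset\<close>)
      fix s assume s: "s \<in> {0..2 * pi}"
      have "cball (a + cis s * (b - a)) \<rho> \<subseteq> cball a r"
      proof
        fix z assume z: "z \<in> cball (a + cis s * (b - a)) \<rho>"
        have "b + cis (- s) * (z - (a + cis s * (b - a))) \<in> cball b \<rho>"
          using z by (simp add: dist_norm norm_mult norm_minus_commute)
        then have "b + cis (- s) * (z - (a + cis s * (b - a))) \<in> cball a r" using b by blast
        moreover have "b + cis (- s) * (z - (a + cis s * (b - a))) = a + cis (- s) * (z - a)"
          by (simp add: algebra_simps cis_mult mult.assoc[symmetric])
        ultimately show "z \<in> cball a r" by (simp add: dist_norm norm_mult norm_minus_commute)
      qed
      then show "2 * pi * f (a + cis s * (b - a)) \<le> integral {0..2 * pi} (\<lambda>t. f (a + cis s * (b + of_real \<rho> * cis t - a)))"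
        unfolding shift[OF s] by (rule sub[OF \<rho>])
    qed
    also have "\<dots> = integral {0..2 * pi} (\<lambda>t. integral {0..2 * pi} (\<lambda>s. f (a + cis s * (b + of_real \<rho> * cis t - a))))"
    proof -
      have "continuous_on (cbox (0, 0) (2 * pi, 2 * pi)) (\<lambda>(s, t). f (a + cis s * (b + of_real \<rho> * cis t - a)))"
        by (rule continuous_on_subset[OF c2]) simp
      from integral_swap_continuous[OF this] show ?thesis by (simp only: box_real)
    qed
    also have "\<dots> = circle_int G b \<rho>" by (simp add: circle_int_def G_def)
    finally show ?thesis .
  qed
  have main: "G a \<le> G (a + of_real r) + d * r\<^sup>2" if d: "0 < d" for d
  proof -
    \<comment> \<open>The added term makes the submean inequality strict: at an interior maximum the
      circle integral of H would exceed 2 pi times the maximum by at least 2 pi d \<rho>^2. So the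
      maximum is on the boundary, where G is constant by rotation invariance.\<close>
    define H where "H z = G z + d * (cmod (z - a))\<^sup>2" for z
    have Hc: "continuous_on (cball a r) H" unfolding H_def by (intro continuous_intros Gcont)
    obtain b where b: "b \<in> cball a r" "\<And>z. z \<in> cball a r \<Longrightarrow> H z \<le> H b"
      using continuous_attains_sup[OF compact_cball _ Hc] r by fastforce
    have "cmod (b - a) = r"
    proof (rule ccontr)
      assume "cmod (b - a) \<noteq> r"
      then have lt: "cmod (b - a) < r" using b(1) by (auto simp: dist_norm norm_minus_commute)
      define \<rho> where "\<rho> = min (e / 2) (r - cmod (b - a))"
      have \<rho>: "0 < \<rho>" "\<rho> < e" "\<rho> \<le> r - cmod (b - a)" using e lt by (auto simp: \<rho>_def min_def)
      have sb: "cball b \<rho> \<subseteq> cball a r"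
      proof
        fix z assume "z \<in> cball b \<rho>"
        then have "cmod (z - b) \<le> r - cmod (b - a)" using \<rho>(3) by (simp add: dist_norm norm_minus_commute)
        then have "cmod (z - a) \<le> r" using norm_triangle_ineq[of "z - b" "b - a"] by simp
        then show "z \<in> cball a r" by (simp add: dist_norm norm_minus_commute)
      qed
      have gc: "continuous_on (cball b \<rho>) G" "continuous_on (cball b \<rho>) H"
        using Gcont Hc sb by (auto elim: continuous_on_subset)
      have nc: "continuous_on (cball b \<rho>) (\<lambda>z. d * (cmod (z - a))\<^sup>2)" by (intro continuous_intros)
      have "2 * pi * H b = 2 * pi * G b + d * (2 * pi * ((cmod (b - a))\<^sup>2 + \<rho>\<^sup>2)) - 2 * pi * d * \<rho>\<^sup>2"
        by (simp add: H_def algebra_simps)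
      also have "\<dots> \<le> circle_int G b \<rho> + d * circle_int (\<lambda>z. (cmod (z - a))\<^sup>2) b \<rho> - 2 * pi * d * \<rho>\<^sup>2"
        using Gsub[OF \<rho>(1,2) sb] circle_int_norm_sq[OF \<rho>(1), of a b] by simp
      also have "circle_int G b \<rho> + d * circle_int (\<lambda>z. (cmod (z - a))\<^sup>2) b \<rho> = circle_int H b \<rho>"
        unfolding circle_int_def H_def
        using integral_add[OF circle_integrable[OF gc(1)] circle_integrable[OF nc]] \<rho>(1) by simp
      also have "circle_int H b \<rho> \<le> circle_int (\<lambda>_. H b) b \<rho>"
        using sb b(2) \<rho>(1) by (intro circle_int_mono gc) auto
      also have "circle_int (\<lambda>_. H b) b \<rho> = 2 * pi * H b" by (simp add: circle_int_def)
      finally have "2 * pi * d * \<rho>\<^sup>2 \<le> 0" by simp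
      moreover have "0 < 2 * pi * d * \<rho>\<^sup>2" using d \<rho>(1) by simp
      ultimately show False by linarith
    qed
    then have "G b = G (a + of_real r)" by (intro Grad) (use r in \<open>simp_all add: dist_norm\<close>)
    moreover have "G a = H a" by (simp add: H_def)
    moreover have "H a \<le> H b" using b(2)[of a] r by simp
    ultimately show ?thesis using \<open>cmod (b - a) = r\<close> by (simp add: H_def)
  qed
  have "G a \<le> G (a + of_real r)"
  proof (rule field_le_epsilon)
    fix \<epsilon> :: real assume "0 < \<epsilon>"
    then show "G a \<le> G (a + of_real r) + \<epsilon>" using main[of "\<epsilon> / r\<^sup>2"] r by simp
  qed
  then show ?thesis by (simp add: G_def circle_int_def mult.commute)
qed

text \<open>For v \<le> 0 the positive part in \<open>circle_mean\<close> vanishes and the negative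
  part is finite, so the extended mean reduces to an ordinary integral.\<close>

lemma circle_mean_nonpos:
  fixes v :: "complex \<Rightarrow> real"
  assumes v: "continuous_on (cball a r) v" "\<And>z. z \<in> cball a r \<Longrightarrow> v z \<le> 0" and r: "0 < r"
  shows "circle_mean (\<lambda>w. ereal (v w)) a r = ereal (circle_int v a r / (2 * pi))"
proof -
  define h where "h t = - v (a + of_real r * cis t)" for t
  have hc: "continuous_on T h" for T unfolding h_def
    by (intro continuous_on_minus circle_continuous[OF v(1)]) (use r in simp)
  have h0: "0 \<le> h t" for t unfolding h_def using v(2)[OF circle_point_in_cball] r by simp
  have "bounded (h ` {0..2 * pi})" by (intro compact_imp_bounded compact_continuous_image hc) simp
  then obtain B where "\<forall>y\<in>h ` {0..2 * pi}. norm y \<le> B" unfolding bounded_iff by blast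
  then have B: "\<And>t. t \<in> {0..2 * pi} \<Longrightarrow> \<bar>h t\<bar> \<le> B" by simp
  have "(\<integral>\<^sup>+t\<in>{0..2 * pi}. ennreal (h t) \<partial>lborel) \<le> (\<integral>\<^sup>+t. ennreal B * indicator {0..2 * pi} t \<partial>lborel)"
    using B by (intro nn_integral_mono) (force simp: indicator_def intro!: ennreal_leI)
  also have "\<dots> < \<infinity>" by (simp add: nn_integral_cmult_indicator ennreal_mult_less_top)
  finally have fin: "(\<integral>\<^sup>+t\<in>{0..2 * pi}. ennreal (h t) \<partial>lborel) < \<infinity>" .
  have "h \<in> borel_measurable borel" by (rule borel_measurable_continuous_onI[OF hc])
  then have "set_borel_measurable borel {0..2 * pi} h" by (simp add: set_borel_measurable_def)
  from set_nn_integral_lborel_eq_integral[OF this h0 fin]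
  have 1: "(\<integral>\<^sup>+t\<in>{0..2 * pi}. ennreal (h t) \<partial>lborel) = ennreal (integral {0..2 * pi} h)" by simp
  have 2: "integral {0..2 * pi} h = - circle_int v a r" unfolding h_def[abs_def] circle_int_def by simp
  have "0 \<le> integral {0..2 * pi} h" by (intro integral_nonneg integrable_continuous_real hc h0)
  then have 3: "enn2ereal (ennreal (integral {0..2 * pi} h)) = ereal (- circle_int v a r)"
    using 2 by (simp add: enn2ereal_ennreal)
  have 4: "(\<integral>\<^sup>+ t \<in> {0..2 * pi}. e2ennreal (ereal (v (a + of_real r * cis t))) \<partial>lborel) = 0"
  proof -
    have "e2ennreal (ereal (v (a + of_real r * cis t))) = 0" for t
      using h0[of t] by (simp add: h_def ennreal_neg)
    then show ?thesis by simp
  qed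
  have 5: "(\<integral>\<^sup>+ t \<in> {0..2 * pi}. e2ennreal (- ereal (v (a + of_real r * cis t))) \<partial>lborel) = (\<integral>\<^sup>+t\<in>{0..2 * pi}. ennreal (h t) \<partial>lborel)"
    by (simp add: h_def)
  show ?thesis unfolding circle_mean_def 4 5 1 3 by (simp add: zero_ennreal.rep_eq zero_ereal_def)
qed

section \<open>Convergent sums\<close>

context flute_seq begin

definition angle :: "real \<Rightarrow> complex \<Rightarrow> real" where
  "angle L z = arctan ((L\<^sup>2 - (cmod z)\<^sup>2) / (2 * L * Im z))"

text \<open>The Moebius map inside \<open>Ln\<close> carries the half plane onto the right half
  plane and the geodesic |z| = L onto the positive real axis. There the principal logarithm is
  holomorphic and its imaginary part is the angle.\<close>

definition angle_hol :: "real \<Rightarrow> complex \<Rightarrow> complex" where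
  "angle_hol L z = Ln (- \<i> * ((z - of_real L) / (z + of_real L)))"

lemma angle_frac:
  assumes "0 < L" "0 < Im z"
  shows "Re (- \<i> * ((z - of_real L) / (z + of_real L))) = 2 * L * Im z / (cmod (z + of_real L))\<^sup>2"
    "Im (- \<i> * ((z - of_real L) / (z + of_real L))) = (L\<^sup>2 - (cmod z)\<^sup>2) / (cmod (z + of_real L))\<^sup>2"
    "0 < (cmod (z + of_real L))\<^sup>2"
proof -
  have nz: "z + of_real L \<noteq> 0" using assms(2) by (auto simp: complex_eq_iff)
  then show "0 < (cmod (z + of_real L))\<^sup>2" by simp
  have e: "(z - of_real L) / (z + of_real L) = ((z - of_real L) * cnj (z + of_real L)) / of_real ((cmod (z + of_real L))\<^sup>2)"
    by (simp only: complex_div_cnj[of "z - of_real L"])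
  have R: "Re (- \<i> * q) = Im q" "Im (- \<i> * q) = - Re q" for q by simp_all
  have "Im ((z - of_real L) / (z + of_real L)) = 2 * L * Im z / (cmod (z + of_real L))\<^sup>2"
    unfolding e Im_divide_of_real by (simp add: algebra_simps)
  then show "Re (- \<i> * ((z - of_real L) / (z + of_real L))) = 2 * L * Im z / (cmod (z + of_real L))\<^sup>2" unfolding R .
  have "Re ((z - of_real L) / (z + of_real L)) = ((cmod z)\<^sup>2 - L\<^sup>2) / (cmod (z + of_real L))\<^sup>2"
    unfolding e Re_divide_of_real by (simp add: algebra_simps cmod_power2 power2_eq_square[of "Re z"] power2_eq_square[of "Im z"] power2_eq_square[of L])
  then show "Im (- \<i> * ((z - of_real L) / (z + of_real L))) = (L\<^sup>2 - (cmod z)\<^sup>2) / (cmod (z + of_real L))\<^sup>2"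
    unfolding R by (simp add: minus_divide_left)
qed

lemma angle_Im: assumes "0 < L" "0 < Im z" shows "angle L z = Im (angle_hol L z)"
proof -
  define w where "w = - \<i> * ((z - of_real L) / (z + of_real L))"
  note f = angle_frac[OF assms, folded w_def]
  have R: "0 < Re w" using f assms by simp
  then have "w \<noteq> 0" by auto
  then have "Im (Ln w) = arctan (Im w / Re w)"
    using arg_conv_arctan[OF R] Arg_eq_Im_Ln[of w] by simp
  also have "Im w / Re w = (L\<^sup>2 - (cmod z)\<^sup>2) / (2 * L * Im z)"
    unfolding f(1) f(2) using f(3) by simp
  finally show ?thesis by (simp add: angle_def angle_hol_def w_def)
qed

lemma angle_holomorphic: assumes "0 < L" shows "angle_hol L holomorphic_on uhp"
  unfolding angle_hol_def
proof (intro holomorphic_intros)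
  fix z assume z: "z \<in> uhp"
  then show "z + of_real L \<noteq> 0" by (auto simp: complex_eq_iff)
  have "0 < Re (- \<i> * ((z - of_real L) / (z + of_real L)))" using angle_frac[OF assms, of z] z assms by simp
  then show "- \<i> * ((z - of_real L) / (z + of_real L)) \<notin> \<real>\<^sub>\<le>\<^sub>0"
    using complex_nonpos_Reals_iff by (metis not_less)
qed

lemma angle_continuous: "0 < L \<Longrightarrow> continuous_on uhp (angle L)"
  unfolding angle_def by (intro continuous_intros) auto

lemma mv_cmod_sq:
  assumes "0 < Im z"
  shows "(cmod (mv j z))\<^sup>2 * (cmod (z - of_real (cen j)))\<^sup>2
    = (cmod (of_real (cen j) * (z - of_real (cen j)) + of_real ((rad j)\<^sup>2)))\<^sup>2"
proof -
  have nz: "z - of_real (cen j) \<noteq> 0" using assms by (auto simp: complex_eq_iff)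
  have "(- c - r / d) * d = - (c * d + r)" if "d \<noteq> 0" for c r d :: complex
    using that by (simp add: field_simps)
  from this[OF nz] have "mv j z * (z - of_real (cen j)) = - (of_real (cen j) * (z - of_real (cen j)) + of_real ((rad j)\<^sup>2))"
    unfolding mv_eq[OF assms] .
  then show ?thesis by (metis norm_minus_cancel norm_mult power_mult_distrib)
qed

lemma mv_Im_eq:
  assumes "0 < Im z" shows "Im (mv j z) = (rad j)\<^sup>2 * Im z / (cmod (z - of_real (cen j)))\<^sup>2"
proof -
  have "mv j z = - of_real (cen j) - of_real ((rad j)\<^sup>2) * cnj (z - of_real (cen j)) / of_real ((cmod (z - of_real (cen j)))\<^sup>2)"
    unfolding mv_eq[OF assms] by (simp only: complex_div_cnj[of "of_real ((rad j)\<^sup>2)"])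
  then show ?thesis by (simp only: minus_complex.sel uminus_complex.sel Im_divide_of_real) (simp flip: of_real_power)
qed

text \<open>The function \<open>angle L\<close> increases with the hyperbolic distance to \<open>\<bar>z\<bar> = L\<close>, which
  is smaller at a point outside a side than at its mirror image inside.\<close>

lemma angle_mv:
  assumes L: "node (Suc (fst j)) < L" and z: "0 < Im z"
  shows "rad j \<le> cmod (z - of_real (cen j)) \<Longrightarrow> angle L z \<le> angle L (mv j z)"
    and "cmod (z - of_real (cen j)) \<le> rad j \<Longrightarrow> angle L (mv j z) \<le> angle L z"
proof -
  define D where "D = (cmod (z - of_real (cen j)))\<^sup>2"
  define c where "c = cen j"
  define \<rho> where "\<rho> = rad j"
  have nz: "z - of_real (cen j) \<noteq> 0" using z by (auto simp: complex_eq_iff)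
  have D: "0 < D" and \<rho>: "0 < \<rho>" using nz by (simp_all add: D_def \<rho>_def)
  have Lp: "0 < L" using L node_nonneg[of "Suc (fst j)"] by linarith
  \<comment> \<open>c^2 - \<rho>^2 is the product of the two nodes at the ends of the side, and both
    are below L.\<close>
  have K: "0 < L\<^sup>2 - c\<^sup>2 + \<rho>\<^sup>2"
  proof -
    define a b where "a = node (fst j)" and "b = node (Suc (fst j))"
    have cr: "c\<^sup>2 - \<rho>\<^sup>2 = a * b"
      by (auto simp: c_def \<rho>_def cen_def rad_def a_def b_def node_Suc power2_eq_square field_simps)
    have "0 \<le> a" "a \<le> b" "b < L" using L by (auto simp: a_def b_def node_mono)
    then have "a * b < L * L" by (intro mult_strict_mono') auto
    then show ?thesis using cr by (simp add: power2_eq_square)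
  qed
  have E: "(cmod (mv j z))\<^sup>2 * D = (cmod (of_real c * (z - of_real c) + of_real (\<rho>\<^sup>2)))\<^sup>2"
    unfolding D_def c_def \<rho>_def by (rule mv_cmod_sq[OF z])
  have E2: "(cmod (of_real c * (z - of_real c) + of_real (\<rho>\<^sup>2)))\<^sup>2 = c\<^sup>2 * D + \<rho>\<^sup>2 * \<rho>\<^sup>2 + 2 * c * \<rho>\<^sup>2 * (Re z - c)"
    unfolding D_def cmod_power2 c_def by (simp add: power2_eq_square algebra_simps)
  have Dz: "D = (cmod z)\<^sup>2 - 2 * c * Re z + c\<^sup>2"
    unfolding D_def cmod_power2 c_def by (simp add: power2_eq_square algebra_simps)
  have Imv: "Im (mv j z) = \<rho>\<^sup>2 * Im z / D" using mv_Im_eq[OF z, of j] by (simp add: D_def \<rho>_def)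
  have "(L\<^sup>2 - (cmod (mv j z))\<^sup>2) / (2 * L * Im (mv j z)) = (L\<^sup>2 * D - (cmod (mv j z))\<^sup>2 * D) / (2 * L * (\<rho>\<^sup>2 * Im z))"
    unfolding Imv using D \<rho> Lp z by (simp add: field_simps)
  \<comment> \<open>The correction term has the sign of D - \<rho>^2, which tells on which side of
    the circle z lies.\<close>
  also have "(L\<^sup>2 * D - (cmod (mv j z))\<^sup>2 * D) = \<rho>\<^sup>2 * (L\<^sup>2 - (cmod z)\<^sup>2) + (D - \<rho>\<^sup>2) * (L\<^sup>2 - c\<^sup>2 + \<rho>\<^sup>2)"
    unfolding E E2 by (simp add: Dz algebra_simps power2_eq_square)
  also have "\<dots> / (2 * L * (\<rho>\<^sup>2 * Im z)) = (L\<^sup>2 - (cmod z)\<^sup>2) / (2 * L * Im z) + (D - \<rho>\<^sup>2) * (L\<^sup>2 - c\<^sup>2 + \<rho>\<^sup>2) / (2 * L * (\<rho>\<^sup>2 * Im z))"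
    using \<rho> Lp z by (simp add: add_divide_distrib)
  finally have eq: "(L\<^sup>2 - (cmod (mv j z))\<^sup>2) / (2 * L * Im (mv j z)) =
      (L\<^sup>2 - (cmod z)\<^sup>2) / (2 * L * Im z) + (D - \<rho>\<^sup>2) * (L\<^sup>2 - c\<^sup>2 + \<rho>\<^sup>2) / (2 * L * (\<rho>\<^sup>2 * Im z))" .
  have den: "0 < 2 * L * (\<rho>\<^sup>2 * Im z)" using \<rho> Lp z by simp
  show "angle L z \<le> angle L (mv j z)" if "rad j \<le> cmod (z - of_real (cen j))"
  proof -
    have "\<rho>\<^sup>2 \<le> D" unfolding D_def \<rho>_def
      using that less_imp_le[OF rad_pos[of j]] by (intro power_mono) auto
    then have "0 \<le> (D - \<rho>\<^sup>2) * (L\<^sup>2 - c\<^sup>2 + \<rho>\<^sup>2) / (2 * L * (\<rho>\<^sup>2 * Im z))"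
      using K den by (intro divide_nonneg_pos mult_nonneg_nonneg) auto
    then show ?thesis unfolding angle_def eq by (intro arctan_monotone') simp
  qed
  show "angle L (mv j z) \<le> angle L z" if "cmod (z - of_real (cen j)) \<le> rad j"
  proof -
    have "D \<le> \<rho>\<^sup>2" unfolding D_def \<rho>_def using that by (intro power_mono) auto
    then have "(D - \<rho>\<^sup>2) * (L\<^sup>2 - c\<^sup>2 + \<rho>\<^sup>2) / (2 * L * (\<rho>\<^sup>2 * Im z)) \<le> 0"
      using K den by (intro divide_nonpos_pos mult_nonpos_nonneg) auto
    then show ?thesis unfolding angle_def eq by (intro arctan_monotone') simp
  qed
qed

lemma angle_foldp: "angle L (foldp z) = angle L z"
  by (simp add: angle_def foldp_def cmod_power2)

lemma height_lift: assumes "y \<in> dom" shows "angle L (height (lift y)) = angle L (unf y)"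
  using assms height_prj[of "unf y"] by (simp add: dom_def lift_def angle_foldp)

lemma height_Im: assumes "q \<in> topspace S" shows "0 < Im (height q)" "\<exists>n. cmod (height q) < node n"
proof -
  obtain z where z: "z \<in> Q" "q = prj z" using assms by (auto simp: topspace_flute)
  have "Im (height q) = Im z" "cmod (height q) = cmod z"
    unfolding z(2) height_prj[OF z(1)] by (simp_all add: foldp_def cmod_def)
  then show "0 < Im (height q)" "\<exists>n. cmod (height q) < node n"
    using z(1) by (auto simp: Q_def reg_def)
qed

text \<open>Near a side, the negative angle at the unfolded point is by \<open>angle_mv\<close> the
  larger of its values at y and at \<open>mv j y\<close>, on both halves of the neighbourhood. Each
  of the two is the imaginary part of a holomorphic function; off the sides one function serves
  twice.\<close>

lemma angle_local_max:
  assumes c: "flute_chart len U \<phi>" and L: "\<And>n. node n < L" and w0: "w0 \<in> \<phi> ` U"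
  shows "\<exists>W h k. open W \<and> w0 \<in> W \<and> h holomorphic_on W \<and> k holomorphic_on W \<and>
    (\<forall>w\<in>W. - angle L (height (the_inv_into U \<phi> w)) = max (Im (h w)) (Im (k w)))"
proof -
  have Lp: "0 < L" using L[of 0] by simp
  obtain q where q: "q \<in> U" "w0 = \<phi> q" using w0 by auto
  then obtain p where p: "p \<in> Q" "q = prj p" using chart_subset[OF c] by blast
  obtain g W where W: "hyp_isometry g" "open W" "\<phi> (prj p) \<in> W" "W \<subseteq> uhp" "g (\<phi> (prj p)) = p"
    "\<And>w. w \<in> W \<Longrightarrow> w \<in> \<phi> ` U \<and> g w \<in> dom \<and> the_inv_into U \<phi> w = lift (g w)"
    using chart_local_inv[OF c p(1)] q p by metis
  have ang: "angle L (height (the_inv_into U \<phi> w)) = angle L (unf (g w))" if "w \<in> W" for w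
    using W(6)[OF that] height_lift[of "g w" L] by simp
  have hol: "(\<lambda>w. - angle_hol L (k w)) holomorphic_on uhp" if "hyp_isometry k" for k
  proof (rule holomorphic_on_minus)
    have "angle_hol L \<circ> k holomorphic_on uhp"
      by (rule holomorphic_on_compose_gen[OF iso_holomorphic[OF that] angle_holomorphic[OF Lp]])
        (use iso_Im[OF that] in auto)
    then show "(\<lambda>w. angle_hol L (k w)) holomorphic_on uhp" by (simp add: o_def)
  qed
  have im: "Im (- angle_hol L (k w)) = - angle L (k w)" if "hyp_isometry k" "0 < Im w" for k w
    using angle_Im[OF Lp iso_Im[OF that]] by simp
  have w0W: "w0 \<in> W" "g w0 = p" using W q p by auto
  show ?thesis
  proof (cases "on_side p")
    case False
    define T where "T = W \<inter> {w. 0 < Im w \<and> g w \<in> Qo}"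
    have "open T" unfolding T_def by (intro open_Int W(2) iso_open_preimage W(1) open_Qo)
    moreover have "w0 \<in> T" using w0W W(4) p False by (auto simp: T_def Qo_def)
    moreover have "(\<lambda>w. - angle_hol L (g w)) holomorphic_on T"
      by (rule holomorphic_on_subset[OF hol[OF W(1)]]) (auto simp: T_def)
    moreover have "- angle L (height (the_inv_into U \<phi> w)) = Im (- angle_hol L (g w))" if "w \<in> T" for w
      using that ang[of w] im[OF W(1), of w] by (auto simp: T_def unf_Q Qo_Q)
    ultimately show ?thesis
      by (intro exI[of _ T] exI[of _ "\<lambda>w. - angle_hol L (g w)"]) auto
  next
    case True
    then obtain j where j: "cmod (p - of_real (cen j)) = rad j" by (auto simp: on_side_def)
    obtain V where V: "open V" "p \<in> V" "V \<subseteq> uhp"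
      "\<And>y. y \<in> V \<Longrightarrow> rad j \<le> cmod (y - of_real (cen j)) \<Longrightarrow> y \<in> Q"
      using nbhd_side[OF p(1) j] by metis
    obtain k where k: "hyp_isometry k" "\<And>v. 0 < Im v \<Longrightarrow> k v = mv j (g v)"
      using iso_comp[OF W(1) iso_mv[of j]] by auto
    define T where "T = W \<inter> {w. 0 < Im w \<and> g w \<in> V}"
    have "open T" unfolding T_def by (intro open_Int W(2) iso_open_preimage W(1) V(1))
    moreover have "w0 \<in> T" using w0W W(4) V(2) by (auto simp: T_def)
    moreover have "(\<lambda>w. - angle_hol L (g w)) holomorphic_on T"
      by (rule holomorphic_on_subset[OF hol[OF W(1)]]) (auto simp: T_def)
    moreover have "(\<lambda>w. - angle_hol L (k w)) holomorphic_on T"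
      by (rule holomorphic_on_subset[OF hol[OF k(1)]]) (auto simp: T_def)
    moreover have "- angle L (height (the_inv_into U \<phi> w)) = max (Im (- angle_hol L (g w))) (Im (- angle_hol L (k w)))"
      if w: "w \<in> T" for w
    proof -
      have ww: "w \<in> W" "0 < Im w" "g w \<in> V" "0 < Im (g w)" using w V(3) by (auto simp: T_def)
      have e: "- angle L (height (the_inv_into U \<phi> w)) = - angle L (unf (g w))" using ang[OF ww(1)] by simp
      have m: "Im (- angle_hol L (g w)) = - angle L (g w)" "Im (- angle_hol L (k w)) = - angle L (mv j (g w))"
        using im[OF W(1) ww(2)] im[OF k(1) ww(2)] k(2)[OF ww(2)] by simp_all
      note amv = angle_mv[OF L[of "Suc (fst j)"] ww(4)]
      show ?thesis
      proof (cases "g w \<in> ins j")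
        case True
        then have "angle L (mv j (g w)) \<le> angle L (g w)" using amv(2) by (auto simp: ins_def)
        then show ?thesis unfolding e m unf_ins[OF True] by simp
      next
        case False
        then have "g w \<in> Q" "angle L (g w) \<le> angle L (mv j (g w))"
          using amv(1) V(4)[OF ww(3)] ww(4) by (auto simp: ins_def)
        then show ?thesis unfolding e m by (simp add: unf_Q)
      qed
    qed
    ultimately show ?thesis
      by (intro exI[of _ T] exI[of _ "\<lambda>w. - angle_hol L (g w)"] exI[of _ "\<lambda>w. - angle_hol L (k w)"]) auto
  qed
qed

lemma angle_height_pos:
  assumes "q \<in> topspace S" "\<And>n. node n < L" shows "0 < angle L (height q)"
proof -
  obtain n where n: "cmod (height q) < node n" using height_Im(2)[OF assms(1)] by auto
  have "(cmod (height q))\<^sup>2 < L\<^sup>2" using n assms(2)[of n] by (intro power_strict_mono) auto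
  moreover have "0 < L" using assms(2)[of 0] by simp
  ultimately show ?thesis using height_Im(1)[OF assms(1)] unfolding angle_def by simp
qed

theorem not_parabolic:
  assumes L: "\<And>n. node n < L" shows "\<not> parabolic_type (associated_surface x)"
proof -
  have Lp: "0 < L" using L[of 0] by simp
  define u where "u q = ereal (- angle L (height q))" for q
  have "subharmonic (associated_surface x) u"
    unfolding subharmonic_def surf_simps
  proof (intro conjI ballI allI impI)
    show "u p < \<infinity>" for p by (simp add: u_def)
    fix c
    have "continuous_on uhp (\<lambda>z. ereal (- angle L z))"
      by (intro continuous_on_ereal continuous_on_minus angle_continuous Lp)
    from continuous_open_preimage[OF this open_uhp open_lessThan[of c]]
    have "open {z. 0 < Im z \<and> ereal (- angle L z) < c}" by (simp add: Int_def vimage_def)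
    then have "openin S {q \<in> topspace S. height q \<in> {z. 0 < Im z \<and> ereal (- angle L z) < c}}"
      using continuous_height by (auto simp: continuous_map_def)
    moreover have "{q \<in> topspace S. height q \<in> {z. 0 < Im z \<and> ereal (- angle L z) < c}} = {p \<in> topspace S. u p < c}"
      using height_Im by (auto simp: u_def)
    ultimately show "openin S {p \<in> topspace S. u p < c}" by simp
  next
    fix Up assume "Up \<in> {(U, \<phi>). flute_chart len U \<phi>}"
    then obtain U \<phi> where Up: "Up = (U, \<phi>)" and c: "flute_chart len U \<phi>" by auto
    have "u (the_inv_into U \<phi> a) \<le> circle_mean (u \<circ> the_inv_into U \<phi>) a r" if r: "0 < r" "cball a r \<subseteq> \<phi> ` U" for a r
    proof -
      define f where "f w = - angle L (height (the_inv_into U \<phi> w))" for w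
      have loc: "\<exists>W. open W \<and> w0 \<in> W \<and> (\<exists>h k. h holomorphic_on W \<and> k holomorphic_on W \<and>
          (\<forall>w\<in>W. f w = max (Im (h w)) (Im (k w))))" if "w0 \<in> cball a r" for w0
        using angle_local_max[OF c L, of w0] r that unfolding f_def by blast
      have maxc: "continuous_on W f" if "h holomorphic_on W" "k holomorphic_on W" "\<forall>w\<in>W. f w = max (Im (h w)) (Im (k w))" for W h k
      proof -
        have "continuous_on W (\<lambda>w. max (Im (h w)) (Im (k w)))"
          by (intro continuous_on_max continuous_intros holomorphic_on_imp_continuous_on that)
        then show ?thesis using that(3) by (simp cong: continuous_on_cong)
      qed
      have fc: "continuous_on (cball a r) f"
      proof (rule continuous_at_imp_continuous_on, rule ballI)
        fix w0 assume "w0 \<in> cball a r"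
        then obtain W h k where W: "open W" "w0 \<in> W" "h holomorphic_on W" "k holomorphic_on W"
          "\<forall>w\<in>W. f w = max (Im (h w)) (Im (k w))" using loc by blast
        show "isCont f w0" using maxc[OF W(3-5)] W(1,2) by (simp add: continuous_on_eq_continuous_at)
      qed
      define \<C> where "\<C> = {W. open W \<and> (\<exists>h k. h holomorphic_on W \<and> k holomorphic_on W \<and>
          (\<forall>w\<in>W. f w = max (Im (h w)) (Im (k w))))}"
      have "{} \<in> \<C>" unfolding \<C>_def by (auto intro!: exI[of _ "\<lambda>_. 0"])
      then have ne: "\<C> \<noteq> {}" by blast
      have cov: "cball a r \<subseteq> \<Union>\<C>"
      proof
        fix w0 assume "w0 \<in> cball a r"
        then show "w0 \<in> \<Union>\<C>" using loc[of w0] unfolding \<C>_def by blast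
      qed
      have opn: "\<And>B. B \<in> \<C> \<Longrightarrow> open B" by (simp add: \<C>_def)
      \<comment> \<open>On discs smaller than the Lebesgue number f is one maximum of two functions
        with the mean value property, hence submean; \<open>submean_local_to_global\<close> passes
        to the given disc of arbitrary size.\<close>
      obtain \<delta> where \<delta>: "0 < \<delta>" "\<And>T. T \<subseteq> cball a r \<Longrightarrow> diameter T < \<delta> \<Longrightarrow> \<exists>B\<in>\<C>. T \<subseteq> B"
        using Lebesgue_number_lemma[OF compact_cball ne cov opn] by metis
      have "2 * pi * f a \<le> circle_int f a r"
      proof (rule submean_local_to_global[OF fc r(1), of "\<delta> / 2"])
        show "0 < \<delta> / 2" using \<delta>(1) by simp
        fix b \<rho> assume \<rho>: "0 < \<rho>" "\<rho> < \<delta> / 2" and sb: "cball b \<rho> \<subseteq> cball a r"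
        have "diameter (cball b \<rho>) < \<delta>" using \<rho> by (simp add: diameter_cball)
        then obtain W0 where W0: "W0 \<in> \<C>" "cball b \<rho> \<subseteq> W0" using \<delta>(2)[OF sb] by blast
        then obtain h k where hk: "h holomorphic_on W0" "k holomorphic_on W0"
          "\<forall>w\<in>W0. f w = max (Im (h w)) (Im (k w))" unfolding \<C>_def by blast
        have W: "h holomorphic_on cball b \<rho>" "k holomorphic_on cball b \<rho>"
          by (rule holomorphic_on_subset[OF hk(1) W0(2)], rule holomorphic_on_subset[OF hk(2) W0(2)])
        have W3: "f w = max (Im (h w)) (Im (k w))" if "w \<in> cball b \<rho>" for w
          using hk(3) W0(2) that by blast
        have ci: "continuous_on (cball b \<rho>) (\<lambda>z. Im (h z))" "continuous_on (cball b \<rho>) (\<lambda>z. Im (k z))" "continuous_on (cball b \<rho>) f"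
          by (intro continuous_intros holomorphic_on_imp_continuous_on W, intro continuous_intros holomorphic_on_imp_continuous_on W,
              rule continuous_on_subset[OF fc sb])
        have "2 * pi * Im (h b) \<le> circle_int f b \<rho>" "2 * pi * Im (k b) \<le> circle_int f b \<rho>"
          unfolding circle_int_holomorphic[OF W(1) \<rho>(1), symmetric] circle_int_holomorphic[OF W(2) \<rho>(1), symmetric]
          using W3 \<rho>(1) by (auto intro!: circle_int_mono ci)
        then show "2 * pi * f b \<le> circle_int f b \<rho>" using W3[of b] \<rho>(1) by (auto simp: max_def)
      qed
      then have "f a \<le> circle_int f a r / (2 * pi)" by (simp add: field_simps)
      moreover have "f z \<le> 0" if "z \<in> cball a r" for z
      proof -
        have "the_inv_into U \<phi> z \<in> U" using that r(2) chart_inj[OF c] the_inv_into_into[of \<phi> U z U] by blast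
        then have "the_inv_into U \<phi> z \<in> topspace S" using openin_subset[OF chart_openin[OF c]] by blast
        then show ?thesis using angle_height_pos[OF _ L] by (force simp: f_def intro: less_imp_le)
      qed
      ultimately have "ereal (f a) \<le> circle_mean (\<lambda>w. ereal (f w)) a r"
        using circle_mean_nonpos[OF fc _ r(1)] by simp
      then show ?thesis by (simp add: u_def f_def o_def)
    qed
    then show "case Up of (U, \<phi>) \<Rightarrow> \<forall>a r. 0 < r \<and> cball a r \<subseteq> \<phi> ` U \<longrightarrow>
           u (the_inv_into U \<phi> a) \<le> circle_mean (u \<circ> the_inv_into U \<phi>) a r" unfolding Up by auto
  qed
  moreover have "\<forall>p \<in> topspace S. u p < 0" using angle_height_pos[OF _ L] by (simp add: u_def)
  moreover have "\<exists>p \<in> topspace S. \<exists>q \<in> topspace S. u p \<noteq> u q"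
  proof -
    define t where "t = node 1 / 2"
    have t: "0 < t" "t < node 1" using node_Suc_pos[of 0] by (simp_all add: t_def)
    have Q: "Complex 0 t \<in> Q" "Complex 0 (t / 2) \<in> Q"
      using t by (auto intro!: Qo_Q axis_Qo exI[of _ 1] simp: reg_def cmod_eq_Im)
    \<comment> \<open>On the imaginary axis the angle decreases strictly with the height, so two
      points of the axis show that u is not constant.\<close>
    have "(L\<^sup>2 - t\<^sup>2) / (2 * L * t) < (L\<^sup>2 - (t / 2)\<^sup>2) / (2 * L * (t / 2))"
    proof -
      have "(L\<^sup>2 - t\<^sup>2) / (2 * L * t) < (L\<^sup>2 - (t / 2)\<^sup>2) / (2 * L * t)"
        using t Lp by (intro divide_strict_right_mono) (auto simp: power2_eq_square)
      also have "\<dots> \<le> (L\<^sup>2 - (t / 2)\<^sup>2) / (2 * L * (t / 2))"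
      proof -
        have "t / 2 \<le> L" using t L[of 1] by linarith
        then have "(t / 2)\<^sup>2 \<le> L\<^sup>2" using t by (intro power_mono) auto
        then show ?thesis using t Lp by (intro divide_left_mono) auto
      qed
      finally show ?thesis .
    qed
    then have "angle L (Complex 0 t) \<noteq> angle L (Complex 0 (t / 2))"
      using t unfolding angle_def by (simp add: cmod_eq_Im arctan_eq_iff)
    then have "u (prj (Complex 0 t)) \<noteq> u (prj (Complex 0 (t / 2)))"
      using Q by (simp add: u_def height_prj angle_foldp)
    then show ?thesis using Q unfolding topspace_flute by blast
  qed
  ultimately show ?thesis unfolding parabolic_type_def surf_simps by blast
qed

end

section \<open>Hyperbolic area\<close>

lemma measurable_Complex [measurable (raw)]:
  assumes "f \<in> borel_measurable M" "g \<in> borel_measurable M"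
  shows "(\<lambda>x. Complex (f x) (g x)) \<in> borel_measurable M"
  unfolding Complex_eq using assms by measurable

lemma lborel_complex: "lborel = distr (lborel \<Otimes>\<^sub>M lborel) borel (\<lambda>p. Complex (fst p) (snd p))"
proof (rule lborel_eqI)
  fix l u :: complex assume le: "\<And>b. b \<in> Basis \<Longrightarrow> l \<bullet> b \<le> u \<bullet> b"
  have le': "Re l \<le> Re u" "Im l \<le> Im u" using le[of 1] le[of \<i>] by (simp_all add: Basis_complex_def inner_complex_def)
  have "(\<lambda>p. Complex (fst p) (snd p)) -` box l u \<inter> space (lborel \<Otimes>\<^sub>M lborel) = {Re l<..<Re u} \<times> {Im l<..<Im u}"
    by (auto simp: box_def Basis_complex_def inner_complex_def space_pair_measure)
  then have "emeasure (distr (lborel \<Otimes>\<^sub>M lborel) borel (\<lambda>p. Complex (fst p) (snd p))) (box l u)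
      = emeasure (lborel \<Otimes>\<^sub>M lborel) ({Re l<..<Re u} \<times> {Im l<..<Im u})"
    by (subst emeasure_distr) auto
  also have "\<dots> = ennreal (Re u - Re l) * ennreal (Im u - Im l)"
    using le' by (subst lborel.emeasure_pair_measure_Times) auto
  also have "\<dots> = (\<Prod>b\<in>Basis. (u - l) \<bullet> b)"
    using le' by (simp add: Basis_complex_def inner_complex_def ennreal_mult')
  finally show "emeasure (distr (lborel \<Otimes>\<^sub>M lborel) borel (\<lambda>p. Complex (fst p) (snd p))) (box l u)
      = (\<Prod>b\<in>Basis. (u - l) \<bullet> b)" .
qed simp

lemma nn_integral_complex:
  assumes [measurable]: "f \<in> borel_measurable borel"
  shows "(\<integral>\<^sup>+z. f z \<partial>lborel) = (\<integral>\<^sup>+y. \<integral>\<^sup>+x. f (Complex x y) \<partial>lborel \<partial>lborel)"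
proof -
  have "(\<integral>\<^sup>+z. f z \<partial>lborel) = (\<integral>\<^sup>+p. f (Complex (fst p) (snd p)) \<partial>(lborel \<Otimes>\<^sub>M lborel))"
    by (subst lborel_complex) (simp add: nn_integral_distr)
  also have "\<dots> = (\<integral>\<^sup>+y. \<integral>\<^sup>+x. f (Complex x y) \<partial>lborel \<partial>lborel)"
    by (subst lborel_pair.nn_integral_snd[symmetric]) simp_all
  finally show ?thesis .
qed

lemma nn_integral_complex':
  assumes [measurable]: "f \<in> borel_measurable borel"
  shows "(\<integral>\<^sup>+z. f z \<partial>lborel) = (\<integral>\<^sup>+x. \<integral>\<^sup>+y. f (Complex x y) \<partial>lborel \<partial>lborel)"
  unfolding nn_integral_complex[OF assms] by (rule lborel_pair.Fubini') simp

lemma nn_integral_complex_affine: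
  fixes b :: complex
  assumes [measurable]: "f \<in> borel_measurable borel" and a: "a \<noteq> 0"
  shows "(\<integral>\<^sup>+z. f z \<partial>lborel) = ennreal (a\<^sup>2) * (\<integral>\<^sup>+z. f (b + of_real a * z) \<partial>lborel)"
  by (subst lborel_affine[OF a, of b])
    (simp add: nn_integral_density nn_integral_distr nn_integral_cmult scaleR_conv_of_real)

lemma nn_integral_shear:
  assumes [measurable]: "f \<in> borel_measurable borel"
  shows "(\<integral>\<^sup>+z. f (Complex (Re z + k * Im z) (Im z)) \<partial>lborel) = (\<integral>\<^sup>+z. f z \<partial>lborel)"
    and "(\<integral>\<^sup>+z. f (Complex (Re z) (Im z + k * Re z)) \<partial>lborel) = (\<integral>\<^sup>+z. f z \<partial>lborel)"
proof -
  have tr: "(\<integral>\<^sup>+x. g (x + c) \<partial>lborel) = (\<integral>\<^sup>+x. g x \<partial>lborel)" if "g \<in> borel_measurable borel" for g and c :: real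
    using nn_integral_real_affine[OF that, of 1 c] by (simp add: add.commute)
  have "(\<integral>\<^sup>+z. f (Complex (Re z + k * Im z) (Im z)) \<partial>lborel) = (\<integral>\<^sup>+y. \<integral>\<^sup>+x. f (Complex (x + k * y) y) \<partial>lborel \<partial>lborel)"
    by (subst nn_integral_complex) simp_all
  also have "\<dots> = (\<integral>\<^sup>+y. \<integral>\<^sup>+x. f (Complex x y) \<partial>lborel \<partial>lborel)"
  proof (rule nn_integral_cong)
    fix y show "(\<integral>\<^sup>+x. f (Complex (x + k * y) y) \<partial>lborel) = (\<integral>\<^sup>+x. f (Complex x y) \<partial>lborel)"
      by (rule tr[of "\<lambda>x. f (Complex x y)"]) simp
  qed
  finally show "(\<integral>\<^sup>+z. f (Complex (Re z + k * Im z) (Im z)) \<partial>lborel) = (\<integral>\<^sup>+z. f z \<partial>lborel)"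
    by (subst nn_integral_complex[OF assms])
  have "(\<integral>\<^sup>+z. f (Complex (Re z) (Im z + k * Re z)) \<partial>lborel) = (\<integral>\<^sup>+x. \<integral>\<^sup>+y. f (Complex x (y + k * x)) \<partial>lborel \<partial>lborel)"
    by (subst nn_integral_complex') simp_all
  also have "\<dots> = (\<integral>\<^sup>+x. \<integral>\<^sup>+y. f (Complex x y) \<partial>lborel \<partial>lborel)"
  proof (rule nn_integral_cong)
    fix x show "(\<integral>\<^sup>+y. f (Complex x (y + k * x)) \<partial>lborel) = (\<integral>\<^sup>+y. f (Complex x y) \<partial>lborel)"
      by (rule tr[of "\<lambda>y. f (Complex x y)"]) simp
  qed
  finally show "(\<integral>\<^sup>+z. f (Complex (Re z) (Im z + k * Re z)) \<partial>lborel) = (\<integral>\<^sup>+z. f z \<partial>lborel)"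
    by (subst nn_integral_complex'[OF assms])
qed

text \<open>A rotation by an angle other than \<open>\<pi>\<close> is a product of three shears.\<close>

lemma nn_integral_rotate:
  assumes [measurable]: "f \<in> borel_measurable borel"
  shows "(\<integral>\<^sup>+z. f (cis t * z) \<partial>lborel) = (\<integral>\<^sup>+z. f z \<partial>lborel)"
proof (cases "cos t = -1")
  case True
  then have "sin t = 0" using sin_cos_squared_add[of t] by simp
  then have "cis t = -1" using True by (simp add: complex_eq_iff)
  then show ?thesis using nn_integral_complex_affine[OF assms, of "-1" 0] by simp
next
  case False
  \<comment> \<open>This is - tan (t / 2), the horizontal shear in the three-shear form of a
    rotation.\<close>
  define k where "k = - sin t / (1 + cos t)"
  have nz: "1 + cos t \<noteq> 0" using False by linarith
  have ss: "sin t * sin t = (1 - cos t) * (1 + cos t)"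
    using sin_cos_squared_add[of t] by (simp add: power2_eq_square algebra_simps)
  have ks: "k * sin t = cos t - 1"
  proof -
    have "k * sin t = - (sin t * sin t) / (1 + cos t)" by (simp add: k_def)
    also have "\<dots> = - (1 - cos t)" unfolding ss using nz by (simp add: field_simps)
    finally show ?thesis by simp
  qed
  have kc: "k * (1 + cos t) = - sin t" using nz by (simp add: k_def)
  define A where "A z = Complex (Re z + k * Im z) (Im z)" for z
  define B where "B z = Complex (Re z) (Im z + sin t * Re z)" for z
  have [measurable]: "A \<in> borel_measurable borel" "B \<in> borel_measurable borel"
    unfolding A_def[abs_def] B_def[abs_def] by measurable
  have e: "cis t * z = A (B (A z))" for z
  proof -
    have R1: "Re z + k * Im z + k * (Im z + sin t * (Re z + k * Im z))
       = Re z + k * Im z * (1 + (1 + k * sin t)) + (k * sin t) * Re z" by (simp add: algebra_simps)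
    have "\<dots> = cos t * Re z - sin t * Im z"
    proof -
      have "k * Im z * (1 + (1 + k * sin t)) = (k * (1 + cos t)) * Im z" unfolding ks by (simp add: algebra_simps)
      then show ?thesis unfolding kc ks by (simp add: algebra_simps)
    qed
    moreover have "Im z + sin t * (Re z + k * Im z) = sin t * Re z + cos t * Im z"
    proof -
      have "Im z + sin t * (Re z + k * Im z) = sin t * Re z + (1 + k * sin t) * Im z" by (simp add: algebra_simps)
      then show ?thesis unfolding ks by simp
    qed
    ultimately show ?thesis using R1 by (simp add: A_def B_def complex_eq_iff)
  qed
  have "(\<integral>\<^sup>+z. f (cis t * z) \<partial>lborel) = (\<integral>\<^sup>+z. f (A (B (A z))) \<partial>lborel)" by (simp only: e)
  also have "\<dots> = (\<integral>\<^sup>+z. f (A (B z)) \<partial>lborel)"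
    using nn_integral_shear(1)[of "\<lambda>z. f (A (B z))" k] by (simp add: A_def)
  also have "\<dots> = (\<integral>\<^sup>+z. f (A z) \<partial>lborel)"
    using nn_integral_shear(2)[of "\<lambda>z. f (A z)" "sin t"] by (simp add: B_def)
  also have "\<dots> = (\<integral>\<^sup>+z. f z \<partial>lborel)"
    using nn_integral_shear(1)[of f k] by (simp add: A_def)
  finally show ?thesis .
qed

text \<open>The image of Lebesgue measure under exp is dy / y: substitution on each interval from -n
  to n, then monotone convergence.\<close>

lemma distr_exp: "distr lborel borel exp = density lborel (\<lambda>y::real. indicator {0<..} y * ennreal (1 / y))"
proof (rule measure_eqI)
  fix A :: "real set" assume "A \<in> sets (distr lborel borel exp)"
  then have [measurable]: "A \<in> sets borel" by simp
  have sub: "(\<integral>\<^sup>+t. indicator A (exp t) * indicator {- real n..real n} t \<partial>lborel)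
     = (\<integral>\<^sup>+y. indicator A y * ennreal (1 / y) * indicator {exp (- real n)..exp (real n)} y \<partial>lborel)" for n :: nat
  proof -
    have "(\<integral>\<^sup>+y. ennreal (indicator A y / y * indicator {exp (- real n)..exp (real n)} y) \<partial>lborel)
        = (\<integral>\<^sup>+t. ennreal (indicator A (exp t) / exp t * exp t * indicator {- real n..real n} t) \<partial>lborel)"
      by (rule nn_integral_substitution) (auto intro!: derivative_eq_intros continuous_intros simp: set_borel_measurable_def)
    also have "\<dots> = (\<integral>\<^sup>+t. indicator A (exp t) * indicator {- real n..real n} t \<partial>lborel)"
      by (intro nn_integral_cong) (auto simp: indicator_def)
    also have "(\<integral>\<^sup>+y. ennreal (indicator A y / y * indicator {exp (- real n)..exp (real n)} y) \<partial>lborel)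
       = (\<integral>\<^sup>+y. indicator A y * ennreal (1 / y) * indicator {exp (- real n)..exp (real n)} y \<partial>lborel)"
      by (intro nn_integral_cong) (auto simp: indicator_def)
    finally show ?thesis by simp
  qed
  have s1: "(SUP n::nat. indicator {- real n..real n} t :: ennreal) = 1" for t
  proof (rule antisym)
    obtain n :: nat where "\<bar>t\<bar> \<le> real n" using real_arch_simple by blast
    then have "(1::ennreal) = indicator {- real n..real n} t" by (auto simp: indicator_def)
    also have "\<dots> \<le> (SUP n::nat. indicator {- real n..real n} t)" by (rule SUP_upper) simp
    finally show "1 \<le> (SUP n::nat. indicator {- real n..real n} t :: ennreal)" .
  qed (auto intro!: SUP_least simp: indicator_def)
  have s2: "(SUP n::nat. indicator {exp (- real n)..exp (real n)} y :: ennreal) = indicator {0<..} y" for y :: real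
  proof (cases "0 < y")
    case True
    obtain n :: nat where "\<bar>ln y\<bar> \<le> real n" using real_arch_simple by blast
    then have "- real n \<le> ln y" "ln y \<le> real n" by auto
    then have "exp (- real n) \<le> y" "y \<le> exp (real n)"
      using True by (metis exp_le_cancel_iff exp_ln)+
    then have "(1::ennreal) = indicator {exp (- real n)..exp (real n)} y" by (auto simp: indicator_def)
    also have "\<dots> \<le> (SUP n::nat. indicator {exp (- real n)..exp (real n)} y)" by (rule SUP_upper) simp
    finally have "1 \<le> (SUP n::nat. indicator {exp (- real n)..exp (real n)} y :: ennreal)" .
    moreover have "(SUP n::nat. indicator {exp (- real n)..exp (real n)} y) \<le> (1::ennreal)"
      by (intro SUP_least) (simp add: indicator_def)
    moreover have "indicator {0<..} y = (1::ennreal)" using True by simp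
    ultimately show ?thesis by (metis antisym)
  next
    case False
    then have "y \<notin> {exp (- real n)..exp (real n)}" for n :: nat using exp_gt_zero[of "- real n"] by (auto simp del: exp_gt_zero)
    then show ?thesis using False by simp
  qed
  have m: "(exp :: real \<Rightarrow> real) -` A \<in> sets borel"
    using measurable_sets[of "exp :: real \<Rightarrow> real" borel borel A] by simp
  have "emeasure (distr lborel borel exp) A = emeasure lborel (exp -` A)"
    by (subst emeasure_distr) auto
  also have "\<dots> = (\<integral>\<^sup>+t. indicator (exp -` A) t \<partial>lborel)" using m by simp
  also have "\<dots> = (\<integral>\<^sup>+t. indicator A (exp t) \<partial>lborel)"
    by (intro nn_integral_cong) (simp add: indicator_def)
  also have "\<dots> = (\<integral>\<^sup>+t. (SUP n::nat. indicator A (exp t) * indicator {- real n..real n} t) \<partial>lborel)"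
    by (simp add: SUP_mult_left_ennreal[symmetric] s1)
  also have "\<dots> = (SUP n::nat. \<integral>\<^sup>+t. indicator A (exp t) * indicator {- real n..real n} t \<partial>lborel)"
    by (intro nn_integral_monotone_convergence_SUP)
      (auto simp: incseq_def le_fun_def intro!: mult_left_mono split: split_indicator)
  also have "\<dots> = (SUP n. \<integral>\<^sup>+y. indicator A y * ennreal (1 / y) * indicator {exp (- real n)..exp (real n)} y \<partial>lborel)"
    by (simp only: sub)
  also have "\<dots> = (\<integral>\<^sup>+y. (SUP n. indicator A y * ennreal (1 / y) * indicator {exp (- real n)..exp (real n)} y) \<partial>lborel)"
  proof (intro nn_integral_monotone_convergence_SUP[symmetric])
    have "indicator {exp (- real m)..exp (real m)} y \<le> (indicator {exp (- real n)..exp (real n)} y :: ennreal)"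
      if "m \<le> n" for m n :: nat and y :: real
    proof -
      have "exp (- real n) \<le> exp (- real m)" "exp (real m) \<le> exp (real n)" using that by simp_all
      then show ?thesis by (intro indicator_leI) (auto simp del: exp_le_cancel_iff)
    qed
    then show "incseq (\<lambda>i x. indicator A x * ennreal (1 / x) * indicator {exp (- real i)..exp (real i)} x)"
      by (auto simp: incseq_def le_fun_def intro!: mult_left_mono)
  qed simp
  also have "\<dots> = (\<integral>\<^sup>+y. indicator {0<..} y * ennreal (1 / y) * indicator A y \<partial>lborel)"
    by (simp add: SUP_mult_left_ennreal[symmetric] s2 mult_ac)
  also have "\<dots> = emeasure (density lborel (\<lambda>y::real. indicator {0<..} y * ennreal (1 / y))) A"
    by (subst emeasure_density) auto
  finally show "emeasure (distr lborel borel exp) A = emeasure (density lborel (\<lambda>y::real. indicator {0<..} y * ennreal (1 / y))) A" .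
qed simp

lemma nn_integral_dx_over_x:
  assumes [measurable]: "h \<in> borel_measurable borel"
  shows "(\<integral>\<^sup>+y. indicator {0<..} y * ennreal (1 / y) * h y \<partial>lborel) = (\<integral>\<^sup>+t. h (exp t) \<partial>lborel)"
proof -
  have "(\<integral>\<^sup>+t. h (exp t) \<partial>lborel) = (\<integral>\<^sup>+y. h y \<partial>distr lborel borel exp)"
    by (subst nn_integral_distr) auto
  also have "\<dots> = (\<integral>\<^sup>+y. indicator {0<..} y * ennreal (1 / y) * h y \<partial>lborel)"
    unfolding distr_exp by (subst nn_integral_density) auto
  finally show ?thesis by simp
qed

text \<open>In the variable ln y the map is a reflection and a translation, both preserving Lebesgue
  measure.\<close>

lemma nn_integral_dx_over_x_invert:
  assumes [measurable]: "h \<in> borel_measurable borel" and c: "0 < c"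
  shows "(\<integral>\<^sup>+y. indicator {0<..} y * ennreal (1 / y) * h (c / y) \<partial>lborel)
     = (\<integral>\<^sup>+y. indicator {0<..} y * ennreal (1 / y) * h y \<partial>lborel)"
proof -
  have "(\<integral>\<^sup>+y. indicator {0<..} y * ennreal (1 / y) * h (c / y) \<partial>lborel) = (\<integral>\<^sup>+t. h (c / exp t) \<partial>lborel)"
    by (rule nn_integral_dx_over_x) measurable
  also have "\<dots> = (\<integral>\<^sup>+t. h (exp (ln c + - 1 * t)) \<partial>lborel)"
    using c by (simp add: exp_diff divide_inverse)
  also have "\<dots> = (\<integral>\<^sup>+t. h (exp t) \<partial>lborel)"
    using nn_integral_real_affine[of "\<lambda>t. h (exp t)" "-1" "ln c"] by simp
  also have "\<dots> = (\<integral>\<^sup>+y. indicator {0<..} y * ennreal (1 / y) * h y \<partial>lborel)"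
    by (rule nn_integral_dx_over_x[symmetric]) measurable
  finally show ?thesis .
qed

section \<open>Hyperbolic area and its invariance\<close>

definition hyp :: "complex measure" where
  "hyp = density lborel (\<lambda>z. indicator uhp z * ennreal (1 / (Im z)\<^sup>2))"

lemma uhp_borel [measurable]: "uhp \<in> sets borel" using open_uhp by simp

lemma sets_hyp [measurable_cong, simp]: "sets hyp = sets borel" by (simp add: hyp_def)
lemma space_hyp [simp]: "space hyp = UNIV" by (simp add: hyp_def)

lemma nn_integral_hyp:
  "f \<in> borel_measurable borel \<Longrightarrow> (\<integral>\<^sup>+z. f z \<partial>hyp) = (\<integral>\<^sup>+z. indicator uhp z * ennreal (1 / (Im z)\<^sup>2) * f z \<partial>lborel)"
  unfolding hyp_def by (subst nn_integral_density) auto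

lemma sigma_finite_hyp: "sigma_finite_measure hyp"
  unfolding hyp_def
  by (subst sigma_finite_measure.sigma_finite_iff_density_finite[OF sigma_finite_lborel])
     (auto simp: ennreal_mult_eq_top_iff split: split_indicator)

interpretation hyp: sigma_finite_measure hyp by (rule sigma_finite_hyp)
interpretation hyp_pair: pair_sigma_finite hyp hyp ..

text \<open>With x = y \<xi> the density dx dy / y^2 becomes d\<xi> dy / y. These coordinates are
  chosen because the inversion acts on them one variable at a time, so no change of variables in the
  plane is required.\<close>

lemma nn_integral_hyp_coords:
  assumes [measurable]: "f \<in> borel_measurable borel"
  shows "(\<integral>\<^sup>+z. f z \<partial>hyp) = (\<integral>\<^sup>+\<xi>. \<integral>\<^sup>+y. indicator {0<..} y * ennreal (1 / y) * f (of_real y * Complex \<xi> 1) \<partial>lborel \<partial>lborel)"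
proof -
  have "(\<integral>\<^sup>+z. f z \<partial>hyp) = (\<integral>\<^sup>+y. \<integral>\<^sup>+x. indicator {0<..} y * ennreal (1 / y\<^sup>2) * f (Complex x y) \<partial>lborel \<partial>lborel)"
    unfolding nn_integral_hyp[OF assms] by (subst nn_integral_complex) (auto simp: indicator_def)
  also have "\<dots> = (\<integral>\<^sup>+y. \<integral>\<^sup>+\<xi>. indicator {0<..} y * ennreal (1 / y) * f (of_real y * Complex \<xi> 1) \<partial>lborel \<partial>lborel)"
  proof (rule nn_integral_cong)
    fix y :: real
    show "(\<integral>\<^sup>+x. indicator {0<..} y * ennreal (1 / y\<^sup>2) * f (Complex x y) \<partial>lborel)
       = (\<integral>\<^sup>+\<xi>. indicator {0<..} y * ennreal (1 / y) * f (of_real y * Complex \<xi> 1) \<partial>lborel)"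
    proof (cases "0 < y")
      case True
      have "(\<integral>\<^sup>+x. indicator {0<..} y * ennreal (1 / y\<^sup>2) * f (Complex x y) \<partial>lborel)
        = ennreal y * (\<integral>\<^sup>+\<xi>. ennreal (1 / y\<^sup>2) * f (Complex (y * \<xi>) y) \<partial>lborel)"
        using nn_integral_real_affine[of "\<lambda>x. ennreal (1 / y\<^sup>2) * f (Complex x y)" y 0] True by simp
      also have "\<dots> = (\<integral>\<^sup>+\<xi>. ennreal y * (ennreal (1 / y\<^sup>2) * f (Complex (y * \<xi>) y)) \<partial>lborel)"
        by (rule nn_integral_cmult[symmetric]) measurable
      also have "\<dots> = (\<integral>\<^sup>+\<xi>. indicator {0<..} y * ennreal (1 / y) * f (of_real y * Complex \<xi> 1) \<partial>lborel)"
      proof (rule nn_integral_cong)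
        fix \<xi>
        have "ennreal y * ennreal (1 / y\<^sup>2) = ennreal (1 / y)"
          using True by (subst ennreal_mult[symmetric]) (auto simp: power2_eq_square)
        moreover have "of_real y * Complex \<xi> 1 = Complex (y * \<xi>) y" by (simp add: complex_eq_iff)
        ultimately show "ennreal y * (ennreal (1 / y\<^sup>2) * f (Complex (y * \<xi>) y)) =
           indicator {0<..} y * ennreal (1 / y) * f (of_real y * Complex \<xi> 1)"
          using True by (simp add: mult.assoc[symmetric])
      qed
      finally show ?thesis .
    qed simp
  qed
  also have "\<dots> = (\<integral>\<^sup>+\<xi>. \<integral>\<^sup>+y. indicator {0<..} y * ennreal (1 / y) * f (of_real y * Complex \<xi> 1) \<partial>lborel \<partial>lborel)"
    by (rule lborel_pair.Fubini') measurable
  finally show ?thesis .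
qed

text \<open>The inversion sends y (\<xi> + \<i>) to (c / y) (- \<xi> + \<i>) with c = 1 / (1 +
  \<xi>^2): an inversion of y in each fibre, followed by the reflection of \<xi>.\<close>

lemma nn_integral_hyp_inversion:
  assumes [measurable]: "f \<in> borel_measurable borel"
  shows "(\<integral>\<^sup>+z. f (- 1 / z) \<partial>hyp) = (\<integral>\<^sup>+z. f z \<partial>hyp)"
proof -
  have "(\<integral>\<^sup>+z. f (- 1 / z) \<partial>hyp) = (\<integral>\<^sup>+\<xi>. \<integral>\<^sup>+y. indicator {0<..} y * ennreal (1 / y) * f (- 1 / (of_real y * Complex \<xi> 1)) \<partial>lborel \<partial>lborel)"
    by (rule nn_integral_hyp_coords) measurable
  also have "\<dots> = (\<integral>\<^sup>+\<xi>. \<integral>\<^sup>+y. indicator {0<..} y * ennreal (1 / y) * f (of_real y * Complex (- \<xi>) 1) \<partial>lborel \<partial>lborel)"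
  proof (rule nn_integral_cong)
    fix \<xi> :: real
    define c where "c = 1 / (1 + \<xi>\<^sup>2)"
    have p: "0 < 1 + \<xi>\<^sup>2" by (simp add: add_pos_nonneg)
    then have c: "0 < c" by (simp add: c_def)
    have "- 1 / (of_real y * Complex \<xi> 1) = of_real (c / y) * Complex (- \<xi>) 1" for y
    proof -
      have "Complex \<xi> 1 * Complex (- \<xi>) 1 = - of_real (1 + \<xi>\<^sup>2)"
        by (simp add: complex_eq_iff power2_eq_square)
      then have "Complex \<xi> 1 * (of_real c * Complex (- \<xi>) 1) = - of_real (c * (1 + \<xi>\<^sup>2))"
        by (simp only: mult.left_commute[of "Complex \<xi> 1"] of_real_mult mult_minus_right)
      moreover have "c * (1 + \<xi>\<^sup>2) = 1" using p by (simp add: c_def)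
      ultimately have "Complex \<xi> 1 * (of_real c * Complex (- \<xi>) 1) = - 1" by simp
      moreover have "Complex \<xi> 1 \<noteq> 0" by (simp add: complex_eq_iff)
      ultimately have "of_real c * Complex (- \<xi>) 1 = - 1 / Complex \<xi> 1" by (simp add: field_simps)
      then show ?thesis by (metis divide_divide_eq_left mult.commute of_real_divide times_divide_eq_left)
    qed
    then show "(\<integral>\<^sup>+y. indicator {0<..} y * ennreal (1 / y) * f (- 1 / (of_real y * Complex \<xi> 1)) \<partial>lborel)
      = (\<integral>\<^sup>+y. indicator {0<..} y * ennreal (1 / y) * f (of_real y * Complex (- \<xi>) 1) \<partial>lborel)"
      using nn_integral_dx_over_x_invert[of "\<lambda>s. f (of_real s * Complex (- \<xi>) 1)", OF _ c] by simp
  qed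
  also have "\<dots> = (\<integral>\<^sup>+\<xi>. \<integral>\<^sup>+y. indicator {0<..} y * ennreal (1 / y) * f (of_real y * Complex \<xi> 1) \<partial>lborel \<partial>lborel)"
    using nn_integral_real_affine[of "\<lambda>\<xi>. \<integral>\<^sup>+y. indicator {0<..} y * ennreal (1 / y) * f (of_real y * Complex \<xi> 1) \<partial>lborel" "-1" 0]
    by simp
  also have "\<dots> = (\<integral>\<^sup>+z. f z \<partial>hyp)" by (rule nn_integral_hyp_coords[OF assms, symmetric])
  finally show ?thesis .
qed

lemma nn_integral_hyp_affine:
  assumes [measurable]: "f \<in> borel_measurable borel" and a: "0 < a"
  shows "(\<integral>\<^sup>+z. f (of_real b + of_real a * z) \<partial>hyp) = (\<integral>\<^sup>+z. f z \<partial>hyp)"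
proof -
  have "(\<integral>\<^sup>+z. f z \<partial>hyp) = ennreal (a\<^sup>2) * (\<integral>\<^sup>+z. indicator uhp (of_real b + of_real a * z) * ennreal (1 / (Im (of_real b + of_real a * z))\<^sup>2) * f (of_real b + of_real a * z) \<partial>lborel)"
    unfolding nn_integral_hyp[OF assms(1)] using a by (intro nn_integral_complex_affine) auto
  also have "\<dots> = (\<integral>\<^sup>+z. ennreal (a\<^sup>2) * (indicator uhp (of_real b + of_real a * z) * ennreal (1 / (Im (of_real b + of_real a * z))\<^sup>2) * f (of_real b + of_real a * z)) \<partial>lborel)"
    by (rule nn_integral_cmult[symmetric]) measurable
  also have "\<dots> = (\<integral>\<^sup>+z. indicator uhp z * ennreal (1 / (Im z)\<^sup>2) * f (of_real b + of_real a * z) \<partial>lborel)"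
  proof (rule nn_integral_cong)
    fix z
    show "ennreal (a\<^sup>2) * (indicator uhp (of_real b + of_real a * z) * ennreal (1 / (Im (of_real b + of_real a * z))\<^sup>2) * f (of_real b + of_real a * z))
       = indicator uhp z * ennreal (1 / (Im z)\<^sup>2) * f (of_real b + of_real a * z)"
    proof (cases "0 < Im z")
      case True
      have "ennreal (a\<^sup>2) * ennreal (1 / (Im (of_real b + of_real a * z))\<^sup>2) = ennreal (1 / (Im z)\<^sup>2)"
        using a True by (subst ennreal_mult[symmetric]) (auto simp: power_mult_distrib)
      then show ?thesis using True a by (simp add: mult.assoc[symmetric])
    next
      case False
      then have "\<not> 0 < a * Im z" using a by (simp add: zero_less_mult_iff)
      then show ?thesis using False by simp
    qed
  qed
  also have "\<dots> = (\<integral>\<^sup>+z. f (of_real b + of_real a * z) \<partial>hyp)"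
    by (rule nn_integral_hyp[symmetric]) measurable
  finally show ?thesis by simp
qed

lemma nn_integral_hyp_cong:
  assumes "f \<in> borel_measurable borel" "g \<in> borel_measurable borel" "\<And>z. 0 < Im z \<Longrightarrow> f z = g z"
  shows "(\<integral>\<^sup>+z. f z \<partial>hyp) = (\<integral>\<^sup>+z. g z \<partial>hyp)"
  unfolding nn_integral_hyp[OF assms(1)] nn_integral_hyp[OF assms(2)]
  using assms(3) by (intro nn_integral_cong) (auto split: split_indicator)

lemma iso_measurable [measurable_dest]: "hyp_isometry m \<Longrightarrow> m \<in> borel_measurable borel"
  unfolding hyp_isometry_def by auto

text \<open>For c = 0 the map is affine; otherwise it is a translation, the inversion and an affine
  map in succession.\<close>

theorem nn_integral_hyp_isometry:
  assumes [measurable]: "f \<in> borel_measurable borel" and m: "hyp_isometry m"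
  shows "(\<integral>\<^sup>+z. f (m z) \<partial>hyp) = (\<integral>\<^sup>+z. f z \<partial>hyp)"
proof -
  obtain a b c d where ad: "a * d - b * c = 1" and md: "m = mob a b c d" using m hyp_isometry_mob by auto
  have [measurable]: "m \<in> borel_measurable borel" using m by (rule iso_measurable)
  show ?thesis
  proof (cases "c = 0")
    case True
    then have "d \<noteq> 0" using ad by auto
    then have d: "d \<noteq> 0" "a = 1 / d" using ad True by (simp_all add: eq_divide_eq)
    have "m z = of_real (b / d) + of_real (1 / d\<^sup>2) * z" for z
      unfolding md mob_def using d True by (simp add: add_divide_distrib power2_eq_square)
    then show ?thesis using nn_integral_hyp_affine[of f "1 / d\<^sup>2" "b / d"] d by simp
  next
    case False
    have e: "m z = of_real (a / c) + of_real (1 / c\<^sup>2) * (- 1 / (of_real (d / c) + of_real 1 * z))" if z: "0 < Im z" for z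
    proof -
      define w where "w = of_real c * z + of_real d"
      have w: "w \<noteq> 0" unfolding w_def by (rule mob_denom_nz[OF ad z])
      have c: "complex_of_real c \<noteq> 0" using False by simp
      have "of_real (d / c) + of_real 1 * z = w / of_real c" using c by (simp add: w_def field_simps)
      then have r: "of_real (a / c) + of_real (1 / c\<^sup>2) * (- 1 / (of_real (d / c) + of_real 1 * z)) = (of_real a * w - 1) / (of_real c * w)"
        using c w by (simp add: field_simps power2_eq_square)
      have "of_real c * (of_real a * z + of_real b) = of_real a * w - complex_of_real (a * d - b * c)"
        by (simp add: w_def algebra_simps)
      then have "of_real a * w - 1 = of_real c * (of_real a * z + of_real b)" by (simp add: ad)
      then show ?thesis unfolding r using c by (simp add: md mob_def w_def)
    qed
    have "(\<integral>\<^sup>+z. f (m z) \<partial>hyp) = (\<integral>\<^sup>+z. f (of_real (a / c) + of_real (1 / c\<^sup>2) * (- 1 / (of_real (d / c) + of_real 1 * z))) \<partial>hyp)"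
      by (rule nn_integral_hyp_cong) (measurable, measurable, use e in simp)
    also have "\<dots> = (\<integral>\<^sup>+z. f (of_real (a / c) + of_real (1 / c\<^sup>2) * (- 1 / z)) \<partial>hyp)"
      by (rule nn_integral_hyp_affine[of "\<lambda>z. f (of_real (a / c) + of_real (1 / c\<^sup>2) * (- 1 / z))", OF _ zero_less_one]) measurable
    also have "\<dots> = (\<integral>\<^sup>+z. f (of_real (a / c) + of_real (1 / c\<^sup>2) * z) \<partial>hyp)"
      by (rule nn_integral_hyp_inversion[of "\<lambda>z. f (of_real (a / c) + of_real (1 / c\<^sup>2) * z)"]) measurable
    also have "\<dots> = (\<integral>\<^sup>+z. f z \<partial>hyp)"
      by (rule nn_integral_hyp_affine) (measurable, use False in simp)
    finally show ?thesis .
  qed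
qed

lemma nn_integral_circle_rotate:
  assumes [measurable]: "f \<in> borel_measurable borel" and w: "cmod w = 1"
  shows "(\<integral>\<^sup>+t\<in>{0..2 * pi}. f (cis t * w) \<partial>lborel) = (\<integral>\<^sup>+t\<in>{0..2 * pi}. f (cis t) \<partial>lborel)"
proof -
  define s where "s = Arg2pi w"
  have s: "0 \<le> s" "s < 2 * pi" by (simp_all add: s_def Arg2pi_ge_0 Arg2pi_lt_2pi)
  have ws: "w = cis s" using Arg2pi_eq[of w] w by (simp add: s_def cis_conv_exp mult.commute)
  define F where "F t = f (cis t)" for t
  have [measurable]: "cis \<in> borel_measurable borel"
    by (intro borel_measurable_continuous_onI continuous_intros)
  have Fm [measurable]: "F \<in> borel_measurable borel" unfolding F_def[abs_def] by measurable
  have per: "F (t + 2 * pi) = F t" for t by (simp add: F_def cis.ctr)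
  have tr: "(\<integral>\<^sup>+t. g (t + c) \<partial>lborel) = (\<integral>\<^sup>+t. g t \<partial>lborel)" if "g \<in> borel_measurable borel" for g and c :: real
    using nn_integral_real_affine[OF that, of 1 c] by (simp add: add.commute)
  have "(\<integral>\<^sup>+t\<in>{0..2 * pi}. f (cis t * w) \<partial>lborel) = (\<integral>\<^sup>+t. F (t + s) * indicator {s..2 * pi + s} (t + s) \<partial>lborel)"
    by (intro nn_integral_cong) (auto simp: F_def ws cis_mult split: split_indicator)
  also have "\<dots> = (\<integral>\<^sup>+t. F t * indicator {s..2 * pi + s} t \<partial>lborel)"
    by (rule tr[of "\<lambda>t. F t * indicator {s..2 * pi + s} t"]) measurable
  also have "\<dots> = (\<integral>\<^sup>+t. F t * indicator {s..2 * pi} t + F t * indicator {2 * pi<..2 * pi + s} t \<partial>lborel)"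
    using s by (intro nn_integral_cong) (auto split: split_indicator)
  also have "\<dots> = (\<integral>\<^sup>+t. F t * indicator {s..2 * pi} t \<partial>lborel) + (\<integral>\<^sup>+t. F t * indicator {2 * pi<..2 * pi + s} t \<partial>lborel)"
    by (rule nn_integral_add) measurable
  also have "(\<integral>\<^sup>+t. F t * indicator {2 * pi<..2 * pi + s} t \<partial>lborel) = (\<integral>\<^sup>+t. F (t + 2 * pi) * indicator {2 * pi<..2 * pi + s} (t + 2 * pi) \<partial>lborel)"
    by (rule tr[of "\<lambda>t. F t * indicator {2 * pi<..2 * pi + s} t", symmetric]) measurable
  also have "\<dots> = (\<integral>\<^sup>+t. F t * indicator {0<..s} t \<partial>lborel)"
    by (intro nn_integral_cong) (auto simp: per split: split_indicator)
  also have "(\<integral>\<^sup>+t. F t * indicator {s..2 * pi} t \<partial>lborel) + (\<integral>\<^sup>+t. F t * indicator {0<..s} t \<partial>lborel)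
     = (\<integral>\<^sup>+t. F t * indicator {s..2 * pi} t + F t * indicator {0<..s} t \<partial>lborel)"
    by (rule nn_integral_add[symmetric]) measurable
  also have "\<dots> = (\<integral>\<^sup>+t. F t * indicator {0..2 * pi} t \<partial>lborel)"
  proof (rule nn_integral_cong_AE)
    have "AE t in lborel. t \<noteq> (0::real) \<and> t \<noteq> s" using AE_lborel_singleton[of 0] AE_lborel_singleton[of s] by eventually_elim simp
    then show "AE t in lborel. F t * indicator {s..2 * pi} t + F t * indicator {0<..s} t = F t * indicator {0..2 * pi} t"
      by eventually_elim (use s in \<open>auto split: split_indicator\<close>)
  qed
  finally show ?thesis by (simp add: F_def)
qed

interpretation hyp_lborel: pair_sigma_finite hyp "lborel :: real measure" ..

section \<open>An isometry invariant averaging kernel\<close>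

text \<open>The pseudohyperbolic distance, tanh of half the hyperbolic distance.\<close>

definition pd :: "complex \<Rightarrow> complex \<Rightarrow> real" where "pd x y = cmod (x - y) / cmod (x - cnj y)"
definition cay :: "complex \<Rightarrow> complex" where "cay w = (w - \<i>) / (w + \<i>)"
definition icay :: "complex \<Rightarrow> complex" where "icay \<zeta> = \<i> * (1 + \<zeta>) / (1 - \<zeta>)"
text \<open>The hyperbolic rotation about \<i>; the half angles make it multiplication by
  \<open>cis \<theta>\<close> after the Cayley transform \<open>cay\<close>.\<close>

definition rot :: "real \<Rightarrow> complex \<Rightarrow> complex" where
  "rot \<theta> = mob (cos (\<theta> / 2)) (sin (\<theta> / 2)) (- sin (\<theta> / 2)) (cos (\<theta> / 2))"
text \<open>The isometry that carries \<i> to x, with inverse \<open>affi x\<close>; it moves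
  averages about \<i> to averages about x.\<close>

definition aff :: "complex \<Rightarrow> complex \<Rightarrow> complex" where "aff x w = of_real (Re x) + of_real (Im x) * w"
definition affi :: "complex \<Rightarrow> complex \<Rightarrow> complex" where "affi x y = (y - of_real (Re x)) / of_real (Im x)"

lemma pd_nonneg [simp]: "0 \<le> pd x y" by (simp add: pd_def)

lemma pd_commute: "pd x y = pd y x"
proof -
  have "cmod (x - cnj y) = cmod (y - cnj x)"
    by (metis complex_cnj_cnj complex_cnj_diff complex_mod_cnj norm_minus_commute)
  then show ?thesis by (simp add: pd_def norm_minus_commute)
qed

lemma pd_denom: assumes "0 < Im x" "0 < Im y" shows "Im x \<le> cmod (x - cnj y)" "x - cnj y \<noteq> 0"
proof -
  have "Im x + Im y \<le> cmod (x - cnj y)" using abs_Im_le_cmod[of "x - cnj y"] by simp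
  then show "Im x \<le> cmod (x - cnj y)" using assms by linarith
  then show "x - cnj y \<noteq> 0" using assms by auto
qed

lemma pd_iso:
  assumes m: "hyp_isometry m" and x: "0 < Im x" and y: "0 < Im y"
  shows "pd (m x) (m y) = pd x y"
proof -
  obtain a b c d where ad: "a * d - b * c = 1" and md: "m = mob a b c d" using m hyp_isometry_mob by auto
  define X Y where "X = of_real c * x + of_real d" and "Y = of_real c * y + of_real d"
  have X: "X \<noteq> 0" and Y: "Y \<noteq> 0" using mob_denom_nz[OF ad] x y by (auto simp: X_def Y_def)
  have det: "complex_of_real a * of_real d - of_real b * of_real c = 1"
    by (simp add: ad flip: of_real_mult of_real_diff)
  have "m x - m y = ((of_real a * x + of_real b) * Y - (of_real a * y + of_real b) * X) / (X * Y)"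
    using X Y by (simp add: md mob_def X_def Y_def diff_frac_eq)
  also have "(of_real a * x + of_real b) * Y - (of_real a * y + of_real b) * X
      = (complex_of_real a * of_real d - of_real b * of_real c) * (x - y)"
    by (simp add: X_def Y_def algebra_simps)
  finally have 1: "m x - m y = (x - y) / (X * Y)" by (simp add: det)
  have cY: "cnj Y \<noteq> 0" using Y by simp
  have "m x - cnj (m y) = ((of_real a * x + of_real b) * cnj Y - (of_real a * cnj y + of_real b) * X) / (X * cnj Y)"
    using X cY by (simp add: md mob_def X_def Y_def diff_frac_eq)
  also have "(of_real a * x + of_real b) * cnj Y - (of_real a * cnj y + of_real b) * X
      = (complex_of_real a * of_real d - of_real b * of_real c) * (x - cnj y)"
    by (simp add: X_def Y_def algebra_simps)
  finally have 2: "m x - cnj (m y) = (x - cnj y) / (X * cnj Y)" by (simp add: det)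
  show ?thesis unfolding pd_def 1 2 using X Y by (simp add: norm_divide norm_mult)
qed

lemma iso_rot: "hyp_isometry (rot \<theta>)"
  unfolding hyp_isometry_mob rot_def
  by (intro exI[of _ "cos (\<theta> / 2)"] exI[of _ "sin (\<theta> / 2)"] exI[of _ "- sin (\<theta> / 2)"])
     (auto intro!: exI[of _ "cos (\<theta> / 2)"] simp: power2_eq_square[symmetric])

lemma rot_det: "cos (\<theta> / 2) * cos (\<theta> / 2) - sin (\<theta> / 2) * (- sin (\<theta> / 2)) = (1::real)"
  by (simp add: power2_eq_square[symmetric])

lemma rot_rot: assumes "0 < Im z" shows "rot \<theta> (rot (- \<theta>) z) = z"
proof -
  have d: "cos (- \<theta> / 2) * cos (- \<theta> / 2) - sin (- \<theta> / 2) * (- sin (- \<theta> / 2)) = 1"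
    by (simp add: power2_eq_square[symmetric])
  have "rot \<theta> (rot (- \<theta>) z) = mob 1 0 0 1 z"
    unfolding rot_def by (subst mob_comp[OF d assms]) (simp add: power2_eq_square[symmetric])
  then show ?thesis by simp
qed

lemma cay_rot: assumes "0 < Im z" shows "cay (rot \<theta> z) = cis \<theta> * cay z"
proof -
  define c s where "c = complex_of_real (cos (\<theta> / 2))" and "s = complex_of_real (sin (\<theta> / 2))"
  define D where "D = - s * z + c"
  have D: "D \<noteq> 0" using mob_denom_nz[OF rot_det assms] by (simp add: D_def c_def s_def)
  have r: "rot \<theta> z = (c * z + s) / D" by (simp add: rot_def mob_def D_def c_def s_def)
  have zi: "z + \<i> \<noteq> 0" using assms by (auto simp: complex_eq_iff)
  have e: "c + \<i> * s = cis (\<theta> / 2)" "c - \<i> * s = cis (- (\<theta> / 2))"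
    by (simp_all add: c_def s_def complex_eq_iff)
  have ce: "cis (\<theta> / 2) = cis \<theta> * cis (- (\<theta> / 2))" by (simp add: cis_mult)
  have n1: "(c * z + s) - \<i> * D = (c + \<i> * s) * (z - \<i>)" by (simp add: D_def algebra_simps)
  have n2: "(c * z + s) + \<i> * D = (c - \<i> * s) * (z + \<i>)" by (simp add: D_def algebra_simps)
  have "cay (rot \<theta> z) = ((c * z + s) - \<i> * D) / ((c * z + s) + \<i> * D)"
  proof -
    have "rot \<theta> z - \<i> = ((c * z + s) - \<i> * D) / D" "rot \<theta> z + \<i> = ((c * z + s) + \<i> * D) / D"
      using D by (simp_all add: r diff_divide_distrib add_divide_distrib)
    then show ?thesis using D by (simp add: cay_def)
  qed
  also have "\<dots> = cis \<theta> * cay z"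
    unfolding n1 n2 e ce by (simp add: cay_def)
  finally show ?thesis .
qed

lemma icay_cay: assumes "0 < Im w" shows "icay (cay w) = w"
proof -
  have w: "w + \<i> \<noteq> 0" using assms by (auto simp: complex_eq_iff)
  have "1 + cay w = 2 * w / (w + \<i>)" "1 - cay w = 2 * \<i> / (w + \<i>)"
    using w by (simp_all add: cay_def field_simps)
  then show ?thesis using w by (simp add: icay_def)
qed

lemma cay_icay: assumes "\<zeta> \<noteq> 1" shows "cay (icay \<zeta>) = \<zeta>"
proof -
  have n: "1 - \<zeta> \<noteq> 0" using assms by simp
  have "icay \<zeta> - \<i> = 2 * \<i> * \<zeta> / (1 - \<zeta>)" "icay \<zeta> + \<i> = 2 * \<i> / (1 - \<zeta>)"
    using n by (simp_all add: icay_def field_simps)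
  then show ?thesis using n by (simp add: cay_def)
qed

lemma iso_aff: assumes "0 < Im x" shows "hyp_isometry (aff x)"
proof -
  define q where "q = sqrt (Im x)"
  have q: "q * q = Im x" "q \<noteq> 0" using assms by (simp_all add: q_def)
  have "aff x = mob q (Re x / q) 0 (1 / q)"
  proof
    fix w
    have e: "complex_of_real (Im x) = of_real q * of_real q" by (simp only: of_real_mult[symmetric] q(1))
    have "mob q (Re x / q) 0 (1 / q) w = of_real q * (of_real q * w + of_real (Re x / q))"
      by (simp add: mob_def mult.commute)
    also have "\<dots> = of_real q * of_real q * w + of_real q * of_real (Re x / q)"
      by (simp only: distrib_left mult.assoc)
    also have "of_real q * of_real (Re x / q) = complex_of_real (Re x)" using q(2) by simp
    finally show "aff x w = mob q (Re x / q) 0 (1 / q) w" by (simp add: aff_def e add.commute)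
  qed
  moreover have "q * (1 / q) - (Re x / q) * 0 = 1" using q by simp
  ultimately show ?thesis unfolding hyp_isometry_mob by blast
qed

lemma affi_aff: "Im x \<noteq> 0 \<Longrightarrow> affi x (aff x w) = w" by (simp add: affi_def aff_def)
lemma aff_i: "aff x \<i> = x" by (simp add: aff_def complex_eq_iff)

lemma cay_affi: assumes "0 < Im x" shows "cmod (cay (affi x y)) = pd x y"
proof -
  define t where "t = complex_of_real (Im x)"
  have t: "t \<noteq> 0" using assms by (simp add: t_def)
  have "affi x y - \<i> = (y - x) / t" "affi x y + \<i> = (y - cnj x) / t"
    using t by (simp_all add: affi_def field_simps complex_eq_iff t_def)
  then have "cmod (cay (affi x y)) = pd y x" using t by (simp add: cay_def pd_def norm_divide)
  then show ?thesis by (simp add: pd_commute)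
qed

lemma Im_affi: "0 < Im x \<Longrightarrow> 0 < Im y \<Longrightarrow> 0 < Im (affi x y)"
  by (simp add: affi_def)

definition bump :: "real \<Rightarrow> complex \<Rightarrow> ennreal" where
  "bump r w = indicator (ball \<i> r) w * ennreal ((Im w)\<^sup>2)"

text \<open>\<open>kern r (pd x y)\<close> averages the indicator of the Euclidean disc about \<open>\<i>\<close> over hyperbolic rotations; the factor
  \<open>(Im w)\<^sup>2\<close> in \<open>bump\<close> turns hyperbolic into Euclidean area, so that averaging against the kernel is
  an average of Euclidean disc means.\<close>

definition kern :: "real \<Rightarrow> real \<Rightarrow> ennreal" where
  "kern r \<rho> = (\<integral>\<^sup>+\<theta>\<in>{0..2 * pi}. bump r (icay (cis \<theta> * of_real \<rho>)) \<partial>lborel)"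

definition disc_area :: "real \<Rightarrow> ennreal" where "disc_area r = emeasure lborel (ball \<i> r)"

lemma ball_borel [measurable]: "ball a r \<in> sets borel" for a :: complex
  by simp

lemma cis_measurable [measurable]: "cis \<in> borel_measurable borel"
  by (intro borel_measurable_continuous_onI continuous_intros)

lemma bump_measurable [measurable]: "bump r \<in> borel_measurable borel"
  unfolding bump_def[abs_def] by measurable

lemma icay_measurable [measurable]: "icay \<in> borel_measurable borel"
  unfolding icay_def[abs_def] by measurable

lemma kern_measurable [measurable]: "kern r \<in> borel_measurable borel"
  unfolding kern_def[abs_def] by measurable

lemma rot_measurable [measurable (raw)]:
  assumes [measurable]: "f \<in> borel_measurable M" "g \<in> borel_measurable M"
  shows "(\<lambda>x. rot (f x) (g x)) \<in> borel_measurable M"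
  unfolding rot_def mob_def by measurable

lemma aff_measurable [measurable (raw)]:
  assumes [measurable]: "f \<in> borel_measurable M" "g \<in> borel_measurable M"
  shows "(\<lambda>x. aff (f x) (g x)) \<in> borel_measurable M" "(\<lambda>x. affi (f x) (g x)) \<in> borel_measurable M"
  unfolding aff_def affi_def by measurable

lemma pd_measurable [measurable (raw)]:
  assumes [measurable]: "f \<in> borel_measurable M" "g \<in> borel_measurable M"
  shows "(\<lambda>x. pd (f x) (g x)) \<in> borel_measurable M"
proof -
  have [measurable]: "cnj \<in> borel_measurable borel" by (intro borel_measurable_continuous_onI continuous_intros)
  show ?thesis unfolding pd_def by measurable
qed

text \<open>The phase of \<open>cay v\<close> only shifts the angle of rotation, so after averaging
  only the modulus is left.\<close>

lemma kern_rot: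
  assumes v: "0 < Im v"
  shows "(\<integral>\<^sup>+\<theta>\<in>{0..2 * pi}. bump r (rot \<theta> v) \<partial>lborel) = kern r (cmod (cay v))"
proof -
  define w where "w = (if cay v = 0 then 1 else cay v / of_real (cmod (cay v)))"
  have w: "cmod w = 1" "cay v = w * of_real (cmod (cay v))" by (auto simp: w_def norm_divide)
  have "bump r (rot \<theta> v) = bump r (icay (cis \<theta> * w * of_real (cmod (cay v))))" for \<theta>
  proof -
    have "rot \<theta> v = icay (cay (rot \<theta> v))" using icay_cay[of "rot \<theta> v"] iso_Im[OF iso_rot v] by simp
    also have "cay (rot \<theta> v) = cis \<theta> * w * of_real (cmod (cay v))"
      using cay_rot[OF v, of \<theta>] w(2) by (simp add: mult.assoc)
    finally show ?thesis by simp
  qed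
  then have "(\<integral>\<^sup>+\<theta>\<in>{0..2 * pi}. bump r (rot \<theta> v) \<partial>lborel)
     = (\<integral>\<^sup>+\<theta>\<in>{0..2 * pi}. bump r (icay (cis \<theta> * w * of_real (cmod (cay v)))) \<partial>lborel)" by simp
  also have "\<dots> = kern r (cmod (cay v))"
    unfolding kern_def
    by (rule nn_integral_circle_rotate[OF _ w(1), of "\<lambda>z. bump r (icay (z * of_real (cmod (cay v))))"]) measurable
  finally show ?thesis .
qed

text \<open>The kernel is opened up as an average over rotations, the integrals are exchanged, and y
  is replaced by \<open>aff x (rot (- \<theta>) w)\<close>, which preserves area. The bound on r
  keeps the disc inside the half plane.\<close>

lemma kernel_integral:
  assumes [measurable]: "f \<in> borel_measurable borel" and x: "0 < Im x" and r: "r \<le> 1"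
  shows "(\<integral>\<^sup>+y. kern r (pd x y) * f y \<partial>hyp) =
    (\<integral>\<^sup>+\<theta>\<in>{0..2 * pi}. (\<integral>\<^sup>+w\<in>ball \<i> r. f (aff x (rot (- \<theta>) w)) \<partial>lborel) \<partial>lborel)"
proof -
  have "(\<integral>\<^sup>+y. kern r (pd x y) * f y \<partial>hyp) =
     (\<integral>\<^sup>+y. (\<integral>\<^sup>+\<theta>\<in>{0..2 * pi}. bump r (rot \<theta> (affi x y)) \<partial>lborel) * f y \<partial>hyp)"
    by (rule nn_integral_hyp_cong) (measurable, measurable, simp add: kern_rot Im_affi x cay_affi)
  also have "\<dots> = (\<integral>\<^sup>+y. \<integral>\<^sup>+\<theta>. bump r (rot \<theta> (affi x y)) * indicator {0..2 * pi} \<theta> * f y \<partial>lborel \<partial>hyp)"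
    by (subst nn_integral_multc[symmetric]) auto
  also have "\<dots> = (\<integral>\<^sup>+\<theta>. \<integral>\<^sup>+y. bump r (rot \<theta> (affi x y)) * indicator {0..2 * pi} \<theta> * f y \<partial>hyp \<partial>lborel)"
    by (rule hyp_lborel.Fubini'[symmetric]) measurable
  also have "\<dots> = (\<integral>\<^sup>+\<theta>. (\<integral>\<^sup>+w\<in>ball \<i> r. f (aff x (rot (- \<theta>) w)) \<partial>lborel) * indicator {0..2 * pi} \<theta> \<partial>lborel)"
  proof (rule nn_integral_cong)
    fix \<theta> :: real
    obtain m where m: "hyp_isometry m" "\<And>z. 0 < Im z \<Longrightarrow> m z = aff x (rot (- \<theta>) z)"
      using iso_comp[OF iso_rot[of "- \<theta>"] iso_aff[OF x]] by auto
    have [measurable]: "m \<in> borel_measurable borel" by (rule iso_measurable[OF m(1)])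
    have "(\<integral>\<^sup>+y. bump r (rot \<theta> (affi x y)) * indicator {0..2 * pi} \<theta> * f y \<partial>hyp)
       = (\<integral>\<^sup>+w. bump r (rot \<theta> (affi x (m w))) * indicator {0..2 * pi} \<theta> * f (m w) \<partial>hyp)"
      by (rule nn_integral_hyp_isometry[OF _ m(1), symmetric]) measurable
    also have "\<dots> = (\<integral>\<^sup>+w. bump r w * indicator {0..2 * pi} \<theta> * f (aff x (rot (- \<theta>) w)) \<partial>hyp)"
      by (rule nn_integral_hyp_cong) (measurable, measurable, use x in \<open>simp add: m(2) affi_aff rot_rot\<close>)
    also have "\<dots> = (\<integral>\<^sup>+w. indicator {0..2 * pi} \<theta> * (f (aff x (rot (- \<theta>) w)) * indicator (ball \<i> r) w) \<partial>lborel)"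
    proof (subst nn_integral_hyp, measurable, rule nn_integral_cong)
      fix w
      show "indicator uhp w * ennreal (1 / (Im w)\<^sup>2) * (bump r w * indicator {0..2 * pi} \<theta> * f (aff x (rot (- \<theta>) w))) =
        indicator {0..2 * pi} \<theta> * (f (aff x (rot (- \<theta>) w)) * indicator (ball \<i> r) w)"
      proof (cases "w \<in> ball \<i> r")
        case True
        have "\<bar>Im (\<i> - w)\<bar> < 1" using abs_Im_le_cmod[of "\<i> - w"] True r by (simp add: dist_norm)
        then have I: "0 < Im w" by simp
        have "ennreal (1 / (Im w)\<^sup>2) * ennreal ((Im w)\<^sup>2) = 1"
          using I by (subst ennreal_mult[symmetric]) auto
        then have "ennreal (1 / (Im w)\<^sup>2) * bump r w = 1" using True by (simp add: bump_def)
        then have "ennreal (1 / (Im w)\<^sup>2) * (bump r w * A * B) = A * B" for A B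
          by (metis mult.assoc mult_1)
        then show ?thesis using I True by simp
      qed (simp add: bump_def)
    qed
    also have "\<dots> = indicator {0..2 * pi} \<theta> * (\<integral>\<^sup>+w\<in>ball \<i> r. f (aff x (rot (- \<theta>) w)) \<partial>lborel)"
      by (rule nn_integral_cmult) measurable
    finally show "(\<integral>\<^sup>+y. bump r (rot \<theta> (affi x y)) * indicator {0..2 * pi} \<theta> * f y \<partial>hyp) =
       (\<integral>\<^sup>+w\<in>ball \<i> r. f (aff x (rot (- \<theta>) w)) \<partial>lborel) * indicator {0..2 * pi} \<theta>" by (simp add: mult.commute)
  qed
  finally show ?thesis .
qed

lemma kernel_total:
  assumes x: "0 < Im x" and r: "r \<le> 1"
  shows "(\<integral>\<^sup>+y. kern r (pd x y) \<partial>hyp) = disc_area r * ennreal (2 * pi)"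
proof -
  have "(\<integral>\<^sup>+y. kern r (pd x y) \<partial>hyp) = (\<integral>\<^sup>+\<theta>\<in>{0..2 * pi}. (\<integral>\<^sup>+w\<in>ball \<i> r. 1 \<partial>lborel) \<partial>lborel)"
    using kernel_integral[of "\<lambda>_. 1", OF _ x r] by simp
  also have "\<dots> = disc_area r * ennreal (2 * pi)"
    by (simp add: disc_area_def nn_integral_cmult_indicator)
  finally show ?thesis .
qed

text \<open>By \<open>kernel_integral\<close> the kernel mean is an average of disc means in
  isometric coordinates g centred at x. The distance formula for g is handed to the hypothesis so
  that it can be checked that g maps the disc close to x.\<close>

lemma kernel_super:
  assumes [measurable]: "f \<in> borel_measurable borel" and x: "0 < Im x" and r: "r \<le> 1"
    and super: "\<And>g. hyp_isometry g \<Longrightarrow> (\<And>w. 0 < Im w \<Longrightarrow> pd x (g w) = cmod (cay w)) \<Longrightarrow> g \<i> = x \<Longrightarrow>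
        (\<integral>\<^sup>+w\<in>ball \<i> r. f (g w) \<partial>lborel) \<le> disc_area r * f x"
  shows "(\<integral>\<^sup>+y. kern r (pd x y) * f y \<partial>hyp) \<le> disc_area r * f x * ennreal (2 * pi)"
proof -
  have "(\<integral>\<^sup>+w\<in>ball \<i> r. f (aff x (rot (- \<theta>) w)) \<partial>lborel) \<le> disc_area r * f x" for \<theta>
  proof -
    obtain m where m: "hyp_isometry m" "\<And>z. 0 < Im z \<Longrightarrow> m z = aff x (rot (- \<theta>) z)"
      using iso_comp[OF iso_rot[of "- \<theta>"] iso_aff[OF x]] by auto
    have "cay (rot (- \<theta>) \<i>) = 0" by (subst cay_rot) (simp_all add: cay_def)
    then have "rot (- \<theta>) \<i> = icay 0" using icay_cay[of "rot (- \<theta>) \<i>"] iso_Im[OF iso_rot, of \<i>] by simp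
    then have mi: "m \<i> = x" using m(2)[of \<i>] by (simp add: icay_def aff_i)
    have pdm: "pd x (m w) = cmod (cay w)" if w: "0 < Im w" for w
    proof -
      have "pd x (m w) = cmod (cay (affi x (m w)))" by (rule cay_affi[OF x, symmetric])
      also have "affi x (m w) = rot (- \<theta>) w" using m(2)[OF w] affi_aff[of x] x by simp
      also have "cmod (cay (rot (- \<theta>) w)) = cmod (cay w)" using cay_rot[OF w] by (simp add: norm_mult)
      finally show ?thesis .
    qed
    have "(\<integral>\<^sup>+w\<in>ball \<i> r. f (aff x (rot (- \<theta>) w)) \<partial>lborel) = (\<integral>\<^sup>+w\<in>ball \<i> r. f (m w) \<partial>lborel)"
    proof (rule nn_integral_cong)
      fix w
      have "0 < Im w" if "w \<in> ball \<i> r"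
        using abs_Im_le_cmod[of "\<i> - w"] that r by (auto simp: dist_norm)
      then show "f (aff x (rot (- \<theta>) w)) * indicator (ball \<i> r) w = f (m w) * indicator (ball \<i> r) w"
        using m(2)[of w] by (auto split: split_indicator)
    qed
    then show ?thesis using super[OF m(1) pdm mi] by simp
  qed
  then have "(\<integral>\<^sup>+\<theta>\<in>{0..2 * pi}. (\<integral>\<^sup>+w\<in>ball \<i> r. f (aff x (rot (- \<theta>) w)) \<partial>lborel) \<partial>lborel)
     \<le> (\<integral>\<^sup>+\<theta>\<in>{0..2 * pi}. disc_area r * f x \<partial>lborel)"
    by (intro nn_integral_mono mult_right_mono) auto
  then show ?thesis unfolding kernel_integral[OF assms(1) x r] by (simp add: nn_integral_cmult_indicator)
qed

text \<open>A point w of the disc has |w - \<i>| < r \<le> 1, hence |w + \<i>| \<ge> 1, and so its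
  pseudohyperbolic distance to \<i> is below r.\<close>

lemma kern_support:
  assumes "kern r \<rho> \<noteq> 0" "0 \<le> \<rho>" "r \<le> 1" shows "\<rho> < r"
proof (rule ccontr)
  assume n: "\<not> \<rho> < r"
  have "bump r (icay (cis \<theta> * of_real \<rho>)) = 0" for \<theta>
  proof (rule ccontr)
    define \<zeta> where "\<zeta> = cis \<theta> * of_real \<rho>"
    assume "\<not> ?thesis"
    then have b: "cmod (icay \<zeta> - \<i>) < r"
      by (auto simp: bump_def \<zeta>_def dist_norm norm_minus_commute split: split_indicator_asm)
    \<comment> \<open>By the convention for division \<open>icay 1\<close> is 0, which has distance
      1 from \<i>.\<close>
    then have "\<zeta> \<noteq> 1" using assms(3) by (auto simp: icay_def)
    then have "cay (icay \<zeta>) = \<zeta>" by (rule cay_icay)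
    then have \<rho>: "\<rho> = cmod (icay \<zeta> - \<i>) / cmod (icay \<zeta> + \<i>)"
      using assms(2) by (metis \<zeta>_def abs_of_nonneg cay_def mult_1 norm_cis norm_divide norm_mult norm_of_real)
    have "cmod (2 * \<i>) \<le> cmod (icay \<zeta> + \<i>) + cmod (icay \<zeta> - \<i>)"
      using norm_triangle_ineq4[of "icay \<zeta> + \<i>" "icay \<zeta> - \<i>"] by simp
    then have "1 \<le> cmod (icay \<zeta> + \<i>)" using b assms(3) by (simp add: norm_mult)
    then have "\<rho> \<le> cmod (icay \<zeta> - \<i>)" unfolding \<rho> by (simp add: divide_le_eq mult_le_cancel_left1)
    then show False using b n by simp
  qed
  then show False using assms(1) by (simp add: kern_def)
qed

text \<open>For \<rho> \<le> r / 4 \<le> 1 / 8 the rotated point is at distance at most 2 \<rho> /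
  (7 / 8) < r from \<i> at every angle. Its imaginary part is at least 1 / 2, so \<open>bump\<close>
  is at least 1 / 4 along the whole circle of length 2 pi.\<close>

lemma kern_lower:
  assumes "0 \<le> \<rho>" "\<rho> \<le> r / 4" "0 < r" "r \<le> 1 / 2" shows "ennreal (pi / 2) \<le> kern r \<rho>"
proof -
  have b: "ennreal (1 / 4) \<le> bump r (icay (cis \<theta> * of_real \<rho>))" for \<theta>
  proof -
    define \<zeta> where "\<zeta> = cis \<theta> * of_real \<rho>"
    have z: "cmod \<zeta> = \<rho>" using assms by (simp add: \<zeta>_def norm_mult)
    have "cmod 1 \<le> cmod (1 - \<zeta>) + cmod \<zeta>" using norm_triangle_ineq[of "1 - \<zeta>" \<zeta>] by simp
    then have d: "1 - \<rho> \<le> cmod (1 - \<zeta>)" using z by simp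
    have "1 - \<zeta> \<noteq> 0" using d assms by auto
    then have "icay \<zeta> - \<i> = 2 * \<i> * \<zeta> / (1 - \<zeta>)" by (simp add: icay_def field_simps)
    then have "cmod (icay \<zeta> - \<i>) = 2 * \<rho> / cmod (1 - \<zeta>)" by (simp add: norm_divide norm_mult z)
    also have "\<dots> \<le> 2 * \<rho> / (7 / 8)" using d assms by (intro divide_left_mono mult_pos_pos) auto
    also have "\<dots> < r" using assms by simp
    finally have lt: "cmod (icay \<zeta> - \<i>) < r" .
    then have "\<bar>Im (icay \<zeta> - \<i>)\<bar> < 1 / 2" using abs_Im_le_cmod[of "icay \<zeta> - \<i>"] assms by linarith
    then have "- (1 / 2) < Im (icay \<zeta> - \<i>)" unfolding abs_less_iff by linarith
    then have "1 / 2 \<le> Im (icay \<zeta>)" by simp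
    then have "(1 / 2)\<^sup>2 \<le> (Im (icay \<zeta>))\<^sup>2" by (intro power_mono) auto
    then have "1 / 4 \<le> (Im (icay \<zeta>))\<^sup>2" by (simp add: power2_eq_square)
    then show ?thesis using lt by (simp add: bump_def \<zeta>_def dist_norm norm_minus_commute ennreal_leI)
  qed
  have "ennreal (pi / 2) = ennreal (1 / 4) * ennreal (2 * pi)" by (subst ennreal_mult[symmetric]) auto
  also have "\<dots> = (\<integral>\<^sup>+\<theta>\<in>{0..2 * pi}. ennreal (1 / 4) \<partial>lborel)" by (simp add: nn_integral_cmult_indicator)
  also have "\<dots> \<le> kern r \<rho>" unfolding kern_def using b by (intro nn_integral_mono mult_right_mono) auto
  finally show ?thesis .
qed

lemma disc_area_le: assumes "0 \<le> r" shows "disc_area r \<le> ennreal (4 * r\<^sup>2)"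
proof -
  have "ball \<i> r \<subseteq> cbox (Complex (- r) (1 - r)) (Complex r (1 + r))"
  proof
    fix w assume "w \<in> ball \<i> r"
    then have "\<bar>Re (w - \<i>)\<bar> < r" "\<bar>Im (w - \<i>)\<bar> < r"
      using abs_Re_le_cmod[of "w - \<i>"] abs_Im_le_cmod[of "w - \<i>"] by (simp_all add: dist_norm norm_minus_commute)
    then show "w \<in> cbox (Complex (- r) (1 - r)) (Complex r (1 + r))"
      by (auto simp: in_cbox_complex_iff)
  qed
  then have "disc_area r \<le> emeasure lborel (cbox (Complex (- r) (1 - r)) (Complex r (1 + r)))"
    unfolding disc_area_def by (intro emeasure_mono) auto
  also have "\<dots> = ennreal (4 * r\<^sup>2)"
    using assms by (subst emeasure_lborel_cbox) (auto simp: Basis_complex_def inner_complex_def power2_eq_square)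
  finally show ?thesis .
qed

lemma disc_area_pos: "0 < r \<Longrightarrow> 0 < disc_area r"
  unfolding disc_area_def
  by (simp add: emeasure_ball)

text \<open>Polar coordinates are replaced by averaging over rotations of the disc: after exchanging
  the integrals, the inner one is a circle integral of radius |w|, to which the hypothesis
  applies.\<close>

lemma disc_mean:
  fixes f :: "complex \<Rightarrow> ennreal"
  assumes [measurable]: "f \<in> borel_measurable borel" and r: "0 < r"
    and circ: "\<And>\<rho>. 0 < \<rho> \<Longrightarrow> \<rho> < r \<Longrightarrow> (\<integral>\<^sup>+t\<in>{0..2 * pi}. f (a + of_real \<rho> * cis t) \<partial>lborel) \<le> ennreal (2 * pi) * f a"
  shows "(\<integral>\<^sup>+w\<in>ball a r. f w \<partial>lborel) \<le> emeasure lborel (ball a r) * f a"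
proof -
  define \<phi> where "\<phi> w = f (a + w) * indicator (ball 0 r) w" for w
  have [measurable]: "\<phi> \<in> borel_measurable borel" unfolding \<phi>_def[abs_def] by measurable
  have tr: "(\<integral>\<^sup>+w. g w \<partial>lborel) = (\<integral>\<^sup>+w. g (a + w) \<partial>lborel)" if "g \<in> borel_measurable borel" for g :: "complex \<Rightarrow> ennreal"
    using nn_integral_complex_affine[OF that, of 1 a] by simp
  have I: "(\<integral>\<^sup>+w\<in>ball a r. f w \<partial>lborel) = (\<integral>\<^sup>+w. \<phi> w \<partial>lborel)"
    by (subst tr) (auto simp: \<phi>_def dist_norm intro!: nn_integral_cong split: split_indicator)
  have E: "emeasure lborel (ball a r) = emeasure lborel (ball (0::complex) r)"
  proof -
    have "emeasure lborel (ball a r) = (\<integral>\<^sup>+w. indicator (ball a r) w \<partial>lborel)" by simp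
    also have "\<dots> = (\<integral>\<^sup>+w. indicator (ball a r) (a + w) \<partial>lborel)" by (rule tr) measurable
    also have "\<dots> = (\<integral>\<^sup>+w. indicator (ball (0::complex) r) w \<partial>lborel)"
      by (intro nn_integral_cong) (simp add: indicator_def dist_norm)
    finally show ?thesis by simp
  qed
  have "ennreal (2 * pi) * (\<integral>\<^sup>+w. \<phi> w \<partial>lborel) = (\<integral>\<^sup>+t\<in>{0..2 * pi}. (\<integral>\<^sup>+w. \<phi> w \<partial>lborel) \<partial>lborel)"
    by (simp add: nn_integral_cmult_indicator mult.commute)
  also have "\<dots> = (\<integral>\<^sup>+t\<in>{0..2 * pi}. (\<integral>\<^sup>+w. \<phi> (cis t * w) \<partial>lborel) \<partial>lborel)"
    by (simp add: nn_integral_rotate)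
  also have "\<dots> = (\<integral>\<^sup>+t. \<integral>\<^sup>+w. \<phi> (cis t * w) * indicator {0..2 * pi} t \<partial>lborel \<partial>lborel)"
    by (subst nn_integral_multc[symmetric]) auto
  also have "\<dots> = (\<integral>\<^sup>+w. (\<integral>\<^sup>+t\<in>{0..2 * pi}. \<phi> (cis t * w) \<partial>lborel) \<partial>lborel)"
    by (rule lborel_pair.Fubini') measurable
  also have "\<dots> \<le> (\<integral>\<^sup>+w. ennreal (2 * pi) * f a * indicator (ball (0::complex) r) w \<partial>lborel)"
  proof (rule nn_integral_mono)
    fix w :: complex
    show "(\<integral>\<^sup>+t\<in>{0..2 * pi}. \<phi> (cis t * w) \<partial>lborel) \<le> ennreal (2 * pi) * f a * indicator (ball 0 r) w"
    proof (cases "w \<in> ball 0 r")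
      case False
      then show ?thesis by (simp add: \<phi>_def norm_mult)
    next
      case True
      show ?thesis
      proof (cases "w = 0")
        case w: True
        then show ?thesis using r by (simp add: \<phi>_def nn_integral_cmult_indicator mult.commute)
      next
        case w: False
        define u where "u = w / of_real (cmod w)"
        have u: "cmod u = 1" "w = u * of_real (cmod w)" using w by (auto simp: u_def norm_divide)
        have "(\<integral>\<^sup>+t\<in>{0..2 * pi}. \<phi> (cis t * w) \<partial>lborel) = (\<integral>\<^sup>+t\<in>{0..2 * pi}. \<phi> (cis t * u * of_real (cmod w)) \<partial>lborel)"
          by (subst u(2)) (simp add: mult.assoc)
        also have "\<dots> = (\<integral>\<^sup>+t\<in>{0..2 * pi}. \<phi> (cis t * of_real (cmod w)) \<partial>lborel)"
          by (rule nn_integral_circle_rotate[OF _ u(1), of "\<lambda>z. \<phi> (z * of_real (cmod w))"]) measurable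
        also have "\<dots> = (\<integral>\<^sup>+t\<in>{0..2 * pi}. f (a + of_real (cmod w) * cis t) \<partial>lborel)"
          using True by (intro nn_integral_cong) (simp add: \<phi>_def norm_mult mult.commute)
        also have "\<dots> \<le> ennreal (2 * pi) * f a" using True w by (intro circ) auto
        finally show ?thesis using True by simp
      qed
    qed
  qed
  also have "\<dots> = ennreal (2 * pi) * (emeasure lborel (ball a r) * f a)"
    unfolding E by (subst nn_integral_cmult_indicator) (auto simp: mult_ac)
  finally show ?thesis unfolding I
    by (subst (asm) ennreal_mult_le_mult_iff) auto
qed

section \<open>The energy inequality\<close>

context flute_seq begin

lemma open_ins: "open (ins j)"
  unfolding ins_def by (intro open_Collect_conj open_Collect_less continuous_intros)

lemma sets_flute [measurable]: "ins j \<in> sets borel" "Qo \<in> sets borel"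
  using open_ins open_Qo by auto

lemma mv_measurable [measurable]: "mv j \<in> borel_measurable borel"
  by (rule iso_measurable[OF iso_mv])

lemma unf_notin: "(\<And>j. y \<notin> ins j) \<Longrightarrow> unf y = y" by (simp add: unf_def)

lemma unf_measurable [measurable]: "unf \<in> borel_measurable borel"
proof (rule measurableI)
  fix T :: "complex set" assume T: "T \<in> sets borel"
  have "unf -` T = (\<Union>j. ins j \<inter> mv j -` T) \<union> (T - (\<Union>j. ins j))"
  proof (intro equalityI subsetI)
    fix y assume y: "y \<in> unf -` T"
    show "y \<in> (\<Union>j. ins j \<inter> mv j -` T) \<union> (T - (\<Union>j. ins j))"
    proof (cases "\<exists>j. y \<in> ins j")
      case True
      then obtain j where j: "y \<in> ins j" by blast
      then have "y \<in> ins j \<inter> mv j -` T" using y unf_ins[OF j] by simp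
      then show ?thesis by blast
    next
      case False
      then show ?thesis using y unf_notin[of y] by auto
    qed
  next
    fix y assume "y \<in> (\<Union>j. ins j \<inter> mv j -` T) \<union> (T - (\<Union>j. ins j))"
    then show "y \<in> unf -` T"
    proof
      assume "y \<in> (\<Union>j. ins j \<inter> mv j -` T)"
      then obtain j where "y \<in> ins j" "mv j y \<in> T" by blast
      then show ?thesis using unf_ins by simp
    next
      assume "y \<in> T - (\<Union>j. ins j)"
      then show ?thesis using unf_notin[of y] by auto
    qed
  qed
  moreover have "ins j \<inter> mv j -` T \<in> sets borel" for j
    using measurable_sets[OF mv_measurable[of j] T] sets_flute(1)[of j] by auto
  moreover have "(\<Union>j. ins j) \<in> sets borel" using open_ins by (intro borel_open open_UN) auto
  ultimately show "unf -` T \<inter> space borel \<in> sets borel"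
    using T by (auto intro!: sets.countable_UN'')
qed simp

text \<open>\<open>dom\<close> without the sides and their copies. The difference is a null set by
  \<open>AE_domo\<close>, and what remains splits into \<open>Qo\<close> and one piece behind each
  side.\<close>

definition domo :: "complex set" where "domo = {y. 0 < Im y \<and> unf y \<in> Qo}"

lemma domo_measurable [measurable]: "domo \<in> sets borel"
proof -
  have "domo = uhp \<inter> (unf -` Qo \<inter> space borel)" by (auto simp: domo_def)
  then show ?thesis using measurable_sets[OF unf_measurable sets_flute(2)] uhp_borel by auto
qed

lemma Qo_Im: "z \<in> Qo \<Longrightarrow> 0 < Im z" using Qo_Q Q_Im by blast
lemma Qo_notin_ins: "z \<in> Qo \<Longrightarrow> z \<notin> ins j" using Qo_Q Q_notin_ins by blast
lemma Qo_domo: "z \<in> Qo \<Longrightarrow> z \<in> domo" by (simp add: domo_def Qo_Im unf_Q Qo_Q)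

lemma domo_cases:
  assumes "y \<in> domo"
  obtains "y \<in> Qo" "unf y = y" | j where "y \<in> ins j" "mv j y \<in> Qo" "unf y = mv j y"
proof (cases "\<exists>j. y \<in> ins j")
  case True
  then obtain j where "y \<in> ins j" by blast
  then show ?thesis using that(2)[of j] assms unf_ins[of y j] by (simp add: domo_def)
next
  case False
  then have "unf y = y" using unf_notin[of y] by blast
  then show ?thesis using that(1) assms by (simp add: domo_def)
qed

definition piece :: "nat \<times> bool \<Rightarrow> complex \<Rightarrow> ennreal" where
  "piece j y = indicator (ins j) y * indicator Qo (mv j y)"

lemma piece_measurable [measurable]: "piece j \<in> borel_measurable borel"
proof -
  have "{y. mv j y \<in> Qo} \<in> sets borel"
    using measurable_sets[OF mv_measurable[of j] sets_flute(2)] by (simp add: vimage_def)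
  moreover have "piece j y = indicator (ins j) y * indicator {y. mv j y \<in> Qo} y" for y
    by (simp add: piece_def indicator_def)
  ultimately show ?thesis by (simp add: piece_def[abs_def] indicator_def cong: measurable_cong)
qed

text \<open>The half discs are disjoint, so at most one summand is non-zero; none is on
  \<open>Qo\<close>.\<close>

lemma domo_split:
  fixes G :: "complex \<Rightarrow> ennreal"
  shows "indicator domo y * G (unf y) = indicator Qo y * G y +
     (\<Sum>k. piece (k, True) y * G (mv (k, True) y) + piece (k, False) y * G (mv (k, False) y))"
proof (cases "\<exists>j. y \<in> ins j")
  case False
  then have "piece j y = 0" for j by (simp add: piece_def)
  moreover have "unf y = y" using False unf_notin[of y] by blast
  moreover have "y \<in> domo \<longleftrightarrow> y \<in> Qo" using \<open>unf y = y\<close> Qo_Im by (auto simp: domo_def)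
  ultimately show ?thesis by (simp add: indicator_def)
next
  case True
  then obtain k b where j: "y \<in> ins (k, b)" by (metis prod.exhaust)
  have other: "piece j y = 0" if "j \<noteq> (k, b)" for j
  proof -
    have "y \<notin> ins j" using ins_unique[OF j, of j] that by blast
    then show ?thesis by (simp add: piece_def)
  qed
  have "(\<Sum>k. piece (k, True) y * G (mv (k, True) y) + piece (k, False) y * G (mv (k, False) y))
     = (\<Sum>i\<in>{k}. piece (i, True) y * G (mv (i, True) y) + piece (i, False) y * G (mv (i, False) y))"
    by (rule suminf_finite) (auto simp: other)
  also have "\<dots> = piece (k, b) y * G (mv (k, b) y)" by (cases b) (simp_all add: other)
  also have "\<dots> = indicator domo y * G (unf y)"
    using j by (simp add: piece_def domo_def unf_ins indicator_def) (auto simp: ins_def)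
  finally show ?thesis using Qo_notin_ins[of y "(k, b)"] j by (auto simp: indicator_def)
qed

text \<open>An integral over pairs of nearby points of the surface. The second point ranges over
  \<open>Qo\<close> and its copies behind the sides, so that pairs joined across a side are counted,
  and \<psi> sees its representative in \<open>Qo\<close>.\<close>

definition pairs :: "real \<Rightarrow> (complex \<times> complex \<Rightarrow> ennreal) \<Rightarrow> ennreal" where
  "pairs r \<psi> = (\<integral>\<^sup>+x. \<integral>\<^sup>+y. indicator Qo x * (indicator domo y * (kern r (pd x y) * \<psi> (x, unf y))) \<partial>hyp \<partial>hyp)"

text \<open>The share of the pairs that are joined across one side, with both points moved back to
  \<open>Qo\<close>: the copy \<open>mv j y\<close> lies behind the side
  \<open>opp j\<close>.\<close>

definition side_pairs :: "real \<Rightarrow> nat \<times> bool \<Rightarrow> (complex \<times> complex \<Rightarrow> ennreal) \<Rightarrow> ennreal" where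
  "side_pairs r j \<psi> = (\<integral>\<^sup>+x. \<integral>\<^sup>+y. indicator Qo x * (indicator Qo y * (kern r (pd x (mv j y)) * \<psi> (x, y))) \<partial>hyp \<partial>hyp)"

text \<open>Applying \<open>mv (opp j)\<close> to both points turns the distance from y to
  \<open>mv j x\<close> into the one from \<open>mv (opp j) y\<close> to x: crossing a side in one
  direction is crossing its partner in the other.\<close>

lemma side_pairs_swap:
  assumes [measurable]: "\<psi> \<in> borel_measurable (borel \<Otimes>\<^sub>M borel)"
  shows "side_pairs r j (\<lambda>p. \<psi> (snd p, fst p)) = side_pairs r (opp j) \<psi>"
proof -
  have "side_pairs r j (\<lambda>p. \<psi> (snd p, fst p))
     = (\<integral>\<^sup>+y. \<integral>\<^sup>+x. indicator Qo x * (indicator Qo y * (kern r (pd x (mv j y)) * \<psi> (y, x))) \<partial>hyp \<partial>hyp)"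
    unfolding side_pairs_def fst_conv snd_conv by (rule hyp_pair.Fubini'[symmetric]) measurable
  also have "\<dots> = side_pairs r (opp j) \<psi>"
    unfolding side_pairs_def
  proof (intro nn_integral_cong)
    fix x y
    show "indicator Qo y * (indicator Qo x * (kern r (pd y (mv j x)) * \<psi> (x, y))) =
      indicator Qo x * (indicator Qo y * (kern r (pd x (mv (opp j) y)) * \<psi> (x, y)))"
    proof (cases "x \<in> Qo \<and> y \<in> Qo")
      case True
      then have I: "0 < Im x" "0 < Im y" using Qo_Im by auto
      have "pd y (mv j x) = pd (mv (opp j) y) (mv (opp j) (mv j x))"
        by (rule pd_iso[OF iso_mv I(2) mv_Im[OF I(1)], symmetric])
      also have "\<dots> = pd x (mv (opp j) y)" by (simp add: mv_mv[OF I(1)] pd_commute)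
      finally show ?thesis using True by simp
    qed (auto simp: indicator_def)
  qed
  finally show ?thesis .
qed

lemma pairs_split:
  assumes [measurable]: "\<psi> \<in> borel_measurable (borel \<Otimes>\<^sub>M borel)"
  shows "pairs r \<psi> = (\<integral>\<^sup>+x. \<integral>\<^sup>+y. indicator Qo x * (indicator Qo y * (kern r (pd x y) * \<psi> (x, y))) \<partial>hyp \<partial>hyp) +
     (\<Sum>k. side_pairs r (k, False) \<psi> + side_pairs r (k, True) \<psi>)"
proof -
  define t where "t j x y = indicator Qo x * (piece j y * (kern r (pd x y) * \<psi> (x, mv j y)))" for j x y
  have tm [measurable]: "(\<lambda>p. t j (fst p) (snd p)) \<in> borel_measurable (borel \<Otimes>\<^sub>M borel)" for j
    unfolding t_def by measurable
  have t1 [measurable]: "t j x \<in> borel_measurable borel" for j x unfolding t_def by measurable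
  have inner: "(\<integral>\<^sup>+y. indicator Qo x * (indicator domo y * (kern r (pd x y) * \<psi> (x, unf y))) \<partial>hyp) =
     (\<integral>\<^sup>+y. indicator Qo x * (indicator Qo y * (kern r (pd x y) * \<psi> (x, y))) \<partial>hyp) +
     (\<Sum>k. (\<integral>\<^sup>+y. t (k, True) x y \<partial>hyp) + (\<integral>\<^sup>+y. t (k, False) x y \<partial>hyp))" for x
  proof -
    have "(\<integral>\<^sup>+y. indicator Qo x * (indicator domo y * (kern r (pd x y) * \<psi> (x, unf y))) \<partial>hyp) =
       (\<integral>\<^sup>+y. indicator Qo x * (indicator Qo y * (kern r (pd x y) * \<psi> (x, y))) + (\<Sum>k. t (k, True) x y + t (k, False) x y) \<partial>hyp)"
      using domo_split[of _ "\<lambda>z. kern r (pd x y) * \<psi> (x, z)" for y]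
      by (intro nn_integral_cong) (simp add: distrib_left t_def ennreal_suminf_cmult[symmetric] del: ennreal_suminf_cmult)
    also have "\<dots> = (\<integral>\<^sup>+y. indicator Qo x * (indicator Qo y * (kern r (pd x y) * \<psi> (x, y))) \<partial>hyp) +
       (\<integral>\<^sup>+y. (\<Sum>k. t (k, True) x y + t (k, False) x y) \<partial>hyp)"
      by (rule nn_integral_add) measurable
    also have "(\<integral>\<^sup>+y. (\<Sum>k. t (k, True) x y + t (k, False) x y) \<partial>hyp) = (\<Sum>k. \<integral>\<^sup>+y. t (k, True) x y + t (k, False) x y \<partial>hyp)"
      by (rule nn_integral_suminf) measurable
    also have "\<dots> = (\<Sum>k. (\<integral>\<^sup>+y. t (k, True) x y \<partial>hyp) + (\<integral>\<^sup>+y. t (k, False) x y \<partial>hyp))"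
      by (intro suminf_cong nn_integral_add) measurable
    finally show ?thesis .
  qed
  \<comment> \<open>The substitution by \<open>mv (opp j)\<close> moves the piece behind side j back
    to \<open>Qo\<close>.\<close>
  have tside: "(\<integral>\<^sup>+x. \<integral>\<^sup>+y. t j x y \<partial>hyp \<partial>hyp) = side_pairs r (opp j) \<psi>" for j
    unfolding side_pairs_def
  proof (rule nn_integral_cong)
    fix x
    have "(\<integral>\<^sup>+y. t j x y \<partial>hyp) = (\<integral>\<^sup>+y. t j x (mv (opp j) y) \<partial>hyp)"
      by (rule nn_integral_hyp_isometry[OF t1 iso_mv, symmetric])
    also have "\<dots> = (\<integral>\<^sup>+y. indicator Qo x * (indicator Qo y * (kern r (pd x (mv (opp j) y)) * \<psi> (x, y))) \<partial>hyp)"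
    proof (rule nn_integral_hyp_cong)
      fix y :: complex assume y: "0 < Im y"
      have m: "mv j (mv (opp j) y) = y" using mv_mv[OF y, of "opp j"] by simp
      have "piece j (mv (opp j) y) = indicator Qo y"
      proof (cases "y \<in> Qo")
        case True
        then have "rad (opp j) < cmod (y - of_real (cen (opp j)))" unfolding Qo_altdef by blast
        then have "mv (opp j) y \<in> ins j" using mv_inside_iff[OF y, of "opp j"] by simp
        then show ?thesis using True by (simp add: piece_def m)
      qed (simp add: piece_def m)
      then show "t j x (mv (opp j) y) = indicator Qo x * (indicator Qo y * (kern r (pd x (mv (opp j) y)) * \<psi> (x, y)))"
        by (simp add: t_def m)
    qed measurable
    finally show "(\<integral>\<^sup>+y. t j x y \<partial>hyp) = (\<integral>\<^sup>+y. indicator Qo x * (indicator Qo y * (kern r (pd x (mv (opp j) y)) * \<psi> (x, y))) \<partial>hyp)" .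
  qed
  have "pairs r \<psi> = (\<integral>\<^sup>+x. \<integral>\<^sup>+y. indicator Qo x * (indicator Qo y * (kern r (pd x y) * \<psi> (x, y))) \<partial>hyp \<partial>hyp) +
     (\<integral>\<^sup>+x. (\<Sum>k. (\<integral>\<^sup>+y. t (k, True) x y \<partial>hyp) + (\<integral>\<^sup>+y. t (k, False) x y \<partial>hyp)) \<partial>hyp)"
    unfolding pairs_def inner by (rule nn_integral_add) measurable
  also have "(\<integral>\<^sup>+x. (\<Sum>k. (\<integral>\<^sup>+y. t (k, True) x y \<partial>hyp) + (\<integral>\<^sup>+y. t (k, False) x y \<partial>hyp)) \<partial>hyp) =
     (\<Sum>k. \<integral>\<^sup>+x. (\<integral>\<^sup>+y. t (k, True) x y \<partial>hyp) + (\<integral>\<^sup>+y. t (k, False) x y \<partial>hyp) \<partial>hyp)"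
    by (rule nn_integral_suminf) measurable
  also have "\<dots> = (\<Sum>k. side_pairs r (k, False) \<psi> + side_pairs r (k, True) \<psi>)"
  proof (rule suminf_cong)
    fix k
    have "(\<integral>\<^sup>+x. (\<integral>\<^sup>+y. t (k, True) x y \<partial>hyp) + (\<integral>\<^sup>+y. t (k, False) x y \<partial>hyp) \<partial>hyp)
      = (\<integral>\<^sup>+x. \<integral>\<^sup>+y. t (k, True) x y \<partial>hyp \<partial>hyp) + (\<integral>\<^sup>+x. \<integral>\<^sup>+y. t (k, False) x y \<partial>hyp \<partial>hyp)"
      by (rule nn_integral_add) measurable
    then show "(\<integral>\<^sup>+x. (\<integral>\<^sup>+y. t (k, True) x y \<partial>hyp) + (\<integral>\<^sup>+y. t (k, False) x y \<partial>hyp) \<partial>hyp)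
      = side_pairs r (k, False) \<psi> + side_pairs r (k, True) \<psi>"
      by (simp add: tside opp_def)
  qed
  finally show ?thesis .
qed

text \<open>The gluing maps preserve area and the kernel, so the kernel is symmetric on the surface.\<close>

theorem pairs_swap:
  assumes [measurable]: "\<psi> \<in> borel_measurable (borel \<Otimes>\<^sub>M borel)"
  shows "pairs r (\<lambda>p. \<psi> (snd p, fst p)) = pairs r \<psi>"
proof -
  have m [measurable]: "(\<lambda>p. \<psi> (snd p, fst p)) \<in> borel_measurable (borel \<Otimes>\<^sub>M borel)" by measurable
  have "(\<integral>\<^sup>+x. \<integral>\<^sup>+y. indicator Qo x * (indicator Qo y * (kern r (pd x y) * \<psi> (y, x))) \<partial>hyp \<partial>hyp) =
     (\<integral>\<^sup>+y. \<integral>\<^sup>+x. indicator Qo x * (indicator Qo y * (kern r (pd x y) * \<psi> (y, x))) \<partial>hyp \<partial>hyp)"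
    by (rule hyp_pair.Fubini'[symmetric]) measurable
  also have "\<dots> = (\<integral>\<^sup>+x. \<integral>\<^sup>+y. indicator Qo x * (indicator Qo y * (kern r (pd x y) * \<psi> (x, y))) \<partial>hyp \<partial>hyp)"
    by (intro nn_integral_cong) (simp add: pd_commute mult.left_commute)
  finally have 1: "(\<integral>\<^sup>+x. \<integral>\<^sup>+y. indicator Qo x * (indicator Qo y * (kern r (pd x y) * \<psi> (y, x))) \<partial>hyp \<partial>hyp) =
     (\<integral>\<^sup>+x. \<integral>\<^sup>+y. indicator Qo x * (indicator Qo y * (kern r (pd x y) * \<psi> (x, y))) \<partial>hyp \<partial>hyp)" .
  show ?thesis
    unfolding pairs_split[OF m] pairs_split[OF assms] side_pairs_swap[OF assms]
    using 1 by (simp add: opp_def add.commute)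
qed

lemma pairs_add:
  assumes [measurable]: "\<psi> \<in> borel_measurable (borel \<Otimes>\<^sub>M borel)" "\<psi>' \<in> borel_measurable (borel \<Otimes>\<^sub>M borel)"
  shows "pairs r (\<lambda>p. \<psi> p + \<psi>' p) = pairs r \<psi> + pairs r \<psi>'"
proof -
  have "pairs r (\<lambda>p. \<psi> p + \<psi>' p) = (\<integral>\<^sup>+x. (\<integral>\<^sup>+y. indicator Qo x * (indicator domo y * (kern r (pd x y) * \<psi> (x, unf y))) \<partial>hyp) +
     (\<integral>\<^sup>+y. indicator Qo x * (indicator domo y * (kern r (pd x y) * \<psi>' (x, unf y))) \<partial>hyp) \<partial>hyp)"
    unfolding pairs_def distrib_left by (intro nn_integral_cong nn_integral_add) measurable
  also have "\<dots> = pairs r \<psi> + pairs r \<psi>'" unfolding pairs_def by (rule nn_integral_add) measurable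
  finally show ?thesis .
qed

lemma pairs_cong:
  assumes "\<And>x y. x \<in> Qo \<Longrightarrow> y \<in> Qo \<Longrightarrow> \<psi> (x, y) = \<psi>' (x, y)"
  shows "pairs r \<psi> = pairs r \<psi>'"
  unfolding pairs_def using assms
  by (intro nn_integral_cong) (auto simp: domo_def split: split_indicator)

text \<open>A discrete Picone identity. With a = \<eta>(x)^2 \<phi>(y) / \<phi>(x) and b =
  \<eta>(x)^2, superharmonicity gives \<open>pairs r a \<le> pairs r b\<close>, and symmetry gives
  the same with x and y exchanged. The identity \<open>point\<close> turns this into the
  claim.\<close>

theorem energy_inequality:
  fixes \<phi> \<eta> :: "complex \<Rightarrow> real"
  assumes [measurable]: "\<phi> \<in> borel_measurable borel" "\<eta> \<in> borel_measurable borel"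
    and \<phi>: "\<And>z. z \<in> Qo \<Longrightarrow> 0 < \<phi> z" and \<eta>: "\<And>z. 0 \<le> \<eta> z" and r: "r \<le> 1"
    and super: "\<And>x. x \<in> Qo \<Longrightarrow> \<eta> x \<noteq> 0 \<Longrightarrow>
      (\<integral>\<^sup>+y. indicator domo y * (kern r (pd x y) * ennreal (\<phi> (unf y))) \<partial>hyp)
        \<le> ennreal (\<phi> x) * (\<integral>\<^sup>+y. indicator domo y * kern r (pd x y) \<partial>hyp)"
    and fin: "(\<integral>\<^sup>+x. indicator Qo x * ennreal ((\<eta> x)\<^sup>2) \<partial>hyp) < \<infinity>" and area: "disc_area r < \<infinity>"
  shows "pairs r (\<lambda>(x, y). ennreal ((\<eta> x * sqrt (\<phi> y / \<phi> x) - \<eta> y * sqrt (\<phi> x / \<phi> y))\<^sup>2))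
     \<le> pairs r (\<lambda>(x, y). ennreal ((\<eta> x - \<eta> y)\<^sup>2))"
proof -
  define a where "a = (\<lambda>p. ennreal ((\<eta> (fst p))\<^sup>2 * (\<phi> (snd p) / \<phi> (fst p))))"
  define b where "b = (\<lambda>p::complex \<times> complex. ennreal ((\<eta> (fst p))\<^sup>2))"
  define D where "D = (\<lambda>(x, y). ennreal ((\<eta> x - \<eta> y)\<^sup>2))"
  define E where "E = (\<lambda>(x, y). ennreal ((\<eta> x * sqrt (\<phi> y / \<phi> x) - \<eta> y * sqrt (\<phi> x / \<phi> y))\<^sup>2))"
  have [measurable]: "a \<in> borel_measurable (borel \<Otimes>\<^sub>M borel)" "b \<in> borel_measurable (borel \<Otimes>\<^sub>M borel)"
    "D \<in> borel_measurable (borel \<Otimes>\<^sub>M borel)" "E \<in> borel_measurable (borel \<Otimes>\<^sub>M borel)"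
    unfolding a_def b_def D_def E_def by measurable
  have ab: "pairs r a \<le> pairs r b"
    unfolding pairs_def
  proof (rule nn_integral_mono)
    fix x
    show "(\<integral>\<^sup>+y. indicator Qo x * (indicator domo y * (kern r (pd x y) * a (x, unf y))) \<partial>hyp)
       \<le> (\<integral>\<^sup>+y. indicator Qo x * (indicator domo y * (kern r (pd x y) * b (x, unf y))) \<partial>hyp)"
    proof (cases "x \<in> Qo \<and> \<eta> x \<noteq> 0")
      case False
      then have z: "indicator Qo x * (c * (d * a (x, unf y))) = 0" for c d y
        by (auto simp: a_def indicator_def)
      have "(\<integral>\<^sup>+y. indicator Qo x * (indicator domo y * (kern r (pd x y) * a (x, unf y))) \<partial>hyp) = (\<integral>\<^sup>+y. 0 \<partial>hyp)"
        by (rule nn_integral_cong) (rule z)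
      then show ?thesis by simp
    next
      case True
      then have px: "0 < \<phi> x" using \<phi> by blast
      have "(\<integral>\<^sup>+y. indicator Qo x * (indicator domo y * (kern r (pd x y) * a (x, unf y))) \<partial>hyp)
        = (\<integral>\<^sup>+y. ennreal ((\<eta> x)\<^sup>2 / \<phi> x) * (indicator domo y * (kern r (pd x y) * ennreal (\<phi> (unf y)))) \<partial>hyp)"
      proof (rule nn_integral_cong)
        fix y
        have "a (x, unf y) = ennreal ((\<eta> x)\<^sup>2 / \<phi> x) * ennreal (\<phi> (unf y))" if "y \<in> domo"
          using px \<phi>[of "unf y"] that by (auto simp: a_def domo_def ennreal_mult[symmetric])
        then show "indicator Qo x * (indicator domo y * (kern r (pd x y) * a (x, unf y)))
          = ennreal ((\<eta> x)\<^sup>2 / \<phi> x) * (indicator domo y * (kern r (pd x y) * ennreal (\<phi> (unf y))))"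
          using True by (auto simp: mult_ac split: split_indicator)
      qed
      also have "\<dots> = ennreal ((\<eta> x)\<^sup>2 / \<phi> x) * (\<integral>\<^sup>+y. indicator domo y * (kern r (pd x y) * ennreal (\<phi> (unf y))) \<partial>hyp)"
        by (rule nn_integral_cmult) measurable
      also have "\<dots> \<le> ennreal ((\<eta> x)\<^sup>2 / \<phi> x) * (ennreal (\<phi> x) * (\<integral>\<^sup>+y. indicator domo y * kern r (pd x y) \<partial>hyp))"
        using super[of x] True by (intro mult_left_mono) auto
      also have "\<dots> = ennreal ((\<eta> x)\<^sup>2) * (\<integral>\<^sup>+y. indicator domo y * kern r (pd x y) \<partial>hyp)"
        using px by (simp add: mult.assoc[symmetric] ennreal_mult[symmetric])
      also have "\<dots> = (\<integral>\<^sup>+y. ennreal ((\<eta> x)\<^sup>2) * (indicator domo y * kern r (pd x y)) \<partial>hyp)"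
        by (rule nn_integral_cmult[symmetric]) measurable
      also have "\<dots> = (\<integral>\<^sup>+y. indicator Qo x * (indicator domo y * (kern r (pd x y) * b (x, unf y))) \<partial>hyp)"
        using True by (intro nn_integral_cong) (simp add: b_def mult_ac)
      finally show ?thesis .
    qed
  qed
  have bfin: "pairs r b < \<infinity>"
  proof -
    have "pairs r b \<le> (\<integral>\<^sup>+x. indicator Qo x * ennreal ((\<eta> x)\<^sup>2) * (disc_area r * ennreal (2 * pi)) \<partial>hyp)"
      unfolding pairs_def
    proof (rule nn_integral_mono)
      fix x
      show "(\<integral>\<^sup>+y. indicator Qo x * (indicator domo y * (kern r (pd x y) * b (x, unf y))) \<partial>hyp)
         \<le> indicator Qo x * ennreal ((\<eta> x)\<^sup>2) * (disc_area r * ennreal (2 * pi))"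
      proof (cases "x \<in> Qo")
        case True
        have "(\<integral>\<^sup>+y. indicator Qo x * (indicator domo y * (kern r (pd x y) * b (x, unf y))) \<partial>hyp)
          \<le> (\<integral>\<^sup>+y. ennreal ((\<eta> x)\<^sup>2) * kern r (pd x y) \<partial>hyp)"
          using True by (intro nn_integral_mono) (auto simp: b_def mult.commute split: split_indicator)
        also have "\<dots> = ennreal ((\<eta> x)\<^sup>2) * (\<integral>\<^sup>+y. kern r (pd x y) \<partial>hyp)"
          by (rule nn_integral_cmult) measurable
        finally show ?thesis using True kernel_total[OF Qo_Im[OF True] r] by simp
      qed simp
    qed
    also have "\<dots> = (\<integral>\<^sup>+x. indicator Qo x * ennreal ((\<eta> x)\<^sup>2) \<partial>hyp) * (disc_area r * ennreal (2 * pi))"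
      by (rule nn_integral_multc) measurable
    also have "\<dots> < \<infinity>" using fin area by (simp add: ennreal_mult_less_top)
    finally show ?thesis .
  qed
  define a' where "a' = (\<lambda>p. a (snd p, fst p))"
  define b' where "b' = (\<lambda>p. b (snd p, fst p))"
  have [measurable]: "a' \<in> borel_measurable (borel \<Otimes>\<^sub>M borel)" "b' \<in> borel_measurable (borel \<Otimes>\<^sub>M borel)"
    unfolding a'_def b'_def by measurable
  have sw: "pairs r a' = pairs r a" "pairs r b' = pairs r b"
    unfolding a'_def b'_def by (rule pairs_swap, measurable)+
  \<comment> \<open>The two square roots are reciprocal, so the cross term of E is the cross term of
    D.\<close>
  have point: "(a p + a' p) + D p = (b p + b' p) + E p" if p: "fst p \<in> Qo" "snd p \<in> Qo" for p
  proof -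
    obtain x y where xy: "p = (x, y)" by (cases p)
    have px: "0 < \<phi> x" "0 < \<phi> y" using p \<phi> by (auto simp: xy)
    define s t where "s = sqrt (\<phi> y / \<phi> x)" and "t = sqrt (\<phi> x / \<phi> y)"
    have st: "s * t = 1" "s\<^sup>2 = \<phi> y / \<phi> x" "t\<^sup>2 = \<phi> x / \<phi> y"
      using px by (simp_all add: s_def t_def less_imp_le flip: real_sqrt_mult)
    have "(\<eta> x)\<^sup>2 * (\<phi> y / \<phi> x) + (\<eta> y)\<^sup>2 * (\<phi> x / \<phi> y) + (\<eta> x - \<eta> y)\<^sup>2
       = (\<eta> x)\<^sup>2 + (\<eta> y)\<^sup>2 + (\<eta> x * s - \<eta> y * t)\<^sup>2"
    proof -
      have "(\<eta> x * s - \<eta> y * t)\<^sup>2 = (\<eta> x)\<^sup>2 * s\<^sup>2 + (\<eta> y)\<^sup>2 * t\<^sup>2 - 2 * (\<eta> x * \<eta> y) * (s * t)"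
        by (simp add: power2_eq_square algebra_simps)
      then show ?thesis unfolding st by (simp add: power2_diff)
    qed
    moreover have "0 \<le> (\<eta> x)\<^sup>2 * (\<phi> y / \<phi> x)" "0 \<le> (\<eta> y)\<^sup>2 * (\<phi> x / \<phi> y)" using px by simp_all
    ultimately show ?thesis
      by (simp add: xy a_def a'_def b_def b'_def D_def E_def s_def t_def flip: ennreal_plus)
  qed
  have "pairs r (\<lambda>p. (a p + a' p) + D p) = pairs r (\<lambda>p. (b p + b' p) + E p)"
    using point by (intro pairs_cong) auto
  then have eq: "(pairs r a + pairs r a) + pairs r D = (pairs r b + pairs r b) + pairs r E"
    by (simp add: pairs_add sw)
  have "(pairs r b + pairs r b) + pairs r E \<le> (pairs r b + pairs r b) + pairs r D"
    unfolding eq[symmetric] by (intro add_mono ab order_refl)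
  \<comment> \<open>In \<open>ennreal\<close> the common summand can be cancelled because it is
    finite, by \<open>bfin\<close>.\<close>
  then have "pairs r E \<le> pairs r D"
    using bfin by (auto simp: ennreal_add_left_cancel_le)
  then show ?thesis unfolding D_def E_def .
qed

end

section \<open>Superharmonic functions on the surface\<close>

lemma null_sets_hypI: "A \<in> null_sets lborel \<Longrightarrow> AE y in hyp. y \<notin> A"
  unfolding hyp_def by (subst AE_density) (auto dest: AE_not_in)

lemma sphere_null: "{y::complex. cmod (y - c) = r} \<in> null_sets lborel"
proof -
  have e: "{y::complex. cmod (y - c) = r} = sphere c r" by (auto simp: dist_norm norm_minus_commute)
  have "sphere c r \<in> null_sets lebesgue" using negligible_sphere[of c r] by (simp add: negligible_iff_null_sets)
  then show ?thesis unfolding e by (simp add: null_sets_completion_iff)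
qed

lemma AE_hyp_iso:
  assumes A: "A \<in> null_sets lborel" and m: "hyp_isometry m"
  shows "AE y in hyp. m y \<notin> A"
proof -
  have [measurable]: "A \<in> sets borel" "m \<in> borel_measurable borel" using A iso_measurable[OF m] by auto
  have "(\<integral>\<^sup>+y. indicator A (m y) \<partial>hyp) = (\<integral>\<^sup>+y. indicator A y \<partial>hyp)"
    by (rule nn_integral_hyp_isometry[OF _ m]) measurable
  also have "\<dots> = 0"
  proof -
    have "AE y in hyp. indicator A y = (0::ennreal)" using null_sets_hypI[OF A] by eventually_elim simp
    then show ?thesis by (subst nn_integral_0_iff_AE) auto
  qed
  finally have "AE y in hyp. indicator A (m y) = (0::ennreal)"
    by (subst (asm) nn_integral_0_iff_AE) auto
  then show ?thesis by eventually_elim (simp split: split_indicator_asm)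
qed

text \<open>|x - y| < r |x - cnj y| \<le> r (2 Im x + |x - y|), and r \<le> 1 / 10 absorbs the last
  term; the constant 20 / 9 is rounded up to 3.\<close>

lemma pd_close:
  assumes x: "0 < Im x" and y: "0 < Im y" and p: "pd x y < r" and r: "r \<le> 1 / 10"
  shows "cmod (x - y) \<le> 3 * r * Im x"
proof -
  define a where "a = cmod (x - y)"
  define b where "b = cmod (x - cnj y)"
  have b: "0 < b" using pd_denom[OF x y] by (simp add: b_def)
  have a0: "0 \<le> a" by (simp add: a_def)
  have r0: "0 < r" using p pd_nonneg[of x y] by linarith
  have ab: "a < r * b" using p b by (simp add: pd_def a_def b_def divide_less_eq)
  have "cmod (cnj x - cnj y) = a" unfolding a_def by (metis complex_cnj_diff complex_mod_cnj)
  then have "b \<le> cmod (x - cnj x) + a" unfolding b_def using norm_triangle_ineq[of "x - cnj x" "cnj x - cnj y"] by simp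
  also have "cmod (x - cnj x) = 2 * Im x" using x by (simp add: complex_diff_cnj norm_mult)
  finally have "r * b \<le> r * (2 * Im x + a)" using r0 by simp
  then have "a \<le> r * (2 * Im x) + r * a" using ab by (simp add: distrib_left)
  also have "r * a \<le> 1 / 10 * a" using r a0 by (intro mult_right_mono) auto
  finally have "9 / 10 * a \<le> r * (2 * Im x)" by simp
  moreover have "0 \<le> r * Im x" using r0 x by simp
  ultimately show ?thesis unfolding a_def[symmetric] by simp
qed

lemma cay_less: assumes "w \<in> ball \<i> r" "r \<le> 1" shows "cmod (cay w) < r" "0 < Im w"
proof -
  have b: "cmod (w - \<i>) < r" using assms(1) by (simp add: dist_norm norm_minus_commute)
  have "\<bar>Im (w - \<i>)\<bar> < r" using abs_Im_le_cmod[of "w - \<i>"] b by linarith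
  then have "- r < Im (w - \<i>)" unfolding abs_less_iff by linarith
  then show I: "0 < Im w" using assms(2) by simp
  have "1 \<le> cmod (w + \<i>)" using abs_Im_le_cmod[of "w + \<i>"] I by simp
  then have "cmod (w - \<i>) / cmod (w + \<i>) \<le> cmod (w - \<i>)"
    by (simp add: divide_le_eq mult_le_cancel_left1)
  then show "cmod (cay w) < r" using b by (simp add: cay_def norm_divide)
qed

lemma (in flute_seq) chart_ball_preimage: "chart_ball B \<Longrightarrow> openin S V \<Longrightarrow> open {y \<in> B. lift y \<in> V}"
  by (simp add: chart_ball_def)

section \<open>A truncated negative subharmonic function\<close>

locale flute_negative = flute_seq +
  fixes u :: "flute_piece_point set \<Rightarrow> ereal" and N :: real
  assumes unb: "\<And>r. \<exists>n. r < node n"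
    and sub: "subharmonic (associated_surface x) u"
    and neg: "\<And>q. q \<in> topspace S \<Longrightarrow> u q < 0"
    and N: "0 \<le> N"
begin

text \<open>Truncating at \<open>N\<close> makes the superharmonic function \<open>1 - u\<close> bounded, and keeps it positive.\<close>

definition Fe :: "flute_piece_point set \<Rightarrow> ennreal" where
  "Fe q = 1 + min (e2ennreal (- u q)) (ennreal N)"

lemma Fe_bounds: "1 \<le> Fe q" "Fe q \<le> 1 + ennreal N" "Fe q \<noteq> \<infinity>"
proof -
  show 1: "1 \<le> Fe q" by (simp add: Fe_def)
  show 2: "Fe q \<le> 1 + ennreal N" unfolding Fe_def by (intro add_left_mono) simp
  have "1 + ennreal N < \<infinity>" by simp
  with 2 have "Fe q < \<infinity>" by (rule le_less_trans)
  then show "Fe q \<noteq> \<infinity>" by auto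
qed

text \<open>A continuous decreasing function of an upper semicontinuous one. As u(q) < \<infinity>,
  the values just above u(q) still satisfy the open condition.\<close>

lemma Fe_lsc: "openin S {q \<in> topspace S. c < Fe q}"
proof (subst openin_subopen, safe)
  fix q assume q: "q \<in> topspace S" "c < Fe q"
  define G where "G t = 1 + min (e2ennreal (- t)) (ennreal N)" for t
  have anti: "G t' \<le> G t" if "t \<le> t'" for t t'
    using that unfolding G_def by (intro add_left_mono min.mono e2ennreal_mono) auto
  have "continuous_on UNIV (\<lambda>t. e2ennreal (- t))"
    by (intro continuous_on_compose2[OF continuous_on_e2ennreal] continuous_intros) auto
  then have "continuous_on UNIV G" unfolding G_def by (intro continuous_intros continuous_on_min)
  then have "open {t. c < G t}" by (intro open_Collect_less continuous_intros)
  moreover have "u q \<in> {t. c < G t}" using q by (simp add: Fe_def G_def)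
  moreover have "u q < \<infinity>" using neg[OF q(1)] by auto
  ultimately obtain b where b: "u q < b" "{u q..<b} \<subseteq> {t. c < G t}" using open_right by blast
  have "openin S {p \<in> topspace S. u p < b}" using sub unfolding subharmonic_def surf_simps by blast
  moreover have "{p \<in> topspace S. u p < b} \<subseteq> {q \<in> topspace S. c < Fe q}"
  proof safe
    fix p assume p: "u p < b"
    have "c < G (u p)"
    proof (cases "u q \<le> u p")
      case True then show ?thesis using b(2) p by auto
    next
      case False
      then have "G (u q) \<le> G (u p)" by (intro anti) simp
      with q(2) show ?thesis unfolding Fe_def G_def by (rule less_le_trans)
    qed
    then show "c < Fe p" by (simp add: Fe_def G_def)
  qed
  ultimately show "\<exists>T. openin S T \<and> q \<in> T \<and> T \<subseteq> {q \<in> topspace S. c < Fe q}"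
    using q b(1) by (intro exI[of _ "{p \<in> topspace S. u p < b}"]) auto
qed

definition D1 :: "complex set" where "D1 = \<Union>{B. chart_ball B}"
text \<open>The function in half plane coordinates. The value 0 off the open set \<open>D1\<close>
  makes it lower semicontinuous, hence measurable, on the whole plane.\<close>

definition f :: "complex \<Rightarrow> ennreal" where "f y = (if y \<in> D1 then Fe (lift y) else 0)"

lemma Q_D1: assumes "y \<in> Q" shows "y \<in> D1"
proof -
  obtain B where "chart_ball B" "y \<in> B" using chart_ball_exists[OF assms] .
  then show ?thesis by (auto simp: D1_def)
qed

lemma f_Q: "y \<in> Q \<Longrightarrow> f y = Fe (prj y)" by (simp add: f_def Q_D1 lift_Q)

lemma f_open: "open {y. c < f y}"
proof -
  have "{y. c < f y} = (\<Union>B\<in>{B. chart_ball B}. {y \<in> B. lift y \<in> {q \<in> topspace S. c < Fe q}})"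
  proof (intro equalityI subsetI)
    fix y assume "y \<in> {y. c < f y}"
    then have y: "y \<in> D1" "c < Fe (lift y)" by (auto simp: f_def split: if_splits)
    then obtain B where B: "chart_ball B" "y \<in> B" by (auto simp: D1_def)
    then have "lift y \<in> topspace S" using lift_topspace[of y] by (auto simp: chart_ball_def)
    then show "y \<in> (\<Union>B\<in>{B. chart_ball B}. {y \<in> B. lift y \<in> {q \<in> topspace S. c < Fe q}})" using B y by auto
  next
    fix y assume "y \<in> (\<Union>B\<in>{B. chart_ball B}. {y \<in> B. lift y \<in> {q \<in> topspace S. c < Fe q}})"
    then obtain B where "chart_ball B" "y \<in> B" "c < Fe (lift y)" by auto
    then show "y \<in> {y. c < f y}" by (auto simp: f_def D1_def)
  qed
  moreover have "open {y \<in> B. lift y \<in> {q \<in> topspace S. c < Fe q}}" if "chart_ball B" for B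
    by (rule chart_ball_preimage[OF that Fe_lsc])
  ultimately show ?thesis by auto
qed

lemma f_measurable [measurable]: "f \<in> borel_measurable borel"
  by (rule borel_measurableI_greater) (use f_open in auto)

text \<open>If the truncation is active at the centre, f is maximal there. Otherwise f - 1 is
  bounded by -u on the circle and equals -u at the centre, where the mean inequality for u applies.
  A value u = -\<infinity> at the centre makes the bound on the mean of -u infinite.\<close>

lemma super_circle:
  assumes B: "chart_ball B" and g: "hyp_isometry g"
    and \<rho>: "0 < \<rho>" "cball a \<rho> \<subseteq> uhp" "g ` cball a \<rho> \<subseteq> B"
  shows "(\<integral>\<^sup>+t\<in>{0..2 * pi}. f (g (a + of_real \<rho> * cis t)) \<partial>lborel) \<le> ennreal (2 * pi) * f (g a)"
proof -
  have [measurable]: "g \<in> borel_measurable borel" by (rule iso_measurable[OF g])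
  define w where "w z = e2ennreal (- u (lift (g z)))" for z
  have BD: "B \<subseteq> D1" "B \<subseteq> dom" using B by (auto simp: D1_def chart_ball_def)
  have fB: "f (g z) = 1 + min (w z) (ennreal N)" and uB: "u (lift (g z)) < 0" if "z \<in> cball a \<rho>" for z
  proof -
    have "g z \<in> B" using \<rho>(3) that by blast
    then show "f (g z) = 1 + min (w z) (ennreal N)" using BD by (auto simp: f_def Fe_def w_def)
    show "u (lift (g z)) < 0" using neg[OF lift_topspace] BD \<open>g z \<in> B\<close> by blast
  qed
  define I where "I = (\<integral>\<^sup>+t\<in>{0..2 * pi}. w (a + of_real \<rho> * cis t) \<partial>lborel)"
  have pt: "a + of_real \<rho> * cis t \<in> cball a \<rho>" for t using circle_point_in_cball[of \<rho> a t] \<rho> by simp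
  have aB: "a \<in> cball a \<rho>" using \<rho>(1) by simp
  have z: "(\<integral>\<^sup>+ t \<in> {0..2 * pi}. e2ennreal (u (lift (g (a + of_real \<rho> * cis t)))) \<partial>lborel) = 0"
  proof -
    have "e2ennreal (u (lift (g (a + of_real \<rho> * cis t)))) = 0" for t
      using uB[OF pt, of t] by (intro e2ennreal_neg) simp
    then show ?thesis by simp
  qed
  have "u (lift (g a)) \<le> circle_mean (\<lambda>w. u (lift (g w))) a \<rho>"
    by (rule subharmonic_lift[OF sub B g \<rho>])
  then have le: "u (lift (g a)) \<le> (0 - enn2ereal I) / ereal (2 * pi)"
    unfolding circle_mean_def z I_def w_def by (simp add: zero_ennreal.rep_eq)
  have wI: "I \<le> ennreal (2 * pi) * w a"
  proof (cases "u (lift (g a))")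
    case (real m)
    have m: "m < 0" using uB[OF aB] real by simp
    have wa: "w a = ennreal (- m)" by (simp add: w_def real)
    show ?thesis
    proof (cases I)
      case (real i)
      then have "enn2ereal I = ereal i" by (simp add: enn2ereal_ennreal)
      then have "m \<le> - i / (2 * pi)" using le \<open>u (lift (g a)) = ereal m\<close> by (simp add: zero_ereal_def)
      then have "i \<le> 2 * pi * (- m)" by (simp add: field_simps)
      then show ?thesis using m real unfolding wa by (simp add: ennreal_mult[symmetric] ennreal_leI)
    next
      case top
      then have "enn2ereal I = \<infinity>" by simp
      then show ?thesis using le real by simp
    qed
  next
    case PInf then show ?thesis using uB[OF aB] by simp
  next
    case MInf
    then have "w a = \<infinity>" by (simp add: w_def)
    then show ?thesis by (simp add: ennreal_mult_top)
  qed
  show ?thesis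
  proof (cases "w a \<le> ennreal N")
    case False
    have "(\<integral>\<^sup>+t\<in>{0..2 * pi}. f (g (a + of_real \<rho> * cis t)) \<partial>lborel) \<le> (\<integral>\<^sup>+t\<in>{0..2 * pi}. f (g a) \<partial>lborel)"
    proof (intro nn_integral_mono mult_right_mono)
      fix t
      have "f (g a) = 1 + ennreal N" using fB[OF aB] False by (simp add: min_def)
      then show "f (g (a + of_real \<rho> * cis t)) \<le> f (g a)" using fB[OF pt, of t] by (simp add: add_left_mono)
    qed simp
    then show ?thesis by (simp add: nn_integral_cmult_indicator mult.commute)
  next
    case True
    have "(\<integral>\<^sup>+t\<in>{0..2 * pi}. f (g (a + of_real \<rho> * cis t)) \<partial>lborel)
       = (\<integral>\<^sup>+t. indicator {0..2 * pi} t + (f (g (a + of_real \<rho> * cis t)) - 1) * indicator {0..2 * pi} t \<partial>lborel)"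
      using fB[OF pt] by (intro nn_integral_cong) (auto split: split_indicator)
    also have "\<dots> = (\<integral>\<^sup>+t. indicator {0..2 * pi} t \<partial>lborel) + (\<integral>\<^sup>+t\<in>{0..2 * pi}. (f (g (a + of_real \<rho> * cis t)) - 1) \<partial>lborel)"
      by (rule nn_integral_add) measurable
    also have "\<dots> \<le> ennreal (2 * pi) + I"
      unfolding I_def using fB[OF pt]
      by (intro add_mono nn_integral_mono mult_right_mono) auto
    also have "\<dots> \<le> ennreal (2 * pi) + ennreal (2 * pi) * w a" by (intro add_left_mono wI)
    also have "\<dots> = ennreal (2 * pi) * f (g a)" using fB[OF aB] True by (simp add: min_def distrib_left)
    finally show ?thesis .
  qed
qed

lemma super_disc:
  assumes B: "chart_ball B" and g: "hyp_isometry g"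
    and r: "0 < r" "ball a r \<subseteq> uhp" "g ` ball a r \<subseteq> B"
  shows "(\<integral>\<^sup>+w\<in>ball a r. f (g w) \<partial>lborel) \<le> emeasure lborel (ball a r) * f (g a)"
proof (rule disc_mean[OF _ r(1)])
  have [measurable]: "g \<in> borel_measurable borel" by (rule iso_measurable[OF g])
  show "(\<lambda>w. f (g w)) \<in> borel_measurable borel" by measurable
  fix \<rho> assume \<rho>: "0 < \<rho>" "\<rho> < r"
  then have "cball a \<rho> \<subseteq> ball a r" by auto
  then show "(\<integral>\<^sup>+t\<in>{0..2 * pi}. f (g (a + of_real \<rho> * cis t)) \<partial>lborel) \<le> ennreal (2 * pi) * f (g a)"
    using \<rho> r by (intro super_circle[OF B g]) auto
qed

text \<open>Real valued, as the energy inequality requires; off \<open>Qo\<close> the value 1 is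
  merely a positive default.\<close>

definition \<phi> :: "complex \<Rightarrow> real" where "\<phi> z = (if z \<in> Qo then enn2real (f z) else 1)"

lemma \<phi>_measurable [measurable]: "\<phi> \<in> borel_measurable borel"
  unfolding \<phi>_def[abs_def] by measurable

lemma \<phi>_eq: "z \<in> Qo \<Longrightarrow> ennreal (\<phi> z) = Fe (prj z)"
  using Fe_bounds(3)[of "prj z"] by (simp add: \<phi>_def f_Q Qo_Q less_top)

lemma \<phi>_f: "z \<in> Qo \<Longrightarrow> ennreal (\<phi> z) = f z" by (simp add: \<phi>_eq f_Q Qo_Q)

lemma \<phi>_bounds: assumes "z \<in> Qo" shows "1 \<le> \<phi> z" "\<phi> z \<le> 1 + N"
proof -
  have p: "0 \<le> \<phi> z" by (simp add: \<phi>_def)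
  have "ennreal 1 \<le> ennreal (\<phi> z)" using Fe_bounds(1) \<phi>_eq[OF assms] by simp
  then show "1 \<le> \<phi> z" using p by (simp add: ennreal_le_iff)
  have "ennreal (\<phi> z) \<le> ennreal (1 + N)" using Fe_bounds(2) \<phi>_eq[OF assms] N by (simp add: ennreal_plus)
  then show "\<phi> z \<le> 1 + N" by (subst (asm) ennreal_le_iff) (use N in auto)
qed

text \<open>A Lebesgue number for the cover by chart balls. K will contain the support of a cutoff
  in \<open>Qo\<close>, so that one kernel radius serves all its points.\<close>

lemma good_radius:
  assumes "compact K" "K \<subseteq> Q"
  obtains s where "0 < s" "\<And>x. x \<in> K \<Longrightarrow> \<exists>B. chart_ball B \<and> ball x s \<subseteq> B"
proof -
  have "K \<subseteq> \<Union>{B. chart_ball B}" using assms(2) Q_D1 by (auto simp: D1_def)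
  moreover have "open B" if "B \<in> {B. chart_ball B}" for B using that by (simp add: chart_ball_def)
  ultimately obtain s where "0 < s" "\<forall>x\<in>K. \<exists>B\<in>{B. chart_ball B}. ball x s \<subseteq> B"
    using Heine_Borel_lemma[OF assms(1)] by metis
  then show ?thesis by (intro that[of s]) auto
qed

text \<open>Points of \<open>dom\<close> outside \<open>domo\<close> unfold to a side. They lie on
  the circles of the sides or in their preimages under the pairings, countably many null
  sets.\<close>

lemma AE_domo: "AE y in hyp. y \<in> dom \<longrightarrow> y \<in> domo"
proof -
  have "AE y in hyp. y \<notin> {y. cmod (y - of_real (cen i)) = rad i}" for i
    by (rule null_sets_hypI[OF sphere_null])
  then have 1: "AE y in hyp. \<forall>i. y \<notin> {y. cmod (y - of_real (cen i)) = rad i}" by (subst AE_all_countable) simp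
  have "AE y in hyp. mv j y \<notin> {y. cmod (y - of_real (cen i)) = rad i}" for i j
    by (rule AE_hyp_iso[OF sphere_null iso_mv])
  then have "AE y in hyp. \<forall>i. mv j y \<notin> {y. cmod (y - of_real (cen i)) = rad i}" for j by (subst AE_all_countable) simp
  then have 2: "AE y in hyp. \<forall>j. \<forall>i. mv j y \<notin> {y. cmod (y - of_real (cen i)) = rad i}" by (subst AE_all_countable) simp
  show ?thesis using 1 2
  proof eventually_elim
    case (elim y)
    show ?case
    proof
      assume y: "y \<in> dom"
      have "\<not> on_side (unf y)"
      proof (cases "\<exists>j. y \<in> ins j")
        case True
        then obtain j where "y \<in> ins j" by blast
        then have "unf y = mv j y" by (rule unf_ins)
        then show ?thesis using elim(2) unfolding on_side_def by simp
      next
        case False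
        then have "unf y = y" using unf_notin[of y] by blast
        then show ?thesis using elim(1) unfolding on_side_def by simp
      qed
      then show "y \<in> domo" using y by (simp add: domo_def dom_def Qo_def)
    qed
  qed
qed

text \<open>By \<open>pd_close\<close> the condition on r keeps everything the kernel sees from p
  inside the chart ball B, where f has the mean inequality on discs. Replacing the full mass of the
  kernel by its mass on \<open>domo\<close> costs only a null set.\<close>

lemma kernel_super_flute:
  assumes p: "p \<in> Qo" and B: "chart_ball B" "ball p s \<subseteq> B" and r: "0 < r" "r \<le> 1 / 10" "3 * r * Im p < s"
  shows "(\<integral>\<^sup>+y. indicator domo y * (kern r (pd p y) * ennreal (\<phi> (unf y))) \<partial>hyp)
        \<le> ennreal (\<phi> p) * (\<integral>\<^sup>+y. indicator domo y * kern r (pd p y) \<partial>hyp)"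
proof -
  have Ix: "0 < Im p" using Qo_Im[OF p] .
  have BD: "B \<subseteq> D1" "B \<subseteq> dom" using B(1) by (auto simp: D1_def chart_ball_def)
  have near: "y \<in> B" if "0 < Im y" "pd p y < r" for y
  proof -
    have "cmod (p - y) \<le> 3 * r * Im p" by (rule pd_close[OF Ix that r(2)])
    then have "y \<in> ball p s" using r(3) by (simp add: dist_norm)
    then show ?thesis using B(2) by blast
  qed
  have r1: "r \<le> 1" using r by simp
  have "(\<integral>\<^sup>+y. indicator domo y * (kern r (pd p y) * ennreal (\<phi> (unf y))) \<partial>hyp) \<le> (\<integral>\<^sup>+y. kern r (pd p y) * f y \<partial>hyp)"
  proof (rule nn_integral_mono)
    fix y
    show "indicator domo y * (kern r (pd p y) * ennreal (\<phi> (unf y))) \<le> kern r (pd p y) * f y"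
    proof (cases "y \<in> domo \<and> kern r (pd p y) \<noteq> 0")
      case True
      then have "pd p y < r" using kern_support[of r "pd p y"] r1 by simp
      then have "y \<in> B" using near[of y] True by (simp add: domo_def)
      then have "f y = Fe (prj (unf y))" using BD by (auto simp: f_def lift_def)
      then show ?thesis using True \<phi>_eq[of "unf y"] by (simp add: domo_def)
    qed (auto split: split_indicator)
  qed
  also have "\<dots> \<le> disc_area r * f p * ennreal (2 * pi)"
  proof (rule kernel_super[OF f_measurable Ix r1])
    fix g assume g: "hyp_isometry g" "\<And>w. 0 < Im w \<Longrightarrow> pd p (g w) = cmod (cay w)" "g \<i> = p"
    have "(\<integral>\<^sup>+w\<in>ball \<i> r. f (g w) \<partial>lborel) \<le> emeasure lborel (ball \<i> r) * f (g \<i>)"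
    proof (rule super_disc[OF B(1) g(1) r(1)])
      show "ball \<i> r \<subseteq> uhp" using cay_less[of _ r] r1 by auto
      show "g ` ball \<i> r \<subseteq> B"
      proof
        fix y assume "y \<in> g ` ball \<i> r"
        then obtain w where w: "w \<in> ball \<i> r" "y = g w" by auto
        show "y \<in> B" using near[of y] cay_less[OF w(1) r1] g(2)[of w] iso_Im[OF g(1), of w] w(2) by simp
      qed
    qed
    then show "(\<integral>\<^sup>+w\<in>ball \<i> r. f (g w) \<partial>lborel) \<le> disc_area r * f p" by (simp add: disc_area_def g(3))
  qed
  also have "\<dots> = f p * (\<integral>\<^sup>+y. kern r (pd p y) \<partial>hyp)" by (simp add: kernel_total[OF Ix r1] mult_ac)
  also have "(\<integral>\<^sup>+y. kern r (pd p y) \<partial>hyp) = (\<integral>\<^sup>+y. indicator domo y * kern r (pd p y) \<partial>hyp)"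
  proof -
    have I: "AE y in hyp. 0 < Im y" unfolding hyp_def by (subst AE_density) (auto simp: indicator_def)
    show ?thesis
    proof (rule nn_integral_cong_AE)
      show "AE y in hyp. kern r (pd p y) = indicator domo y * kern r (pd p y)"
        using AE_domo I
      proof eventually_elim
        case (elim y)
        show ?case
        proof (cases "kern r (pd p y) = 0")
          case False
          then have "y \<in> B" using near[of y] elim(2) kern_support[of r "pd p y"] r1 by simp
          then have "y \<in> domo" using elim(1) BD by blast
          then show ?thesis by simp
        qed simp
      qed
    qed
  qed
  finally show ?thesis by (simp add: \<phi>_f[OF p])
qed

end

section \<open>Cutoff functions of small energy\<close>

text \<open>The logarithmic cutoff, 1 up to radius R and 0 from radius R exp \<Lambda> on; its
  energy is of order 1 / \<Lambda>.\<close>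

definition cutA :: "real \<Rightarrow> real \<Rightarrow> complex \<Rightarrow> real" where
  "cutA R \<Lambda> z = max 0 (min 1 (1 - ln (cmod z / R) / \<Lambda>))"
text \<open>Removes the cusps: 0 below height d and 1 above height 2 d. Its energy is small because
  the cusps have little area there.\<close>

definition cutB :: "real \<Rightarrow> complex \<Rightarrow> real" where "cutB d z = max 0 (min 1 (Im z / d - 1))"
definition cutoff :: "real \<Rightarrow> real \<Rightarrow> real \<Rightarrow> complex \<Rightarrow> real" where
  "cutoff R \<Lambda> d z = cutA R \<Lambda> z * cutB d z"

text \<open>\<open>densA\<close> and \<open>densB\<close> bound the squared difference of the cutoff
  divided by r^2. Their constants are 2 * 5^2 and 2 * 12^2, with the 5 of \<open>cutA_diff\<close>
  and the 12 of \<open>cutB_diff\<close>. The annulus is widened by factors of 2 because a partner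
  of z may differ in modulus by 30 percent.\<close>

definition densA :: "real \<Rightarrow> real \<Rightarrow> complex \<Rightarrow> real" where
  "densA R \<Lambda> z = (if R / 2 \<le> cmod z \<and> cmod z \<le> 2 * (R * exp \<Lambda>) then 50 * (Im z / cmod z)\<^sup>2 / \<Lambda>\<^sup>2 else 0)"
definition densB :: "real \<Rightarrow> real \<Rightarrow> real \<Rightarrow> complex \<Rightarrow> real" where
  "densB R \<Lambda> d z = (if Im z \<le> 4 * d \<and> cmod z \<le> 2 * (R * exp \<Lambda>) then 288 else 0)"

lemma clamp_lipschitz: "\<bar>max 0 (min 1 a) - max 0 (min 1 b)\<bar> \<le> \<bar>a - b\<bar>" for a b :: real
  by (auto simp: max_def min_def abs_if)

lemma cut_bounds [simp]: "0 \<le> cutA R \<Lambda> z" "cutA R \<Lambda> z \<le> 1" "0 \<le> cutB d z" "cutB d z \<le> 1"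
  by (auto simp: cutA_def cutB_def)

lemma cutoff_nonneg [simp]: "0 \<le> cutoff R \<Lambda> d z" and cutoff_le_1: "cutoff R \<Lambda> d z \<le> 1"
  by (simp_all add: cutoff_def mult_le_one)

lemma cutoff_measurable [measurable]: "cutoff R \<Lambda> d \<in> borel_measurable borel"
  unfolding cutoff_def[abs_def] cutA_def cutB_def by measurable

lemma dens_measurable [measurable]: "densA R \<Lambda> \<in> borel_measurable borel" "densB R \<Lambda> d \<in> borel_measurable borel"
  unfolding densA_def[abs_def] densB_def[abs_def] by measurable

lemma cutA_1: assumes "0 < R" "0 < \<Lambda>" "0 < cmod z" "cmod z \<le> R" shows "cutA R \<Lambda> z = 1"
proof -
  have "0 < cmod z / R" "cmod z / R \<le> 1" using assms by (simp_all del: zero_less_norm_iff)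
  then have "ln (cmod z / R) \<le> 0" using ln_le_minus_one[of "cmod z / R"] by linarith
  then have "ln (cmod z / R) / \<Lambda> \<le> 0" using assms by (intro divide_nonpos_pos) auto
  then show ?thesis by (simp add: cutA_def)
qed

lemma cutA_0: assumes "0 < R" "0 < \<Lambda>" "R * exp \<Lambda> \<le> cmod z" shows "cutA R \<Lambda> z = 0"
proof -
  have "exp \<Lambda> \<le> cmod z / R" using assms by (simp add: field_simps)
  then have "ln (exp \<Lambda>) \<le> ln (cmod z / R)" using exp_gt_zero[of \<Lambda>] by (intro ln_mono) (auto intro: less_le_trans)
  then have "1 \<le> ln (cmod z / R) / \<Lambda>" using assms by (simp add: le_divide_eq)
  then show ?thesis by (simp add: cutA_def)
qed

lemma close_cmod:
  assumes "0 < Im z" "cmod (z - w) \<le> 3 * r * Im z" "r \<le> 1 / 10"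
  shows "cmod (z - w) \<le> 3 / 10 * cmod z" "7 / 10 * cmod z \<le> cmod w" "cmod w \<le> 13 / 10 * cmod z"
proof -
  have "3 * r * Im z \<le> 3 / 10 * Im z" using assms by (intro mult_right_mono) auto
  also have "\<dots> \<le> 3 / 10 * cmod z" using abs_Im_le_cmod[of z] by simp
  finally show 1: "cmod (z - w) \<le> 3 / 10 * cmod z" using assms(2) by linarith
  show "7 / 10 * cmod z \<le> cmod w" "cmod w \<le> 13 / 10 * cmod z"
    using 1 norm_triangle_ineq2[of z w] norm_triangle_ineq2[of w z] norm_minus_commute[of z w] by linarith+
qed

text \<open>Outside the widened annulus both points have the same value, 1 or 0. Inside, the
  logarithms differ by at most 3 r Im z divided by 7/10 of |z|, and 30 / 7 \<le> 5.\<close>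

lemma cutA_diff:
  assumes R: "0 < R" "0 < \<Lambda>" and z: "0 < Im z" and c: "cmod (z - w) \<le> 3 * r * Im z" and r: "0 < r" "r \<le> 1 / 10"
  shows "\<bar>cutA R \<Lambda> z - cutA R \<Lambda> w\<bar> \<le>
    (if R / 2 \<le> cmod z \<and> cmod z \<le> 2 * (R * exp \<Lambda>) then 5 * r * (Im z / cmod z) / \<Lambda> else 0)"
proof -
  define a b where "a = cmod z" and "b = cmod w"
  note cl = close_cmod[OF z c r(2), folded a_def b_def]
  have a: "0 < a" using z by (auto simp: a_def complex_eq_iff)
  have b: "0 < b" using cl(2) a by linarith
  have ab: "\<bar>a - b\<bar> \<le> 3 * r * Im z" using c norm_triangle_ineq3[of z w] by (simp add: a_def b_def)
  consider "R / 2 \<le> a \<and> a \<le> 2 * (R * exp \<Lambda>)" | "a < R / 2" | "2 * (R * exp \<Lambda>) < a" by linarith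
  then show ?thesis
  proof cases
    case 1
    have "\<bar>cutA R \<Lambda> z - cutA R \<Lambda> w\<bar> \<le> \<bar>(1 - ln (a / R) / \<Lambda>) - (1 - ln (b / R) / \<Lambda>)\<bar>"
      unfolding cutA_def a_def b_def by (rule clamp_lipschitz)
    also have "\<dots> = \<bar>ln a - ln b\<bar> / \<Lambda>"
      using R a b by (simp add: ln_div abs_minus_commute flip: diff_divide_distrib)
    also have "\<bar>ln a - ln b\<bar> \<le> 5 * r * (Im z / a)"
    proof -
      have pos: "0 \<le> 3 * r * Im z" using r z by simp
      have "ln a - ln b = ln (a / b)" using a b by (simp add: ln_div)
      also have "\<dots> \<le> a / b - 1" using a b by (intro ln_le_minus_one) simp
      also have "\<dots> = (a - b) / b" using b by (simp add: field_simps)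
      also have "\<dots> \<le> 3 * r * Im z / b" using ab b by (intro divide_right_mono) auto
      also have "\<dots> \<le> 3 * r * Im z / (7 / 10 * a)" using cl(2) a b pos by (intro divide_left_mono) auto
      also have "\<dots> \<le> 5 * r * (Im z / a)" using a r z by (simp add: field_simps)
      finally have 1: "ln a - ln b \<le> 5 * r * (Im z / a)" .
      have "ln b - ln a = ln (b / a)" using a b by (simp add: ln_div)
      also have "\<dots> \<le> b / a - 1" using a b by (intro ln_le_minus_one) simp
      also have "\<dots> = (b - a) / a" using a by (simp add: field_simps)
      also have "\<dots> \<le> 3 * r * Im z / a" using ab a by (intro divide_right_mono) auto
      also have "\<dots> \<le> 5 * r * (Im z / a)" using a r z by (simp add: field_simps)
      finally show ?thesis using 1 by linarith
    qed
    finally show ?thesis using 1 R by (simp add: a_def divide_right_mono)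
  next
    case 2
    have "cutA R \<Lambda> z = 1" "cutA R \<Lambda> w = 1"
      using 2 cl(3) a b R by (auto intro!: cutA_1 simp: a_def b_def)
    then show ?thesis using r z R by (auto intro!: divide_nonneg_nonneg)
  next
    case 3
    have p: "0 < R * exp \<Lambda>" using R by simp
    have "R * exp \<Lambda> \<le> a" "R * exp \<Lambda> \<le> b" using 3 cl(2) p by linarith+
    then have "cutA R \<Lambda> z = 0" "cutA R \<Lambda> w = 0" unfolding a_def b_def by (simp_all add: cutA_0[OF R])
    then show ?thesis using 3 by (simp add: a_def)
  qed
qed

text \<open>Above height 4 d the partner is still above 2 d, so both values are 1; below, 3 r Im z /
  d is at most 12 r.\<close>

lemma cutB_diff:
  assumes d: "0 < d" and z: "0 < Im z" and c: "cmod (z - w) \<le> 3 * r * Im z" and r: "0 < r" "r \<le> 1 / 10"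
  shows "\<bar>cutB d z - cutB d w\<bar> \<le> (if Im z \<le> 4 * d then 12 * r else 0)"
proof -
  have I: "\<bar>Im z - Im w\<bar> \<le> 3 * r * Im z" using c abs_Im_le_cmod[of "z - w"] by simp
  show ?thesis
  proof (cases "Im z \<le> 4 * d")
    case True
    have "\<bar>cutB d z - cutB d w\<bar> \<le> \<bar>(Im z / d - 1) - (Im w / d - 1)\<bar>"
      unfolding cutB_def by (rule clamp_lipschitz)
    also have "\<dots> = \<bar>Im z - Im w\<bar> / d" using d by (simp flip: diff_divide_distrib)
    also have "\<dots> \<le> 3 * r * (4 * d) / d"
      using I True r d by (intro divide_right_mono order_trans[OF I] mult_left_mono) auto
    finally show ?thesis using True d by simp
  next
    case False
    have "3 * r * Im z \<le> 3 / 10 * Im z" using r z by (intro mult_right_mono) auto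
    then have "2 * d \<le> Im w" "2 * d \<le> Im z" using I False d by linarith+
    then have "cutB d z = 1" "cutB d w = 1" using d by (simp_all add: cutB_def field_simps)
    then show ?thesis using False by simp
  qed
qed

text \<open>The product rule for differences, with (p + q)^2 \<le> 2 p^2 + 2 q^2. The factor
  \<open>cutA\<close> at w confines the second part to a bounded region.\<close>

lemma cutoff_diff:
  assumes R: "0 < R" "0 < \<Lambda>" "0 < d" and z: "0 < Im z" and c: "cmod (z - w) \<le> 3 * r * Im z" and r: "0 < r" "r \<le> 1 / 10"
  shows "(cutoff R \<Lambda> d z - cutoff R \<Lambda> d w)\<^sup>2 \<le> r\<^sup>2 * (densA R \<Lambda> z + densB R \<Lambda> d z)"
proof -
  define p where "p = (if R / 2 \<le> cmod z \<and> cmod z \<le> 2 * (R * exp \<Lambda>) then 5 * r * (Im z / cmod z) / \<Lambda> else 0)"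
  define q where "q = (if Im z \<le> 4 * d \<and> cmod z \<le> 2 * (R * exp \<Lambda>) then 12 * r else 0)"
  have A: "\<bar>cutA R \<Lambda> z - cutA R \<Lambda> w\<bar> \<le> p" unfolding p_def by (rule cutA_diff[OF R(1,2) z c r])
  have B: "cutA R \<Lambda> w * \<bar>cutB d z - cutB d w\<bar> \<le> q"
  proof (cases "cmod z \<le> 2 * (R * exp \<Lambda>)")
    case True
    have "cutA R \<Lambda> w * \<bar>cutB d z - cutB d w\<bar> \<le> 1 * \<bar>cutB d z - cutB d w\<bar>" by (intro mult_right_mono) auto
    then show ?thesis using cutB_diff[OF R(3) z c r] True by (auto simp: q_def split: if_splits)
  next
    case False
    have "0 < R * exp \<Lambda>" using R by simp
    then have "R * exp \<Lambda> \<le> cmod w" using False close_cmod(2)[OF z c r(2)] by linarith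
    then have "cutA R \<Lambda> w = 0" using R by (intro cutA_0) auto
    then show ?thesis using r by (simp add: q_def)
  qed
  have "\<bar>cutoff R \<Lambda> d z - cutoff R \<Lambda> d w\<bar>
     = \<bar>(cutA R \<Lambda> z - cutA R \<Lambda> w) * cutB d z + cutA R \<Lambda> w * (cutB d z - cutB d w)\<bar>"
    by (simp add: cutoff_def algebra_simps)
  also have "\<dots> \<le> \<bar>cutA R \<Lambda> z - cutA R \<Lambda> w\<bar> * cutB d z + cutA R \<Lambda> w * \<bar>cutB d z - cutB d w\<bar>"
    by (rule order_trans[OF abs_triangle_ineq]) (simp add: abs_mult)
  also have "\<dots> \<le> \<bar>cutA R \<Lambda> z - cutA R \<Lambda> w\<bar> * 1 + cutA R \<Lambda> w * \<bar>cutB d z - cutB d w\<bar>"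
    by (intro add_right_mono mult_left_mono) auto
  also have "\<dots> \<le> p + q" using A B by simp
  finally have "\<bar>cutoff R \<Lambda> d z - cutoff R \<Lambda> d w\<bar> \<le> p + q" .
  then have "(cutoff R \<Lambda> d z - cutoff R \<Lambda> d w)\<^sup>2 \<le> (p + q)\<^sup>2"
    by (subst power2_abs[symmetric]) (intro power_mono, auto)
  also have "\<dots> \<le> 2 * p\<^sup>2 + 2 * q\<^sup>2"
    using zero_le_power2[of "p - q"] by (simp add: power2_sum power2_diff)
  also have "2 * p\<^sup>2 = r\<^sup>2 * densA R \<Lambda> z"
    by (simp add: p_def densA_def power_mult_distrib power_divide)
  also have "2 * q\<^sup>2 = r\<^sup>2 * densB R \<Lambda> d z"
    by (simp add: q_def densB_def power_mult_distrib)
  finally show ?thesis by (simp add: distrib_left)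
qed

lemma emeasure_cball_le: "0 \<le> \<rho> \<Longrightarrow> emeasure lborel (cball (a::complex) \<rho>) \<le> ennreal (4 * \<rho>\<^sup>2)"
proof -
  assume \<rho>: "0 \<le> \<rho>"
  have "cball a \<rho> \<subseteq> cbox (Complex (Re a - \<rho>) (Im a - \<rho>)) (Complex (Re a + \<rho>) (Im a + \<rho>))"
  proof
    fix w assume "w \<in> cball a \<rho>"
    then have "\<bar>Re (w - a)\<bar> \<le> \<rho>" "\<bar>Im (w - a)\<bar> \<le> \<rho>"
      using abs_Re_le_cmod[of "w - a"] abs_Im_le_cmod[of "w - a"] by (simp_all add: dist_norm norm_minus_commute)
    then show "w \<in> cbox (Complex (Re a - \<rho>) (Im a - \<rho>)) (Complex (Re a + \<rho>) (Im a + \<rho>))"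
      by (auto simp: in_cbox_complex_iff)
  qed
  then have "emeasure lborel (cball a \<rho>) \<le> emeasure lborel (cbox (Complex (Re a - \<rho>) (Im a - \<rho>)) (Complex (Re a + \<rho>) (Im a + \<rho>)))"
    by (intro emeasure_mono) auto
  also have "\<dots> = ennreal (4 * \<rho>\<^sup>2)"
    using \<rho> by (subst emeasure_lborel_cbox) (auto simp: Basis_complex_def inner_complex_def power2_eq_square)
  finally show ?thesis .
qed

text \<open>The annulus \<open>R / 2 \<le> \<bar>z\<bar> \<le> 2 ^ (m + 1) R\<close> is covered by \<open>m + 2\<close> dyadic annuli, each of which
  contributes a bounded amount to \<open>\<integral> \<bar>z\<bar>\<^sup>-\<^sup>2\<close>.\<close>

lemma densA_integral:
  assumes R: "0 < R" and m: "0 < m"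
  shows "(\<integral>\<^sup>+z. ennreal (densA R (real m * ln 2) z) \<partial>hyp) \<le> ennreal (2400 / (real m * (ln 2)\<^sup>2))"
proof -
  define \<Lambda> where "\<Lambda> = real m * ln 2"
  have ex: "exp \<Lambda> = 2 ^ m" by (simp add: \<Lambda>_def exp_of_nat_mult)
  have \<Lambda>: "0 < \<Lambda>" using m by (simp add: \<Lambda>_def)
  \<comment> \<open>On the i-th annulus 1 / |z|^2 is at most 4 / (R 2^i)^2, and the disc containing
    it has area at most 4 (R 2^i)^2. Each annulus thus contributes 50 * 4 * 4 / \<Lambda>^2, and m +
    2 \<le> 3 m leads to the constant 2400.\<close>
  define k where "k i = 50 / \<Lambda>\<^sup>2 * (4 / (R * 2 ^ i)\<^sup>2)" for i :: nat
  have k0: "0 \<le> k i" for i by (simp add: k_def)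
  have "(\<integral>\<^sup>+z. ennreal (densA R \<Lambda> z) \<partial>hyp) = (\<integral>\<^sup>+z. indicator uhp z * ennreal (1 / (Im z)\<^sup>2) * ennreal (densA R \<Lambda> z) \<partial>lborel)"
    by (rule nn_integral_hyp) measurable
  also have "\<dots> \<le> (\<integral>\<^sup>+z. (\<Sum>i<m + 2. ennreal (k i) * indicator (cball (0::complex) (R * 2 ^ i)) z) \<partial>lborel)"
  proof (rule nn_integral_mono)
    fix z :: complex
    show "indicator uhp z * ennreal (1 / (Im z)\<^sup>2) * ennreal (densA R \<Lambda> z) \<le> (\<Sum>i<m + 2. ennreal (k i) * indicator (cball (0::complex) (R * 2 ^ i)) z)"
    proof (cases "0 < Im z \<and> R / 2 \<le> cmod z \<and> cmod z \<le> 2 * (R * exp \<Lambda>)")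
      case False
      then show ?thesis by (auto simp: densA_def split: split_indicator)
    next
      case True
      define i where "i = (LEAST i. cmod z \<le> R * 2 ^ i)"
      have P: "cmod z \<le> R * 2 ^ Suc m" using True by (simp add: ex mult_ac)
      have i1: "cmod z \<le> R * 2 ^ i" unfolding i_def by (rule LeastI[of "\<lambda>i. cmod z \<le> R * 2 ^ i", OF P])
      have im: "i < m + 2" using Least_le[of "\<lambda>i. cmod z \<le> R * 2 ^ i", OF P] by (simp add: i_def)
      have i2: "R * 2 ^ i / 2 \<le> cmod z"
      proof (cases i)
        case 0 then show ?thesis using True by simp
      next
        case (Suc l)
        then have "\<not> cmod z \<le> R * 2 ^ l" unfolding i_def by (metis lessI not_less_Least)
        then show ?thesis using Suc by simp
      qed
      have q: "0 < R * 2 ^ i / 2" using R by simp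
      have "(R * 2 ^ i / 2)\<^sup>2 \<le> (cmod z)\<^sup>2" using i2 q by (intro power_mono) auto
      then have "1 / (cmod z)\<^sup>2 \<le> 1 / (R * 2 ^ i / 2)\<^sup>2" using q by (intro divide_left_mono mult_pos_pos) auto
      then have le: "1 / (cmod z)\<^sup>2 \<le> 4 / (R * 2 ^ i)\<^sup>2" by (simp add: power_divide)
      have "1 / (Im z)\<^sup>2 * densA R \<Lambda> z = 50 / \<Lambda>\<^sup>2 * (1 / (cmod z)\<^sup>2)"
        using True by (simp add: densA_def power_divide)
      also have "\<dots> \<le> k i" unfolding k_def using le by (intro mult_left_mono) auto
      finally have "indicator uhp z * ennreal (1 / (Im z)\<^sup>2) * ennreal (densA R \<Lambda> z) \<le> ennreal (k i)"
        using True by (simp add: ennreal_mult[symmetric] densA_def ennreal_leI)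
      also have "\<dots> = ennreal (k i) * indicator (cball (0::complex) (R * 2 ^ i)) z" using i1 by (simp add: dist_norm)
      also have "\<dots> \<le> (\<Sum>i<m + 2. ennreal (k i) * indicator (cball (0::complex) (R * 2 ^ i)) z)"
        using im by (intro member_le_sum) auto
      finally show ?thesis .
    qed
  qed
  also have "\<dots> = (\<Sum>i<m + 2. ennreal (k i) * emeasure lborel (cball (0::complex) (R * 2 ^ i)))"
    proof (subst nn_integral_sum)
    show "(\<lambda>z. ennreal (k i) * indicator (cball (0::complex) (R * 2 ^ i)) z) \<in> borel_measurable lborel" for i
      by (intro borel_measurable_times_ennreal borel_measurable_indicator borel_measurable_const) simp
  qed (simp add: nn_integral_cmult_indicator)
  also have "\<dots> \<le> (\<Sum>i<m + 2. ennreal (800 / \<Lambda>\<^sup>2))"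
  proof (rule sum_mono)
    fix i
    have "ennreal (k i) * emeasure lborel (cball (0::complex) (R * 2 ^ i)) \<le> ennreal (k i) * ennreal (4 * (R * 2 ^ i)\<^sup>2)"
      using R by (intro mult_left_mono emeasure_cball_le) auto
    also have "\<dots> = ennreal (k i * (4 * (R * 2 ^ i)\<^sup>2))" using k0[of i] by (simp add: ennreal_mult)
    also have "k i * (4 * (R * 2 ^ i)\<^sup>2) = 800 / \<Lambda>\<^sup>2" using R by (simp add: k_def)
    finally show "ennreal (k i) * emeasure lborel (cball (0::complex) (R * 2 ^ i)) \<le> ennreal (800 / \<Lambda>\<^sup>2)" .
  qed
  also have "\<dots> = ennreal (real (m + 2) * (800 / \<Lambda>\<^sup>2))"
    unfolding sum_constant card_lessThan ennreal_of_nat_eq_real_of_nat by (rule ennreal_mult[symmetric]) simp_all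
  also have "\<dots> \<le> ennreal (2400 / (real m * (ln 2)\<^sup>2))"
  proof (rule ennreal_leI)
    have "real (m + 2) * (800 / \<Lambda>\<^sup>2) \<le> (3 * real m) * (800 / \<Lambda>\<^sup>2)"
      using m by (intro mult_right_mono) auto
    also have "\<dots> = 2400 / (real m * (ln 2)\<^sup>2)"
      using m by (simp add: \<Lambda>_def power_mult_distrib power2_eq_square field_simps)
    finally show "real (m + 2) * (800 / \<Lambda>\<^sup>2) \<le> 2400 / (real m * (ln 2)\<^sup>2)" .
  qed
  finally show ?thesis by (simp add: \<Lambda>_def)
qed

text \<open>The squared distances in question, suitably scaled, are a / (a + W) and b / (b + W) with
  the same W \<ge> 0, so they compare as a and b. The difference a - b factors into terms of
  opposite sign, one for each side of the circle.\<close>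

lemma reflect_pd_aux:
  fixes X Y :: complex and \<rho> :: real
  assumes X: "\<rho> \<le> cmod X" and Y: "cmod Y \<le> \<rho>" and I: "0 < Im X" "0 < Im Y" and \<rho>: "0 < \<rho>"
  shows "cmod (X * cnj Y - of_real (\<rho>\<^sup>2)) * cmod (X - cnj Y) \<le> cmod (X * Y - of_real (\<rho>\<^sup>2)) * cmod (X - Y)"
proof -
  define a where "a = (cmod (X * cnj Y - of_real (\<rho>\<^sup>2)))\<^sup>2"
  define b where "b = \<rho>\<^sup>2 * (cmod (X - Y))\<^sup>2"
  define W where "W = 4 * \<rho>\<^sup>2 * (Im X * Im Y)"
  have 1: "(cmod (X * Y - of_real (\<rho>\<^sup>2)))\<^sup>2 = a + W"
    unfolding a_def W_def cmod_power2 by (simp add: power2_eq_square algebra_simps)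
  have 2: "\<rho>\<^sup>2 * (cmod (X - cnj Y))\<^sup>2 = b + W"
    unfolding b_def W_def cmod_power2 by (simp add: power2_eq_square algebra_simps)
  have 3: "a - b = ((cmod X)\<^sup>2 - \<rho>\<^sup>2) * ((cmod Y)\<^sup>2 - \<rho>\<^sup>2)"
    unfolding a_def b_def cmod_power2 by (simp add: power2_eq_square algebra_simps)
  have "\<rho>\<^sup>2 \<le> (cmod X)\<^sup>2" "(cmod Y)\<^sup>2 \<le> \<rho>\<^sup>2" using X Y \<rho> by (auto intro!: power_mono)
  then have "a - b \<le> 0" unfolding 3 by (intro mult_nonneg_nonpos) auto
  then have ab: "a \<le> b" by simp
  have "0 \<le> W" using I by (simp add: W_def)
  then have "a * (b + W) \<le> (a + W) * b" using ab by (simp add: algebra_simps mult_left_mono)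
  then have "\<rho>\<^sup>2 * (a * (cmod (X - cnj Y))\<^sup>2) \<le> \<rho>\<^sup>2 * ((cmod (X * Y - of_real (\<rho>\<^sup>2)))\<^sup>2 * (cmod (X - Y))\<^sup>2)"
  proof -
    have "\<rho>\<^sup>2 * (a * (cmod (X - cnj Y))\<^sup>2) = a * (b + W)" using 2 by (simp add: mult.left_commute)
    also have "\<dots> \<le> (a + W) * b" by fact
    also have "\<dots> = \<rho>\<^sup>2 * ((cmod (X * Y - of_real (\<rho>\<^sup>2)))\<^sup>2 * (cmod (X - Y))\<^sup>2)"
      unfolding 1 b_def by (simp add: mult.left_commute)
    finally show ?thesis .
  qed
  then have "a * (cmod (X - cnj Y))\<^sup>2 \<le> (cmod (X * Y - of_real (\<rho>\<^sup>2)))\<^sup>2 * (cmod (X - Y))\<^sup>2"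
    using \<rho> by simp
  then have "(cmod (X * cnj Y - of_real (\<rho>\<^sup>2)) * cmod (X - cnj Y))\<^sup>2 \<le> (cmod (X * Y - of_real (\<rho>\<^sup>2)) * cmod (X - Y))\<^sup>2"
    by (simp add: a_def power_mult_distrib)
  then show ?thesis by (rule power2_le_imp_le) simp
qed

section \<open>Reflection in sides and the energy of the cutoff\<close>

context flute_seq begin

text \<open>\<open>J (mv j y)\<close> is the mirror image of y in side j, lying on the same side as
  z.\<close>

lemma pd_reflect:
  assumes z: "z \<in> Qo" and y: "y \<in> ins j"
  shows "pd z (J (mv j y)) \<le> pd z y"
proof -
  define c \<rho> where "c = complex_of_real (cen j)" and "\<rho> = rad j"
  define X Y where "X = z - c" and "Y = y - c"
  have I: "0 < Im X" "0 < Im Y" using Qo_Im[OF z] y by (auto simp: X_def Y_def c_def ins_def)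
  have Iy: "0 < Im y" using y by (simp add: ins_def)
  have X: "\<rho> \<le> cmod X" using z unfolding Qo_altdef X_def c_def \<rho>_def by (auto intro: less_imp_le)
  have Y: "cmod Y \<le> \<rho>" using y by (auto simp: ins_def Y_def c_def \<rho>_def)
  have nz: "Y \<noteq> 0" "cnj Y \<noteq> 0" using I by auto
  have "J (mv j y) = c + of_real (\<rho>\<^sup>2) / cnj Y"
    unfolding mv_eq[OF Iy] J_def by (simp add: c_def \<rho>_def Y_def)
  then have 1: "z - J (mv j y) = (X * cnj Y - of_real (\<rho>\<^sup>2)) / cnj Y"
    and 2: "z - cnj (J (mv j y)) = (X * Y - of_real (\<rho>\<^sup>2)) / Y"
    using nz by (simp_all add: X_def diff_divide_distrib c_def)
  have e: "z - y = X - Y" "z - cnj y = X - cnj Y" by (simp_all add: X_def Y_def c_def)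
  have p1: "pd z (J (mv j y)) = cmod (X * cnj Y - of_real (\<rho>\<^sup>2)) / cmod (X * Y - of_real (\<rho>\<^sup>2))"
    unfolding pd_def 1 2 using nz by (simp add: norm_divide)
  have d1: "0 < cmod (X - cnj Y)" using pd_denom(2)[OF Qo_Im[OF z] Iy] e by simp
  have "z - cnj (J (mv j y)) \<noteq> 0" by (rule pd_denom(2)) (use Qo_Im[OF z] mv_Im[OF Iy] in auto)
  then have d2: "0 < cmod (X * Y - of_real (\<rho>\<^sup>2))" using 2 by auto
  show ?thesis
    unfolding p1 unfolding pd_def e using reflect_pd_aux[OF X Y I] d1 d2
    by (simp add: \<rho>_def divide_le_eq mult_ac le_divide_eq)
qed

lemma cutoff_J: "cutoff R \<Lambda> d (J z) = cutoff R \<Lambda> d z"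
  by (simp add: cutoff_def cutA_def cutB_def)

text \<open>The cutoff does not change under \<open>J\<close>, so its value at \<open>unf y\<close>
  is also its value at the mirror image of y. That point is at least as close to z as y, so
  \<open>cutoff_diff\<close> applies across sides as well.\<close>

lemma unf_partner:
  assumes "z \<in> Qo" "y \<in> domo"
  obtains w where "0 < Im w" "cutoff R \<Lambda> d w = cutoff R \<Lambda> d (unf y)" "pd z w \<le> pd z y"
  using assms(2)
proof (cases rule: domo_cases)
  case 1 then show ?thesis using that[of y] Qo_Im by simp
next
  case (2 j)
  then show ?thesis using that[of "J (mv j y)"] pd_reflect[OF assms(1) 2(1)] Qo_Im[OF 2(2)] by (simp add: cutoff_J)
qed

text \<open>At height \<open>y\<close> above a cusp the domain has width \<open>O(y\<^sup>2)\<close>.\<close>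

lemma cusp_area:
  assumes n: "\<rho> < node n" and t: "0 \<le> t"
  shows "(\<integral>\<^sup>+z. indicator Qo z * indicator {z. cmod z \<le> \<rho> \<and> Im z \<le> t} z \<partial>hyp) \<le> ennreal (t * (\<Sum>k<n. 8 / x k))"
proof -
  \<comment> \<open>A bound for the width, at height y, of the cusp region at either end of the k-th
    interval; T collects both ends and both signs.\<close>
  define c where "c k y = 2 * y\<^sup>2 / x k" for k and y :: real
  define T where "T k y = {node k..node k + c k y} \<union> {node (Suc k) - c k y..node (Suc k)} \<union>
     {- node k - c k y..- node k} \<union> {- node (Suc k)..- node (Suc k) + c k y}" for k and y :: real
  have c0: "0 \<le> c k y" for k y using x_pos[of k] by (simp add: c_def)
  have Tm [measurable]: "T k y \<in> sets borel" for k y by (simp add: T_def)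
  have Tle: "emeasure lborel (T k y) \<le> ennreal (8 * y\<^sup>2 / x k)" for k y
  proof -
    have "emeasure lborel (T k y) \<le> emeasure lborel {node k..node k + c k y} + emeasure lborel {node (Suc k) - c k y..node (Suc k)} +
      emeasure lborel {- node k - c k y..- node k} + emeasure lborel {- node (Suc k)..- node (Suc k) + c k y}"
      unfolding T_def by (intro order_trans[OF emeasure_subadditive] add_mono order_refl) auto
    also have "\<dots> = ennreal (c k y) + ennreal (c k y) + ennreal (c k y) + ennreal (c k y)" using c0[of k y] by (simp add: emeasure_lborel_Icc_eq)
    also have "\<dots> = ennreal (c k y + c k y + c k y + c k y)" using c0[of k y] by (simp only: ennreal_plus[symmetric] add_nonneg_nonneg)
    also have "c k y + c k y + c k y + c k y = 8 * y\<^sup>2 / x k" by (simp add: c_def)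
    finally show ?thesis .
  qed
  have key: "\<exists>k<n. Re z \<in> T k (Im z)" if z: "z \<in> Qo" "cmod z \<le> \<rho>" for z
  proof -
    define a where "a = \<bar>Re z\<bar>"
    have an: "a < node n" using abs_Re_le_cmod[of z] z(2) n by (simp add: a_def)
    define k where "k = (LEAST k. a < node (Suc k))"
    have ex: "\<exists>k. a < node (Suc k)" using an node_strict_mono[of n "Suc n"] by (intro exI[of _ n]) simp
    have k1: "a < node (Suc k)" unfolding k_def by (rule LeastI_ex[OF ex])
    have k2: "node k \<le> a"
    proof (cases k)
      case 0 then show ?thesis by (simp add: a_def)
    next
      case (Suc l)
      then have "\<not> a < node (Suc l)" unfolding k_def by (metis lessI not_less_Least)
      then show ?thesis using Suc by simp
    qed
    have "k < n"
    proof (rule ccontr)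
      assume "\<not> k < n" then have "node n \<le> node k" by (intro node_mono) simp
      then show False using k2 an by simp
    qed
    define b where "b = (0 \<le> Re z)"
    have "rad (k, b) < cmod (z - of_real (cen (k, b)))" using z(1) unfolding Qo_altdef by blast
    then have "(rad (k, b))\<^sup>2 < (cmod (z - of_real (cen (k, b))))\<^sup>2" by (intro power_strict_mono) (auto simp: less_imp_le)
    also have "\<dots> = (a - (node k + node (Suc k)) / 2)\<^sup>2 + (Im z)\<^sup>2"
      unfolding cmod_power2 by (auto simp: cen_def a_def b_def power2_eq_square algebra_simps abs_if)
    also have "(a - (node k + node (Suc k)) / 2)\<^sup>2 = (rad (k, b))\<^sup>2 - (a - node k) * (node (Suc k) - a)"
      by (simp add: rad_def node_Suc power2_eq_square field_simps)
    finally have lt: "(a - node k) * (node (Suc k) - a) < (Im z)\<^sup>2" by simp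
    have xk: "0 < x k" "node (Suc k) = node k + x k" using x_pos by (auto simp: node_Suc)
    \<comment> \<open>The larger of the two factors in \<open>lt\<close> is at least half of x(k),
      so the smaller one is at most 2 (Im z)^2 / x(k).\<close>
    have "a - node k \<le> c k (Im z) \<or> node (Suc k) - a \<le> c k (Im z)"
    proof (cases "x k / 2 \<le> a - node k")
      case True
      have "x k / 2 * (node (Suc k) - a) \<le> (a - node k) * (node (Suc k) - a)" using True k1 by (intro mult_right_mono) auto
      then have "x k / 2 * (node (Suc k) - a) \<le> (Im z)\<^sup>2" using lt by linarith
      then have "node (Suc k) - a \<le> c k (Im z)" using xk(1) by (simp add: c_def field_simps)
      then show ?thesis ..
    next
      case False
      then have "(a - node k) * (x k / 2) \<le> (a - node k) * (node (Suc k) - a)" using xk k2 by (intro mult_left_mono) auto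
      then have "(a - node k) * (x k / 2) \<le> (Im z)\<^sup>2" using lt by linarith
      then have "a - node k \<le> c k (Im z)" using xk(1) by (simp add: c_def field_simps)
      then show ?thesis ..
    qed
    then have "Re z \<in> T k (Im z)" using k1 k2 by (auto simp: T_def a_def abs_if split: if_splits)
    then show ?thesis using \<open>k < n\<close> by blast
  qed
  define A where "A = {z. cmod z \<le> \<rho> \<and> Im z \<le> t}"
  have [measurable]: "A \<in> sets borel" unfolding A_def by measurable
  have "(\<integral>\<^sup>+z. indicator Qo z * indicator A z \<partial>hyp)
     = (\<integral>\<^sup>+y. \<integral>\<^sup>+s. indicator uhp (Complex s y) * ennreal (1 / y\<^sup>2) * (indicator Qo (Complex s y) * indicator A (Complex s y)) \<partial>lborel \<partial>lborel)"
    by (subst nn_integral_hyp, measurable, subst nn_integral_complex) auto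
  also have "\<dots> \<le> (\<integral>\<^sup>+y. ennreal (\<Sum>k<n. 8 / x k) * indicator {0..t} y \<partial>lborel)"
  proof (rule nn_integral_mono)
    fix y :: real
    show "(\<integral>\<^sup>+s. indicator uhp (Complex s y) * ennreal (1 / y\<^sup>2) * (indicator Qo (Complex s y) * indicator A (Complex s y)) \<partial>lborel)
       \<le> ennreal (\<Sum>k<n. 8 / x k) * indicator {0..t} y"
    proof (cases "0 < y \<and> y \<le> t")
      case False
      then have "indicator uhp (Complex s y) * ennreal (1 / y\<^sup>2) * (indicator Qo (Complex s y) * indicator A (Complex s y)) = 0" for s
        by (auto simp: A_def split: split_indicator)
      then show ?thesis by (simp only: nn_integral_const mult_zero_left zero_le)
    next
      case True
      have "(\<integral>\<^sup>+s. indicator uhp (Complex s y) * ennreal (1 / y\<^sup>2) * (indicator Qo (Complex s y) * indicator A (Complex s y)) \<partial>lborel)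
         \<le> (\<integral>\<^sup>+s. ennreal (1 / y\<^sup>2) * (\<Sum>k<n. indicator (T k y) s) \<partial>lborel)"
      proof (rule nn_integral_mono)
        fix s
        show "indicator uhp (Complex s y) * ennreal (1 / y\<^sup>2) * (indicator Qo (Complex s y) * indicator A (Complex s y)) \<le> ennreal (1 / y\<^sup>2) * (\<Sum>k<n. indicator (T k y) s)"
        proof (cases "Complex s y \<in> Qo \<and> Complex s y \<in> A")
          case True
          then obtain k where k: "k < n" "s \<in> T k y" using key[of "Complex s y"] by (auto simp: A_def)
          have "(1::ennreal) = indicator (T k y) s" using k by simp
          also have "\<dots> \<le> (\<Sum>k<n. indicator (T k y) s)" using k by (intro member_le_sum) auto
          finally have "ennreal (1 / y\<^sup>2) * 1 \<le> ennreal (1 / y\<^sup>2) * (\<Sum>k<n. indicator (T k y) s)" by (intro mult_left_mono) auto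
          then show ?thesis using True \<open>0 < y \<and> y \<le> t\<close> by simp
        qed (auto split: split_indicator)
      qed
      also have "\<dots> = ennreal (1 / y\<^sup>2) * (\<Sum>k<n. emeasure lborel (T k y))"
        by (subst nn_integral_cmult) (auto simp: nn_integral_sum)
      also have "\<dots> \<le> ennreal (1 / y\<^sup>2) * (\<Sum>k<n. ennreal (8 * y\<^sup>2 / x k))"
        by (intro mult_left_mono sum_mono Tle) auto
      also have "(\<Sum>k<n. ennreal (8 * y\<^sup>2 / x k)) = ennreal (\<Sum>k<n. 8 * y\<^sup>2 / x k)"
        using x_pos by (intro sum_ennreal) (simp add: less_imp_le)
      also have "ennreal (1 / y\<^sup>2) * \<dots> = ennreal (1 / y\<^sup>2 * (\<Sum>k<n. 8 * y\<^sup>2 / x k))"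
        using x_pos by (intro ennreal_mult[symmetric] sum_nonneg) (auto simp: less_imp_le)
      also have "1 / y\<^sup>2 * (\<Sum>k<n. 8 * y\<^sup>2 / x k) = (\<Sum>k<n. 8 / x k)"
        using True by (simp add: sum_distrib_left)
      finally show ?thesis using True by simp
    qed
  qed
  also have "\<dots> = ennreal (\<Sum>k<n. 8 / x k) * ennreal t" using t by (simp add: nn_integral_cmult_indicator)
  also have "\<dots> = ennreal (t * (\<Sum>k<n. 8 / x k))"
    using t x_pos by (subst ennreal_mult[symmetric]) (auto intro!: sum_nonneg simp: less_imp_le mult.commute)
  finally show ?thesis by (simp add: A_def)
qed

text \<open>The order of choices matters: \<Lambda> first makes the radial energy small. The disc of
  radius 2 R exp \<Lambda> then meets finitely many cusps, as the nodes are unbounded, and only then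
  is d taken small in terms of their number and widths.\<close>

lemma cutoff_energy_small:
  assumes unb: "\<And>r. \<exists>n. r < node n" and R: "0 < R" and d0: "0 < d0" and e: "0 < e"
  obtains \<Lambda> d where "0 < \<Lambda>" "0 < d" "d \<le> d0"
    "(\<integral>\<^sup>+z. indicator Qo z * ennreal (densA R \<Lambda> z + densB R \<Lambda> d z) \<partial>hyp) \<le> ennreal e"
proof -
  \<comment> \<open>Chosen so that 2400 / (q (ln 2)^2), the bound of \<open>densA_integral\<close>
    at m = q, is e / 2.\<close>
  define q where "q = 4800 / (e * (ln 2)\<^sup>2)"
  obtain m :: nat where m: "q < real m" using reals_Archimedean2 by blast
  have q0: "0 < q" using e by (simp add: q_def)
  then have m0: "0 < m" using m by (metis less_trans of_nat_0_less_iff)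
  define \<Lambda> where "\<Lambda> = real m * ln 2"
  have \<Lambda>: "0 < \<Lambda>" using m0 by (simp add: \<Lambda>_def)
  have "2400 / (real m * (ln 2)\<^sup>2) \<le> 2400 / (q * (ln 2)\<^sup>2)"
    using m q0 m0 by (intro divide_left_mono mult_right_mono mult_pos_pos) auto
  also have "\<dots> = e / 2" using e by (simp add: q_def)
  finally have mA: "2400 / (real m * (ln 2)\<^sup>2) \<le> e / 2" .
  obtain n where n: "2 * (R * exp \<Lambda>) < node n" using unb by blast
  define M where "M = (\<Sum>k<n. 8 / x k)"
  have M0: "0 \<le> M" unfolding M_def using x_pos by (intro sum_nonneg) (simp add: less_imp_le)
  \<comment> \<open>2304 = 2 * 288 * 4: the constant of \<open>densB\<close> times the height 4 d,
    with half of e to spend; M + 1 avoids division by zero.\<close>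
  define d where "d = min d0 (e / (2304 * (M + 1)))"
  have d: "0 < d" "d \<le> d0" using d0 e M0 by (auto simp: d_def)
  have "288 * (4 * d * M) \<le> 288 * (4 * (e / (2304 * (M + 1))) * (M + 1))"
    using M0 e by (intro mult_left_mono mult_mono) (auto simp: d_def)
  also have "\<dots> = e / 2" using M0 by (simp add: field_simps)
  finally have dB: "288 * (4 * d * M) \<le> e / 2" .
  have "(\<integral>\<^sup>+z. indicator Qo z * ennreal (densA R \<Lambda> z + densB R \<Lambda> d z) \<partial>hyp)
     = (\<integral>\<^sup>+z. indicator Qo z * ennreal (densA R \<Lambda> z) + indicator Qo z * ennreal (densB R \<Lambda> d z) \<partial>hyp)"
    by (intro nn_integral_cong) (auto simp: densA_def densB_def distrib_left)
  also have "\<dots> = (\<integral>\<^sup>+z. indicator Qo z * ennreal (densA R \<Lambda> z) \<partial>hyp) + (\<integral>\<^sup>+z. indicator Qo z * ennreal (densB R \<Lambda> d z) \<partial>hyp)"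
    by (rule nn_integral_add) measurable
  also have "\<dots> \<le> ennreal (e / 2) + ennreal (e / 2)"
  proof (rule add_mono)
    have "(\<integral>\<^sup>+z. indicator Qo z * ennreal (densA R \<Lambda> z) \<partial>hyp) \<le> (\<integral>\<^sup>+z. ennreal (densA R \<Lambda> z) \<partial>hyp)"
      by (intro nn_integral_mono) (auto split: split_indicator)
    also have "\<dots> \<le> ennreal (2400 / (real m * (ln 2)\<^sup>2))" unfolding \<Lambda>_def by (rule densA_integral[OF R m0])
    also have "\<dots> \<le> ennreal (e / 2)" using mA by (rule ennreal_leI)
    finally show "(\<integral>\<^sup>+z. indicator Qo z * ennreal (densA R \<Lambda> z) \<partial>hyp) \<le> ennreal (e / 2)" .
    define A where "A = {z. cmod z \<le> 2 * (R * exp \<Lambda>) \<and> Im z \<le> 4 * d}"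
    have [measurable]: "A \<in> sets borel" unfolding A_def by measurable
    have "(\<integral>\<^sup>+z. indicator Qo z * ennreal (densB R \<Lambda> d z) \<partial>hyp) = (\<integral>\<^sup>+z. ennreal 288 * (indicator Qo z * indicator A z) \<partial>hyp)"
      by (intro nn_integral_cong) (auto simp: densB_def A_def split: split_indicator)
    also have "\<dots> = ennreal 288 * (\<integral>\<^sup>+z. indicator Qo z * indicator A z \<partial>hyp)" by (rule nn_integral_cmult) measurable
    also have "\<dots> \<le> ennreal 288 * ennreal (4 * d * M)"
      unfolding A_def M_def using cusp_area[OF n, of "4 * d"] d by (intro mult_left_mono) auto
    also have "\<dots> = ennreal (288 * (4 * d * M))" using d M0 by (intro ennreal_mult[symmetric]) auto
    also have "\<dots> \<le> ennreal (e / 2)" using dB by (rule ennreal_leI)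
    finally show "(\<integral>\<^sup>+z. indicator Qo z * ennreal (densB R \<Lambda> d z) \<partial>hyp) \<le> ennreal (e / 2)" .
  qed
  also have "\<dots> = ennreal e" using e by (simp flip: ennreal_plus)
  finally show ?thesis using that \<Lambda> d by blast
qed

end

section \<open>Functions of vanishing oscillation energy\<close>

lemma nn_integral_complex_translate:
  fixes b :: complex
  assumes "f \<in> borel_measurable borel"
  shows "(\<integral>\<^sup>+z. f (b + z) \<partial>lborel) = (\<integral>\<^sup>+z. f z \<partial>lborel)"
  using nn_integral_complex_affine[OF assms, of 1 b] by simp

text \<open>Cauchy-Schwarz over n steps of length |w| gives one factor n, and the n translated
  integrals give another. The steps stay within h of x, hence in the doubled ball.\<close>

lemma oscillation_telescope:
  fixes \<phi> :: "complex \<Rightarrow> real"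
  assumes [measurable]: "\<phi> \<in> borel_measurable borel" and w: "real n * cmod w \<le> h"
  shows "(\<integral>\<^sup>+x. indicator (ball p h) x * ennreal ((\<phi> (x + of_nat n * w) - \<phi> x)\<^sup>2) \<partial>lborel)
    \<le> ennreal ((real n)\<^sup>2) * (\<integral>\<^sup>+x. indicator (ball p (2 * h)) x * ennreal ((\<phi> (x + w) - \<phi> x)\<^sup>2) \<partial>lborel)"
proof -
  define g where "g x = ennreal ((\<phi> (x + w) - \<phi> x)\<^sup>2)" for x
  have [measurable]: "g \<in> borel_measurable borel" unfolding g_def[abs_def] by measurable
  have b [measurable]: "ball p h \<in> sets borel" "ball p (2 * h) \<in> sets borel" by simp_all
  have pt: "ennreal ((\<phi> (x + of_nat n * w) - \<phi> x)\<^sup>2) \<le> ennreal (real n) * (\<Sum>k<n. g (of_nat k * w + x))" for x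
  proof -
    have "\<phi> (x + of_nat n * w) - \<phi> x = (\<Sum>k<n. \<phi> (x + of_nat (Suc k) * w) - \<phi> (x + of_nat k * w))"
      by (subst sum_lessThan_telescope) simp
    also have "\<dots>\<^sup>2 \<le> real n * (\<Sum>k<n. (\<phi> (x + of_nat (Suc k) * w) - \<phi> (x + of_nat k * w))\<^sup>2)"
      using sum_squared_le_sum_of_squares[of "\<lambda>k. \<phi> (x + of_nat (Suc k) * w) - \<phi> (x + of_nat k * w)" "{..<n}"]
      by (cases "n = 0") (simp_all add: mult.commute)
    finally have "ennreal ((\<phi> (x + of_nat n * w) - \<phi> x)\<^sup>2) \<le> ennreal (real n * (\<Sum>k<n. (\<phi> (x + of_nat (Suc k) * w) - \<phi> (x + of_nat k * w))\<^sup>2))"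
      by (rule ennreal_leI)
    also have "\<dots> = ennreal (real n) * (\<Sum>k<n. ennreal ((\<phi> (x + of_nat (Suc k) * w) - \<phi> (x + of_nat k * w))\<^sup>2))"
      by (simp add: ennreal_mult sum_nonneg sum_ennreal)
    also have "\<dots> = ennreal (real n) * (\<Sum>k<n. g (of_nat k * w + x))"
      by (simp add: g_def algebra_simps)
    finally show ?thesis .
  qed
  have "(\<integral>\<^sup>+x. indicator (ball p h) x * ennreal ((\<phi> (x + of_nat n * w) - \<phi> x)\<^sup>2) \<partial>lborel)
     \<le> (\<integral>\<^sup>+x. ennreal (real n) * (\<Sum>k<n. indicator (ball p (2 * h)) (of_nat k * w + x) * g (of_nat k * w + x)) \<partial>lborel)"
  proof (rule nn_integral_mono)
    fix x
    show "indicator (ball p h) x * ennreal ((\<phi> (x + of_nat n * w) - \<phi> x)\<^sup>2)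
       \<le> ennreal (real n) * (\<Sum>k<n. indicator (ball p (2 * h)) (of_nat k * w + x) * g (of_nat k * w + x))"
    proof (cases "x \<in> ball p h")
      case True
      have "of_nat k * w + x \<in> ball p (2 * h)" if "k < n" for k
      proof -
        have "real k * cmod w \<le> real n * cmod w" using that by (intro mult_right_mono) auto
        then have "cmod (of_nat k * w) \<le> h" using w by (simp add: norm_mult)
        moreover have "cmod (x - p) < h" using True by (simp add: dist_norm norm_minus_commute)
        ultimately have "cmod (of_nat k * w + (x - p)) < 2 * h" using norm_triangle_ineq[of "of_nat k * w" "x - p"] by linarith
        then show ?thesis by (simp add: dist_norm norm_minus_commute add_diff_eq)
      qed
      then have "(\<Sum>k<n. indicator (ball p (2 * h)) (of_nat k * w + x) * g (of_nat k * w + x)) = (\<Sum>k<n. g (of_nat k * w + x))"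
        by (intro sum.cong) auto
      then show ?thesis using True pt[of x] by simp
    qed simp
  qed
  also have "\<dots> = ennreal (real n) * (\<Sum>k<n. \<integral>\<^sup>+x. indicator (ball p (2 * h)) (of_nat k * w + x) * g (of_nat k * w + x) \<partial>lborel)"
    by (subst nn_integral_cmult, measurable, subst nn_integral_sum) simp_all
  also have "\<dots> = ennreal (real n) * (\<Sum>k<n. \<integral>\<^sup>+x. indicator (ball p (2 * h)) x * g x \<partial>lborel)"
    by (subst nn_integral_complex_translate[of "\<lambda>x. indicator (ball p (2 * h)) x * g x"], measurable)
  also have "\<dots> = ennreal ((real n)\<^sup>2) * (\<integral>\<^sup>+x. indicator (ball p (2 * h)) x * g x \<partial>lborel)"
    by (simp add: power2_eq_square ennreal_mult ennreal_of_nat_eq_real_of_nat mult.assoc)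
  finally show ?thesis by (simp add: g_def)
qed

text \<open>Scaling W = n w in the plane costs n^2 and telescoping another n^2, exactly balanced by
  s^4 at s = h / n. So the oscillation over fixed distances below h is smaller than every e, hence
  zero, and \<phi> agrees almost everywhere with its value at some x0 near p.\<close>

lemma oscillation_ae_const:
  fixes \<phi> :: "complex \<Rightarrow> real"
  assumes [measurable]: "\<phi> \<in> borel_measurable borel" and h: "0 < h"
    and small: "\<And>e. 0 < e \<Longrightarrow> \<exists>s0>0. \<forall>s. 0 < s \<and> s \<le> s0 \<longrightarrow>
      (\<integral>\<^sup>+x. indicator (ball p (3 * h)) x * (\<integral>\<^sup>+y. indicator (ball p (3 * h)) y *
         (indicator {..<s} (cmod (x - y)) * ennreal ((\<phi> x - \<phi> y)\<^sup>2)) \<partial>lborel) \<partial>lborel) \<le> ennreal (e * s ^ 4)"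
  obtains c where "AE y in lborel. y \<in> ball p (h / 2) \<longrightarrow> \<phi> y = c"
proof -
  define G where "G W = (\<integral>\<^sup>+x. indicator (ball p h) x * ennreal ((\<phi> (x + W) - \<phi> x)\<^sup>2) \<partial>lborel)" for W
  define H where "H w = (\<integral>\<^sup>+x. indicator (ball p (2 * h)) x * ennreal ((\<phi> (x + w) - \<phi> x)\<^sup>2) \<partial>lborel)" for w
  have b [measurable]: "ball p h \<in> sets borel" "ball p (2 * h) \<in> sets borel" "ball p (3 * h) \<in> sets borel"
    "ball (0::complex) s \<in> sets borel" for s by simp_all
  have [measurable]: "G \<in> borel_measurable borel" "H \<in> borel_measurable borel"
    unfolding G_def[abs_def] H_def[abs_def] by measurable
  define I where "I = (\<integral>\<^sup>+W. indicator (ball 0 h) W * G W \<partial>lborel)"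
  have "I \<le> ennreal e" if e: "0 < e" for e
  proof -
    obtain s0 where s0: "0 < s0" and s: "\<And>s. 0 < s \<Longrightarrow> s \<le> s0 \<Longrightarrow>
      (\<integral>\<^sup>+x. indicator (ball p (3 * h)) x * (\<integral>\<^sup>+y. indicator (ball p (3 * h)) y *
         (indicator {..<s} (cmod (x - y)) * ennreal ((\<phi> x - \<phi> y)\<^sup>2)) \<partial>lborel) \<partial>lborel) \<le> ennreal (e / h ^ 4 * s ^ 4)"
      using small[of "e / h ^ 4"] e h by auto
    obtain n :: nat where n: "max 1 (h / s0) < real n" using reals_Archimedean2 by blast
    then have n1: "1 \<le> real n" "0 < n" "h / s0 < real n" by auto
    define t where "t = h / real n"
    have t: "0 < t" "t \<le> s0" "t \<le> h" "real n * t = h" using n1 h s0 by (auto simp: t_def field_simps)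
    have "(\<integral>\<^sup>+w. indicator (ball 0 t) w * H w \<partial>lborel) =
       (\<integral>\<^sup>+w. \<integral>\<^sup>+x. indicator (ball 0 t) w * (indicator (ball p (2 * h)) x * ennreal ((\<phi> (x + w) - \<phi> x)\<^sup>2)) \<partial>lborel \<partial>lborel)"
      unfolding H_def by (intro nn_integral_cong nn_integral_cmult[symmetric]) measurable
    also have "\<dots> = (\<integral>\<^sup>+x. \<integral>\<^sup>+w. indicator (ball 0 t) w * (indicator (ball p (2 * h)) x * ennreal ((\<phi> (x + w) - \<phi> x)\<^sup>2)) \<partial>lborel \<partial>lborel)"
      by (rule lborel_pair.Fubini') measurable
    also have "\<dots> \<le> (\<integral>\<^sup>+x. indicator (ball p (3 * h)) x * (\<integral>\<^sup>+y. indicator (ball p (3 * h)) y *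
         (indicator {..<t} (cmod (x - y)) * ennreal ((\<phi> x - \<phi> y)\<^sup>2)) \<partial>lborel) \<partial>lborel)"
    proof (rule nn_integral_mono)
      fix x
      define F where "F y = indicator (ball p (3 * h)) y * (indicator {..<t} (cmod (x - y)) * ennreal ((\<phi> x - \<phi> y)\<^sup>2))" for y
      have [measurable]: "F \<in> borel_measurable borel" unfolding F_def[abs_def] by measurable
      show "(\<integral>\<^sup>+w. indicator (ball 0 t) w * (indicator (ball p (2 * h)) x * ennreal ((\<phi> (x + w) - \<phi> x)\<^sup>2)) \<partial>lborel)
        \<le> indicator (ball p (3 * h)) x * (\<integral>\<^sup>+y. F y \<partial>lborel)"
      proof (cases "x \<in> ball p (2 * h)")
        case True
        have "(\<integral>\<^sup>+w. indicator (ball 0 t) w * (indicator (ball p (2 * h)) x * ennreal ((\<phi> (x + w) - \<phi> x)\<^sup>2)) \<partial>lborel) \<le> (\<integral>\<^sup>+w. F (x + w) \<partial>lborel)"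
        proof (rule nn_integral_mono)
          fix w
          have "x + w \<in> ball p (3 * h)" if "w \<in> ball 0 t"
            using dist_triangle[of p "x + w" x] that True t(3) by (simp add: dist_norm)
          then show "indicator (ball 0 t) w * (indicator (ball p (2 * h)) x * ennreal ((\<phi> (x + w) - \<phi> x)\<^sup>2)) \<le> F (x + w)"
            using True by (auto simp: F_def power2_commute split: split_indicator)
        qed
        also have "\<dots> = (\<integral>\<^sup>+y. F y \<partial>lborel)" by (rule nn_integral_complex_translate) measurable
        also have "\<dots> = indicator (ball p (3 * h)) x * (\<integral>\<^sup>+y. F y \<partial>lborel)" using True h by simp
        finally show ?thesis .
      qed simp
    qed
    also have "\<dots> \<le> ennreal (e / h ^ 4 * t ^ 4)" by (rule s[OF t(1,2)])
    finally have Ht: "(\<integral>\<^sup>+w. indicator (ball 0 t) w * H w \<partial>lborel) \<le> ennreal (e / h ^ 4 * t ^ 4)" .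
    have "I = ennreal ((real n)\<^sup>2) * (\<integral>\<^sup>+w. indicator (ball 0 h) (of_nat n * w) * G (of_nat n * w) \<partial>lborel)"
      unfolding I_def using nn_integral_complex_affine[of "\<lambda>W. indicator (ball 0 h) W * G W" "real n" 0] n1 by simp
    also have "\<dots> \<le> ennreal ((real n)\<^sup>2) * (\<integral>\<^sup>+w. ennreal ((real n)\<^sup>2) * (indicator (ball 0 t) w * H w) \<partial>lborel)"
    proof (intro mult_left_mono nn_integral_mono)
      fix w :: complex
      have iff: "of_nat n * w \<in> ball 0 h \<longleftrightarrow> w \<in> ball 0 t" using n1 by (simp add: dist_norm norm_mult t_def field_simps)
      have "G (of_nat n * w) \<le> ennreal ((real n)\<^sup>2) * H w" if "w \<in> ball 0 t"
      proof -
        have "of_nat n * w \<in> ball 0 h" using that iff by simp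
        then have "real n * cmod w \<le> h" by (simp add: dist_norm norm_mult)
        then show ?thesis unfolding G_def H_def by (rule oscillation_telescope[rotated]) measurable
      qed
      then show "indicator (ball 0 h) (of_nat n * w) * G (of_nat n * w) \<le> ennreal ((real n)\<^sup>2) * (indicator (ball 0 t) w * H w)"
        using iff by (auto split: split_indicator)
    qed simp
    also have "\<dots> = ennreal ((real n) ^ 4) * (\<integral>\<^sup>+w. indicator (ball 0 t) w * H w \<partial>lborel)"
      by (subst nn_integral_cmult, measurable) (simp add: mult.assoc[symmetric] ennreal_mult[symmetric] flip: power_add)
    also have "\<dots> \<le> ennreal ((real n) ^ 4) * ennreal (e / h ^ 4 * t ^ 4)" using Ht by (rule mult_left_mono) simp
    also have "\<dots> = ennreal ((real n) ^ 4 * (e / h ^ 4 * t ^ 4))"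
      using e by (intro ennreal_mult[symmetric]) auto
    also have "(real n) ^ 4 * (e / h ^ 4 * t ^ 4) = e"
      using n1 h by (simp add: t_def power_divide)
    finally show ?thesis .
  qed
  then have "I \<le> 0 + ennreal e" if "0 < e" for e using that by simp
  then have "I \<le> 0" by (rule ennreal_le_epsilon)
  then have "I = 0" by simp
  have "I = (\<integral>\<^sup>+W. \<integral>\<^sup>+x. indicator (ball 0 h) W * (indicator (ball p h) x * ennreal ((\<phi> (x + W) - \<phi> x)\<^sup>2)) \<partial>lborel \<partial>lborel)"
    unfolding I_def G_def by (intro nn_integral_cong nn_integral_cmult[symmetric]) measurable
  also have "\<dots> = (\<integral>\<^sup>+x. \<integral>\<^sup>+W. indicator (ball 0 h) W * (indicator (ball p h) x * ennreal ((\<phi> (x + W) - \<phi> x)\<^sup>2)) \<partial>lborel \<partial>lborel)"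
    by (rule lborel_pair.Fubini') measurable
  finally have "(\<integral>\<^sup>+x. \<integral>\<^sup>+W. indicator (ball 0 h) W * (indicator (ball p h) x * ennreal ((\<phi> (x + W) - \<phi> x)\<^sup>2)) \<partial>lborel \<partial>lborel) = 0"
    using \<open>I = 0\<close> by simp
  then have AE: "AE x in lborel. (\<integral>\<^sup>+W. indicator (ball 0 h) W * (indicator (ball p h) x * ennreal ((\<phi> (x + W) - \<phi> x)\<^sup>2)) \<partial>lborel) = 0"
    by (subst (asm) nn_integral_0_iff_AE) measurable
  have "\<exists>x0. x0 \<in> ball p (h / 2) \<and> (\<integral>\<^sup>+W. indicator (ball 0 h) W * (indicator (ball p h) x0 * ennreal ((\<phi> (x0 + W) - \<phi> x0)\<^sup>2)) \<partial>lborel) = 0"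
  proof (rule ccontr)
    assume n: "\<not> ?thesis"
    have "AE x in lborel. x \<notin> ball p (h / 2)" using AE by eventually_elim (use n in blast)
    then have "emeasure lborel (ball p (h / 2)) = 0" by (subst (asm) AE_iff_null_sets[symmetric]) auto
    then show False using h unit_ball_vol_pos[of 2] by (simp add: emeasure_ball)
  qed
  then obtain x0 where x0: "x0 \<in> ball p (h / 2)"
    and z: "(\<integral>\<^sup>+W. indicator (ball 0 h) W * (indicator (ball p h) x0 * ennreal ((\<phi> (x0 + W) - \<phi> x0)\<^sup>2)) \<partial>lborel) = 0" by blast
  define F where "F y = indicator (ball 0 h) (y - x0) * (indicator (ball p h) x0 * ennreal ((\<phi> y - \<phi> x0)\<^sup>2))" for y
  have [measurable]: "F \<in> borel_measurable borel" unfolding F_def[abs_def] by measurable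
  have "(\<integral>\<^sup>+y. F y \<partial>lborel) = (\<integral>\<^sup>+W. F (x0 + W) \<partial>lborel)" by (rule nn_integral_complex_translate[symmetric]) measurable
  also have "\<dots> = 0" using z by (simp add: F_def)
  finally have "AE y in lborel. F y = 0" by (subst (asm) nn_integral_0_iff_AE) measurable
  then have "AE y in lborel. y \<in> ball p (h / 2) \<longrightarrow> \<phi> y = \<phi> x0"
  proof eventually_elim
    case (elim y)
    show ?case
    proof
      assume y: "y \<in> ball p (h / 2)"
      have "y - x0 \<in> ball 0 h" using dist_triangle_half_r[of p y h x0] x0 y by (simp add: dist_norm norm_minus_commute)
      moreover have "x0 \<in> ball p h" using x0 h by simp
      ultimately show "\<phi> y = \<phi> x0" using elim by (simp add: F_def)
    qed
  qed
  then show ?thesis using that by blast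
qed

section \<open>Small energy of the superharmonic function\<close>

context flute_negative begin

text \<open>On U the cutoff is 1, so the energy of \<phi> there is dominated by the left-hand side
  of \<open>energy_inequality\<close>, and the right-hand side is the energy of the cutoff. The
  threshold for r depends on the cutoff and hence on e.\<close>

lemma energy_small:
  assumes [measurable]: "U \<in> sets borel" and U: "U \<subseteq> Qo" "\<And>z. z \<in> U \<Longrightarrow> cmod z \<le> R" "\<And>z. z \<in> U \<Longrightarrow> 2 * d0 \<le> Im z"
    and pos: "0 < R" "0 < d0" "0 < e"
  shows "\<exists>r0>0. \<forall>r. 0 < r \<and> r \<le> r0 \<longrightarrow>
    (\<integral>\<^sup>+x. \<integral>\<^sup>+y. indicator U x * (indicator U y * (kern r (pd x y) * ennreal ((\<phi> x - \<phi> y)\<^sup>2))) \<partial>hyp \<partial>hyp)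
      \<le> ennreal (e * r ^ 4)"
proof -
  define M where "M = 1 + N"
  have M: "1 \<le> M" using N by (simp add: M_def)
  \<comment> \<open>The divisor collects 4 r^2 from the disc area, 2 pi from the rotations, and the
    comparison constant M^2; the remaining r^2 is that of \<open>cutoff_diff\<close>.\<close>
  define e' where "e' = e / (8 * pi * M\<^sup>2)"
  have e': "0 < e'" using pos M by (simp add: e'_def)
  obtain \<Lambda> d where \<Lambda>: "0 < \<Lambda>" "0 < d" "d \<le> d0"
    and small: "(\<integral>\<^sup>+z. indicator Qo z * ennreal (densA R \<Lambda> z + densB R \<Lambda> d z) \<partial>hyp) \<le> ennreal e'"
    using cutoff_energy_small[OF unb pos(1,2) e'] .
  define \<eta> where "\<eta> = cutoff R \<Lambda> d"
  have [measurable]: "\<eta> \<in> borel_measurable borel" unfolding \<eta>_def by measurable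
  define L where "L = R * exp \<Lambda>"
  have L: "0 < L" using pos by (simp add: L_def)
  \<comment> \<open>A compact subset of \<open>Q\<close> containing the support of the cutoff in
    \<open>Qo\<close>, obtained by staying above height d.\<close>
  define K where "K = cball (0::complex) L \<inter> {z. d \<le> Im z} \<inter> (\<Inter>j. {z. rad j \<le> cmod (z - of_real (cen j))})"
  have "closed ({z. d \<le> Im z} \<inter> (\<Inter>j. {z. rad j \<le> cmod (z - of_real (cen j))}))"
    by (intro closed_Int closed_INT ballI closed_Collect_le continuous_intros)
  then have K: "compact K" unfolding K_def Int_assoc by (intro compact_Int_closed) auto
  have KQ: "K \<subseteq> Q" using \<Lambda>(2) unb by (auto simp: K_def Q_def reg_def)
  obtain s where s: "0 < s" "\<And>z. z \<in> K \<Longrightarrow> \<exists>B. chart_ball B \<and> ball z s \<subseteq> B" using good_radius[OF K KQ] by metis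
  have supp: "z \<in> K" if "z \<in> Qo" "\<eta> z \<noteq> 0" for z
  proof -
    have "cutA R \<Lambda> z \<noteq> 0" "cutB d z \<noteq> 0" using that(2) by (auto simp: \<eta>_def cutoff_def)
    then have "cmod z < L" using cutA_0[OF pos(1) \<Lambda>(1), of z] unfolding L_def by force
    moreover have "d \<le> Im z"
    proof (rule ccontr)
      assume "\<not> d \<le> Im z"
      then have "cutB d z = 0" using \<Lambda>(2) by (simp add: cutB_def field_simps)
      then show False using \<open>cutB d z \<noteq> 0\<close> by simp
    qed
    ultimately show ?thesis using Qo_Q[OF that(1)] by (auto simp: K_def Q_def)
  qed
  have one: "\<eta> z = 1" if "z \<in> U" for z
  proof -
    have "0 < Im z" using U(3)[OF that] pos by linarith
    then have "0 < cmod z" by (auto simp: complex_eq_iff)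
    then have "cutA R \<Lambda> z = 1" using U(2)[OF that] pos \<Lambda> by (intro cutA_1) auto
    moreover have "cutB d z = 1" using U(3)[OF that] \<Lambda>(2,3) by (simp add: cutB_def field_simps)
    ultimately show ?thesis by (simp add: \<eta>_def cutoff_def)
  qed
  have fin: "(\<integral>\<^sup>+z. indicator Qo z * ennreal ((\<eta> z)\<^sup>2) \<partial>hyp) < \<infinity>"
  proof -
    have "(\<integral>\<^sup>+z. indicator Qo z * ennreal ((\<eta> z)\<^sup>2) \<partial>hyp)
      = (\<integral>\<^sup>+z. indicator uhp z * ennreal (1 / (Im z)\<^sup>2) * (indicator Qo z * ennreal ((\<eta> z)\<^sup>2)) \<partial>lborel)"
      by (rule nn_integral_hyp) measurable
    also have "\<dots> \<le> (\<integral>\<^sup>+z. ennreal (1 / d\<^sup>2) * indicator (cball (0::complex) L) z \<partial>lborel)"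
    proof (rule nn_integral_mono)
      fix z
      show "indicator uhp z * ennreal (1 / (Im z)\<^sup>2) * (indicator Qo z * ennreal ((\<eta> z)\<^sup>2)) \<le> ennreal (1 / d\<^sup>2) * indicator (cball (0::complex) L) z"
      proof (cases "z \<in> Qo \<and> \<eta> z \<noteq> 0")
        case True
        then have zK: "z \<in> cball (0::complex) L" "d \<le> Im z" using supp[of z] by (auto simp: K_def)
        have "(\<eta> z)\<^sup>2 \<le> 1" by (auto simp: \<eta>_def cutoff_le_1 intro: power_le_one)
        moreover have "1 / (Im z)\<^sup>2 \<le> 1 / d\<^sup>2" using zK \<Lambda>(2) by (intro divide_left_mono power_mono mult_pos_pos) auto
        ultimately have "1 / (Im z)\<^sup>2 * (\<eta> z)\<^sup>2 \<le> 1 / d\<^sup>2 * 1" by (intro mult_mono) auto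
        then have "ennreal (1 / (Im z)\<^sup>2) * ennreal ((\<eta> z)\<^sup>2) \<le> ennreal (1 / d\<^sup>2)" by (simp add: ennreal_mult[symmetric] ennreal_leI)
        then show ?thesis using True zK Qo_Im[of z] by simp
      qed (auto split: split_indicator)
    qed
    also have "\<dots> = ennreal (1 / d\<^sup>2) * emeasure lborel (cball (0::complex) L)" by (rule nn_integral_cmult_indicator) simp
    also have "\<dots> \<le> ennreal (1 / d\<^sup>2) * ennreal (4 * L\<^sup>2)" using L by (intro mult_left_mono emeasure_cball_le) auto
    also have "\<dots> < \<infinity>" by (simp add: ennreal_mult_less_top)
    finally show ?thesis .
  qed
  \<comment> \<open>On K heights are at most L, so 3 r Im p < s as \<open>kernel_super_flute\<close>
    requires; 1 / 10 is the bound in \<open>pd_close\<close>.\<close>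
  define r0 where "r0 = min (1 / 10) (s / (4 * L))"
  have r0: "0 < r0" using s L by (simp add: r0_def)
  have "(\<integral>\<^sup>+x. \<integral>\<^sup>+y. indicator U x * (indicator U y * (kern r (pd x y) * ennreal ((\<phi> x - \<phi> y)\<^sup>2))) \<partial>hyp \<partial>hyp)
      \<le> ennreal (e * r ^ 4)" if "0 < r" "r \<le> r0" for r
  proof -
    have r: "0 < r" "r \<le> 1 / 10" "r \<le> 1" "4 * L * r \<le> s" using that L by (auto simp: r0_def field_simps)
    have area: "disc_area r \<le> ennreal (4 * r\<^sup>2)" using r by (intro disc_area_le) simp
    define E where "E = (\<lambda>(x, y). ennreal ((\<eta> x * sqrt (\<phi> y / \<phi> x) - \<eta> y * sqrt (\<phi> x / \<phi> y))\<^sup>2))"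
    define D where "D = (\<lambda>(x, y). ennreal ((\<eta> x - \<eta> y)\<^sup>2))"
    have [measurable]: "E \<in> borel_measurable (borel \<Otimes>\<^sub>M borel)" "D \<in> borel_measurable (borel \<Otimes>\<^sub>M borel)"
      unfolding E_def D_def by measurable
    have EI: "pairs r E \<le> pairs r D" unfolding E_def D_def
    proof (rule energy_inequality)
      show "(\<integral>\<^sup>+y. indicator domo y * (kern r (pd p y) * ennreal (\<phi> (unf y))) \<partial>hyp)
        \<le> ennreal (\<phi> p) * (\<integral>\<^sup>+y. indicator domo y * kern r (pd p y) \<partial>hyp)" if p: "p \<in> Qo" "\<eta> p \<noteq> 0" for p
      proof -
        have pK: "p \<in> K" by (rule supp[OF p])
        then obtain B where B: "chart_ball B" "ball p s \<subseteq> B" using s(2) by blast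
        have "cmod p \<le> L" using pK by (simp add: K_def)
        then have "Im p \<le> L" using abs_Im_le_cmod[of p] by linarith
        then have "3 * r * Im p \<le> 3 * r * L" using r by (intro mult_left_mono) auto
        also have "3 * r * L = 3 / 4 * (4 * L * r)" by simp
        also have "\<dots> \<le> 3 / 4 * s" using r(4) by (rule mult_left_mono) simp
        also have "\<dots> < s" using s(1) by simp
        finally show ?thesis using kernel_super_flute[OF p(1) B r(1,2)] by simp
      qed
      show "disc_area r < \<infinity>" using area by (rule le_less_trans) simp
    qed (use \<phi>_bounds(1) fin r in \<open>auto simp: \<eta>_def intro: less_le_trans[OF zero_less_one]\<close>)
    have "pairs r D \<le> (\<integral>\<^sup>+x. (disc_area r * ennreal (2 * pi) * ennreal (r\<^sup>2)) * (indicator Qo x * ennreal (densA R \<Lambda> x + densB R \<Lambda> d x)) \<partial>hyp)"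
      unfolding pairs_def
    proof (rule nn_integral_mono)
      fix x
      define c where "c = densA R \<Lambda> x + densB R \<Lambda> d x"
      have c: "0 \<le> c" by (simp add: c_def densA_def densB_def)
      show "(\<integral>\<^sup>+y. indicator Qo x * (indicator domo y * (kern r (pd x y) * D (x, unf y))) \<partial>hyp)
         \<le> (disc_area r * ennreal (2 * pi) * ennreal (r\<^sup>2)) * (indicator Qo x * ennreal (densA R \<Lambda> x + densB R \<Lambda> d x))"
      proof (cases "x \<in> Qo")
        case True
        have Ix: "0 < Im x" by (rule Qo_Im[OF True])
        have "(\<integral>\<^sup>+y. indicator Qo x * (indicator domo y * (kern r (pd x y) * D (x, unf y))) \<partial>hyp)
          \<le> (\<integral>\<^sup>+y. kern r (pd x y) * ennreal (r\<^sup>2 * c) \<partial>hyp)"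
        proof (rule nn_integral_mono)
          fix y
          show "indicator Qo x * (indicator domo y * (kern r (pd x y) * D (x, unf y))) \<le> kern r (pd x y) * ennreal (r\<^sup>2 * c)"
          proof (cases "y \<in> domo \<and> kern r (pd x y) \<noteq> 0")
            case y: True
            then have pd: "pd x y < r" using kern_support[of r "pd x y"] r by simp
            obtain w where w: "0 < Im w" "cutoff R \<Lambda> d w = cutoff R \<Lambda> d (unf y)" "pd x w \<le> pd x y"
              using unf_partner[OF True] y by metis
            have "cmod (x - w) \<le> 3 * r * Im x" using pd w(3) by (intro pd_close[OF Ix w(1) _ r(2)]) simp
            then have "(cutoff R \<Lambda> d x - cutoff R \<Lambda> d w)\<^sup>2 \<le> r\<^sup>2 * c"
              unfolding c_def by (intro cutoff_diff[OF pos(1) \<Lambda>(1,2) Ix _ r(1,2)])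
            then have "D (x, unf y) \<le> ennreal (r\<^sup>2 * c)" by (simp add: D_def \<eta>_def w(2) ennreal_leI)
            then show ?thesis using True y by (simp add: mult_left_mono)
          qed (auto split: split_indicator)
        qed
        also have "\<dots> = (\<integral>\<^sup>+y. kern r (pd x y) \<partial>hyp) * ennreal (r\<^sup>2 * c)" by (rule nn_integral_multc) measurable
        also have "\<dots> = (disc_area r * ennreal (2 * pi)) * (ennreal (r\<^sup>2) * ennreal c)"
          using c by (simp add: kernel_total[OF Ix r(3)] ennreal_mult)
        finally show ?thesis using True by (simp add: c_def mult.assoc)
      qed simp
    qed
    also have "\<dots> = (disc_area r * ennreal (2 * pi) * ennreal (r\<^sup>2)) * (\<integral>\<^sup>+x. indicator Qo x * ennreal (densA R \<Lambda> x + densB R \<Lambda> d x) \<partial>hyp)"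
      by (rule nn_integral_cmult) measurable
    also have "\<dots> \<le> (ennreal (4 * r\<^sup>2) * ennreal (2 * pi) * ennreal (r\<^sup>2)) * ennreal e'"
      by (intro mult_mono mult_right_mono area small) auto
    also have "\<dots> = ennreal (4 * r\<^sup>2 * (2 * pi) * r\<^sup>2 * e')"
      using e' by (simp only: ennreal_mult[symmetric] mult_nonneg_nonneg zero_le_power2 zero_le_numeral pi_ge_zero less_imp_le)
    finally have pD: "pairs r D \<le> ennreal (4 * r\<^sup>2 * (2 * pi) * r\<^sup>2 * e')" .
    have "(\<integral>\<^sup>+x. \<integral>\<^sup>+y. indicator U x * (indicator U y * (kern r (pd x y) * ennreal ((\<phi> x - \<phi> y)\<^sup>2))) \<partial>hyp \<partial>hyp)
      \<le> (\<integral>\<^sup>+x. \<integral>\<^sup>+y. ennreal (M\<^sup>2) * (indicator Qo x * (indicator domo y * (kern r (pd x y) * E (x, unf y)))) \<partial>hyp \<partial>hyp)"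
    proof (intro nn_integral_mono)
      fix x y
      show "indicator U x * (indicator U y * (kern r (pd x y) * ennreal ((\<phi> x - \<phi> y)\<^sup>2)))
         \<le> ennreal (M\<^sup>2) * (indicator Qo x * (indicator domo y * (kern r (pd x y) * E (x, unf y))))"
      proof (cases "x \<in> U \<and> y \<in> U")
        case True
        then have xy: "x \<in> Qo" "y \<in> Qo" using U(1) by auto
        then have un: "unf y = y" "y \<in> domo" by (simp_all add: unf_Q Qo_Q Qo_domo)
        define a b where "a = \<phi> x" and "b = \<phi> y"
        have ab: "1 \<le> a" "a \<le> M" "1 \<le> b" "b \<le> M" using \<phi>_bounds xy by (auto simp: a_def b_def M_def)
        \<comment> \<open>For values between 1 and M this symmetric quotient controls (a - b)^2 up
          to the factor a b \<le> M^2; here the truncation of the function is used.\<close>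
        have "(sqrt (b / a) - sqrt (a / b))\<^sup>2 = b / a - 2 * sqrt (b / a * (a / b)) + a / b"
          unfolding power2_diff real_sqrt_mult using ab by simp
        also have "\<dots> = (a - b)\<^sup>2 / (a * b)" using ab by (simp add: field_simps power2_eq_square)
        finally have "(a - b)\<^sup>2 = a * b * (sqrt (b / a) - sqrt (a / b))\<^sup>2" using ab by simp
        also have "\<dots> \<le> M\<^sup>2 * (sqrt (b / a) - sqrt (a / b))\<^sup>2"
          unfolding power2_eq_square[of M] using ab by (intro mult_right_mono mult_mono) auto
        finally have "ennreal ((a - b)\<^sup>2) \<le> ennreal (M\<^sup>2) * ennreal ((sqrt (b / a) - sqrt (a / b))\<^sup>2)"
          by (simp add: ennreal_mult[symmetric] ennreal_leI)
        then have "ennreal ((\<phi> x - \<phi> y)\<^sup>2) \<le> ennreal (M\<^sup>2) * E (x, y)"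
          using True by (simp add: E_def one a_def b_def)
        then have "kern r (pd x y) * ennreal ((\<phi> x - \<phi> y)\<^sup>2) \<le> kern r (pd x y) * (ennreal (M\<^sup>2) * E (x, y))"
          by (rule mult_left_mono) simp
        then show ?thesis using True xy un by (simp add: mult.left_commute)
      qed auto
    qed
    also have "\<dots> = ennreal (M\<^sup>2) * pairs r E"
      unfolding pairs_def by (subst nn_integral_cmult, measurable)+
    also have "\<dots> \<le> ennreal (M\<^sup>2) * pairs r D" using EI by (rule mult_left_mono) simp
    also have "\<dots> \<le> ennreal (M\<^sup>2) * ennreal (4 * r\<^sup>2 * (2 * pi) * r\<^sup>2 * e')" using pD by (rule mult_left_mono) simp
    also have "\<dots> = ennreal (M\<^sup>2 * (4 * r\<^sup>2 * (2 * pi) * r\<^sup>2 * e'))"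
      using e' by (intro ennreal_mult[symmetric]) auto
    also have "M\<^sup>2 * (4 * r\<^sup>2 * (2 * pi) * r\<^sup>2 * e') = e * r ^ 4"
      using M by (simp add: e'_def power2_eq_square power4_eq_xxxx)
    finally show ?thesis .
  qed
  then show ?thesis using r0 by blast
qed

end

lemma lborel_le_hyp:
  assumes [measurable]: "U \<in> sets borel" "F \<in> borel_measurable borel"
    and U: "\<And>z. z \<in> U \<Longrightarrow> 0 < Im z" "\<And>z. z \<in> U \<Longrightarrow> Im z \<le> t"
  shows "(\<integral>\<^sup>+z. indicator U z * F z \<partial>lborel) \<le> ennreal (t\<^sup>2) * (\<integral>\<^sup>+z. indicator U z * F z \<partial>hyp)"
proof -
  have "(\<integral>\<^sup>+z. indicator U z * F z \<partial>lborel) \<le>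
    (\<integral>\<^sup>+z. ennreal (t\<^sup>2) * (indicator uhp z * ennreal (1 / (Im z)\<^sup>2) * (indicator U z * F z)) \<partial>lborel)"
  proof (rule nn_integral_mono)
    fix z
    show "indicator U z * F z \<le> ennreal (t\<^sup>2) * (indicator uhp z * ennreal (1 / (Im z)\<^sup>2) * (indicator U z * F z))"
    proof (cases "z \<in> U")
      case True
      have "(Im z)\<^sup>2 \<le> t\<^sup>2" using U[OF True] by (intro power_mono) auto
      then have "1 \<le> t\<^sup>2 * (1 / (Im z)\<^sup>2)" using U(1)[OF True] by (simp add: le_divide_eq)
      then have "1 \<le> ennreal (t\<^sup>2 * (1 / (Im z)\<^sup>2))" using ennreal_leI by fastforce
      also have "\<dots> = ennreal (t\<^sup>2) * ennreal (1 / (Im z)\<^sup>2)" by (rule ennreal_mult) auto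
      finally have "1 * F z \<le> ennreal (t\<^sup>2) * ennreal (1 / (Im z)\<^sup>2) * F z" by (rule mult_right_mono) simp
      then show ?thesis using True U(1)[OF True] by (simp add: mult.assoc)
    qed simp
  qed
  also have "\<dots> = ennreal (t\<^sup>2) * (\<integral>\<^sup>+z. indicator U z * F z \<partial>hyp)"
    by (subst nn_integral_cmult, measurable, subst nn_integral_hyp) simp_all
  finally show ?thesis .
qed

lemma AE_hyp_lborel: assumes "AE y in hyp. P y" shows "AE y in lborel. 0 < Im y \<longrightarrow> P y"
proof -
  have "AE y in lborel. 0 < indicator uhp y * ennreal (1 / (Im y)\<^sup>2) \<longrightarrow> P y"
    using assms unfolding hyp_def by (subst (asm) AE_density) auto
  then show ?thesis by eventually_elim auto
qed

lemma pd_le: assumes "0 < Im x" "0 < Im y" shows "pd x y \<le> cmod (x - y) / Im x"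
proof -
  have "Im x \<le> cmod (x - cnj y)" using abs_Im_le_cmod[of "x - cnj y"] assms by simp
  then show ?thesis unfolding pd_def using assms by (intro divide_left_mono mult_pos_pos) auto
qed

section \<open>Constancy on the surface\<close>

context flute_negative begin

text \<open>On a ball where heights are comparable with Im p, Euclidean and hyperbolic area and
  distance differ by constants. \<open>kern_lower\<close> turns kernel energy into the oscillation
  integral of \<open>oscillation_ae_const\<close>.\<close>

lemma locally_ae_const:
  assumes p: "p \<in> Qo"
  obtains \<delta> c where "0 < \<delta>" "ball p \<delta> \<subseteq> Qo" "AE y in lborel. y \<in> ball p \<delta> \<longrightarrow> \<phi> y = c"
proof -
  obtain \<delta>0 where \<delta>0: "0 < \<delta>0" "ball p \<delta>0 \<subseteq> Qo" using open_Qo p open_contains_ball by blast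
  define q where "q = Im p"
  have q: "0 < q" using Qo_Im[OF p] by (simp add: q_def)
  define h where "h = min (\<delta>0 / 3) (q / 6)"
  have h: "0 < h" "3 * h \<le> \<delta>0" "3 * h \<le> q / 2" using \<delta>0 q by (auto simp: h_def)
  define U where "U = ball p (3 * h)"
  have [measurable]: "U \<in> sets borel" by (simp add: U_def)
  have UQ: "U \<subseteq> Qo" using \<delta>0 h by (auto simp: U_def)
  have UI: "q / 2 \<le> Im z" "0 < Im z" "Im z \<le> 2 * q" if "z \<in> U" for z
  proof -
    have "\<bar>Im (z - p)\<bar> < 3 * h" using that abs_Im_le_cmod[of "z - p"] by (simp add: U_def dist_norm norm_minus_commute)
    then have "\<bar>Im z - q\<bar> < q / 2" using h(3) by (simp add: q_def)
    then show "q / 2 \<le> Im z" "0 < Im z" "Im z \<le> 2 * q" using q by linarith+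
  qed
  have UR: "cmod z \<le> cmod p + 3 * h" if "z \<in> U" for z
    using that norm_triangle_ineq2[of z p] by (simp add: U_def dist_norm norm_minus_commute)
  \<comment> \<open>With heights at least q / 2, |x - y| < \<kappa> r gives
    \<open>pd x y \<le> r / 4\<close>, the range of \<open>kern_lower\<close>.\<close>
  define \<kappa> where "\<kappa> = q / 8"
  have \<kappa>: "0 < \<kappa>" using q by (simp add: \<kappa>_def)
  obtain c where c: "AE y in lborel. y \<in> ball p (h / 2) \<longrightarrow> \<phi> y = c"
  proof (rule oscillation_ae_const[OF \<phi>_measurable h(1)])
    fix e :: real assume e: "0 < e"
    \<comment> \<open>Undoes the losses below: (2 q)^2 for each of the two area comparisons, 2 / pi
      from \<open>kern_lower\<close>, and s = \<kappa> r.\<close>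
    define e1 where "e1 = e * \<kappa> ^ 4 * (pi / 2) / ((2 * q)\<^sup>2 * (2 * q)\<^sup>2)"
    have e1: "0 < e1" using e \<kappa> q by (simp add: e1_def)
    have "0 < cmod p + 3 * h" using h(1) by (intro add_nonneg_pos) auto
    then obtain r0 where r0: "0 < r0" and r0s: "\<And>r. 0 < r \<Longrightarrow> r \<le> r0 \<Longrightarrow>
        (\<integral>\<^sup>+x. \<integral>\<^sup>+y. indicator U x * (indicator U y * (kern r (pd x y) * ennreal ((\<phi> x - \<phi> y)\<^sup>2))) \<partial>hyp \<partial>hyp) \<le> ennreal (e1 * r ^ 4)"
      using energy_small[of U "cmod p + 3 * h" "q / 4" e1] UQ UR UI(1) q e1 by auto
    have "(\<integral>\<^sup>+x. indicator U x * (\<integral>\<^sup>+y. indicator U y * (indicator {..<s} (cmod (x - y)) * ennreal ((\<phi> x - \<phi> y)\<^sup>2)) \<partial>lborel) \<partial>lborel) \<le> ennreal (e * s ^ 4)"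
      if s: "0 < s" "s \<le> \<kappa> * min r0 (1 / 2)" for s
    proof -
      define r where "r = s / \<kappa>"
      have "r \<le> min r0 (1 / 2)" unfolding r_def using s(2) \<kappa> by (subst pos_divide_le_eq) (simp_all only: mult.commute)
      then have r: "0 < r" "r \<le> r0" "r \<le> 1 / 2" "s = \<kappa> * r" using s(1) \<kappa> by (simp_all add: r_def)
      define k where "k x y = kern r (pd x y) * ennreal ((\<phi> x - \<phi> y)\<^sup>2)" for x y
      have [measurable]: "(\<lambda>y. k x y) \<in> borel_measurable borel" "(\<lambda>(x, y). k x y) \<in> borel_measurable (borel \<Otimes>\<^sub>M borel)" for x
        unfolding k_def by measurable
      define C where "C = ennreal (2 / pi) * ennreal ((2 * q)\<^sup>2)"
      have "(\<integral>\<^sup>+x. indicator U x * (\<integral>\<^sup>+y. indicator U y * (indicator {..<s} (cmod (x - y)) * ennreal ((\<phi> x - \<phi> y)\<^sup>2)) \<partial>lborel) \<partial>lborel)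
         \<le> (\<integral>\<^sup>+x. indicator U x * (C * (\<integral>\<^sup>+y. indicator U y * k x y \<partial>hyp)) \<partial>lborel)"
      proof (rule nn_integral_mono)
        fix x
        show "indicator U x * (\<integral>\<^sup>+y. indicator U y * (indicator {..<s} (cmod (x - y)) * ennreal ((\<phi> x - \<phi> y)\<^sup>2)) \<partial>lborel)
          \<le> indicator U x * (C * (\<integral>\<^sup>+y. indicator U y * k x y \<partial>hyp))"
        proof (cases "x \<in> U")
          case True
          have "(\<integral>\<^sup>+y. indicator U y * (indicator {..<s} (cmod (x - y)) * ennreal ((\<phi> x - \<phi> y)\<^sup>2)) \<partial>lborel)
             \<le> (\<integral>\<^sup>+y. ennreal (2 / pi) * (indicator U y * k x y) \<partial>lborel)"
          proof (rule nn_integral_mono)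
            fix y
            show "indicator U y * (indicator {..<s} (cmod (x - y)) * ennreal ((\<phi> x - \<phi> y)\<^sup>2)) \<le> ennreal (2 / pi) * (indicator U y * k x y)"
            proof (cases "y \<in> U \<and> cmod (x - y) < s")
              case y: True
              have "pd x y \<le> cmod (x - y) / Im x" using UI True y by (intro pd_le) auto
              also have "\<dots> \<le> s / (q / 2)" using UI[OF True] y q s by (intro frac_le) auto
              also have "\<dots> = r / 4" using q by (simp add: r(4) \<kappa>_def)
              finally have "ennreal (pi / 2) \<le> kern r (pd x y)" using r by (intro kern_lower) auto
              then have "ennreal (2 / pi) * ennreal (pi / 2) \<le> ennreal (2 / pi) * kern r (pd x y)" by (rule mult_left_mono) simp
              moreover have "ennreal (2 / pi) * ennreal (pi / 2) = 1" by (simp add: ennreal_mult[symmetric])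
              ultimately have "1 * ennreal ((\<phi> x - \<phi> y)\<^sup>2) \<le> ennreal (2 / pi) * kern r (pd x y) * ennreal ((\<phi> x - \<phi> y)\<^sup>2)"
                by (intro mult_right_mono) auto
              then show ?thesis using y by (simp add: k_def mult.assoc)
            qed (auto split: split_indicator)
          qed
          also have "\<dots> = ennreal (2 / pi) * (\<integral>\<^sup>+y. indicator U y * k x y \<partial>lborel)" by (rule nn_integral_cmult) measurable
          also have "\<dots> \<le> ennreal (2 / pi) * (ennreal ((2 * q)\<^sup>2) * (\<integral>\<^sup>+y. indicator U y * k x y \<partial>hyp))"
            using UI by (intro mult_left_mono lborel_le_hyp) auto
          finally show ?thesis using True by (simp add: C_def mult.assoc)
        qed simp
      qed
      also have "\<dots> \<le> ennreal ((2 * q)\<^sup>2) * (\<integral>\<^sup>+x. indicator U x * (C * (\<integral>\<^sup>+y. indicator U y * k x y \<partial>hyp)) \<partial>hyp)"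
      proof (rule lborel_le_hyp)
        show "(\<lambda>x. C * (\<integral>\<^sup>+y. indicator U y * k x y \<partial>hyp)) \<in> borel_measurable borel" by measurable
      qed (use UI in auto)
      also have "(\<integral>\<^sup>+x. indicator U x * (C * (\<integral>\<^sup>+y. indicator U y * k x y \<partial>hyp)) \<partial>hyp)
        = (\<integral>\<^sup>+x. C * (\<integral>\<^sup>+y. indicator U x * (indicator U y * k x y) \<partial>hyp) \<partial>hyp)"
        by (intro nn_integral_cong) (simp add: nn_integral_cmult mult.left_commute)
      also have "\<dots> = C * (\<integral>\<^sup>+x. \<integral>\<^sup>+y. indicator U x * (indicator U y * k x y) \<partial>hyp \<partial>hyp)"
        by (rule nn_integral_cmult) measurable
      finally have "(\<integral>\<^sup>+x. indicator U x * (\<integral>\<^sup>+y. indicator U y * (indicator {..<s} (cmod (x - y)) * ennreal ((\<phi> x - \<phi> y)\<^sup>2)) \<partial>lborel) \<partial>lborel)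
        \<le> ennreal ((2 * q)\<^sup>2) * (C * (\<integral>\<^sup>+x. \<integral>\<^sup>+y. indicator U x * (indicator U y * k x y) \<partial>hyp \<partial>hyp))" .
      also have "\<dots> \<le> ennreal ((2 * q)\<^sup>2) * (C * ennreal (e1 * r ^ 4))"
        using r0s[OF r(1,2)] unfolding k_def by (intro mult_left_mono) auto
      also have "\<dots> = ennreal ((2 * q)\<^sup>2 * (2 / pi * (2 * q)\<^sup>2 * (e1 * r ^ 4)))"
        unfolding C_def using e1
        by (simp only: ennreal_mult[symmetric] mult_nonneg_nonneg divide_nonneg_nonneg zero_le_power2 zero_le_even_power even_numeral zero_le_numeral pi_ge_zero less_imp_le)
      also have "(2 * q)\<^sup>2 * (2 / pi * (2 * q)\<^sup>2 * (e1 * r ^ 4)) = e * s ^ 4"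
        using q by (simp add: e1_def r(4) power2_eq_square power4_eq_xxxx)
      finally show ?thesis .
    qed
    then show "\<exists>s0>0. \<forall>s. 0 < s \<and> s \<le> s0 \<longrightarrow>
      (\<integral>\<^sup>+x. indicator (ball p (3 * h)) x * (\<integral>\<^sup>+y. indicator (ball p (3 * h)) y *
         (indicator {..<s} (cmod (x - y)) * ennreal ((\<phi> x - \<phi> y)\<^sup>2)) \<partial>lborel) \<partial>lborel) \<le> ennreal (e * s ^ 4)"
      unfolding U_def using \<kappa> r0 by (intro exI[of _ "\<kappa> * min r0 (1 / 2)"]) auto
  qed
  show ?thesis
    by (rule that[of "h / 2" c]) (use h \<delta>0 c in auto)
qed

text \<open>A larger value at p would by lower semicontinuity persist on a ball, which has positive
  measure.\<close>

lemma f_le_ae: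
  assumes T: "open T" "p \<in> T" and ae: "AE y in lborel. y \<in> T \<longrightarrow> f y = c" shows "f p \<le> c"
proof (rule ccontr)
  assume n: "\<not> f p \<le> c"
  have "open (T \<inter> {y. c < f y})" using T f_open by (intro open_Int) auto
  then obtain \<delta> where \<delta>: "0 < \<delta>" "ball p \<delta> \<subseteq> T \<inter> {y. c < f y}" using T n open_contains_ball by (metis (no_types, lifting) IntI mem_Collect_eq not_le)
  have "AE y in lborel. y \<notin> ball p \<delta>" using ae by eventually_elim (use \<delta>(2) in force)
  then have "emeasure lborel (ball p \<delta>) = 0" by (subst (asm) AE_iff_null_sets[symmetric]) auto
  then show False using \<delta>(1) unit_ball_vol_pos[of 2] by (simp add: emeasure_ball)
qed

text \<open>The mean of f over a disc about p is c, and the mean inequality bounds it by f(p). With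
  \<open>f_le_ae\<close>, an almost everywhere constant value becomes the value at every
  point.\<close>

lemma f_ge_ae:
  assumes B: "chart_ball B" "p \<in> B" and ae: "AE y in lborel. y \<in> B \<longrightarrow> f y = c" shows "c \<le> f p"
proof -
  have I: "0 < Im p" using B by (auto simp: chart_ball_def dom_def)
  have "open B" using B(1) by (simp add: chart_ball_def)
  then obtain \<delta> where \<delta>: "0 < \<delta>" "ball p \<delta> \<subseteq> B" using B(2) open_contains_ball by blast
  define r where "r = min 1 (\<delta> / Im p)"
  have r: "0 < r" "r \<le> 1" "Im p * r \<le> \<delta>" using \<delta> I by (auto simp: r_def min_def field_simps)
  have aff: "aff p w \<in> ball p (Im p * r) \<longleftrightarrow> w \<in> ball \<i> r" for w
  proof -
    have "p - aff p w = of_real (Im p) * (\<i> - w)" by (simp add: aff_def complex_eq_iff algebra_simps)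
    then have "dist p (aff p w) = Im p * dist \<i> w" using I by (simp add: dist_norm norm_mult)
    then show ?thesis using I by simp
  qed
  have disc: "(\<integral>\<^sup>+w\<in>ball \<i> r. f (aff p w) \<partial>lborel) \<le> emeasure lborel (ball \<i> r) * f (aff p \<i>)"
  proof (rule super_disc[OF B(1) iso_aff[OF I] r(1)])
    show "ball \<i> r \<subseteq> uhp" using cay_less(2)[of _ r] r by auto
    show "aff p ` ball \<i> r \<subseteq> B"
    proof
      fix y assume "y \<in> aff p ` ball \<i> r"
      then obtain w where w: "w \<in> ball \<i> r" "y = aff p w" by blast
      have "y \<in> ball p (Im p * r)" unfolding w(2) aff by (rule w(1))
      then show "y \<in> B" using r(3) \<delta>(2) by auto
    qed
  qed
  have [measurable]: "ball p (Im p * r) \<in> sets borel" "ball \<i> r \<in> sets borel" by simp_all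
  have tr: "(\<integral>\<^sup>+y. F y * indicator (ball p (Im p * r)) y \<partial>lborel) = ennreal ((Im p)\<^sup>2) * (\<integral>\<^sup>+w\<in>ball \<i> r. F (aff p w) \<partial>lborel)"
    if [measurable]: "F \<in> borel_measurable borel" for F
  proof -
    have "(\<integral>\<^sup>+y. F y * indicator (ball p (Im p * r)) y \<partial>lborel)
      = ennreal ((Im p)\<^sup>2) * (\<integral>\<^sup>+w. F (aff p w) * indicator (ball p (Im p * r)) (aff p w) \<partial>lborel)"
      unfolding aff_def by (rule nn_integral_complex_affine) (measurable, use I in simp)
    also have "(\<lambda>w. F (aff p w) * indicator (ball p (Im p * r)) (aff p w)) = (\<lambda>w. F (aff p w) * indicator (ball \<i> r) w)"
      by (intro ext) (simp only: indicator_def aff)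
    finally show ?thesis .
  qed
  have "ennreal ((Im p)\<^sup>2) * (\<integral>\<^sup>+w\<in>ball \<i> r. c \<partial>lborel) = (\<integral>\<^sup>+y. c * indicator (ball p (Im p * r)) y \<partial>lborel)"
    by (rule tr[symmetric]) simp
  also have "\<dots> = (\<integral>\<^sup>+y. f y * indicator (ball p (Im p * r)) y \<partial>lborel)"
  proof (rule nn_integral_cong_AE)
    show "AE y in lborel. c * indicator (ball p (Im p * r)) y = f y * indicator (ball p (Im p * r)) y"
      using ae
    proof eventually_elim
      case (elim y)
      have "y \<in> B" if "y \<in> ball p (Im p * r)" using that r(3) \<delta>(2) by auto
      then show ?case using elim by (auto split: split_indicator)
    qed
  qed
  also have "\<dots> = ennreal ((Im p)\<^sup>2) * (\<integral>\<^sup>+w\<in>ball \<i> r. f (aff p w) \<partial>lborel)" by (rule tr) measurable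
  also have "\<dots> \<le> ennreal ((Im p)\<^sup>2) * (emeasure lborel (ball \<i> r) * f (aff p \<i>))" using disc by (rule mult_left_mono) simp
  finally have "ennreal ((Im p)\<^sup>2) * (disc_area r * c) \<le> ennreal ((Im p)\<^sup>2) * (disc_area r * f p)"
    by (simp add: disc_area_def aff_i nn_integral_cmult_indicator mult.commute)
  moreover have "disc_area r \<noteq> 0" "disc_area r \<noteq> top"
    using disc_area_pos[OF r(1)] disc_area_le[of r] r by (auto simp: top_unique)
  ultimately show ?thesis using I by (simp add: ennreal_mult_le_mult_iff)
qed

text \<open>Local constancy on the connected set \<open>Qo\<close>.\<close>

lemma f_const_Qo: obtains c where "\<And>z. z \<in> Qo \<Longrightarrow> f z = c"
proof -
  have "\<forall>z\<in>Qo. eventually (\<lambda>w. f z = f w) (at z within Qo)"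
  proof
    fix p assume p: "p \<in> Qo"
    obtain \<delta> c where d: "0 < \<delta>" "ball p \<delta> \<subseteq> Qo" and ae: "AE y in lborel. y \<in> ball p \<delta> \<longrightarrow> \<phi> y = c"
      using locally_ae_const[OF p] .
    have ae': "AE y in lborel. y \<in> ball p \<delta> \<longrightarrow> f y = ennreal c"
      using ae
    proof eventually_elim
      case (elim y) then show ?case using d(2) \<phi>_f[of y] by auto
    qed
    have cb: "chart_ball (ball p \<delta>)" using d by (intro chart_ball_Qo) auto
    have eq: "f z = ennreal c" if "z \<in> ball p \<delta>" for z
      using f_le_ae[OF open_ball that ae'] f_ge_ae[OF cb that ae'] by (rule antisym)
    show "eventually (\<lambda>w. f p = f w) (at p within Qo)"
      using eq[of p] eq d(1) by (intro eventually_at_topological[THEN iffD2] exI[of _ "ball p \<delta>"]) auto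
  qed
  then have "f a = f b" if "a \<in> Qo" "b \<in> Qo" for a b
    using connected_local_const[OF connected_Qo[OF unb] that] by blast
  then show ?thesis using that[of "f (\<i> * of_real (node 1 / 2))"] axis_point by blast
qed

text \<open>It remains to treat points of sides. In a chart ball almost every point unfolds into
  \<open>Qo\<close>, so f is almost everywhere c there, and the two preceding comparisons give the
  value c at p.\<close>

lemma Fe_const: assumes "q \<in> topspace S" "q' \<in> topspace S" shows "Fe q = Fe q'"
proof -
  obtain c where c: "\<And>z. z \<in> Qo \<Longrightarrow> f z = c" using f_const_Qo by metis
  have "f p = c" if p: "p \<in> Q" for p
  proof -
    obtain B where B: "chart_ball B" "p \<in> B" using chart_ball_exists[OF p] .
    have BD: "B \<subseteq> D1" "B \<subseteq> dom" "open B" using B(1) by (auto simp: D1_def chart_ball_def)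
    have ae: "AE y in lborel. y \<in> B \<longrightarrow> f y = c"
      using AE_hyp_lborel[OF AE_domo]
    proof eventually_elim
      case (elim y)
      show ?case
      proof
        assume y: "y \<in> B"
        then have "y \<in> dom" "y \<in> D1" using BD by auto
        then have u: "unf y \<in> Qo" using elim by (simp add: dom_def domo_def)
        have "f y = Fe (prj (unf y))" using \<open>y \<in> D1\<close> by (simp add: f_def lift_def)
        also have "\<dots> = f (unf y)" using u by (simp add: f_Q Qo_Q)
        finally show "f y = c" using c[OF u] by simp
      qed
    qed
    show ?thesis using f_le_ae[OF BD(3) B(2) ae] f_ge_ae[OF B ae] by (rule antisym)
  qed
  then show ?thesis using assms by (force simp: topspace_flute f_Q)
qed

end

section \<open>Parabolicity for divergent sums\<close>

context flute_seq begin

theorem parabolic: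
  assumes unb: "\<And>r. \<exists>n. r < node n"
  shows "parabolic_type (associated_surface x)"
proof -
  have False if u: "subharmonic (associated_surface x) u" and neg: "\<And>q. q \<in> topspace S \<Longrightarrow> u q < 0"
    and pq: "p \<in> topspace S" "q \<in> topspace S" "u p < u q" for u p q
  proof -
    obtain m where m: "u q = ereal m" "m < 0" using neg[OF pq(2)] pq(3) by (cases "u q") auto
    have "ereal (- m) < - u p" using pq(3) m by (cases "u p") auto
    \<comment> \<open>A truncation level strictly between -u(q) and -u(p) keeps the two values
      apart: \<open>Fe q\<close> is below 1 + N while \<open>Fe p\<close> equals it.\<close>
    then obtain N where mN: "ereal (- m) < ereal N" "ereal N < - u p" using ereal_dense2 by blast
    interpret flute_negative x u N using u neg unb mN m by unfold_locales auto
    have "Fe q = 1 + ennreal (- m)" using m mN(1) by (simp add: Fe_def min_absorb1 ennreal_leI)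
    moreover have "ennreal N \<le> e2ennreal (- u p)" using e2ennreal_mono[of "ereal N" "- u p"] mN(2) by simp
    then have "Fe p = 1 + ennreal N" by (simp add: Fe_def min_absorb2)
    ultimately have "1 + ennreal (- m) = 1 + ennreal N" using Fe_const[OF pq(1,2)] by simp
    then have "ennreal (- m) = ennreal N" by (simp add: ennreal_add_left_cancel)
    then show False using mN(1) m by simp
  qed
  then show ?thesis
    unfolding parabolic_type_def surf_simps using riemann_surface_S[OF unb] noncompact_S[OF unb]
    by (metis linorder_neqE)
qed

end

theorem corollary0p1:
  fixes x :: "nat \<Rightarrow> real"
  assumes "\<And>n. x n > 0"
  shows "parabolic_type (associated_surface x) \<longleftrightarrow> \<not> summable x"
proof -
  interpret flute_seq x using assms by unfold_locales
  show ?thesis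
  proof
    assume "parabolic_type (associated_surface x)"
    \<comment> \<open>The sum of the series serves as L; positive terms put it strictly above every
      node.\<close>
    moreover have "node n < suminf x" if "summable x" for n
      unfolding node_def using assms that by (intro sum_less_suminf)
    ultimately show "\<not> summable x" using not_parabolic by blast
  next
    assume ns: "\<not> summable x"
    have "\<exists>n. r < node n" for r
    proof (rule ccontr)
      assume "\<nexists>n. r < node n"
      then have "summable x" using assms
        by (intro summableI_nonneg_bounded[of x r]) (auto simp: node_def not_less less_imp_le)
      then show False using ns by simp
    qed
    then show "parabolic_type (associated_surface x)" by (rule parabolic)
  qed
qed

end
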